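(* Let $s\in(0,1)$, $n\le3$, and let $u$ be a solution of $(-\Delta)^{s/2}u=u-u^3$ in $\mathbb{R}^n$. Suppose that $\frac{\partial u}{\partial x_n}(x)>0$ for all $x\in\mathbb{R}^n$ and $\lim_{x_n\to\pm\infty}u(x',x_n)=\pm1$. Then $u$ is one-dimensional, i.e. there exist $\bar u:\mathbb{R}\to\mathbb{R}$ and $\bar\omega\in S^{n-1}$ with $u(x)=\bar u(\bar\omega\cdot x)$ for all $x\in\mathbb{R}^n$.
   Context: Here $(-\Delta)^{s/2}u(x):=\int_{\mathbb{R}^n}\frac{u(x)-u(x+y)}{|y|^{n+s}}\,dy$ (normalization constant dropped). Points of $\mathbb{R}^n$ are written $x=(x',x_n)$ with $x'\in\mathbb{R}^{n-1}$. *)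

theory Defs
  imports "HOL-Analysis.Analysis"
begin

text \<open>Fractional Laplacian (normalisation constant dropped):
  (-Delta)^(s/2) u(x) = integral over R^n of (u(x) - u(x+y)) / |y|^(n+s) dy.\<close>

definition frac_lap_kernel :: "real \<Rightarrow> (real^'n \<Rightarrow> real) \<Rightarrow> real^'n \<Rightarrow> real^'n \<Rightarrow> real" where
  "frac_lap_kernel s u x y = (u x - u (x + y)) / (norm y powr (real CARD('n) + s))"

definition frac_lap :: "real \<Rightarrow> (real^'n \<Rightarrow> real) \<Rightarrow> real^'n \<Rightarrow> real" where
  "frac_lap s u x = (LINT y|lborel. frac_lap_kernel s u x y)"

definition allen_cahn_solution :: "real \<Rightarrow> (real^'n \<Rightarrow> real) \<Rightarrow> bool" where
  "allen_cahn_solution s u \<longleftrightarrow>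
     continuous_on UNIV u \<and>
     (\<forall>x. integrable lborel (frac_lap_kernel s u x) \<and> frac_lap s u x = u x - u x ^ 3)"

end

(* Write G = grad u, p = |G|, and let K be the kernel |z|^(-n-s). Every directional derivative solves the
   linearised equation and e0.G is a positive solution, which gives stability. It yields the energy estimate
   "double integral of (p p' - G.G') K over a ball of radius r is at most C r^(n-2-s)" and a comparison
   inequality for the supersolutions e.G - t p. Integration by parts and the energy estimate bound the total
   variation of u on balls by C r^(n-1). For n = 2 the energy tends to 0, so G has a constant direction.

   For n = 3, rotate e0 to an extreme direction e with e.G >= 0. The flux of G in this direction is negligible
   on some large scales, so u is almost invariant under translations along e there, the energy can be
   distributed over many disjoint translated balls, and u is nearly flat at such a scale. The foliation
   u(x + t e0) makes u one-sidedly minimal, whence p has mass at least c r^2 on large balls. With this lower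
   bound the comparison inequality carries flatness down to every fixed scale, with no loss in the limit. *)
theory Submission
  imports Defs
begin

text \<open>On a ball of radius r, the squared mass of p minus the squared length of the vector
  integral of G is at most (2r)^(n+s) times the energy, hence at most C r^(2n-2). This is the order
  of the squared mass itself, at every scale, so the estimate alone never forces alignment. For n =
  2 a fixed ball inherits the energy bound r^(-s) of arbitrarily large balls; for n = 3 the bound
  r^(1-s) grows, and a small factor has to come from elsewhere: sharing the energy among k balls
  supplies k^(-s). The second obstacle is the slow decay of the kernel. The situation at scale r
  feels all larger scales, so the descent must control the badly directed mass on all balls at once,
  and since the comparison inequality only bounds a product of a positive and a negative mass, it
  says nothing unless p has mass to begin with. Because s < 1, min 1 |z| is integrable against the
  kernel: bounded Lipschitz functions are admissible throughout and no principal value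
  occurs.\<close>

abbreviation nn_lborel :: "('a::euclidean_space => ennreal) => ennreal" (binder "NNBINT " 10) where
 "nn_lborel f \<equiv> nn_integral lborel f"

lemmas Lintegrable_add = Bochner_Integration.integrable_add
lemmas Lintegrable_bound = Bochner_Integration.integrable_bound
lemmas Lintegrable_diff = Bochner_Integration.integrable_diff
lemmas Lintegrable_sum = Bochner_Integration.integrable_sum
lemmas Lintegral_add = Bochner_Integration.integral_add
lemmas Lintegral_cong = Bochner_Integration.integral_cong
lemmas Lintegral_diff = Bochner_Integration.integral_diff
lemmas Lintegral_minus = Bochner_Integration.integral_minus
lemmas Lintegral_mult_right_zero = Bochner_Integration.integral_mult_right_zero
lemmas Lintegral_nonneg = Bochner_Integration.integral_nonneg
lemmas Lintegral_sum = Bochner_Integration.integral_sum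

section \<open>Integration on dyadic shells\<close>

lemma integrable_if_nn_le:
 fixes f :: "'b => real"
 assumes "f \<in> borel_measurable M" "\<And>x. 0 \<le> f x" "(\<integral>\<^sup>+x. ennreal (f x) \<partial>M) \<le> ennreal c" "0 \<le> c"
 shows "integrable M f" "integral\<^sup>L M f \<le> c"
proof -
 show i: "integrable M f"
 proof (rule integrableI_nonneg)
  show "(\<integral>\<^sup>+x. ennreal (f x) \<partial>M) < \<infinity>" using assms(3) by (simp add: order_le_less_trans)
 qed (use assms in auto)
 have "ennreal (integral\<^sup>L M f) = (\<integral>\<^sup>+x. ennreal (f x) \<partial>M)"
  using i assms(2) by (intro nn_integral_eq_integral[symmetric]) auto
 then have "ennreal (integral\<^sup>L M f) \<le> ennreal c" using assms(3) by simp
 then show "integral\<^sup>L M f \<le> c" using assms(4) by (simp add: ennreal_le_iff)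
qed

lemma suminf_ennreal_geometric:
 assumes "0 \<le> c" "0 \<le> q" "q < 1"
 shows "(\<Sum>k. ennreal (c * q ^ k)) = ennreal (c / (1 - q))"
proof -
 have "(%k. q ^ k) sums (1 / (1 - q))" using assms by (intro geometric_sums) auto
 then have "(%k. c * q ^ k) sums (c * (1 / (1 - q)))" by (rule sums_mult)
 then show ?thesis using assms by (subst suminf_ennreal2) (auto simp: sums_iff)
qed

lemma dyadic_near:
 fixes d \<rho> :: real
 assumes "0 < d" "d < \<rho>"
 obtains k :: nat where "\<rho> / 2 ^ (k+1) \<le> d" "d < \<rho> / 2 ^ k"
proof -
 obtain N :: nat where "\<rho> / d < 2 ^ N" using real_arch_pow[of 2 "\<rho> / d"] by auto
 then have "\<rho> / 2 ^ N < d" using assms by (simp add: field_simps)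
 then have ex: "\<exists>k. \<rho> / 2 ^ k \<le> d" by (meson less_imp_le)
 define m where "m = (LEAST k. \<rho> / 2 ^ k \<le> d)"
 have m: "\<rho> / 2 ^ m \<le> d" unfolding m_def using ex by (rule LeastI_ex)
 then have "m \<noteq> 0" using assms by (cases m) auto
 then obtain k where k: "m = Suc k" by (cases m) auto
 then have "\<not> \<rho> / 2 ^ k \<le> d" using not_less_Least[of k "%k. \<rho> / 2 ^ k \<le> d"] unfolding m_def by auto
 with m k that show ?thesis by auto
qed

lemma dyadic_far:
 fixes d \<rho> :: real
 assumes "0 < \<rho>" "\<rho> \<le> d"
 obtains k :: nat where "\<rho> * 2 ^ k \<le> d" "d < \<rho> * 2 ^ (k+1)"
proof -
 obtain N :: nat where "d / \<rho> < 2 ^ N" using real_arch_pow[of 2 "d / \<rho>"] by auto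
 then have ex: "\<exists>k. d < \<rho> * 2 ^ k" using assms by (auto simp: field_simps)
 define m where "m = (LEAST k. d < \<rho> * 2 ^ k)"
 have m: "d < \<rho> * 2 ^ m" unfolding m_def using ex by (rule LeastI_ex)
 then have "m \<noteq> 0" using assms by (cases m) auto
 then obtain k where k: "m = Suc k" by (cases m) auto
 then have "\<not> d < \<rho> * 2 ^ k" using not_less_Least[of k "%k. d < \<rho> * 2 ^ k"] unfolding m_def by auto
 with m k that[of k] show ?thesis by simp
qed

lemma ball_in_sets_borel [measurable]: "ball y r \<in> sets borel" for y :: "'a::metric_space"
 by simp

lemma cball_in_sets_borel [measurable]: "cball y r \<in> sets borel" for y :: "'a::metric_space"
 by simp

text \<open>The shell between \<rho>/2^(k+1) and \<rho>/2^k carries mass at most A (\<rho>/2^k)^m,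
  and the weight there is at most its value at the inner radius. Since b < m, the contributions form
  a geometric series of ratio 2^(-(m-b)).\<close>

lemma nn_near_shells:
 fixes g :: "'a::euclidean_space => ennreal" and y :: 'a
 assumes g[measurable]: "g \<in> borel_measurable lborel" and "0 < \<rho>" "0 \<le> A" "0 < b" "b < m"
  and mass: "\<And>t. 0 < t ==> t \<le> \<rho> ==> (NNBINT x. g x * indicator (ball y t) x) \<le> ennreal (A * t powr m)"
 shows "(NNBINT x. g x * ennreal (norm (x - y) powr -b) * indicator (ball y \<rho>) x)
   \<le> ennreal (2 powr b / (1 - 2 powr -(m-b)) * A * \<rho> powr (m - b))"
proof -
 define f where "f k x = g x * indicator (ball y (\<rho>/2^k)) x * ennreal ((\<rho>/2^(k+1)) powr -b)" for k :: nat and x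
 have pt: "g x * ennreal (norm (x - y) powr -b) * indicator (ball y \<rho>) x \<le> (\<Sum>k. f k x)" for x
 proof (cases "x = y \<or> x \<notin> ball y \<rho>")
  case True then show ?thesis by auto
 next
  case False
  then have d: "0 < norm (x - y)" "norm (x - y) < \<rho>" by (auto simp: dist_norm norm_minus_commute)
  from dyadic_near[OF d] obtain k :: nat where k: "\<rho> / 2 ^ (k+1) \<le> norm (x - y)" "norm (x - y) < \<rho> / 2 ^ k" by blast
  have "norm (x - y) powr -b \<le> (\<rho> / 2 ^ (k+1)) powr -b"
   using k(1) assms by (intro powr_mono2') auto
  then have "g x * ennreal (norm (x - y) powr -b) * indicator (ball y \<rho>) x \<le> f k x"
   using k(2) False unfolding f_def
   by (auto simp: dist_norm norm_minus_commute intro!: mult_left_mono ennreal_leI)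
  also have "... \<le> (\<Sum>k. f k x)"
   using sum_le_suminf[of "%k. f k x" "{k}"] by simp
  finally show ?thesis .
 qed
 have fm[measurable]: "f k \<in> borel_measurable lborel" for k unfolding f_def by measurable
 define q where "q = 2 powr -(m-b)"
 define c where "c = A * \<rho> powr (m-b) * 2 powr b"
 have q: "0 \<le> q" "q < 1" unfolding q_def using assms powr_less_one[of 2 "-(m-b)"] by (auto)
 have c: "0 \<le> c" unfolding c_def using assms by auto
 have fk: "(NNBINT x. f k x) \<le> ennreal (c * q ^ k)" for k
 proof -
  have "(NNBINT x. f k x) = (NNBINT x. g x * indicator (ball y (\<rho>/2^k)) x) * ennreal ((\<rho>/2^(k+1)) powr -b)"
   unfolding f_def by (rule nn_integral_multc) measurable
  also have "... \<le> ennreal (A * (\<rho>/2^k) powr m) * ennreal ((\<rho>/2^(k+1)) powr -b)"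
   using assms by (intro mult_right_mono mass) (auto simp: field_simps)
  also have "... = ennreal (A * (\<rho>/2^k) powr m * (\<rho>/2^(k+1)) powr -b)"
   using assms by (simp add: ennreal_mult)
  also have "A * (\<rho>/2^k) powr m * (\<rho>/2^(k+1)) powr -b = c * q ^ k"
  proof -
   have 1: "(\<rho>/2^k) powr m = \<rho> powr m * 2 powr (- real k * m)"
    using assms by (simp add: powr_divide powr_minus_divide powr_powr flip: powr_realpow)
   have 2: "(\<rho>/2^(k+1)) powr -b = \<rho> powr -b * 2 powr ((real k + 1) * b)"
    using assms by (simp add: powr_divide powr_minus_divide powr_powr powr_add powr_mult distrib_right flip: powr_realpow)
   have 3: "q ^ k = 2 powr (- real k * (m-b))"
    unfolding q_def by (simp add: powr_powr algebra_simps flip: powr_realpow)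
   show ?thesis unfolding 1 2 3 c_def
    by (simp add: powr_diff powr_add powr_minus field_simps flip: powr_add)
  qed
  finally show ?thesis .
 qed
 have "(NNBINT x. g x * ennreal (norm (x - y) powr -b) * indicator (ball y \<rho>) x)
   \<le> (NNBINT x. (\<Sum>k. f k x))" by (intro nn_integral_mono pt)
 also have "... = (\<Sum>k. NNBINT x. f k x)" by (rule nn_integral_suminf) measurable
 also have "... \<le> (\<Sum>k. ennreal (c * q ^ k))" by (intro suminf_le fk) auto
 also have "... = ennreal (c / (1 - q))" using suminf_ennreal_geometric[OF c q] .
 finally show ?thesis unfolding c_def q_def by (simp add: mult_ac)
qed

text \<open>The counterpart at infinity: radii double instead of halving, and the ratio 2^(m-b) is
  below one because m < b.\<close>

lemma nn_far_shells:
 fixes g :: "'a::euclidean_space => ennreal" and y :: 'a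
 assumes g[measurable]: "g \<in> borel_measurable lborel" and "0 < \<rho>" "0 \<le> A" "0 < m" "m < b"
  and mass: "\<And>t. \<rho> \<le> t ==> (NNBINT x. g x * indicator (ball y t) x) \<le> ennreal (A * t powr m)"
 shows "(NNBINT x. g x * ennreal (norm (x - y) powr -b) * indicator (- ball y \<rho>) x)
   \<le> ennreal (2 powr m / (1 - 2 powr (m-b)) * A * \<rho> powr (m - b))"
proof -
 define f where "f k x = g x * indicator (ball y (\<rho>*2^(k+1))) x * ennreal ((\<rho>*2^k) powr -b)" for k :: nat and x
 have pt: "g x * ennreal (norm (x - y) powr -b) * indicator (- ball y \<rho>) x \<le> (\<Sum>k. f k x)" for x
 proof (cases "x \<in> ball y \<rho>")
  case True then show ?thesis by auto
 next
  case False
  then have d: "\<rho> \<le> norm (x - y)" by (auto simp: dist_norm norm_minus_commute)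
  from dyadic_far[OF \<open>0 < \<rho>\<close> d] obtain k :: nat where k: "\<rho> * 2 ^ k \<le> norm (x - y)" "norm (x - y) < \<rho> * 2 ^ (k+1)" by blast
  have "norm (x - y) powr -b \<le> (\<rho> * 2 ^ k) powr -b"
   using k(1) assms by (intro powr_mono2') auto
  then have "g x * ennreal (norm (x - y) powr -b) * indicator (- ball y \<rho>) x \<le> f k x"
   using k(2) False unfolding f_def
   by (auto simp: dist_norm norm_minus_commute intro!: mult_left_mono ennreal_leI)
  also have "... \<le> (\<Sum>k. f k x)"
   using sum_le_suminf[of "%k. f k x" "{k}"] by simp
  finally show ?thesis .
 qed
 have fm[measurable]: "f k \<in> borel_measurable lborel" for k unfolding f_def by measurable
 define q where "q = 2 powr (m-b)"
 define c where "c = A * \<rho> powr (m-b) * 2 powr m"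
 have q: "0 \<le> q" "q < 1" unfolding q_def using assms powr_less_one[of 2 "m-b"] by (auto)
 have c: "0 \<le> c" unfolding c_def using assms by auto
 have fk: "(NNBINT x. f k x) \<le> ennreal (c * q ^ k)" for k
 proof -
  have le: "\<rho> \<le> \<rho> * 2^(k+1)" using assms by (simp add: mult_le_cancel_left1 flip: power_Suc)
  have "(NNBINT x. f k x) = (NNBINT x. g x * indicator (ball y (\<rho>*2^(k+1))) x) * ennreal ((\<rho>*2^k) powr -b)"
   unfolding f_def by (rule nn_integral_multc) measurable
  also have "... \<le> ennreal (A * (\<rho>*2^(k+1)) powr m) * ennreal ((\<rho>*2^k) powr -b)"
   using le by (intro mult_right_mono mass) (auto)
  also have "... = ennreal (A * (\<rho>*2^(k+1)) powr m * (\<rho>*2^k) powr -b)"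
   using assms by (simp add: ennreal_mult)
  also have "A * (\<rho>*2^(k+1)) powr m * (\<rho>*2^k) powr -b = c * q ^ k"
  proof -
   have 1: "(\<rho>*2^(k+1)) powr m = \<rho> powr m * 2 powr ((real k + 1) * m)"
    using assms by (simp add: powr_mult powr_powr powr_add distrib_right flip: powr_realpow)
   have 2: "(\<rho>*2^k) powr -b = \<rho> powr -b * 2 powr (- real k * b)"
    using assms by (simp add: powr_mult powr_powr flip: powr_realpow)
   have 3: "q ^ k = 2 powr (real k * (m-b))"
    unfolding q_def by (simp add: powr_powr algebra_simps flip: powr_realpow)
   show ?thesis unfolding 1 2 3 c_def
    by (simp add: powr_diff powr_add powr_minus field_simps flip: powr_add)
  qed
  finally show ?thesis .
 qed
 have "(NNBINT x. g x * ennreal (norm (x - y) powr -b) * indicator (- ball y \<rho>) x)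
   \<le> (NNBINT x. (\<Sum>k. f k x))" by (intro nn_integral_mono pt)
 also have "... = (\<Sum>k. NNBINT x. f k x)" by (rule nn_integral_suminf) measurable
 also have "... \<le> (\<Sum>k. ennreal (c * q ^ k))" by (intro suminf_le fk) auto
 also have "... = ennreal (c / (1 - q))" using suminf_ennreal_geometric[OF c q] .
 finally show ?thesis unfolding c_def q_def by (simp add: mult_ac)
qed


section \<open>The kernel and its truncated moments\<close>

locale frac_order =
 fixes s :: real
 assumes s_pos: "0 < s" and s_lt1: "s < 1"
begin

definition kern :: "'a::euclidean_space => real" where
 "kern z = norm z powr -(real DIM('a) + s)"

abbreviation pkern :: "'a::euclidean_space \<times> 'a => real" where "pkern q \<equiv> kern (fst q - snd q)"

lemma kern_nonneg [simp]: "0 \<le> kern z" by (simp add: kern_def)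

lemma kern_0 [simp]: "kern 0 = 0" by (simp add: kern_def)

lemma kern_minus [simp]: "kern (- z) = kern z" by (simp add: kern_def)

lemma kern_commute: "kern (x - y) = kern (y - x)" by (simp add: kern_def norm_minus_commute)

lemma kern_measurable [measurable]: "kern \<in> borel_measurable borel"
 unfolding kern_def by measurable

lemma kern_ge:
 fixes z :: "'a::euclidean_space"
 assumes "z \<noteq> 0" "norm z \<le> r"
 shows "r powr -(real DIM('a) + s) \<le> kern z"
 unfolding kern_def using assms s_pos by (intro powr_mono2') auto


text \<open>The truncation switches at |x - y| = 1/l. Inside, the weight is l^a |x - y|^(-(n+s-a)),
  integrable near y because n + s < m + a; outside, it is at most the kernel, integrable at infinity
  because m < n + s. Both pieces scale like l^(n+s-m). The cases used are m = n, a = 1 for Lebesgue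
  measure and m = n - 1, a = 2 for the measure p dx.\<close>

lemma nn_kmin_ex:
 fixes m :: real and a :: nat
 assumes "0 < m" "m < DIM('a::euclidean_space) + s" "DIM('a) + s < m + a" "a < DIM('a) + s"
 shows "\<exists>C>0. \<forall>(g :: 'a => ennreal) y l A. g \<in> borel_measurable lborel \<longrightarrow> 0 < l \<longrightarrow> 0 \<le> A \<longrightarrow>
   (\<forall>t>0. (NNBINT x. g x * indicator (ball y t) x) \<le> ennreal (A * t powr m)) \<longrightarrow>
   (NNBINT x. g x * ennreal (min 1 (l * norm (x - y)) ^ a * kern (x - y)))
   \<le> ennreal (C * A * l powr (DIM('a) + s - m))"
proof -
 define n where "n = real DIM('a)"
 define b where "b = n + s - a"
 define C1 where "C1 = 2 powr b / (1 - 2 powr -(m-b))"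
 define C2 where "C2 = 2 powr m / (1 - 2 powr (m-(n+s)))"
 have b: "0 < b" "b < m" "m < n + s" using assms by (auto simp: b_def n_def)
 have C: "0 < C1" "0 < C2" unfolding C1_def C2_def
  using b powr_less_one[of 2 "-(m-b)"] powr_less_one[of 2 "m-(n+s)"] by (auto)
 show ?thesis
 proof (intro exI[of _ "C1 + C2"] conjI allI impI)
  fix g :: "'a => ennreal" and y and l A :: real
  assume g[measurable]: "g \<in> borel_measurable lborel" and l: "0 < l" and A: "0 \<le> (A::real)"
   and mass: "\<forall>t>0. (NNBINT x. g x * indicator (ball y t) x) \<le> ennreal (A * t powr m)"
  let ?\<rho> = "1 / l"
  have mass': "(NNBINT x. g x * indicator (ball y t) x) \<le> ennreal (A * t powr m)" if "1 / l \<le> t" for t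
   using mass l that by (meson divide_pos_pos less_le_trans zero_less_one)
  have pt: "g x * ennreal (min 1 (l * norm (x - y)) ^ a * kern (x - y))
   \<le> ennreal (l powr a) * (g x * ennreal (norm (x - y) powr -b) * indicator (ball y ?\<rho>) x)
    + g x * ennreal (norm (x - y) powr -(n+s)) * indicator (- ball y ?\<rho>) x" for x
  proof (cases "x = y")
   case True then show ?thesis by simp
  next
   case False
   show ?thesis
   proof (cases "x \<in> ball y ?\<rho>")
    case True
    have "min 1 (l * norm (x - y)) ^ a * kern (x - y) \<le> (l * norm (x - y)) ^ a * kern (x - y)"
     using l by (intro mult_right_mono power_mono) auto
    also have "... = l powr a * norm (x - y) powr -b"
     using l False unfolding kern_def b_def n_def
     by (simp add: power_mult_distrib powr_realpow powr_diff powr_add powr_minus field_simps)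
    finally show ?thesis using True
     by (auto simp: ennreal_mult''[symmetric] mult.left_commute[of "ennreal (l powr a)"] intro!: mult_left_mono ennreal_leI)
   next
    case False
    have "min 1 (l * norm (x - y)) ^ a * kern (x - y) \<le> 1 * kern (x - y)"
     using l by (intro mult_right_mono power_le_one) auto
    then show ?thesis using False by (auto simp: kern_def n_def intro!: mult_left_mono ennreal_leI)
   qed
  qed
  have "(NNBINT x. g x * ennreal (min 1 (l * norm (x - y)) ^ a * kern (x - y))) \<le>
   (NNBINT x. ennreal (l powr a) * (g x * ennreal (norm (x - y) powr -b) * indicator (ball y ?\<rho>) x)
    + g x * ennreal (norm (x - y) powr -(n+s)) * indicator (- ball y ?\<rho>) x)"
   by (intro nn_integral_mono pt)
  also have "... = ennreal (l powr a) * (NNBINT x. (g x * ennreal (norm (x - y) powr -b) * indicator (ball y ?\<rho>) x))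
    + (NNBINT x. g x * ennreal (norm (x - y) powr -(n+s)) * indicator (- ball y ?\<rho>) x)"
   by (subst nn_integral_add) (auto simp: nn_integral_cmult)
  also have "... \<le> ennreal (l powr a) * ennreal (C1 * A * ?\<rho> powr (m - b)) + ennreal (C2 * A * ?\<rho> powr (m - (n+s)))"
   unfolding C1_def C2_def using l A b mass mass' assms(1)
   by (intro add_mono mult_left_mono nn_near_shells nn_far_shells) auto
  also have "... = ennreal (l powr a * (C1 * A * ?\<rho> powr (m - b)) + C2 * A * ?\<rho> powr (m - (n+s)))"
   using C A by (simp add: ennreal_mult ennreal_plus)
  also have "l powr a * (C1 * A * ?\<rho> powr (m - b)) + C2 * A * ?\<rho> powr (m - (n+s)) = (C1 + C2) * A * l powr (n + s - m)"
  proof -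
   have "l powr a * ?\<rho> powr (m - b) = l powr (n + s - m)"
    using l by (simp add: b_def powr_divide powr_minus_divide[symmetric] flip: powr_add powr_minus) (simp add: powr_divide powr_minus powr_diff powr_add field_simps)
   moreover have "?\<rho> powr (m - (n+s)) = l powr (n + s - m)"
    using l by (simp add: powr_divide powr_diff powr_add powr_minus field_simps)
   ultimately show ?thesis by (simp add: algebra_simps)
  qed
  finally show "(NNBINT x. g x * ennreal (min 1 (l * norm (x - y)) ^ a * kern (x - y)))
   \<le> ennreal ((C1 + C2) * A * l powr (DIM('a) + s - m))" by (simp add: n_def)
 qed (use C in auto)
qed

lemma kmin_integrable_ex:
 "\<exists>C>0. \<forall>l>0. integrable lborel (%z::'a::euclidean_space. min 1 (l * norm z) * kern z) \<and>
   (LBINT z. min 1 (l * norm (z::'a)) * kern z) \<le> C * l powr s"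
proof -
 let ?n = "real DIM('a)"
 have n1: "1 \<le> ?n" using DIM_positive[where 'a='a] by (simp add: Suc_le_eq)
 have "\<exists>C>0. \<forall>(g :: 'a => ennreal) y l A. g \<in> borel_measurable lborel \<longrightarrow> 0 < l \<longrightarrow> 0 \<le> A \<longrightarrow>
   (\<forall>t>0. (NNBINT x. g x * indicator (ball y t) x) \<le> ennreal (A * t powr ?n)) \<longrightarrow>
   (NNBINT x. g x * ennreal (min 1 (l * norm (x - y)) ^ 1 * kern (x - y)))
   \<le> ennreal (C * A * l powr (?n + s - ?n))"
  using s_pos s_lt1 n1 by (intro nn_kmin_ex; (simp only: of_nat_1)?; linarith)
 then obtain C where C: "C > 0" "\<And>(g :: 'a => ennreal) y l A. g \<in> borel_measurable lborel ==> 0 < l ==> 0 \<le> A ==>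
   (\<forall>t>0. (NNBINT x. g x * indicator (ball y t) x) \<le> ennreal (A * t powr ?n)) ==>
   (NNBINT x. g x * ennreal (min 1 (l * norm (x - y)) ^ 1 * kern (x - y)))
   \<le> ennreal (C * A * l powr (?n + s - ?n))" by blast
 show ?thesis
 proof (intro exI[of _ "C * unit_ball_vol (DIM('a))"] conjI allI impI)
  show "0 < C * unit_ball_vol (DIM('a))" using C by simp
  fix l :: real assume l: "0 < l"
  have mass: "(NNBINT x. 1 * indicator (ball (0::'a) t) x) \<le> ennreal (unit_ball_vol (DIM('a)) * t powr ?n)" if "t > 0" for t
   using that by (simp add: emeasure_ball powr_realpow)
  have "(NNBINT x. 1 * ennreal (min 1 (l * norm (x - 0)) ^ 1 * kern (x - (0::'a))))
   \<le> ennreal (C * unit_ball_vol (DIM('a)) * l powr (?n + s - ?n))"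
   using l mass by (intro C(2)) auto
  then have *: "(NNBINT x. ennreal (min 1 (l * norm x) * kern (x::'a)))
   \<le> ennreal (C * unit_ball_vol (DIM('a)) * l powr s)" by simp
  show "integrable lborel (%z::'a. min 1 (l * norm z) * kern z)"
   by (rule integrable_if_nn_le(1)[OF _ _ *]) (use l C in auto)
  show "(LBINT z. min 1 (l * norm (z::'a)) * kern z) \<le> C * unit_ball_vol (DIM('a)) * l powr s"
   by (rule integrable_if_nn_le(2)[OF _ _ *]) (use l C in auto)
 qed
qed

end

section \<open>Regularity\<close>

text \<open>This is the gain in \<open>holder_basic_ex\<close>, where one distance shrinks to a
  ninth and another grows at most threefold. In terms of x = 3^\<beta> it equals (x - 1)(1 + x -
  x^2)/x^2, positive as long as x stays below the golden ratio; \<beta> \<le> 1/3 gives x <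
  3/2.\<close>

lemma holder_gain_pos:
 fixes \<beta> :: real
 assumes "0 < \<beta>" "\<beta> \<le> 1/3"
 shows "0 < 2 - 9 powr -\<beta> - 3 powr \<beta>"
proof -
 define x :: real where "x = 3 powr \<beta>"
 have x1: "1 < x" unfolding x_def using assms by (simp add: gr_one_powr)
 have "x ^ 3 = 3 powr (3 * \<beta>)" unfolding x_def
  by (simp add: powr_powr mult.commute flip: powr_realpow)
 also have "... \<le> 3 powr 1" using assms by (intro powr_mono) auto
 finally have x3: "x ^ 3 \<le> 3" by simp
 have x2: "x < 3/2"
 proof (rule ccontr)
  assume "\<not> x < 3/2"
  then have "(3/2) ^ 3 \<le> x ^ 3" by (intro power_mono) auto
  with x3 show False by (simp add: power3_eq_cube)
 qed
 have 9: "9 powr -\<beta> = 1 / x ^ 2"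
 proof -
  have "(9::real) = 3 powr 2" by simp
  then have "9 powr -\<beta> = (3 powr 2) powr -\<beta>" by simp
  also have "... = 3 powr (2 * -\<beta>)" by (simp only: powr_powr)
  also have "... = 1 / (3 powr \<beta>) ^ 2"
   by (simp add: powr_minus_divide powr_powr mult.commute flip: powr_realpow)
  finally show ?thesis unfolding x_def .
 qed
 have "x * x < x * (3/2)" using x1 x2 by (intro mult_strict_left_mono) auto
 then have "x * x < 1 + x" using x2 by linarith
 then have "0 < (x - 1) * (1 + x - x * x)" using x1 by (intro mult_pos_pos) auto
 also have "(x - 1) * (1 + x - x * x) = 2 * x^2 - 1 - x ^ 3" by (simp add: algebra_simps power2_eq_square power3_eq_cube)
 finally have "0 < (2 * x^2 - 1 - x ^ 3) / x ^ 2" using x1 by simp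
 also have "... = 2 - 1 / x^2 - x" using x1 by (simp add: field_simps power2_eq_square power3_eq_cube)
 finally show ?thesis unfolding 9 by (simp add: x_def)
qed

lemma bump_lipschitz:
 fixes x y :: "'a::real_normed_vector"
 shows "\<bar>max 0 (1 - norm x) - max 0 (1 - norm y)\<bar> \<le> min 1 (norm (x - y))"
 using norm_triangle_ineq3[of x y] norm_ge_zero[of x] norm_ge_zero[of y] unfolding max_def min_def by argo

section \<open>Hoelder estimate by doubling of variables\<close>

context frac_order
begin

definition lint :: "('a::euclidean_space => real) => 'a => bool" where
 "lint v x \<longleftrightarrow> integrable lborel (%z. (v x - v (x + z)) * kern z)"

definition Lop :: "('a::euclidean_space => real) => 'a => real" where
 "Lop v x = (LBINT z. (v x - v (x + z)) * kern z)"

text \<open>If the Hoelder bound fails, v x - v y - A |x - y|^\<beta> has positive supremum, which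
  need not be attained on the whole space. A bump of arbitrarily small height around a nearly
  optimal point forces a maximum. The condition 2B \<le> A makes the function nonpositive as soon as
  |x - y| \<ge> 1, which keeps y near x.\<close>

lemma doubling_max:
 fixes v :: "'a::euclidean_space => real"
 assumes cont: "continuous_on UNIV v" and bd: "\<And>x. \<bar>v x\<bar> \<le> B" and A: "2 * B \<le> A" "0 < A" and \<beta>: "0 < \<beta>"
  and ex: "A * norm (x1 - y1) powr \<beta> < v x1 - v y1" and e0: "0 < e0"
 obtains x0 xb yb :: 'a and \<epsilon> :: real where "0 < \<epsilon>" "\<epsilon> \<le> e0" "xb \<noteq> yb" "norm (xb - yb) \<le> 1"
  "\<And>x y. v x - v y - A * norm (x - y) powr \<beta> + 2 * \<epsilon> * max 0 (1 - norm (x - x0))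
    \<le> v xb - v yb - A * norm (xb - yb) powr \<beta> + 2 * \<epsilon> * max 0 (1 - norm (xb - x0))"
proof -
 define \<Phi> where "\<Phi> q = v (fst q) - v (snd q) - A * norm (fst q - snd q) powr \<beta>" for q
 define m where "m = (SUP q. \<Phi> q)"
 have \<Phi>le: "\<Phi> q \<le> 2 * B" for q unfolding \<Phi>_def using bd[of "fst q"] bd[of "snd q"] A
  by (smt (verit) mult_nonneg_nonneg powr_ge_zero)
 have bdd: "bdd_above (range \<Phi>)" using \<Phi>le by (auto intro!: bdd_aboveI)
 have \<Phi>m: "\<Phi> q \<le> m" for q unfolding m_def using bdd by (intro cSUP_upper) auto
 have mpos: "0 < m" using \<Phi>m[of "(x1, y1)"] ex by (simp add: \<Phi>_def)
 define \<epsilon> where "\<epsilon> = min e0 (m / 2)"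
 have \<epsilon>: "0 < \<epsilon>" "\<epsilon> \<le> e0" "\<epsilon> < m" using mpos e0 by (auto simp: \<epsilon>_def)
 have "\<exists>q. m - \<epsilon> < \<Phi> q"
 proof (rule ccontr)
  assume "\<not> ?thesis"
  then have "m \<le> m - \<epsilon>" unfolding m_def by (intro cSUP_least) (auto simp: not_less m_def)
  then show False using \<epsilon> by simp
 qed
 then obtain x0 y0 where q0: "m - \<epsilon> < \<Phi> (x0, y0)" by (metis surj_pair)
 have close: "norm (x - y) < 1" if "0 < \<Phi> (x, y)" for x y
 proof (rule ccontr)
  assume "\<not> norm (x - y) < 1"
  then have "1 \<le> norm (x - y) powr \<beta>" using \<beta> by (simp add: ge_one_powr_ge_zero)
  then have "A * 1 \<le> A * norm (x - y) powr \<beta>" using A by (intro mult_left_mono) auto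
  moreover have "v x - v y \<le> 2 * B" using bd[of x] bd[of y] by linarith
  moreover have "A * norm (x - y) powr \<beta> < v x - v y" using that by (simp add: \<Phi>_def)
  ultimately show False using A by linarith
 qed
 \<comment> \<open>The pair (x0, y0) is within \<epsilon> of the supremum m and the bump has height
   2\<epsilon>, so its value exceeds m + \<epsilon>. Off \<open>S\<close> either the bump vanishes
   or \<Phi> \<le> 0, and \<Psi> stays at most m + \<epsilon>; hence the maximum over the compact
   \<open>S\<close> is global.\<close>
 define \<Psi> where "\<Psi> q = \<Phi> q + 2 * \<epsilon> * max 0 (1 - norm (fst q - x0))" for q
 define S where "S = cball x0 1 \<times> cball x0 3"
 have comp: "compact S" unfolding S_def by (intro compact_Times compact_cball)
 have near: "norm (x0 - y0) < 1" using close[of x0 y0] q0 \<epsilon> by simp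
 have q0S: "(x0, y0) \<in> S" unfolding S_def using near by (auto simp: dist_norm)
 have c1: "continuous_on S (%q. v (fst q))" "continuous_on S (%q. v (snd q))"
  by (auto intro!: continuous_on_compose2[OF cont] continuous_intros)
 have c2: "continuous_on S (%q. norm (fst q - snd q) powr \<beta>)"
  using \<beta> by (intro continuous_on_powr') (auto intro!: continuous_intros)
 have c3: "continuous_on S (%q. 2 * \<epsilon> * max 0 (1 - norm (fst q - x0)))" by (intro continuous_intros)
 have "continuous_on S \<Psi>" unfolding \<Psi>_def \<Phi>_def
  by (intro continuous_on_add continuous_on_diff continuous_on_mult continuous_on_const c1 c2 c3)
 moreover have "S \<noteq> {}" using q0S by auto
 ultimately obtain xb yb where
  b: "(xb, yb) \<in> S" "\<And>q. q \<in> S ==> \<Psi> q \<le> \<Psi> (xb, yb)"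
  using continuous_attains_sup[OF comp, of \<Psi>] by (metis surj_pair)
 have \<Psi>0: "m + \<epsilon> < \<Psi> (x0, y0)" using q0 by (simp add: \<Psi>_def)
 have max: "\<Psi> (x, y) \<le> \<Psi> (xb, yb)" for x y
 proof (cases "(x, y) \<in> S")
  case True then show ?thesis using b by blast
 next
  case False
  have "\<Psi> (x, y) \<le> m + \<epsilon>"
  proof (cases "x \<in> cball x0 1")
   case True
   then have "y \<notin> cball x0 3" using False by (auto simp: S_def)
   then have "2 < norm (x - y)" using True norm_triangle_ineq[of "x0 - x" "x - y"] by (auto simp: dist_norm)
   then have "\<Phi> (x, y) \<le> 0" using close[of x y] by force
   moreover have "\<epsilon> * max 0 (1 - norm (x - x0)) \<le> \<epsilon> * 1" using \<epsilon> by (intro mult_left_mono) auto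
   ultimately show ?thesis using \<epsilon> unfolding \<Psi>_def fst_conv by linarith
  next
   case False
   then have "max 0 (1 - norm (x - x0)) = 0" by (auto simp: dist_norm norm_minus_commute)
   then show ?thesis using \<Phi>m[of "(x, y)"] \<epsilon> by (simp add: \<Psi>_def)
  qed
  also have "... \<le> \<Psi> (x0, y0)" using \<Psi>0 by simp
  also have "... \<le> \<Psi> (xb, yb)" using b q0S by blast
  finally show ?thesis .
 qed
 have "\<epsilon> * max 0 (1 - norm (xb - x0)) \<le> \<epsilon> * 1" using \<epsilon> by (intro mult_left_mono) auto
 moreover have "m + \<epsilon> < \<Phi> (xb, yb) + 2 * \<epsilon> * max 0 (1 - norm (xb - x0))"
  using max[of x0 y0] \<Psi>0 unfolding \<Psi>_def fst_conv by linarith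
 ultimately have "0 < \<Phi> (xb, yb)" using \<epsilon> by linarith
 then have "norm (xb - yb) < 1" "xb \<noteq> yb" using close by (auto simp: \<Phi>_def)
 then show ?thesis using \<epsilon> max by (intro that[of \<epsilon> xb yb x0]) (auto simp: \<Psi>_def \<Phi>_def)
qed

text \<open>Ellipticity at the maximal pair. With a = xb - yb and z close to -a, moving xb by z
  brings it next to yb, and moving yb by z puts it at distance about 2|a| from xb. Maximality then
  makes the integrand of Lop v xb - Lop v yb at least A c1 |a|^\<beta> times the kernel, up to the
  bump. Over a ball of radius |a|/9 this sums to A c2 |a|^(\<beta>-s), which is at least A c2
  because \<beta> \<le> s and |a| \<le> 1, against the upper bound 2B.\<close>

lemma holder_basic_ex:
 assumes \<beta>: "0 < \<beta>" "\<beta> \<le> 1/3" "\<beta> \<le> s" and B: "0 < B"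
 shows "\<exists>A>0. \<forall>v :: 'a::euclidean_space => real. continuous_on UNIV v \<longrightarrow> (\<forall>x. \<bar>v x\<bar> \<le> B) \<longrightarrow>
  (\<forall>x. lint v x \<and> \<bar>Lop v x\<bar> \<le> B) \<longrightarrow> (\<forall>x y. \<bar>v x - v y\<bar> \<le> A * norm (x - y) powr \<beta>)"
proof -
 define n where "n = real DIM('a)"
 obtain J where J: "J > 0" "integrable lborel (%z::'a. min 1 (1 * norm z) * kern z)"
   "(LBINT z. min 1 (1 * norm (z::'a)) * kern z) \<le> J * 1 powr s"
  using kmin_integrable_ex[where 'a='a] by (metis zero_less_one)
 define c1 where "c1 = 2 - 9 powr -\<beta> - 3 powr \<beta>"
 have c1: "0 < c1" unfolding c1_def using holder_gain_pos \<beta> by auto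
 define \<omega> where "\<omega> = unit_ball_vol n"
 have \<omega>: "0 < \<omega>" unfolding \<omega>_def n_def by simp
 define c2 where "c2 = c1 * \<omega> * 2 powr -(n+s) * 9 powr -n"
 have c2: "0 < c2" unfolding c2_def using c1 \<omega> by simp
 \<comment> \<open>The first entry is what \<open>doubling_max\<close> asks for. The second makes
   the gain exceed 2B, for the two values of \<open>Lop\<close>, plus the 1 that the bump may
   cost.\<close>
 define A where "A = max (2 * B) ((2 * B + 2) / c2)"
 have A: "2 * B \<le> A" "0 < A" "2 * B + 2 \<le> A * c2" using B c2 by (auto simp: A_def field_simps max_def)
 have main: "v x1 - v y1 \<le> A * norm (x1 - y1) powr \<beta>"
  if cont: "continuous_on UNIV v" and bd: "\<And>x. \<bar>v x\<bar> \<le> B" and li: "\<And>x. lint v x" and Lb: "\<And>x. \<bar>Lop v x\<bar> \<le> B"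
  for v :: "'a => real" and x1 y1
 proof (rule ccontr)
  assume "\<not> ?thesis"
  then have ex: "A * norm (x1 - y1) powr \<beta> < v x1 - v y1" by simp
  have e0: "0 < 1 / (2 * J)" using J by simp
  obtain x0 xb yb \<epsilon> where \<epsilon>: "0 < \<epsilon>" "\<epsilon> \<le> 1 / (2 * J)" and ne: "xb \<noteq> yb" and le1: "norm (xb - yb) \<le> 1"
   and max: "\<And>x y. v x - v y - A * norm (x - y) powr \<beta> + 2 * \<epsilon> * max 0 (1 - norm (x - x0))
    \<le> v xb - v yb - A * norm (xb - yb) powr \<beta> + 2 * \<epsilon> * max 0 (1 - norm (xb - x0))"
   using doubling_max[OF cont bd A(1,2) \<beta>(1) ex e0] by metis
  define a where "a = xb - yb"
  have a: "0 < norm a" "norm a \<le> 1" using ne le1 by (auto simp: a_def)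
  define D where "D = ball (- a) (norm a / 9)"
  define g where "g = A * c1 * norm a powr \<beta> * (2 * norm a) powr -(n+s)"
  define I where "I z = (v xb - v (xb + z)) * kern z - (v yb - v (yb + z)) * kern z" for z
  have bump: "2 * \<epsilon> * max 0 (1 - norm (xb - x0)) - 2 * \<epsilon> * max 0 (1 - norm (xb + z - x0)) \<le> 2 * \<epsilon> * min 1 (norm z)" for z
  proof -
   have "max 0 (1 - norm (xb - x0)) - max 0 (1 - norm (xb + z - x0)) \<le> min 1 (norm z)"
    using bump_lipschitz[of "xb - x0" "xb + z - x0"] by (simp add: abs_le_iff)
   then show ?thesis using \<epsilon> by (simp flip: right_diff_distrib)
  qed
  have low: "g * indicator D z - 2 * \<epsilon> * (min 1 (norm z) * kern z) \<le> I z" for z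
  proof (cases "z \<in> D")
   case True
   have "norm (a + z) < norm a / 9" using True unfolding D_def by (simp add: dist_norm norm_minus_commute) (metis add.commute minus_diff_eq norm_minus_cancel diff_minus_eq_add)
   have z1: "norm z \<le> 2 * norm a" using norm_triangle_ineq[of "a + z" "- a"] \<open>norm (a + z) < norm a / 9\<close> a by (simp; linarith)
   have z0: "z \<noteq> 0" using \<open>norm (a + z) < norm a / 9\<close> a by auto
   have p1: "norm (a + z) powr \<beta> \<le> norm a powr \<beta> * 9 powr -\<beta>"
   proof -
    have "norm (a + z) powr \<beta> \<le> (norm a / 9) powr \<beta>"
     using \<open>norm (a + z) < norm a / 9\<close> \<beta> by (intro powr_mono2) auto
    then show ?thesis by (simp add: powr_divide powr_minus_divide)
   qed
   have "norm (a - z) \<le> 3 * norm a" using norm_triangle_ineq4[of a z] z1 by simp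
   then have p2: "norm (a - z) powr \<beta> \<le> norm a powr \<beta> * 3 powr \<beta>"
    using powr_mono2[of \<beta> "norm (a - z)" "3 * norm a"] \<beta> by (simp add: powr_mult mult.commute)
   have m1: "v xb - v (xb + z) \<ge> A * (norm a powr \<beta> - norm (a + z) powr \<beta>) - 2 * \<epsilon> * min 1 (norm z)"
    using max[of "xb + z" yb] bump[of z] unfolding a_def by (simp add: algebra_simps)
   have m2: "v (yb + z) - v yb \<ge> A * (norm a powr \<beta> - norm (a - z) powr \<beta>)"
    using max[of xb "yb + z"] unfolding a_def by (simp add: algebra_simps)
   have "A * (norm a powr \<beta> - norm (a + z) powr \<beta>) + A * (norm a powr \<beta> - norm (a - z) powr \<beta>)
    = A * (2 * norm a powr \<beta> - norm (a + z) powr \<beta> - norm (a - z) powr \<beta>)" by (simp add: algebra_simps)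
   also have "... \<ge> A * (2 * norm a powr \<beta> - norm a powr \<beta> * 9 powr -\<beta> - norm a powr \<beta> * 3 powr \<beta>)"
    using p1 p2 A by (intro mult_left_mono) auto
   finally have m3: "A * c1 * norm a powr \<beta> - 2 * \<epsilon> * min 1 (norm z) \<le> (v xb - v (xb + z)) - (v yb - v (yb + z))"
    using m1 m2 by (simp add: c1_def algebra_simps)
   have kg: "(2 * norm a) powr -(n+s) \<le> kern z" using kern_ge[OF z0 z1] by (simp add: n_def)
   have "g \<le> A * c1 * norm a powr \<beta> * kern z" unfolding g_def using kg A c1 by (intro mult_left_mono) auto
   moreover have "(A * c1 * norm a powr \<beta> - 2 * \<epsilon> * min 1 (norm z)) * kern z \<le> ((v xb - v (xb + z)) - (v yb - v (yb + z))) * kern z"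
    using m3 by (intro mult_right_mono) auto
   ultimately show ?thesis using True by (simp add: I_def algebra_simps)
  next
   case False
   \<comment> \<open>Off \<open>D\<close> both points are moved by the same z: their distance is
     unchanged and only the bump can lose.\<close>
   have "- 2 * \<epsilon> * min 1 (norm z) \<le> (v xb - v (xb + z)) - (v yb - v (yb + z))"
    using max[of "xb + z" "yb + z"] bump[of z] by (simp add: algebra_simps)
   then have "(- 2 * \<epsilon> * min 1 (norm z)) * kern z \<le> ((v xb - v (xb + z)) - (v yb - v (yb + z))) * kern z"
    by (intro mult_right_mono) auto
   then show ?thesis using False by (simp add: I_def algebra_simps)
  qed
  have iI: "integrable lborel I" unfolding I_def using li[of xb] li[of yb] by (intro Lintegrable_diff) (auto simp: lint_def)
  have Ieq: "integral\<^sup>L lborel I = Lop v xb - Lop v yb"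
   unfolding I_def Lop_def using li[of xb] li[of yb] by (intro Lintegral_diff) (auto simp: lint_def)
  have iD: "integrable lborel (indicator D :: 'a => real)"
   unfolding D_def by (intro integrable_real_indicator) (auto simp: emeasure_ball)
  have iJ: "integrable lborel (%z::'a. min 1 (norm z) * kern z)" using J(2) by simp
  have mD: "measure lborel D = \<omega> * (norm a / 9) powr n"
   unfolding D_def measure_def \<omega>_def n_def using a by (simp add: emeasure_ball powr_realpow)
  have "(LBINT z. g * indicator D z - 2 * \<epsilon> * (min 1 (norm z) * kern z)) \<le> integral\<^sup>L lborel I"
   by (intro integral_mono iI low Lintegrable_diff integrable_mult_right iD iJ)
  also have "(LBINT z. g * indicator D z - 2 * \<epsilon> * (min 1 (norm z) * kern z))
   = g * measure lborel D - 2 * \<epsilon> * (LBINT z. min 1 (norm (z::'a)) * kern z)"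
   using iD iJ by (subst Lintegral_diff) (auto simp: D_def)
  finally have 1: "g * measure lborel D - 2 * \<epsilon> * (LBINT z. min 1 (norm (z::'a)) * kern z) \<le> 2 * B"
   using Ieq Lb[of xb] Lb[of yb] by linarith
  have 2: "2 * \<epsilon> * (LBINT z. min 1 (norm (z::'a)) * kern z) \<le> 1"
  proof -
   have "2 * \<epsilon> * (LBINT z. min 1 (norm (z::'a)) * kern z) \<le> 2 * (1 / (2 * J)) * J"
    using \<epsilon> J by (intro mult_mono) (auto intro!: integral_nonneg)
   then show ?thesis using J by simp
  qed
  have "g * measure lborel D = A * c2 * norm a powr (\<beta> - s)"
   unfolding g_def mD c2_def using a
   by (simp add: powr_mult powr_divide powr_diff powr_add powr_minus field_simps)
  moreover have "1 \<le> norm a powr (\<beta> - s)"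
   using a \<beta> powr_mono2'[of "\<beta> - s" "norm a" 1] by simp
  then have "A * c2 * 1 \<le> A * c2 * norm a powr (\<beta> - s)" using A c2 by (intro mult_left_mono) auto
  ultimately have "A * c2 \<le> g * measure lborel D" by linarith
  with 1 2 A(3) show False by linarith
 qed
 show ?thesis
 proof (intro exI[of _ A] conjI allI impI)
  show "0 < A" by (fact A(2))
  fix v :: "'a => real" and x y
  assume h: "continuous_on UNIV v" "\<forall>x. \<bar>v x\<bar> \<le> B" "\<forall>x. lint v x \<and> \<bar>Lop v x\<bar> \<le> B"
  have "v x - v y \<le> A * norm (x - y) powr \<beta>" "v y - v x \<le> A * norm (y - x) powr \<beta>"
   using h by (auto intro!: main)
  then show "\<bar>v x - v y\<bar> \<le> A * norm (x - y) powr \<beta>" by (simp add: norm_minus_commute abs_le_iff)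
 qed
qed


section \<open>From second differences to Lipschitz bounds\<close>

lemma second_diff_iterate:
 fixes v :: "'a::real_normed_vector => real"
 assumes sd: "\<And>x h. \<bar>v (x + h + h) - 2 * v (x + h) + v x\<bar> \<le> A * norm h powr \<sigma>"
 shows "\<bar>v (x + h) - v x\<bar> \<le> (1/2)^k * \<bar>v (x + 2^k *\<^sub>R h) - v x\<bar>
   + A / 2 * norm h powr \<sigma> * (\<Sum>i<k. (2 powr (\<sigma> - 1)) ^ i)"
proof (induction k)
 case 0 then show ?case by simp
next
 case (Suc k)
 define h' where "h' = 2^k *\<^sub>R h"
 have e: "x + h' + h' = x + 2^Suc k *\<^sub>R h" unfolding h'_def by (simp add: algebra_simps flip: scaleR_add_left)
 have n: "norm h' powr \<sigma> = (2 powr \<sigma>)^k * norm h powr \<sigma>"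
  unfolding h'_def by (simp add: powr_mult powr_powr mult.commute flip: powr_realpow)
 have "2 * \<bar>v (x + h') - v x\<bar> \<le> \<bar>v (x + h' + h') - v x\<bar> + A * norm h' powr \<sigma>"
  using sd[of x h'] by (simp add: abs_if split: if_splits)
 then have "(1/2)^k * \<bar>v (x + h') - v x\<bar> \<le> (1/2)^k * (1/2 * \<bar>v (x + h' + h') - v x\<bar> + A/2 * norm h' powr \<sigma>)"
  by (intro mult_left_mono) auto
 also have "... = (1/2)^Suc k * \<bar>v (x + 2^Suc k *\<^sub>R h) - v x\<bar> + A / 2 * norm h powr \<sigma> * (2 powr (\<sigma> - 1)) ^ k"
  unfolding e n by (simp add: powr_diff power_divide algebra_simps)
 finally show ?case using Suc unfolding h'_def by (simp add: algebra_simps)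
qed

text \<open>An increment is half of the increment with doubled step, up to half a second difference.
  Iterating until the step has length about one, where the bound on v applies, leaves a geometric
  sum of ratio 2^(\<sigma>-1). For \<sigma> < 1 it converges; for \<sigma> > 1 its last term
  dominates and is comparable with |h|^(1-\<sigma>). At \<sigma> = 1 a logarithm would
  appear.\<close>

lemma second_diff_holder:
 fixes v :: "'a::real_normed_vector => real"
 assumes bd: "\<And>x. \<bar>v x\<bar> \<le> B" and "0 \<le> A" "0 < \<sigma>"
  and sd: "\<And>x h. \<bar>v (x + h + h) - 2 * v (x + h) + v x\<bar> \<le> A * norm h powr \<sigma>"
 shows "\<sigma> < 1 ==> \<bar>v (x + h) - v x\<bar> \<le> (2 * B + A / 2 / (1 - 2 powr (\<sigma> - 1))) * norm h powr \<sigma>"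
  and "1 < \<sigma> ==> \<bar>v (x + h) - v x\<bar> \<le> (2 * B + A / 2 * 2 powr (\<sigma> - 1) / (2 powr (\<sigma> - 1) - 1)) * norm h"
proof -
 have B0: "0 \<le> B" using bd[of 0] by linarith
 have tr: "\<bar>v y - v z\<bar> \<le> 2 * B" for y z using bd[of y] bd[of z] by linarith
 define q where "q = 2 powr (\<sigma> - 1)"
 consider "h = 0" | "1 \<le> norm h" | "h \<noteq> 0" "norm h < 1" by fastforce
 note cs = this
 have small: "\<exists>k. 1/2 ^ k \<le> norm h \<and> 2^k * norm h < 2" if "h \<noteq> 0" "norm h < 1"
 proof -
  from dyadic_near[of "norm h" 1] that obtain k :: nat where "1 / 2^(k+1) \<le> norm h" "norm h < 1 / 2 ^ k" by auto
  then show ?thesis by (intro exI[of _ "k+1"]) (auto simp: field_simps)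
 qed
 have base: "\<bar>v (x + h) - v x\<bar> \<le> 2 * B * norm h + A / 2 * norm h powr \<sigma> * (\<Sum>i<k. q ^ i)" if "1/2 ^ k \<le> norm h" for k
 proof -
  have "(1/2)^k * \<bar>v (x + 2^k *\<^sub>R h) - v x\<bar> \<le> norm h * (2 * B)"
   using that tr by (intro mult_mono) (auto simp: power_divide)
  then have "(1/2)^k * \<bar>v (x + 2^k *\<^sub>R h) - v x\<bar> \<le> 2 * B * norm h" by (simp add: mult_ac)
  then show ?thesis using second_diff_iterate[OF sd, of x h k] unfolding q_def by linarith
 qed
 { assume \<sigma>: "\<sigma> < 1"
  have q: "0 < q" "q < 1" unfolding q_def using \<sigma> powr_less_one[of 2 "\<sigma> - 1"] by auto
  have C: "0 \<le> A / 2 / (1 - q)" using q assms by simp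
  show "\<bar>v (x + h) - v x\<bar> \<le> (2 * B + A / 2 / (1 - 2 powr (\<sigma> - 1))) * norm h powr \<sigma>"
   using cs
  proof cases
   case 1 then show ?thesis by simp
  next
   case 2
   then have "1 \<le> norm h powr \<sigma>" using assms by (simp add: ge_one_powr_ge_zero)
   then have "2 * B * 1 \<le> 2 * B * norm h powr \<sigma>" using B0 by (intro mult_left_mono) auto
   moreover have "0 \<le> (A / 2 / (1 - q)) * norm h powr \<sigma>" by (intro mult_nonneg_nonneg C) auto
   ultimately have "2 * B \<le> (2 * B + A / 2 / (1 - q)) * norm h powr \<sigma>" unfolding distrib_right by linarith
   then show ?thesis using tr[of "x + h" x] unfolding q_def by linarith
  next
   case 3
   from small[OF 3] obtain k where k: "1/2 ^ k \<le> norm h" by blast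
   have "(\<Sum>i<k. q ^ i) \<le> 1 / (1 - q)" using q by (simp add: geometric_sum field_simps sum_gp_strict)
   then have "A / 2 * norm h powr \<sigma> * (\<Sum>i<k. q ^ i) \<le> A / 2 * norm h powr \<sigma> * (1 / (1 - q))"
    using assms by (intro mult_left_mono) auto
   moreover have "norm h \<le> norm h powr \<sigma>" using 3 \<sigma> powr_mono'[of \<sigma> 1 "norm h"] by simp
   then have "2 * B * norm h \<le> 2 * B * norm h powr \<sigma>" using B0 by (intro mult_left_mono) auto
   moreover have "A / 2 * norm h powr \<sigma> * (1 / (1 - q)) = A / 2 / (1 - q) * norm h powr \<sigma>" by simp
   ultimately show ?thesis using base[OF k] unfolding q_def[symmetric] distrib_right by linarith
  qed }
 { assume \<sigma>: "1 < \<sigma>"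
  have q: "1 < q" unfolding q_def using \<sigma> by (simp add: gr_one_powr)
  have C: "0 \<le> A / 2 * q / (q - 1)" using q assms by simp
  show "\<bar>v (x + h) - v x\<bar> \<le> (2 * B + A / 2 * 2 powr (\<sigma> - 1) / (2 powr (\<sigma> - 1) - 1)) * norm h"
   using cs
  proof cases
   case 1 then show ?thesis by simp
  next
   case 2
   have "2 * B * 1 \<le> 2 * B * norm h" using 2 B0 by (intro mult_left_mono) auto
   moreover have "0 \<le> (A / 2 * q / (q - 1)) * norm h" by (intro mult_nonneg_nonneg C) auto
   ultimately have "2 * B \<le> (2 * B + A / 2 * q / (q - 1)) * norm h" unfolding distrib_right by linarith
   then show ?thesis using tr[of "x + h" x] unfolding q_def by linarith
  next
   case 3
   from small[OF 3] obtain k where k: "1/2 ^ k \<le> norm h" "2^k * norm h < 2" by blast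
   have "(\<Sum>i<k. q ^ i) = (q ^ k - 1) / (q - 1)" using q by (simp add: sum_gp_strict field_simps)
   also have "... \<le> q ^ k / (q - 1)" using q by (simp add: divide_right_mono)
   finally have s: "(\<Sum>i<k. q ^ i) \<le> q ^ k / (q - 1)" .
   have "norm h powr \<sigma> * q ^ k = norm h * (2^k * norm h) powr (\<sigma> - 1)"
proof -
    have "q ^ k = (2 powr real k) powr (\<sigma> - 1)" unfolding q_def by (simp add: powr_powr mult.commute flip: powr_realpow)
    also have "2 powr real k = 2 ^ k" by (simp add: powr_realpow)
    finally have "norm h * (2^k * norm h) powr (\<sigma> - 1) = norm h powr 1 * norm h powr (\<sigma> - 1) * q ^ k"
     using 3 by (simp add: powr_mult)
    also have "norm h powr 1 * norm h powr (\<sigma> - 1) = norm h powr \<sigma>" using powr_mult_base[of "norm h" "\<sigma> - 1"] by simp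
    finally show ?thesis by simp
   qed
   also have "... \<le> norm h * 2 powr (\<sigma> - 1)" using k \<sigma> by (intro mult_left_mono powr_mono2) auto
   finally have s2: "norm h powr \<sigma> * q ^ k \<le> norm h * q" unfolding q_def .
   have "A / 2 * norm h powr \<sigma> * (\<Sum>i<k. q ^ i) \<le> A / 2 * norm h powr \<sigma> * (q ^ k / (q - 1))"
    using assms s by (intro mult_left_mono) auto
   also have "... = A / 2 / (q - 1) * (norm h powr \<sigma> * q ^ k)" by simp
   also have "... \<le> A / 2 / (q - 1) * (norm h * q)" using s2 q assms by (intro mult_left_mono) auto
   also have "... = A / 2 * q / (q - 1) * norm h" by simp
   finally show ?thesis using base[OF k(1)] unfolding q_def[symmetric] distrib_right by linarith
  qed }
qed

lemma Lop_diff_scaled: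
 fixes v :: "'a::euclidean_space => real"
 assumes "\<And>x. lint v x"
 shows "lint (%x. (v (x + h) - v x) / c) x" "Lop (%x. (v (x + h) - v x) / c) x = (Lop v (x + h) - Lop v x) / c"
proof -
 have e: "((v (x + h) - v x) / c - (v (x + z + h) - v (x + z)) / c) * kern z
  = ((v (x + h) - v (x + h + z)) * kern z - (v x - v (x + z)) * kern z) / c" for z
  by (simp add: algebra_simps diff_divide_distrib add_divide_distrib)
 have i: "integrable lborel (%z. (v (x + h) - v (x + h + z)) * kern z)" "integrable lborel (%z. (v x - v (x + z)) * kern z)"
  using assms by (auto simp: lint_def)
 show "lint (%x. (v (x + h) - v x) / c) x" unfolding lint_def e using i by auto
 show "Lop (%x. (v (x + h) - v x) / c) x = (Lop v (x + h) - Lop v x) / c"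
  unfolding Lop_def e using i by simp
qed

text \<open>Solutions of Lop v = f(x, v x), seen only through bounds. The constants are fixed for
  the whole class because the bootstrap is applied to difference quotients and must not depend on
  their step.\<close>

definition semilin :: "real => real => ('a::euclidean_space => real) => bool" where
 "semilin B Q v \<longleftrightarrow> continuous_on UNIV v \<and> (\<forall>x. \<bar>v x\<bar> \<le> B) \<and> (\<forall>x. lint v x \<and> \<bar>Lop v x\<bar> \<le> B) \<and>
   (\<forall>x y. \<bar>Lop v x - Lop v y\<bar> \<le> Q * (\<bar>v x - v y\<bar> + norm (x - y)))"

text \<open>For |h| < 1 the quotient (v(.+h) - v)/|h|^\<gamma> is bounded, and so is its image under
  \<open>Lop\<close>, by the Lipschitz condition in \<open>semilin\<close>. The basic Hoelder bound
  applies to it uniformly in h, and its increment by the same h is a second difference of v divided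
  by |h|^\<gamma>.\<close>

lemma semilin_upgrade:
 assumes \<beta>: "0 < \<beta>" "\<beta> \<le> 1/3" "\<beta> \<le> s" and B: "0 < B" and Q: "0 < Q" and \<gamma>: "0 < \<gamma>" "\<gamma> \<le> 1" and A: "0 < A"
  and hyp: "\<And>(v :: 'a::euclidean_space => real) x y. semilin B Q v ==> \<bar>v x - v y\<bar> \<le> A * norm (x - y) powr \<gamma>"
 shows "\<exists>A'>0. \<forall>v :: 'a => real. semilin B Q v \<longrightarrow> (\<forall>x h. \<bar>v (x + h + h) - 2 * v (x + h) + v x\<bar> \<le> A' * norm h powr (\<gamma> + \<beta>))"
proof -
 define B' where "B' = max A (Q * (A + 1))"
 have B': "0 < B'" using A by (simp add: B'_def)
 from holder_basic_ex[OF \<beta> B', where 'a='a] obtain C where C0: "C > 0" and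
  C1: "\<forall>v :: 'a => real. continuous_on UNIV v \<longrightarrow> (\<forall>x. \<bar>v x\<bar> \<le> B') \<longrightarrow>
  (\<forall>x. lint v x \<and> \<bar>Lop v x\<bar> \<le> B') \<longrightarrow> (\<forall>x y. \<bar>v x - v y\<bar> \<le> C * norm (x - y) powr \<beta>)" by blast
 show ?thesis
 proof (intro exI[of _ "max C (4 * B)"] conjI allI impI)
  show "0 < max C (4 * B)" using C0 by simp
  fix v :: "'a => real" and x h :: 'a
  assume v: "semilin B Q v"
  consider "h = 0" | "1 \<le> norm h" | "h \<noteq> 0" "norm h < 1" by fastforce
  then show "\<bar>v (x + h + h) - 2 * v (x + h) + v x\<bar> \<le> max C (4 * B) * norm h powr (\<gamma> + \<beta>)"
  proof cases
   case 1 then show ?thesis by simp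
  next
   case 2
   have "\<bar>v (x + h + h)\<bar> \<le> B" "\<bar>v (x + h)\<bar> \<le> B" "\<bar>v x\<bar> \<le> B" using v by (auto simp: semilin_def)
   then have "\<bar>v (x + h + h) - 2 * v (x + h) + v x\<bar> \<le> 4 * B * 1" by linarith
   also have "... \<le> max C (4 * B) * norm h powr (\<gamma> + \<beta>)"
    using 2 \<beta> \<gamma> B by (intro mult_mono) (auto simp: ge_one_powr_ge_zero)
   finally show ?thesis .
  next
   case 3
   define c where "c = norm h powr \<gamma>"
   have c: "0 < c" "norm h \<le> c" using 3 \<gamma> powr_mono'[of \<gamma> 1 "norm h"] by (auto simp: c_def)
   define w where "w x = (v (x + h) - v x) / c" for x
   have cv: "continuous_on UNIV v" and li: "\<And>x. lint v x" using v by (auto simp: semilin_def)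
   have "continuous_on UNIV w" unfolding w_def using c
    by (intro continuous_intros continuous_on_compose2[OF cv]) auto
   moreover have dv: "\<bar>v (y + h) - v y\<bar> \<le> A * c" for y using hyp[OF v, of "y + h" y] by (simp add: c_def)
   then have "\<bar>w y\<bar> \<le> B'" for y using c by (simp add: w_def B'_def abs_divide divide_le_eq le_max_iff_disj)
   moreover have "lint w y \<and> \<bar>Lop w y\<bar> \<le> B'" for y
   proof
    show "lint w y" unfolding w_def by (rule Lop_diff_scaled(1)[OF li])
    have "\<bar>Lop v (y + h) - Lop v y\<bar> \<le> Q * (\<bar>v (y + h) - v y\<bar> + norm (y + h - y))" using v unfolding semilin_def by blast
    also have "... \<le> Q * (A * c + c)" using Q dv[of y] c by (intro mult_left_mono add_mono) auto
    finally have "\<bar>Lop v (y + h) - Lop v y\<bar> \<le> Q * (A + 1) * c" by (simp add: algebra_simps)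
    then show "\<bar>Lop w y\<bar> \<le> B'" unfolding w_def Lop_diff_scaled(2)[OF li] using c
     by (simp add: B'_def abs_divide divide_le_eq le_max_iff_disj)
   qed
   ultimately have "\<bar>w (x + h) - w x\<bar> \<le> C * norm h powr \<beta>" using C1 by (metis add_diff_cancel_left')
   moreover have "w (x + h) - w x = (v (x + h + h) - 2 * v (x + h) + v x) / c"
    unfolding w_def by (simp add: diff_divide_distrib add_divide_distrib)
   ultimately have "\<bar>v (x + h + h) - 2 * v (x + h) + v x\<bar> \<le> C * norm h powr \<beta> * c"
    using c by (simp add: abs_divide divide_le_eq)
   also have "... = C * norm h powr (\<gamma> + \<beta>)" by (simp add: c_def powr_add)
   also have "... \<le> max C (4 * B) * norm h powr (\<gamma> + \<beta>)" by (intro mult_right_mono) auto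
   finally show ?thesis .
  qed
 qed
qed

text \<open>Each round of \<open>semilin_upgrade\<close> and \<open>second_diff_holder\<close>
  raises the Hoelder exponent by \<beta>; the round that passes the exponent 1 gives the Lipschitz
  bound.\<close>

lemma semilin_lipschitz_ex:
 assumes B: "0 < B" and Q: "0 < Q"
 shows "\<exists>\<Lambda>>0. \<forall>v :: 'a::euclidean_space => real. semilin B Q v \<longrightarrow> (\<forall>x y. \<bar>v x - v y\<bar> \<le> \<Lambda> * norm (x - y))"
proof -
 define \<mu> where "\<mu> = min s (1/3)"
 obtain N :: nat where N: "1 / \<mu> < N" using reals_Archimedean2 by blast
 \<comment> \<open>With this step 1 is the midpoint between N\<beta> and (N+1)\<beta>, so the
   exceptional exponent 1 is never met.\<close>
 define \<beta> where "\<beta> = 2 / (2 * real N + 1)"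
 have m: "0 < \<mu>" using s_pos by (simp add: \<mu>_def)
 have N0: "0 < N" using N m by (metis divide_pos_pos gr0I of_nat_0 not_less_iff_gr_or_eq zero_less_one less_trans)
 have "1 < real N * \<mu>" using N m by (simp add: divide_less_eq mult.commute)
 then have b1: "1 / real N < \<mu>" using N0 by (simp add: divide_less_eq mult.commute)
 have "\<beta> \<le> 1 / real N" using N0 by (simp add: \<beta>_def field_simps)
 with b1 have "\<beta> \<le> \<mu>" by linarith
 moreover have "0 < \<beta>" by (simp add: \<beta>_def)
 ultimately have \<beta>: "0 < \<beta>" "\<beta> \<le> 1/3" "\<beta> \<le> s" by (auto simp: \<mu>_def)
 have "2 * real N + 1 \<noteq> 0" by linarith
 then have "\<beta> * (2 * real N + 1) = 2" using \<beta>_def by (metis nonzero_eq_divide_eq)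
 then have "2 * (real N * \<beta>) + \<beta> = 2" by (simp add: algebra_simps)
 with \<beta> have N\<beta>: "real N * \<beta> < 1" "1 < real N * \<beta> + \<beta>" by linarith+
 have hold: "\<exists>A>0. \<forall>v :: 'a => real. semilin B Q v \<longrightarrow> (\<forall>x y. \<bar>v x - v y\<bar> \<le> A * norm (x - y) powr (real (Suc k) * \<beta>))"
  if "Suc k \<le> N" for k using that
 proof (induction k)
  case 0
  show ?case using holder_basic_ex[OF \<beta> B, where 'a='a] by (auto simp: semilin_def)
 next
  case (Suc k)
  then obtain A where A: "A > 0" "\<And>(v :: 'a => real) x y. semilin B Q v ==> \<bar>v x - v y\<bar> \<le> A * norm (x - y) powr (real (Suc k) * \<beta>)" by auto
  define \<gamma> where "\<gamma> = real (Suc k) * \<beta>"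
  define \<sigma> where "\<sigma> = \<gamma> + \<beta>"
  have \<sigma>: "\<sigma> = real (Suc (Suc k)) * \<beta>" by (simp add: \<sigma>_def \<gamma>_def algebra_simps)
  have "\<sigma> \<le> real N * \<beta>" unfolding \<sigma> using Suc.prems \<beta> by (intro mult_right_mono) auto
  then have "\<sigma> < 1" using N\<beta> by linarith
  moreover have "0 < \<sigma>" unfolding \<sigma> using \<beta> by simp
  ultimately have \<sigma>1: "\<sigma> < 1" "0 < \<sigma>" by auto
  have \<gamma>: "0 < \<gamma>" "\<gamma> \<le> 1" using \<sigma>1 \<beta> by (auto simp: \<sigma>_def) (auto simp: \<gamma>_def)
  from semilin_upgrade[OF \<beta> B Q \<gamma> A(1) A(2)[folded \<gamma>_def]] obtain A' where A': "A' > 0"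
   "\<And>(v :: 'a => real) x h. semilin B Q v ==> \<bar>v (x + h + h) - 2 * v (x + h) + v x\<bar> \<le> A' * norm h powr \<sigma>"
   unfolding \<sigma>_def by blast
  define C where "C = 2 * B + A' / 2 / (1 - 2 powr (\<sigma> - 1))"
  have "0 < C" unfolding C_def using B A' \<sigma>1 powr_less_one[of 2 "\<sigma> - 1"] by (intro add_pos_pos) auto
  moreover have "\<bar>v x - v y\<bar> \<le> C * norm (x - y) powr \<sigma>" if "semilin B Q v" for v :: "'a => real" and x y
   using second_diff_holder(1)[of v B A' \<sigma> y "x - y"] that A' \<sigma>1 unfolding C_def by (auto simp: semilin_def)
  ultimately show ?case unfolding \<sigma> by blast
 qed
 from hold[of "N - 1"] N0 obtain A where A: "A > 0"
  "\<And>(v :: 'a => real) x y. semilin B Q v ==> \<bar>v x - v y\<bar> \<le> A * norm (x - y) powr (real N * \<beta>)" by auto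
 define \<sigma> where "\<sigma> = real N * \<beta> + \<beta>"
 have \<gamma>: "0 < real N * \<beta>" "real N * \<beta> \<le> 1" using N0 \<beta> N\<beta> by auto
 from semilin_upgrade[OF \<beta> B Q \<gamma> A] obtain A' where A': "A' > 0"
  "\<And>(v :: 'a => real) x h. semilin B Q v ==> \<bar>v (x + h + h) - 2 * v (x + h) + v x\<bar> \<le> A' * norm h powr \<sigma>"
  unfolding \<sigma>_def by blast
 have \<sigma>: "1 < \<sigma>" using N\<beta> by (simp add: \<sigma>_def)
 define C where "C = 2 * B + A' / 2 * 2 powr (\<sigma> - 1) / (2 powr (\<sigma> - 1) - 1)"
 have "0 < C" unfolding C_def using B A' \<sigma> gr_one_powr[of 2 "\<sigma> - 1"] by (intro add_pos_pos) auto
 moreover have "\<bar>v x - v y\<bar> \<le> C * norm (x - y)" if "semilin B Q v" for v :: "'a => real" and x y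
  using second_diff_holder(2)[of v B A' \<sigma> y "x - y"] that A' \<sigma> unfolding C_def by (auto simp: semilin_def)
 ultimately show ?thesis by blast
qed

end

section \<open>Bounded Lipschitz functions in the domain of the operator\<close>

context frac_order
begin

lemma kmin_integrable:
 assumes "0 < l"
 shows "integrable lborel (%z::'a::euclidean_space. min 1 (l * norm z) * kern z)"
 using kmin_integrable_ex[where 'a='a] assms by auto

lemma lipschitz_measurable:
 fixes v :: "'a::euclidean_space => real"
 assumes "\<And>x y. \<bar>v x - v y\<bar> \<le> \<Lambda> * norm (x - y)"
 shows "v \<in> borel_measurable borel" "continuous_on UNIV v"
proof -
 have "\<Lambda> \<ge> 0"
 proof -
  obtain b :: 'a where "b \<in> Basis" by (meson nonempty_Basis ex_in_conv)
  then show ?thesis using assms[of b 0] by simp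
 qed
 then have "\<Lambda>-lipschitz_on UNIV v" using assms by (intro lipschitz_onI) (auto simp: dist_norm)
 then show c: "continuous_on UNIV v" by (rule lipschitz_on_continuous_on)
 show "v \<in> borel_measurable borel" using c by (rule borel_measurable_continuous_onI)
qed

lemma diff_kern_bound:
 fixes v :: "'a::euclidean_space => real"
 assumes "\<And>x. \<bar>v x\<bar> \<le> B" "\<And>x y. \<bar>v x - v y\<bar> \<le> \<Lambda> * norm (x - y)" "0 \<le> \<Lambda>"
 shows "\<bar>v x - v y\<bar> \<le> (2 * B + \<Lambda>) * min 1 (norm (x - y))"
proof -
 have B: "0 \<le> B" using assms(1)[of x] by linarith
 show ?thesis
 proof (cases "norm (x - y) \<le> 1")
  case True
  have "\<Lambda> * norm (x - y) \<le> (2 * B + \<Lambda>) * norm (x - y)" using B by (intro mult_right_mono) auto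
  then show ?thesis using True assms(2)[of x y] by (simp add: min_def)
 next
  case False
  then show ?thesis using assms(1)[of x] assms(1)[of y] assms(3) by (simp add: min_def)
 qed
qed

lemma lipschitz_lint:
 fixes v :: "'a::euclidean_space => real"
 assumes "\<And>x. \<bar>v x\<bar> \<le> B" "\<And>x y. \<bar>v x - v y\<bar> \<le> \<Lambda> * norm (x - y)" "0 \<le> \<Lambda>"
 shows "lint v x"
 unfolding lint_def
proof (rule Lintegrable_bound)
 show "integrable lborel (%z::'a. (2 * B + \<Lambda>) * (min 1 (1 * norm z) * kern z))"
  by (intro integrable_mult_right kmin_integrable) auto
 have [measurable]: "v \<in> borel_measurable borel" using lipschitz_measurable assms(2) by blast
 show "(%z. (v x - v (x + z)) * kern z) \<in> borel_measurable lborel" by measurable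
 have "\<bar>(v x - v (x + z)) * kern z\<bar> \<le> \<bar>(2 * B + \<Lambda>) * (min 1 (1 * norm z) * kern z)\<bar>" for z
 proof -
  have "\<bar>(v x - v (x + z)) * kern z\<bar> \<le> (2 * B + \<Lambda>) * min 1 (norm (x - (x + z))) * kern z"
   unfolding abs_mult using diff_kern_bound[OF assms, of x "x + z"] by (intro mult_mono) auto
  also have "... \<le> \<bar>(2 * B + \<Lambda>) * (min 1 (1 * norm z) * kern z)\<bar>" by simp
  finally show ?thesis .
 qed
 then show "AE z in lborel. norm ((v x - v (x + z)) * kern z) \<le> norm ((2 * B + \<Lambda>) * (min 1 (1 * norm z) * kern z))"
  by simp
qed

end

lemma cubic_diff:
 fixes a b :: real
 shows "(a - a^3) - (b - b^3) = (1 - (a^2 + a * b + b^2)) * (a - b)"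
 by (simp add: algebra_simps power2_eq_square power3_eq_cube)

lemma cubic_coeff_bound:
 fixes a b :: real
 assumes "\<bar>a\<bar> \<le> 1" "\<bar>b\<bar> \<le> 1"
 shows "\<bar>1 - (a^2 + a * b + b^2)\<bar> \<le> 2"
proof -
 have "a^2 \<le> 1" "b^2 \<le> 1" "\<bar>a * b\<bar> \<le> 1" using assms by (auto simp: abs_square_le_1 abs_mult mult_le_one)
 moreover have "0 \<le> a^2 + a * b + b^2"
 proof -
  have "0 \<le> (a + b/2)^2 + 3/4 * b^2" by simp
  also have "... = a^2 + a * b + b^2" by (simp add: power2_eq_square algebra_simps)
  finally show ?thesis .
 qed
 ultimately show ?thesis by (auto simp: abs_le_iff)
qed

text \<open>The slope d is a limit point of the difference quotients with steps 1/(j+1). Adding up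
  mixed second differences shows that g (N h) - g 0 differs from N (g h - g 0) by at most \<Lambda>
  (N h)^2; letting N h tend to t > 0 gives the expansion there. The second difference with steps t
  and -t carries it over to t < 0, at the cost of doubling the constant.\<close>

lemma quadratic_taylor_1d:
 fixes g :: "real => real"
 assumes lip: "\<And>t r. \<bar>g t - g r\<bar> \<le> \<Lambda>1 * \<bar>t - r\<bar>"
  and c11: "\<And>t h k. \<bar>g (t + h + k) - g (t + h) - g (t + k) + g t\<bar> \<le> \<Lambda> * \<bar>h\<bar> * \<bar>k\<bar>"
 shows "\<exists>d. \<forall>t. \<bar>g t - g 0 - t * d\<bar> \<le> 2 * \<Lambda> * t^2"
proof -
 define \<tau> where "\<tau> j = 1 / real (Suc j)" for j
 define q where "q j = (g (\<tau> j) - g 0) / \<tau> j" for j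
 have \<tau>: "0 < \<tau> j" for j by (simp add: \<tau>_def)
 have \<tau>0: "\<tau> \<longlonglongrightarrow> 0" unfolding \<tau>_def using LIMSEQ_inverse_real_of_nat by (simp add: inverse_eq_divide)
 have \<Lambda>: "0 \<le> \<Lambda>" using c11[of 0 1 1] by linarith
 have "\<bar>q j\<bar> \<le> \<Lambda>1" for j using lip[of "\<tau> j" 0] \<tau>[of j] by (simp add: q_def abs_divide divide_le_eq)
 then have "bounded (range q)" by (auto simp: bounded_iff)
 then obtain d r where r: "strict_mono r" and d: "(q \<circ> r) \<longlonglongrightarrow> d"
  using bounded_imp_convergent_subsequence by blast
 have avg: "\<bar>g (real N * h) - g 0 - real N * (g h - g 0)\<bar> \<le> \<Lambda> * (real N * \<bar>h\<bar>)^2" for N h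
 proof (induction N)
  case 0 then show ?case by simp
 next
  case (Suc N)
  have "\<bar>g (real N * h + h) - g (real N * h) - g h + g 0\<bar> \<le> \<Lambda> * \<bar>real N * h\<bar> * \<bar>h\<bar>"
   using c11[of 0 "real N * h" h] by simp
  moreover have "g (real (Suc N) * h) - g 0 - real (Suc N) * (g h - g 0) =
   (g (real N * h + h) - g (real N * h) - g h + g 0) + (g (real N * h) - g 0 - real N * (g h - g 0))"
   by (simp add: algebra_simps)
  ultimately have "\<bar>g (real (Suc N) * h) - g 0 - real (Suc N) * (g h - g 0)\<bar> \<le> \<Lambda> * \<bar>real N * h\<bar> * \<bar>h\<bar> + \<Lambda> * (real N * \<bar>h\<bar>)^2"
   using Suc by linarith
  also have "... = \<Lambda> * ((real N + real N ^ 2) * \<bar>h\<bar>^2)" by (simp add: abs_mult algebra_simps power2_eq_square)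
  also have "... \<le> \<Lambda> * (real (Suc N)^2 * \<bar>h\<bar>^2)" using \<Lambda>
   by (intro mult_left_mono mult_right_mono) (auto simp: power2_eq_square algebra_simps)
  finally show ?case by (simp only: power_mult_distrib)
 qed
 have pos: "\<bar>g t - g 0 - t * d\<bar> \<le> \<Lambda> * t^2" if t: "0 < t" for t
 proof -
  define N where "N j = nat \<lfloor>t / \<tau> (r j)\<rfloor>" for j
  define t' where "t' j = real (N j) * \<tau> (r j)" for j
  have \<tau>r: "(%j. \<tau> (r j)) \<longlonglongrightarrow> 0" using LIMSEQ_subseq_LIMSEQ[OF \<tau>0 r] by (simp add: o_def)
  have t'b: "t - \<tau> (r j) \<le> t' j" "t' j \<le> t" for j
  proof -
   have nn: "0 \<le> \<lfloor>t / \<tau> (r j)\<rfloor>" using t \<tau>[of "r j"] by (simp add: divide_nonneg_pos)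
   have "real (N j) \<le> t / \<tau> (r j)" "t / \<tau> (r j) - 1 \<le> real (N j)" using nn unfolding N_def by linarith+
   then show "t - \<tau> (r j) \<le> t' j" "t' j \<le> t" using \<tau>[of "r j"] by (auto simp: t'_def field_simps)
  qed
  have t': "t' \<longlonglongrightarrow> t"
  proof (rule tendsto_sandwich)
   show "(%j. t - \<tau> (r j)) \<longlonglongrightarrow> t" using tendsto_diff[OF tendsto_const \<tau>r, of t] by simp
  qed (use t'b in auto)
  have "continuous_on UNIV g"
  proof (rule lipschitz_on_continuous_on)
   show "\<bar>\<Lambda>1\<bar>-lipschitz_on UNIV g"
   proof (rule lipschitz_onI)
    fix x y show "dist (g x) (g y) \<le> \<bar>\<Lambda>1\<bar> * dist x y"
     using lip[of x y] mult_right_mono[OF abs_ge_self[of \<Lambda>1], of "\<bar>x - y\<bar>"] by (simp add: dist_real_def)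
   qed simp
  qed
  then have gt: "(%j. g (t' j)) \<longlonglongrightarrow> g t"
   using t' by (metis continuous_on_tendsto_compose UNIV_I eventually_sequentiallyI)
  have "\<bar>g (t' j) - g 0 - t' j * q (r j)\<bar> \<le> \<Lambda> * (t' j)^2" for j
   using avg[of "N j" "\<tau> (r j)"] \<tau>[of "r j"] by (simp add: t'_def q_def)
  moreover have "(%j. \<bar>g (t' j) - g 0 - t' j * q (r j)\<bar>) \<longlonglongrightarrow> \<bar>g t - g 0 - t * d\<bar>"
   using d by (intro tendsto_intros gt t') (simp add: o_def)
  moreover have "(%j. \<Lambda> * (t' j)^2) \<longlonglongrightarrow> \<Lambda> * t^2" by (intro tendsto_intros t')
  ultimately show ?thesis by (intro LIMSEQ_le) auto
 qed
 show ?thesis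
 proof (intro exI[of _ d] allI)
  fix t :: real
  consider "t = 0" | "0 < t" | "0 < - t" by linarith
  then show "\<bar>g t - g 0 - t * d\<bar> \<le> 2 * \<Lambda> * t^2"
  proof cases
   case 1 then show ?thesis by simp
  next
   case 2
   have "\<Lambda> * t^2 \<le> 2 * \<Lambda> * t^2" using \<Lambda> by simp
   then show ?thesis using pos[OF 2] by linarith
  next
   case 3
   have "\<bar>g 0 - g t - g (- t) + g 0\<bar> \<le> \<Lambda> * t^2" using c11[of 0 t "- t"] by (simp add: power2_eq_square)
   moreover have "\<bar>g (- t) - g 0 + t * d\<bar> \<le> \<Lambda> * t^2" using pos[OF 3] by simp
   ultimately show ?thesis by linarith
  qed
 qed
qed

section \<open>The monotone solution and its gradient\<close>

locale monotone_layer = frac_order s for s :: real +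
 fixes u :: "'a::euclidean_space => real" and e0 :: 'a
 assumes u_cont: "continuous_on UNIV u"
  and u_lint: "\<And>x. lint u x"
  and u_eq: "\<And>x. Lop u x = u x - u x ^ 3"
  and e0_unit: "norm e0 = 1"
  and u_deriv: "\<And>x. \<exists>d>0. ((%t. u (x + t *\<^sub>R e0)) has_real_derivative d) (at 0)"
  and u_top: "\<And>x. ((%t. u (x + t *\<^sub>R e0)) \<longlongrightarrow> 1) at_top"
  and u_bot: "\<And>x. ((%t. u (x + t *\<^sub>R e0)) \<longlongrightarrow> -1) at_bot"
begin

lemma u_strict:
 assumes "a < b" shows "u (x + a *\<^sub>R e0) < u (x + b *\<^sub>R e0)"
proof (rule DERIV_pos_imp_increasing[OF assms])
 fix t :: real
 obtain d where d: "d > 0" "((%r. u ((x + t *\<^sub>R e0) + r *\<^sub>R e0)) has_real_derivative d) (at 0)"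
  using u_deriv by blast
 have "((%r. u (x + (t + r) *\<^sub>R e0)) has_real_derivative d) (at 0)"
  using d(2) by (simp add: algebra_simps)
 then have "((%r. u (x + r *\<^sub>R e0)) has_real_derivative d) (at t)"
  using DERIV_shift[of "%r. u (x + r *\<^sub>R e0)" d 0 t] by (simp add: add.commute)
 then show "\<exists>y. DERIV (%r. u (x + r *\<^sub>R e0)) t :> y \<and> 0 < y" using d by blast
qed

lemma u_mono: "a \<le> b ==> u (x + a *\<^sub>R e0) \<le> u (x + b *\<^sub>R e0)"
 using u_strict[of a b x] by (cases "a = b") auto

lemma u_lt_1: "u x < 1" and u_gt_m1: "-1 < u x"
proof -
 have "u (x + 1 *\<^sub>R e0) \<le> 1"
 proof (rule tendsto_lowerbound[OF u_top])
  show "\<forall>\<^sub>F t in at_top. u (x + 1 *\<^sub>R e0) \<le> u (x + t *\<^sub>R e0)"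
   using eventually_ge_at_top[of 1] by eventually_elim (rule u_mono)
 qed auto
 then show "u x < 1" using u_strict[of 0 1 x] by simp
 have "-1 \<le> u (x + (-1) *\<^sub>R e0)"
 proof (rule tendsto_upperbound[OF u_bot])
  show "\<forall>\<^sub>F t in at_bot. u (x + t *\<^sub>R e0) \<le> u (x + (-1) *\<^sub>R e0)"
   using eventually_le_at_bot[of "-1"] by eventually_elim (rule u_mono)
 qed auto
 then show "-1 < u x" using u_strict[of "-1" 0 x] by simp
qed

lemma u_abs: "\<bar>u x\<bar> \<le> 1" "\<bar>u x\<bar> < 1"
 using u_lt_1[of x] u_gt_m1[of x] by auto

lemma u_lipschitz_ex: "\<exists>\<Lambda>>0. \<forall>x y. \<bar>u x - u y\<bar> \<le> \<Lambda> * norm (x - y)"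
proof -
 have "semilin 2 2 u"
  unfolding semilin_def
 proof (intro conjI allI)
  show "continuous_on UNIV u" by (rule u_cont)
  fix x y
  show "\<bar>u x\<bar> \<le> 2" using u_abs[of x] by linarith
  show "lint u x" by (rule u_lint)
  have "\<bar>u x ^ 3\<bar> \<le> 1" using u_abs(1)[of x] by (simp add: power_abs power_le_one)
  then show "\<bar>Lop u x\<bar> \<le> 2" using u_abs(1)[of x] unfolding u_eq by linarith
  have "\<bar>Lop u x - Lop u y\<bar> \<le> 2 * \<bar>u x - u y\<bar>"
   unfolding u_eq cubic_diff abs_mult by (intro mult_right_mono cubic_coeff_bound u_abs) auto
  also have "... \<le> 2 * (\<bar>u x - u y\<bar> + norm (x - y))" by simp
  finally show "\<bar>Lop u x - Lop u y\<bar> \<le> 2 * (\<bar>u x - u y\<bar> + norm (x - y))" .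
 qed
 then show ?thesis using semilin_lipschitz_ex[of 2 2, where 'a='a] by auto
qed

text \<open>The quotient v = (u(.+h) - u)/|h| solves Lop v = q v, where q is a quadratic polynomial
  in u(.+h) and u, hence bounded and Lipschitz. So all these quotients lie in one class
  \<open>semilin\<close>, and their common Lipschitz bound is the bound on mixed second differences
  of u.\<close>

lemma u_c11_ex: "\<exists>\<Lambda>>0. \<forall>x h k. \<bar>u (x + h + k) - u (x + h) - u (x + k) + u x\<bar> \<le> \<Lambda> * norm h * norm k"
proof -
 obtain \<Lambda> where \<Lambda>: "\<Lambda> > 0" "\<And>x y. \<bar>u x - u y\<bar> \<le> \<Lambda> * norm (x - y)" using u_lipschitz_ex by blast
 define B where "B = 2 * \<Lambda>"
 define Q where "Q = 2 + 6 * \<Lambda>^2"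
 have BQ: "0 < B" "0 < Q" using \<Lambda> by (auto simp: B_def Q_def add_pos_nonneg)
 obtain \<Lambda>2 where \<Lambda>2: "\<Lambda>2 > 0" "\<And>(v::'a => real) x y. semilin B Q v ==> \<bar>v x - v y\<bar> \<le> \<Lambda>2 * norm (x - y)"
  using semilin_lipschitz_ex[OF BQ, where 'a='a] by blast
 have "\<bar>u (x + h + k) - u (x + h) - u (x + k) + u x\<bar> \<le> \<Lambda>2 * norm h * norm k" for x h k
 proof (cases "h = 0")
  case True then show ?thesis by simp
 next
  case False
  define c where "c = norm h"
  have c: "0 < c" using False by (simp add: c_def)
  define v where "v y = (u (y + h) - u y) / c" for y
  define q where "q y = 1 - (u (y + h)^2 + u (y + h) * u y + u y ^ 2)" for y
  have vb: "\<bar>v y\<bar> \<le> \<Lambda>" for y using \<Lambda>(2)[of "y + h" y] c by (simp add: v_def c_def abs_divide divide_le_eq)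
  have qb: "\<bar>q y\<bar> \<le> 2" for y unfolding q_def by (intro cubic_coeff_bound u_abs)
  have Lv: "Lop v y = q y * v y" for y
   unfolding v_def Lop_diff_scaled(2)[OF u_lint] u_eq cubic_diff q_def by simp
  have ql: "\<bar>q y - q z\<bar> \<le> 6 * \<Lambda> * norm (y - z)" for y z
  proof -
   define a b a' b' where d: "a = u (y + h)" "b = u y" "a' = u (z + h)" "b' = u z"
   have 1: "\<bar>a - a'\<bar> \<le> \<Lambda> * norm (y - z)" "\<bar>b - b'\<bar> \<le> \<Lambda> * norm (y - z)"
    using \<Lambda>(2)[of "y + h" "z + h"] \<Lambda>(2)[of y z] by (auto simp: d)
   have 2: "\<bar>a\<bar> \<le> 1" "\<bar>b\<bar> \<le> 1" "\<bar>a'\<bar> \<le> 1" "\<bar>b'\<bar> \<le> 1" using u_abs by (auto simp: d)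
   have "q z - q y = (a + a' + b) * (a - a') + (a' + b + b') * (b - b')"
    unfolding q_def d[symmetric] by (simp add: algebra_simps power2_eq_square)
   then have "\<bar>q z - q y\<bar> \<le> \<bar>a + a' + b\<bar> * \<bar>a - a'\<bar> + \<bar>a' + b + b'\<bar> * \<bar>b - b'\<bar>"
    by (metis abs_mult abs_triangle_ineq)
   also have "... \<le> 3 * (\<Lambda> * norm (y - z)) + 3 * (\<Lambda> * norm (y - z))"
    using 1 2 by (intro add_mono mult_mono) auto
   finally show ?thesis by (simp add: abs_minus_commute)
  qed
  have "semilin B Q v" unfolding semilin_def
  proof (intro conjI allI)
   show "continuous_on UNIV v" unfolding v_def using c
    by (intro continuous_intros continuous_on_compose2[OF u_cont]) auto
   fix y z
   show "\<bar>v y\<bar> \<le> B" using vb[of y] \<Lambda> by (simp add: B_def)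
   show "lint v y" unfolding v_def by (rule Lop_diff_scaled(1)[OF u_lint])
   show "\<bar>Lop v y\<bar> \<le> B" unfolding Lv B_def abs_mult using vb[of y] qb[of y] by (intro mult_mono) auto
   have "Lop v y - Lop v z = q y * (v y - v z) + (q y - q z) * v z" unfolding Lv by (simp add: algebra_simps)
   then have "\<bar>Lop v y - Lop v z\<bar> \<le> \<bar>q y\<bar> * \<bar>v y - v z\<bar> + \<bar>q y - q z\<bar> * \<bar>v z\<bar>"
    by (metis abs_mult abs_triangle_ineq)
   also have "... \<le> 2 * \<bar>v y - v z\<bar> + (6 * \<Lambda> * norm (y - z)) * \<Lambda>"
    using qb[of y] vb[of z] ql[of y z] \<Lambda> by (intro add_mono mult_mono) auto
   also have "... \<le> Q * \<bar>v y - v z\<bar> + Q * norm (y - z)"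
   proof (intro add_mono)
    show "2 * \<bar>v y - v z\<bar> \<le> Q * \<bar>v y - v z\<bar>" by (intro mult_right_mono) (auto simp: Q_def)
    have "(6 * \<Lambda> * norm (y - z)) * \<Lambda> = (6 * \<Lambda>^2) * norm (y - z)" by (simp add: power2_eq_square)
    also have "... \<le> Q * norm (y - z)" by (intro mult_right_mono) (auto simp: Q_def)
    finally show "(6 * \<Lambda> * norm (y - z)) * \<Lambda> \<le> Q * norm (y - z)" .
   qed
   finally show "\<bar>Lop v y - Lop v z\<bar> \<le> Q * (\<bar>v y - v z\<bar> + norm (y - z))" by (simp add: algebra_simps)
  qed
  then have "\<bar>v (x + k) - v x\<bar> \<le> \<Lambda>2 * norm k" using \<Lambda>2(2)[of v "x + k" x] by simp
  moreover have "v (x + k) - v x = (u (x + h + k) - u (x + h) - u (x + k) + u x) / c"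
   by (simp add: v_def diff_divide_distrib add_divide_distrib add_ac)
  ultimately show ?thesis using c by (simp add: abs_divide divide_le_eq c_def mult_ac)
 qed
 then show ?thesis using \<Lambda>2 by blast
qed

text \<open>One-dimensional expansions along the basis vectors are combined one coordinate at a
  time; mixed second differences pay for the change of base point. The linearised equation is the
  limit of the equations of the difference quotients, whose integrands have a common integrable
  majorant by the uniform bounds.\<close>

lemma gradient_ex:
 "\<exists>(G::'a => 'a) \<Lambda>. 1 \<le> \<Lambda> \<and> (\<forall>x. norm (G x) \<le> \<Lambda>) \<and> (\<forall>x y. norm (G x - G y) \<le> \<Lambda> * norm (x - y)) \<and>
   (\<forall>x h. \<bar>u (x + h) - u x - G x \<bullet> h\<bar> \<le> \<Lambda> * (norm h)^2) \<and>
   (\<forall>e x. Lop (%x. e \<bullet> G x) x = (1 - 3 * (u x)^2) * (e \<bullet> G x))"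
proof -
 obtain \<Lambda>1 where \<Lambda>1: "\<Lambda>1 > 0" "\<And>x y. \<bar>u x - u y\<bar> \<le> \<Lambda>1 * norm (x - y)" using u_lipschitz_ex by blast
 obtain \<Lambda>2 where \<Lambda>2: "\<Lambda>2 > 0" "\<And>x h k. \<bar>u (x + h + k) - u (x + h) - u (x + k) + u x\<bar> \<le> \<Lambda>2 * norm h * norm k"
  using u_c11_ex by blast
 have "\<exists>d. \<forall>t. \<bar>u (x + t *\<^sub>R b) - u x - t * d\<bar> \<le> 2 * \<Lambda>2 * t^2" if "b \<in> Basis" for x b
 proof -
  have nb: "norm b = 1" using that by simp
  have "\<exists>d. \<forall>t. \<bar>u (x + t *\<^sub>R b) - u (x + 0 *\<^sub>R b) - t * d\<bar> \<le> 2 * \<Lambda>2 * t^2"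
  proof (rule quadratic_taylor_1d)
   fix t r :: real
   show "\<bar>u (x + t *\<^sub>R b) - u (x + r *\<^sub>R b)\<bar> \<le> \<Lambda>1 * \<bar>t - r\<bar>"
    using \<Lambda>1(2)[of "x + t *\<^sub>R b" "x + r *\<^sub>R b"] nb by (simp flip: scaleR_diff_left)
  next
   fix t h k :: real
   show "\<bar>u (x + (t + h + k) *\<^sub>R b) - u (x + (t + h) *\<^sub>R b) - u (x + (t + k) *\<^sub>R b) + u (x + t *\<^sub>R b)\<bar> \<le> \<Lambda>2 * \<bar>h\<bar> * \<bar>k\<bar>"
    using \<Lambda>2(2)[of "x + t *\<^sub>R b" "h *\<^sub>R b" "k *\<^sub>R b"] nb by (simp add: algebra_simps)
  qed
  then show ?thesis by simp
 qed
 then have "\<forall>x b. \<exists>d. b \<in> Basis \<longrightarrow> (\<forall>t. \<bar>u (x + t *\<^sub>R b) - u x - t * d\<bar> \<le> 2 * \<Lambda>2 * t^2)" by blast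
 then obtain d where d: "\<And>x b t. b \<in> Basis ==> \<bar>u (x + t *\<^sub>R b) - u x - t * d x b\<bar> \<le> 2 * \<Lambda>2 * t^2" by metis
 define G where "G x = (\<Sum>b\<in>Basis. d x b *\<^sub>R b)" for x
 have part: "\<exists>C\<ge>0. \<forall>x h. \<bar>u (x + (\<Sum>b\<in>S. (h \<bullet> b) *\<^sub>R b)) - u x - (\<Sum>b\<in>S. (h \<bullet> b) * d x b)\<bar> \<le> C * (norm h)^2"
  if "finite S" "S \<subseteq> Basis" for S using that
 proof (induction S)
  case empty then show ?case by (intro exI[of _ 0]) simp
 next
  case (insert b S)
  then obtain C where C: "C \<ge> 0" "\<And>x h. \<bar>u (x + (\<Sum>b\<in>S. (h \<bullet> b) *\<^sub>R b)) - u x - (\<Sum>b\<in>S. (h \<bullet> b) * d x b)\<bar> \<le> C * (norm h)^2" by auto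
  have "\<bar>u (x + (\<Sum>b\<in>insert b S. (h \<bullet> b) *\<^sub>R b)) - u x - (\<Sum>b\<in>insert b S. (h \<bullet> b) * d x b)\<bar> \<le> (C + \<Lambda>2 * card S + 2 * \<Lambda>2) * (norm h)^2" for x h
  proof -
   define H where "H = (\<Sum>b\<in>S. (h \<bullet> b) *\<^sub>R b)"
   have nH: "norm H \<le> card S * norm h"
   proof -
    have "norm H \<le> (\<Sum>b\<in>S. norm ((h \<bullet> b) *\<^sub>R b))" unfolding H_def by (rule norm_sum)
    also have "... \<le> (\<Sum>b\<in>S. norm h)" using insert.prems by (intro sum_mono) (auto simp: Basis_le_norm subset_eq)
    finally show ?thesis by simp
   qed
   have bB: "b \<in> Basis" "norm b = 1" "\<bar>h \<bullet> b\<bar> \<le> norm h" using insert.prems Basis_le_norm by auto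
   have "\<bar>u (x + H + (h \<bullet> b) *\<^sub>R b) - u (x + H) - u (x + (h \<bullet> b) *\<^sub>R b) + u x\<bar> \<le> \<Lambda>2 * norm H * norm ((h \<bullet> b) *\<^sub>R b)"
    by (rule \<Lambda>2(2))
   also have "... \<le> \<Lambda>2 * (card S * norm h) * norm h" using nH bB \<Lambda>2 by (intro mult_mono) auto
   finally have 1: "\<bar>u (x + H + (h \<bullet> b) *\<^sub>R b) - u (x + H) - u (x + (h \<bullet> b) *\<^sub>R b) + u x\<bar> \<le> \<Lambda>2 * card S * (norm h)^2"
    by (simp add: power2_eq_square mult_ac)
   have 2: "\<bar>u (x + (h \<bullet> b) *\<^sub>R b) - u x - (h \<bullet> b) * d x b\<bar> \<le> 2 * \<Lambda>2 * (norm h)^2"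
   proof -
    have "(h \<bullet> b)^2 \<le> (norm h)^2" using bB(3) by (metis abs_norm_cancel abs_le_square_iff)
    then have "2 * \<Lambda>2 * (h \<bullet> b)^2 \<le> 2 * \<Lambda>2 * (norm h)^2" using \<Lambda>2 by (intro mult_left_mono) auto
    then show ?thesis using d[OF bB(1), of x "h \<bullet> b"] by linarith
   qed
   have 3: "\<bar>u (x + H) - u x - (\<Sum>b\<in>S. (h \<bullet> b) * d x b)\<bar> \<le> C * (norm h)^2" using C(2) unfolding H_def by blast
   have "(\<Sum>b\<in>insert b S. (h \<bullet> b) *\<^sub>R b) = H + (h \<bullet> b) *\<^sub>R b" "(\<Sum>b\<in>insert b S. (h \<bullet> b) * d x b) = (\<Sum>b\<in>S. (h \<bullet> b) * d x b) + (h \<bullet> b) * d x b"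
    using insert by (auto simp: H_def)
   then show ?thesis using 1 2 3 unfolding distrib_right by (simp only: add.assoc[symmetric])
  qed
  then show ?case using C \<Lambda>2 by (intro exI[of _ "C + \<Lambda>2 * card S + 2 * \<Lambda>2"]) auto
 qed
 obtain C where C: "C \<ge> 0" "\<And>x h. \<bar>u (x + (\<Sum>b\<in>Basis. (h \<bullet> b) *\<^sub>R b)) - u x - (\<Sum>b\<in>Basis. (h \<bullet> b) * d x b)\<bar> \<le> C * (norm h)^2"
  using part[of Basis] by auto
 have G: "\<bar>u (x + h) - u x - G x \<bullet> h\<bar> \<le> C * (norm h)^2" for x h
 proof -
  have "G x \<bullet> h = (\<Sum>b\<in>Basis. (h \<bullet> b) * d x b)" unfolding G_def inner_sum_left inner_scaleR_left
   by (intro sum.cong) (simp_all add: inner_commute mult.commute)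
  then show ?thesis using C(2)[of x h] by (simp add: euclidean_representation)
 qed
 define \<tau> where "\<tau> j = 1 / real (Suc j)" for j
 have \<tau>: "0 < \<tau> j" for j by (simp add: \<tau>_def)
 have \<tau>0: "\<tau> \<longlonglongrightarrow> 0" unfolding \<tau>_def using LIMSEQ_inverse_real_of_nat by (simp add: inverse_eq_divide)
 define D where "D j e x = (u (x + \<tau> j *\<^sub>R e) - u x) / \<tau> j" for j e x
 have Dlim: "(%j. D j e x) \<longlonglongrightarrow> e \<bullet> G x" for e x
 proof -
  have "\<bar>D j e x - e \<bullet> G x\<bar> \<le> C * (norm e)^2 * \<tau> j" for j
  proof -
   have "\<bar>u (x + \<tau> j *\<^sub>R e) - u x - G x \<bullet> (\<tau> j *\<^sub>R e)\<bar> \<le> C * (norm (\<tau> j *\<^sub>R e))^2" by (rule G)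
   then have "\<bar>u (x + \<tau> j *\<^sub>R e) - u x - \<tau> j * (e \<bullet> G x)\<bar> \<le> (C * (norm e)^2 * \<tau> j) * \<tau> j"
    by (simp add: power_mult_distrib inner_commute power2_eq_square mult_ac)
   moreover have "D j e x - e \<bullet> G x = (u (x + \<tau> j *\<^sub>R e) - u x - \<tau> j * (e \<bullet> G x)) / \<tau> j"
    unfolding D_def using \<tau>[of j] by (simp add: diff_divide_distrib)
   ultimately show ?thesis using \<tau>[of j] by (simp add: abs_divide pos_divide_le_eq)
  qed
  then have ev: "\<forall>\<^sub>F j in sequentially. norm (D j e x - e \<bullet> G x) \<le> C * (norm e)^2 * \<tau> j" by simp
  have "(%j. C * (norm e)^2 * \<tau> j) \<longlonglongrightarrow> 0"
   using tendsto_mult_right_zero[OF \<tau>0] by simp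
  with ev have "(%j. D j e x - e \<bullet> G x) \<longlonglongrightarrow> 0" by (rule Lim_null_comparison)
  then show ?thesis by (simp add: LIM_zero_iff)
 qed
 have Db: "\<bar>D j e x\<bar> \<le> \<Lambda>1 * norm e" for j e x
  using \<Lambda>1(2)[of "x + \<tau> j *\<^sub>R e" x] \<tau>[of j] by (simp add: D_def abs_divide pos_divide_le_eq mult_ac)
 have Dl: "\<bar>D j e x - D j e y\<bar> \<le> \<Lambda>2 * norm e * norm (x - y)" for j e x y
 proof -
  have "\<bar>u (y + \<tau> j *\<^sub>R e + (x - y)) - u (y + \<tau> j *\<^sub>R e) - u (y + (x - y)) + u y\<bar> \<le> \<Lambda>2 * norm (\<tau> j *\<^sub>R e) * norm (x - y)"
   by (rule \<Lambda>2(2))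
  moreover have "D j e x - D j e y = (u (y + \<tau> j *\<^sub>R e + (x - y)) - u (y + \<tau> j *\<^sub>R e) - u (y + (x - y)) + u y) / \<tau> j"
   unfolding D_def by (simp add: algebra_simps diff_divide_distrib[symmetric])
  ultimately show ?thesis using \<tau>[of j] by (simp add: abs_divide pos_divide_le_eq mult_ac)
 qed
 have eb: "\<bar>e \<bullet> G x\<bar> \<le> \<Lambda>1 * norm e" for e x
  by (rule LIMSEQ_le_const2[OF tendsto_rabs[OF Dlim]]) (use Db in auto)
 have el: "\<bar>e \<bullet> G x - e \<bullet> G y\<bar> \<le> \<Lambda>2 * norm e * norm (x - y)" for e x y
  by (rule LIMSEQ_le_const2[OF tendsto_rabs[OF tendsto_diff[OF Dlim Dlim]]]) (use Dl in auto)
 have Gb: "norm (G x) \<le> \<Lambda>1" for x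
  using eb[of "G x" x] by (cases "G x = 0") (auto simp: \<Lambda>1(1) less_imp_le power2_norm_eq_inner[symmetric] power2_eq_square)
 have Gl: "norm (G x - G y) \<le> \<Lambda>2 * norm (x - y)" for x y
 proof (cases "G x = G y")
  case True then show ?thesis using \<Lambda>2 by simp
 next
  case False
  have "(norm (G x - G y))^2 \<le> \<Lambda>2 * norm (G x - G y) * norm (x - y)"
   using el[of "G x - G y" x y] by (simp add: power2_norm_eq_inner inner_diff_right)
  then show ?thesis using False by (simp add: power2_eq_square mult_ac)
 qed
 have lin: "Lop (%x. e \<bullet> G x) x = (1 - 3 * (u x)^2) * (e \<bullet> G x)" for e x
 proof -
  have LD: "Lop (D j e) x = (1 - (u (x + \<tau> j *\<^sub>R e) ^ 2 + u (x + \<tau> j *\<^sub>R e) * u x + u x ^ 2)) * D j e x" for j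
   unfolding D_def Lop_diff_scaled(2)[OF u_lint] u_eq cubic_diff by simp
  have ul: "(%j. u (x + \<tau> j *\<^sub>R e)) \<longlonglongrightarrow> u x"
  proof -
   have "(%j. x + \<tau> j *\<^sub>R e) \<longlonglongrightarrow> x + 0 *\<^sub>R e"
    by (intro tendsto_intros \<tau>0)
   then show ?thesis using continuous_on_tendsto_compose[OF u_cont] by force
  qed
  have lim1: "(%j. Lop (D j e) x) \<longlonglongrightarrow> (1 - (u x ^ 2 + u x * u x + u x ^ 2)) * (e \<bullet> G x)"
   unfolding LD by (intro tendsto_intros ul Dlim)
  define Bd where "Bd = 2 * (\<Lambda>1 * norm e) + \<Lambda>2 * norm e"
  have lim2: "(%j. Lop (D j e) x) \<longlonglongrightarrow> Lop (%x. e \<bullet> G x) x"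
   unfolding Lop_def
  proof (rule integral_dominated_convergence[where w = "%z. Bd * (min 1 (1 * norm z) * kern z)"])
   have [measurable]: "D j e \<in> borel_measurable borel" for j using lipschitz_measurable(1)[OF Dl] .
   have [measurable]: "(%x. e \<bullet> G x) \<in> borel_measurable borel" using lipschitz_measurable(1)[OF el] .
   show "(%z. (e \<bullet> G x - e \<bullet> G (x + z)) * kern z) \<in> borel_measurable lborel" by measurable
   show "(%z. (D j e x - D j e (x + z)) * kern z) \<in> borel_measurable lborel" for j by measurable
   show "integrable lborel (%z::'a. Bd * (min 1 (1 * norm z) * kern z))"
    by (intro integrable_mult_right kmin_integrable) auto
   show "AE z in lborel. (%j. (D j e x - D j e (x + z)) * kern z) \<longlonglongrightarrow> (e \<bullet> G x - e \<bullet> G (x + z)) * kern z"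
    by (intro AE_I2 tendsto_intros Dlim)
   have "norm ((D j e x - D j e (x + z)) * kern z) \<le> Bd * (min 1 (1 * norm z) * kern z)" for j z
   proof -
    have "\<bar>D j e x - D j e (x + z)\<bar> \<le> Bd * min 1 (norm (x - (x + z)))"
     unfolding Bd_def using \<Lambda>2 by (intro diff_kern_bound Db Dl) auto
    then have "\<bar>D j e x - D j e (x + z)\<bar> * kern z \<le> Bd * min 1 (norm z) * kern z" by (intro mult_right_mono) auto
    then show ?thesis by (simp add: abs_mult mult_ac)
   qed
   then show "AE z in lborel. norm ((D j e x - D j e (x + z)) * kern z) \<le> Bd * (min 1 (1 * norm z) * kern z)" for j by simp
  qed
  have "1 - (u x ^ 2 + u x * u x + u x ^ 2) = 1 - 3 * (u x)^2" by (simp add: power2_eq_square)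
  then show ?thesis using LIMSEQ_unique[OF lim2 lim1] by simp
 qed
 define \<Lambda> where "\<Lambda> = Max {1, \<Lambda>1, \<Lambda>2, C}"
 have \<Lambda>: "1 \<le> \<Lambda>" "\<Lambda>1 \<le> \<Lambda>" "\<Lambda>2 \<le> \<Lambda>" "C \<le> \<Lambda>" by (auto simp: \<Lambda>_def)
 show ?thesis
 proof (intro exI[of _ G] exI[of _ \<Lambda>] conjI allI lin)
  show "1 \<le> \<Lambda>" by fact
  fix x y h
  show "norm (G x) \<le> \<Lambda>" using Gb[of x] \<Lambda> by linarith
  show "norm (G x - G y) \<le> \<Lambda> * norm (x - y)" using Gl[of x y] mult_right_mono[OF \<Lambda>(3), of "norm (x - y)"] by simp
  show "\<bar>u (x + h) - u x - G x \<bullet> h\<bar> \<le> \<Lambda> * (norm h)^2" using G[of x h] mult_right_mono[OF \<Lambda>(4), of "(norm h)^2"] by simp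
 qed
qed

end

section \<open>Weak formulation, stability and energy\<close>

lemma nn_integral_lborel_translate:
 fixes f :: "'a::euclidean_space => ennreal"
 assumes [measurable]: "f \<in> borel_measurable borel"
 shows "(NNBINT x. f (x + c)) = (NNBINT x. f x)"
proof -
 have "(NNBINT x. f x) = (\<integral>\<^sup>+x. f x \<partial>(distr lborel borel ((+) c)))"
  by (simp add: lborel_distr_plus)
 also have "... = (NNBINT x. f (c + x))" by (subst nn_integral_distr) auto
 finally show ?thesis by (simp add: add.commute)
qed

lemma integral_lborel_translate:
 fixes f :: "'a::euclidean_space => real"
 assumes [measurable]: "f \<in> borel_measurable borel"
 shows "(LBINT x. f (x + c)) = (LBINT x. f x)"
proof -
 have "(LBINT x. f x) = (\<integral>x. f x \<partial>(distr lborel borel ((+) c)))"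
  by (simp add: lborel_distr_plus)
 also have "... = (LBINT x. f (c + x))" by (subst integral_distr) auto
 finally show ?thesis by (simp add: add.commute)
qed

lemma integrable_lborel_translate:
 fixes f :: "'a::euclidean_space => real"
 assumes "integrable lborel f"
 shows "integrable lborel (%x. f (x + c))"
proof -
 have [measurable]: "f \<in> borel_measurable borel" using borel_measurable_integrable[OF assms] by simp
 have "integrable (distr lborel borel ((+) c)) f" using assms by (simp add: lborel_distr_plus)
 then have "integrable lborel (%x. f (c + x))" by (subst (asm) integrable_distr_eq) auto
 then show ?thesis by (simp add: add.commute)
qed

text \<open>The test functions of the whole development: closed under sums, products, positive parts
  and minima, and admissible for \<open>Lop\<close> because s < 1.\<close>

definition blip :: "('a::euclidean_space => real) => bool" where
 "blip f \<longleftrightarrow> (\<exists>B L. 0 \<le> B \<and> 0 \<le> L \<and> (\<forall>x. \<bar>f x\<bar> \<le> B) \<and> (\<forall>x y. \<bar>f x - f y\<bar> \<le> L * norm (x - y)))"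

lemma blipI:
 assumes "\<And>x. \<bar>f x\<bar> \<le> B" "\<And>x y. \<bar>f x - f y\<bar> \<le> L * norm (x - y)"
 shows "blip f"
proof -
 have "\<bar>f x - f y\<bar> \<le> \<bar>L\<bar> * norm (x - y)" for x y
  using assms(2)[of x y] mult_right_mono[OF abs_ge_self[of L], of "norm (x - y)"] by simp
 moreover have "0 \<le> B" using assms(1)[of 0] by linarith
 ultimately show ?thesis unfolding blip_def using assms(1) by (intro exI[of _ B] exI[of _ "\<bar>L\<bar>"]) auto
qed

lemma blip_add: assumes "blip f" "blip g" shows "blip (%x. f x + g x)"
proof -
 from assms obtain B1 L1 B2 L2 where *: "\<And>x. \<bar>f x\<bar> \<le> B1" "\<And>x y. \<bar>f x - f y\<bar> \<le> L1 * norm (x - y)"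
  "\<And>x. \<bar>g x\<bar> \<le> B2" "\<And>x y. \<bar>g x - g y\<bar> \<le> L2 * norm (x - y)" unfolding blip_def by metis
 show ?thesis
 proof (rule blipI)
  fix x y
  show "\<bar>f x + g x\<bar> \<le> B1 + B2" using *(1,3)[of x] by linarith
  show "\<bar>f x + g x - (f y + g y)\<bar> \<le> (L1 + L2) * norm (x - y)" using *(2,4)[of x y] unfolding distrib_right by linarith
 qed
qed

lemma blip_mult: assumes "blip f" "blip g" shows "blip (%x. f x * g x)"
proof -
 from assms obtain B1 L1 B2 L2 where *: "0 \<le> B1" "0 \<le> B2" "0 \<le> L1" "0 \<le> L2" "\<And>x. \<bar>f x\<bar> \<le> B1" "\<And>x y. \<bar>f x - f y\<bar> \<le> L1 * norm (x - y)"
  "\<And>x. \<bar>g x\<bar> \<le> B2" "\<And>x y. \<bar>g x - g y\<bar> \<le> L2 * norm (x - y)" unfolding blip_def by metis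
 show ?thesis
 proof (rule blipI)
  fix x y
  show "\<bar>f x * g x\<bar> \<le> B1 * B2" unfolding abs_mult using *(5,7)[of x] * by (intro mult_mono) auto
  have "f x * g x - f y * g y = f x * (g x - g y) + (f x - f y) * g y" by (simp add: algebra_simps)
  then have "\<bar>f x * g x - f y * g y\<bar> \<le> \<bar>f x\<bar> * \<bar>g x - g y\<bar> + \<bar>f x - f y\<bar> * \<bar>g y\<bar>" by (metis abs_mult abs_triangle_ineq)
  also have "... \<le> B1 * (L2 * norm (x - y)) + (L1 * norm (x - y)) * B2" using * by (intro add_mono mult_mono) auto
  finally show "\<bar>f x * g x - f y * g y\<bar> \<le> (B1 * L2 + L1 * B2) * norm (x - y)" by (simp add: algebra_simps)
 qed
qed

lemma blip_const [simp]: "blip (%x. c)" by (rule blipI[of _ "\<bar>c\<bar>" 0]) auto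
lemma blip_uminus: "blip f ==> blip (%x. - f x)" using blip_mult[OF blip_const[of "-1"]] by simp
lemma blip_diff: "blip f ==> blip g ==> blip (%x. f x - g x)" using blip_add[OF _ blip_uminus, of f g] by simp
lemma blip_pos: assumes "blip f" shows "blip (%x. max 0 (f x))"
proof -
 from assms obtain B L where *: "\<And>x. \<bar>f x\<bar> \<le> B" "\<And>x y. \<bar>f x - f y\<bar> \<le> L * norm (x - y)" unfolding blip_def by metis
 show ?thesis
 proof (rule blipI)
  fix x y
  show "\<bar>max 0 (f x)\<bar> \<le> B" using *(1)[of x] by auto
  show "\<bar>max 0 (f x) - max 0 (f y)\<bar> \<le> L * norm (x - y)" using *(2)[of x y] by (auto simp: max_def abs_if split: if_splits)
 qed
qed
lemma blip_power2: "blip f ==> blip (%x. f x ^ 2)" unfolding power2_eq_square by (rule blip_mult)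

lemma blip_measurable [measurable_dest]: assumes "blip f" shows "f \<in> borel_measurable borel"
proof -
 from assms obtain B L where *: "0 \<le> L" "\<And>x y. \<bar>f x - f y\<bar> \<le> L * norm (x - y)" unfolding blip_def by metis
 then have "L-lipschitz_on UNIV f" by (intro lipschitz_onI) (auto simp: dist_norm)
 then show "f \<in> borel_measurable borel" by (intro borel_measurable_continuous_onI lipschitz_on_continuous_on)
qed

lemma blip_continuous: assumes "blip f" shows "continuous_on UNIV f"
proof -
 from assms obtain B L where *: "0 \<le> L" "\<And>x y. \<bar>f x - f y\<bar> \<le> L * norm (x - y)" unfolding blip_def by metis
 then have "L-lipschitz_on UNIV f" by (intro lipschitz_onI) (auto simp: dist_norm)
 then show ?thesis by (rule lipschitz_on_continuous_on)
qed

lemma blip_min1: assumes "blip f" obtains C where "0 \<le> C" "\<And>x y. \<bar>f x - f y\<bar> \<le> C * min 1 (norm (x - y))" "\<And>x. \<bar>f x\<bar> \<le> C"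
proof -
 from assms obtain B L where *: "0 \<le> B" "0 \<le> L" "\<And>x. \<bar>f x\<bar> \<le> B" "\<And>x y. \<bar>f x - f y\<bar> \<le> L * norm (x - y)" unfolding blip_def by metis
 have "\<bar>f x - f y\<bar> \<le> (2 * B + L) * min 1 (norm (x - y))" for x y
 proof (cases "norm (x - y) \<le> 1")
  case True
  have "L * norm (x - y) \<le> (2 * B + L) * norm (x - y)" using * by (intro mult_right_mono) auto
  then show ?thesis using True *(4)[of x y] by (simp add: min_def)
 next
  case False
  then show ?thesis using *(3)[of x] *(3)[of y] *(2) by (simp add: min_def)
 qed
 moreover have "\<bar>f x\<bar> \<le> 2 * B + L" for x using *(1,2) *(3)[of x] by linarith
 ultimately show ?thesis using that[of "2 * B + L"] * by auto
qed

text \<open>Meant for test functions such as \<xi>^2/\<phi>, whose denominator may tend to zero at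
  infinity: on the compact ball carrying the numerator it has a positive minimum.\<close>

lemma blip_divide_cutoff:
 assumes f: "blip f" and g: "blip g" and "\<And>x. R \<le> norm x ==> f x = 0" and gpos: "\<And>x::'a::euclidean_space. 0 < g x"
 shows "blip (%x. f x / g x)"
proof -
 from f g obtain B1 L1 B2 L2 where *: "0 \<le> B1" "0 \<le> B2" "0 \<le> L1" "0 \<le> L2" "\<And>x. \<bar>f x\<bar> \<le> B1" "\<And>x y. \<bar>f x - f y\<bar> \<le> L1 * norm (x - y)"
  "\<And>x. \<bar>g x\<bar> \<le> B2" "\<And>x y. \<bar>g x - g y\<bar> \<le> L2 * norm (x - y)" unfolding blip_def by metis
 have "\<exists>c>0. \<forall>x\<in>cball 0 \<bar>R\<bar>. c \<le> g x"
 proof -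
  have "continuous_on (cball 0 \<bar>R\<bar>) g" using blip_continuous[OF g] by (rule continuous_on_subset) simp
  moreover have "cball (0::'a) \<bar>R\<bar> \<noteq> {}" by simp
  ultimately obtain x where "x \<in> cball 0 \<bar>R\<bar>" "\<forall>y\<in>cball 0 \<bar>R\<bar>. g x \<le> g y"
   using continuous_attains_inf[of "cball 0 \<bar>R\<bar>" g] compact_cball by blast
  then show ?thesis using gpos by blast
 qed
 then obtain c where c: "c > 0" "\<And>x. norm x \<le> R ==> c \<le> g x" by force
 define M where "M = L1 / c + B1 * L2 / (c * c)"
 have M: "0 \<le> L1 / c" "0 \<le> B1 * L2 / (c * c)" using * c by auto
 have in_bd: "\<bar>f x / g x - f y / g y\<bar> \<le> M * norm (x - y)" if x: "norm x \<le> R" for x y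
 proof (cases "norm y \<le> R")
  case True
  have "f x / g x - f y / g y = (f x - f y) / g x + f y * (g y - g x) / (g x * g y)"
   using gpos[of x] gpos[of y] by (simp add: field_simps)
  then have "\<bar>f x / g x - f y / g y\<bar> \<le> \<bar>f x - f y\<bar> / g x + \<bar>f y\<bar> * \<bar>g y - g x\<bar> / (g x * g y)"
   using gpos[of x] gpos[of y] by (metis abs_divide abs_mult abs_of_pos abs_triangle_ineq mult_pos_pos)
  also have "... \<le> (L1 * norm (x - y)) / c + B1 * (L2 * norm (x - y)) / (c * c)"
   using *(5)[of y] *(6)[of x y] *(8)[of y x] c(2)[OF x] c(2)[OF True] c(1) *(1,3,4)
   by (intro add_mono frac_le mult_mono) (auto simp: norm_minus_commute)
  finally show ?thesis by (simp add: M_def algebra_simps add_divide_distrib)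
 next
  case False
  then have "f y = 0" using assms(3)[of y] by simp
  then have "\<bar>f x / g x - f y / g y\<bar> = \<bar>f x - f y\<bar> / g x" using gpos[of x] by simp
  also have "... \<le> (L1 * norm (x - y)) / c" using *(6)[of x y] c(2)[OF x] c(1) *(3) by (intro frac_le) auto
  also have "... \<le> M * norm (x - y)" unfolding M_def distrib_right using mult_nonneg_nonneg[OF M(2) norm_ge_zero[of "x - y"]] by simp
  finally show ?thesis .
 qed
 show ?thesis
 proof (rule blipI)
  fix x y
  show "\<bar>f x / g x\<bar> \<le> B1 / c"
  proof (cases "norm x \<le> R")
   case True
   then show ?thesis using *(5)[of x] c gpos[of x] *(1) by (simp add: abs_divide frac_le)
  next
   case False
   then show ?thesis using assms(3)[of x] * c by simp
  qed
  show "\<bar>f x / g x - f y / g y\<bar> \<le> M * norm (x - y)"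
  proof (cases "norm x \<le> R \<or> norm y \<le> R")
   case True then show ?thesis using in_bd[of x y] in_bd[of y x] by (auto simp: norm_minus_commute abs_minus_commute)
  next
   case False then show ?thesis using assms(3) M by (simp add: M_def)
  qed
 qed
qed

lemma min1_sq: "0 \<le> t ==> (min 1 t)^2 \<le> min 1 (t::real)"
 using mult_left_le[of "min 1 t" "min 1 t"] by (simp add: power2_eq_square)

text \<open>Discrete Picone inequality: the right side minus the left side is (b \<xi> - a
  \<zeta>)^2/(a b). Integrated against the kernel, it turns the existence of a positive solution
  into stability.\<close>

lemma picone:
 fixes a b \<xi> \<zeta> :: real
 assumes "0 < a" "0 < b"
 shows "(a - b) * (\<xi>^2 / a - \<zeta>^2 / b) \<le> (\<xi> - \<zeta>)^2"
proof -
 have "0 \<le> (b * \<xi> - a * \<zeta>)^2 / (a * b)" using assms by simp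
 also have "... = (\<xi> - \<zeta>)^2 - (a - b) * (\<xi>^2 / a - \<zeta>^2 / b)"
  using assms by (simp add: field_simps power2_eq_square)
 finally show ?thesis by simp
qed

section \<open>Double integrals and the weak formulation\<close>

context frac_order
begin

abbreviation PP :: "('a::euclidean_space \<times> 'a) measure" where "PP \<equiv> lborel \<Otimes>\<^sub>M lborel"

lemma blip_lint: "blip v ==> lint v x"
 unfolding blip_def using lipschitz_lint by metis

lemma kern_pair_integrable:
 fixes R :: real
 shows "integrable PP (%q::'a::euclidean_space \<times> 'a. indicator (ball 0 R) (fst q) * (min 1 (norm (fst q - snd q)) * pkern q))"
  and "integrable PP (%q::'a \<times> 'a. indicator (ball 0 R) (snd q) * (min 1 (norm (fst q - snd q)) * pkern q))"
proof -
 have i: "integrable lborel (%z::'a. min 1 (norm z) * kern z)" using kmin_integrable[of 1] by simp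
 define J where "J = (NNBINT z. ennreal (min 1 (norm (z::'a)) * kern z))"
 have J: "J < \<infinity>" using i unfolding J_def by (simp add: integrable_iff_bounded)
 have inner: "(NNBINT y. ennreal (min 1 (norm (y - x)) * kern (y - x))) = J" for x :: 'a
  unfolding J_def using nn_integral_lborel_translate[of "%z. ennreal (min 1 (norm (z::'a)) * kern z)" "- x"] by simp
 have fin: "(NNBINT x. (NNBINT y. ennreal (indicator (ball 0 R) x * (min 1 (norm (y - x)) * kern (y - (x::'a)))))) < \<infinity>"
 proof -
  have "(NNBINT x. (NNBINT y. ennreal (indicator (ball 0 R) x * (min 1 (norm (y - x)) * kern (y - (x::'a))))))
   = (NNBINT x. J * indicator (ball (0::'a) R) x)"
   using inner by (intro nn_integral_cong) (auto split: split_indicator)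
  also have "... = J * emeasure lborel (ball (0::'a) R)" by (subst nn_integral_cmult_indicator) auto
  also have "... < \<infinity>" using J emeasure_lborel_ball_finite[of "0::'a" R] by (simp add: ennreal_mult_less_top)
  finally show ?thesis .
 qed
 show 1: "integrable PP (%q::'a \<times> 'a. indicator (ball 0 R) (fst q) * (min 1 (norm (fst q - snd q)) * pkern q))"
 proof (rule integrableI_nonneg)
  have "(\<integral>\<^sup>+q. ennreal (indicator (ball 0 R) (fst q) * (min 1 (norm (fst q - snd q)) * kern (fst q - snd (q::'a\<times>'a)))) \<partial>PP)
   = (NNBINT x. (NNBINT y. ennreal (indicator (ball 0 R) x * (min 1 (norm (x - y)) * kern (x - (y::'a))))))"
   by (subst lborel.nn_integral_fst[symmetric]) auto
  then show "(\<integral>\<^sup>+q. ennreal (indicator (ball 0 R) (fst q) * (min 1 (norm (fst q - snd q)) * kern (fst q - snd (q::'a\<times>'a)))) \<partial>PP) < \<infinity>"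
   using fin by (simp add: kern_commute norm_minus_commute)
 qed (auto)
 have "integrable PP (%q. (%q::'a \<times> 'a. indicator (ball 0 R) (fst q) * (min 1 (norm (fst q - snd q)) * pkern q)) (snd q, fst q))"
  using lborel_pair.integrable_product_swap[OF 1] by (simp add: case_prod_beta')
 then show "integrable PP (%q::'a \<times> 'a. indicator (ball 0 R) (snd q) * (min 1 (norm (fst q - snd q)) * pkern q))"
  by (simp add: kern_commute norm_minus_commute)
qed

lemma pair_integrable:
 fixes f :: "'a::euclidean_space => 'a => real"
 assumes [measurable]: "(%q. f (fst q) (snd q)) \<in> borel_measurable (borel \<Otimes>\<^sub>M borel)"
  and bd: "\<And>x y. \<bar>f x y\<bar> \<le> C * min 1 (norm (x - y))"
  and van: "\<And>x y. R \<le> norm x ==> R \<le> norm y ==> f x y = 0"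
 shows "integrable PP (%q. f (fst q) (snd q) * pkern q)"
proof (rule Lintegrable_bound)
 let ?J = "%q::'a\<times>'a. min 1 (norm (fst q - snd q)) * pkern q"
 show "integrable PP (%q. C * (indicator (ball 0 R) (fst q) * ?J q) + C * (indicator (ball 0 R) (snd q) * ?J q))"
  by (intro Lintegrable_add integrable_mult_right kern_pair_integrable)
 show "(%q. f (fst q) (snd q) * pkern q) \<in> borel_measurable PP" by measurable
 have C: "0 \<le> C"
 proof -
  obtain b :: 'a where "b \<in> Basis" by (meson nonempty_Basis ex_in_conv)
  then show ?thesis using bd[of b 0] by simp
 qed
 have "norm (f x y * kern (x - y)) \<le> norm (C * (indicator (ball 0 R) x * ?J (x, y)) + C * (indicator (ball 0 R) y * ?J (x, y)))" for x y
 proof (cases "R \<le> norm x \<and> R \<le> norm y")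
  case True then show ?thesis using van by simp
 next
  case False
  have "norm (f x y * kern (x - y)) \<le> C * min 1 (norm (x - y)) * kern (x - y)"
   unfolding real_norm_def abs_mult using bd[of x y] by (intro mult_mono) auto
  also have "... = C * ?J (x, y)" by simp
  also have "... \<le> C * (indicator (ball 0 R) x * ?J (x, y)) + C * (indicator (ball 0 R) y * ?J (x, y))"
   using False C by (auto simp: not_le split: split_indicator)
  finally show ?thesis by simp
 qed
 then show "AE q in PP. norm (f (fst q) (snd q) * pkern q) \<le> norm (C * (indicator (ball 0 R) (fst q) * ?J q) + C * (indicator (ball 0 R) (snd q) * ?J q))"
  by (intro AE_I2) (metis prod.collapse)
qed

lemma Lop_alt:
 fixes v :: "'a::euclidean_space => real"
 assumes "blip v"
 shows "Lop v x = (LBINT y. (v x - v y) * kern (x - y))" "integrable lborel (%y. (v x - v y) * kern (x - y))"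
proof -
 note [measurable] = blip_measurable[OF assms]
 have "(LBINT y. (v x - v (y + x)) * kern (x - (y + x))) = (LBINT y. (v x - v y) * kern (x - y))"
  by (rule integral_lborel_translate) measurable
 then show "Lop v x = (LBINT y. (v x - v y) * kern (x - y))" by (simp add: Lop_def add.commute)
 have "integrable lborel (%z. (v x - v (x + z)) * kern z)" using blip_lint[OF assms] by (simp add: lint_def)
 from integrable_lborel_translate[OF this, of "- x"]
 show "integrable lborel (%y. (v x - v y) * kern (x - y))" by (simp add: kern_commute)
qed

text \<open>The integrand is \<psi>(x) (w x - w y) plus the same expression with x and y exchanged.
  Each half is absolutely integrable and integrates to the integral of \<psi> times Lop w, whence
  the factor 2.\<close>

lemma weak_form:
 fixes w \<psi> :: "'a::euclidean_space => real"
 assumes w: "blip w" and \<psi>: "blip \<psi>" and van: "\<And>x. R \<le> norm x ==> \<psi> x = 0"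
 shows "integrable PP (%q. (w (fst q) - w (snd q)) * (\<psi> (fst q) - \<psi> (snd q)) * pkern q)"
  and "(\<integral>q. (w (fst q) - w (snd q)) * (\<psi> (fst q) - \<psi> (snd q)) * pkern q \<partial>PP) = 2 * (LBINT x. \<psi> x * Lop w x)"
  and "integrable lborel (%x. \<psi> x * Lop w x)"
proof -
 note [measurable] = blip_measurable[OF w] blip_measurable[OF \<psi>]
 obtain C where C: "0 \<le> C" "\<And>x y. \<bar>w x - w y\<bar> \<le> C * min 1 (norm (x - y))" using blip_min1[OF w] by metis
 obtain B where B: "0 \<le> B" "\<And>x. \<bar>\<psi> x\<bar> \<le> B" using blip_min1[OF \<psi>] by metis
 have i1: "integrable PP (%q. (\<psi> (fst q) * (w (fst q) - w (snd q))) * pkern q)"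
 proof (rule pair_integrable[where R = R])
  show "\<bar>\<psi> x * (w x - w y)\<bar> \<le> (B * C) * min 1 (norm (x - y))" for x y
  proof -
   have "\<bar>\<psi> x * (w x - w y)\<bar> \<le> B * (C * min 1 (norm (x - y)))" unfolding abs_mult
    using B(2)[of x] C(2)[of x y] B(1) by (intro mult_mono) auto
   then show ?thesis by simp
  qed
 qed (use van in auto)
 define f where "f = (%q. (\<psi> (fst q) * (w (fst q) - w (snd q))) * pkern q)"
 have if1: "integrable PP f" using i1 by (simp add: f_def)
 have i2: "integrable PP (%q. f (snd q, fst q))"
  using lborel_pair.integrable_product_swap[OF if1] by (simp add: case_prod_beta')
 have I2: "(\<integral>q. f (snd q, fst q) \<partial>PP) = (\<integral>q. f q \<partial>PP)"
  using lborel_pair.integral_product_swap[of f] if1 by (simp add: case_prod_beta')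
 have eq: "(w (fst q) - w (snd q)) * (\<psi> (fst q) - \<psi> (snd q)) * pkern q = f q + f (snd q, fst q)" for q
  unfolding f_def by (simp add: kern_commute[of "snd q" "fst q"] algebra_simps)
 show "integrable PP (%q. (w (fst q) - w (snd q)) * (\<psi> (fst q) - \<psi> (snd q)) * pkern q)"
  unfolding eq using if1 i2 by (rule Lintegrable_add)
 have inner: "(LBINT y. f (x, y)) = \<psi> x * Lop w x" for x
  unfolding f_def Lop_alt(1)[OF w] by (simp add: mult.assoc)
 have "(\<integral>q. f q \<partial>PP) = (LBINT x. \<psi> x * Lop w x)"
  using lborel_pair.integral_fst'[OF if1] by (simp add: inner)
 then show "(\<integral>q. (w (fst q) - w (snd q)) * (\<psi> (fst q) - \<psi> (snd q)) * pkern q \<partial>PP) = 2 * (LBINT x. \<psi> x * Lop w x)"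
  unfolding eq using if1 i2 I2 by simp
 show "integrable lborel (%x. \<psi> x * Lop w x)" using lborel_pair.integrable_fst'[OF if1] by (simp add: inner)
qed

end

section \<open>Stability inequalities for the gradient\<close>

locale layer = monotone_layer s u e0 for s :: real and u :: "'a::euclidean_space => real" and e0 :: 'a +
 fixes G :: "'a => 'a" and \<Lambda> :: real
 assumes \<Lambda>1: "1 \<le> \<Lambda>"
  and G_bound: "\<And>x. norm (G x) \<le> \<Lambda>"
  and G_lip: "\<And>x y. norm (G x - G y) \<le> \<Lambda> * norm (x - y)"
  and taylor: "\<And>x h. \<bar>u (x + h) - u x - G x \<bullet> h\<bar> \<le> \<Lambda> * (norm h)^2"
  and linearized: "\<And>e x. Lop (%x. e \<bullet> G x) x = (1 - 3 * (u x)^2) * (e \<bullet> G x)"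
begin

abbreviation p :: "'a => real" where "p x \<equiv> norm (G x)"

lemma dir_deriv: "((%t. u (x + t *\<^sub>R e)) has_real_derivative (e \<bullet> G (x + r *\<^sub>R e))) (at r)"
proof -
 have "((%t. u ((x + r *\<^sub>R e) + t *\<^sub>R e)) has_real_derivative (e \<bullet> G (x + r *\<^sub>R e))) (at 0)"
  unfolding DERIV_def
 proof -
  let ?x = "x + r *\<^sub>R e"
  have b: "norm ((u (?x + (0 + h) *\<^sub>R e) - u (?x + 0 *\<^sub>R e)) / h - e \<bullet> G ?x) \<le> \<Lambda> * (norm e)^2 * \<bar>h\<bar>" if "h \<noteq> 0" for h
  proof -
   have "\<bar>u (?x + h *\<^sub>R e) - u ?x - h * (e \<bullet> G ?x)\<bar> \<le> \<Lambda> * (norm e)^2 * \<bar>h\<bar> * \<bar>h\<bar>"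
    using taylor[of ?x "h *\<^sub>R e"] by (simp add: inner_commute power_mult_distrib power2_eq_square mult_ac)
   moreover have "(u (?x + (0 + h) *\<^sub>R e) - u (?x + 0 *\<^sub>R e)) / h - e \<bullet> G ?x = (u (?x + h *\<^sub>R e) - u ?x - h * (e \<bullet> G ?x)) / h"
    using that by (simp add: field_simps)
   ultimately show ?thesis using that by (simp add: abs_divide divide_le_eq)
  qed
  have "((%h. (u (?x + (0 + h) *\<^sub>R e) - u (?x + 0 *\<^sub>R e)) / h - e \<bullet> G ?x) \<longlongrightarrow> 0) (at 0)"
  proof (rule Lim_null_comparison)
   show "\<forall>\<^sub>F h in at 0. norm ((u (?x + (0 + h) *\<^sub>R e) - u (?x + 0 *\<^sub>R e)) / h - e \<bullet> G ?x) \<le> \<Lambda> * (norm e)^2 * \<bar>h\<bar>"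
    using b by (auto simp: eventually_at_filter)
   show "((%h. \<Lambda> * (norm e)^2 * \<bar>h\<bar>) \<longlongrightarrow> 0) (at (0::real))" by (rule tendsto_eq_intros | simp)+
  qed
  then show "(%h. (u (?x + (0 + h) *\<^sub>R e) - u (?x + 0 *\<^sub>R e)) / h) \<midarrow>0\<rightarrow> e \<bullet> G ?x" by (simp add: LIM_zero_iff)
 qed
 then have "((%t. u (x + (t + r) *\<^sub>R e)) has_real_derivative (e \<bullet> G (x + r *\<^sub>R e))) (at 0)"
  by (simp add: algebra_simps)
 then show ?thesis using DERIV_shift[of "%t. u (x + t *\<^sub>R e)" _ 0 r] by simp
qed

lemma phi_pos: "0 < e0 \<bullet> G x"
proof -
 obtain d where d: "d > 0" "((%t. u (x + t *\<^sub>R e0)) has_real_derivative d) (at 0)" using u_deriv by blast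
 have "d = e0 \<bullet> G x" using DERIV_unique[OF d(2) dir_deriv[of x e0 0, simplified]] by simp
 then show ?thesis using d by simp
qed

lemma p_pos: "0 < p x" using phi_pos[of x] by auto

lemma p_lip: "\<bar>p x - p y\<bar> \<le> \<Lambda> * norm (x - y)"
 using norm_triangle_ineq3[of "G x" "G y"] G_lip[of x y] by linarith

lemma blip_p: "blip p" using G_bound p_lip by (intro blipI[of _ \<Lambda> \<Lambda>]) auto

lemma blip_dir: "blip (%x. e \<bullet> G x)"
proof (rule blipI)
 fix x y
 show "\<bar>e \<bullet> G x\<bar> \<le> norm e * \<Lambda>" using Cauchy_Schwarz_ineq2[of e "G x"] mult_left_mono[OF G_bound[of x], of "norm e"] by simp
 have "\<bar>e \<bullet> G x - e \<bullet> G y\<bar> \<le> norm e * norm (G x - G y)" using Cauchy_Schwarz_ineq2[of e "G x - G y"] by (simp add: inner_diff_right)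
 also have "... \<le> norm e * (\<Lambda> * norm (x - y))" using G_lip by (intro mult_left_mono) auto
 finally show "\<bar>e \<bullet> G x - e \<bullet> G y\<bar> \<le> (norm e * \<Lambda>) * norm (x - y)" by simp
qed

lemma u_lip: "\<bar>u x - u y\<bar> \<le> \<Lambda> * norm (x - y)"
proof -
 define e where "e = x - y"
 have "\<exists>r. r \<in> {0<..<1} \<and> u (y + 1 *\<^sub>R e) - u (y + 0 *\<^sub>R e) = (1 - 0) * (e \<bullet> G (y + r *\<^sub>R e))"
  using MVT2[of 0 1 "%t. u (y + t *\<^sub>R e)" "%r. e \<bullet> G (y + r *\<^sub>R e)"] dir_deriv by auto
 then obtain r where "u x - u y = e \<bullet> G (y + r *\<^sub>R e)" by (auto simp: e_def)
 then have "\<bar>u x - u y\<bar> \<le> norm e * norm (G (y + r *\<^sub>R e))" by (simp add: Cauchy_Schwarz_ineq2)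
 also have "... \<le> norm e * \<Lambda>" using G_bound by (intro mult_left_mono) auto
 finally show ?thesis by (simp add: e_def mult.commute)
qed

lemma blip_u: "blip u" using u_abs(1) u_lip by (rule blipI)

text \<open>p is the largest directional derivative: with \<nu> the direction of G x, the solution
  \<nu>.G lies below p and touches it at x, so the operator at x is smaller for p.\<close>

lemma p_subsolution: "Lop p x \<le> (1 - 3 * (u x)^2) * p x"
proof -
 define \<nu> where "\<nu> = G x /\<^sub>R p x"
 have n: "norm \<nu> = 1" using p_pos[of x] by (simp add: \<nu>_def)
 have nx: "\<nu> \<bullet> G x = p x" using p_pos[of x] by (simp add: \<nu>_def power2_norm_eq_inner[symmetric] power2_eq_square)
 have "Lop p x \<le> Lop (%x. \<nu> \<bullet> G x) x"
  unfolding Lop_def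
 proof (rule integral_mono)
  show "integrable lborel (%z. (p x - p (x + z)) * kern z)" using blip_lint[OF blip_p] by (simp add: lint_def)
  show "integrable lborel (%z. (\<nu> \<bullet> G x - \<nu> \<bullet> G (x + z)) * kern z)" using blip_lint[OF blip_dir] by (simp add: lint_def)
  fix z
  have "\<nu> \<bullet> G (x + z) \<le> p (x + z)" using norm_cauchy_schwarz[of \<nu> "G (x + z)"] n by simp
  then show "(p x - p (x + z)) * kern z \<le> (\<nu> \<bullet> G x - \<nu> \<bullet> G (x + z)) * kern z"
   unfolding nx by (intro mult_right_mono) auto
 qed
 then show ?thesis unfolding linearized nx .
qed

text \<open>For a unit vector e, nonnegativity at x says that the angle between e and G x has cosine
  at least \<theta>. The negative part measures how far this cone condition fails.\<close>

definition vt :: "'a => real => 'a => real" where "vt e \<theta> x = e \<bullet> G x - \<theta> * p x"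

lemma blip_vt: "blip (vt e \<theta>)"
 unfolding vt_def[abs_def] by (intro blip_diff blip_mult blip_dir blip_p blip_const)

lemma vt_supersolution:
 assumes "0 \<le> \<theta>" shows "(1 - 3 * (u x)^2) * vt e \<theta> x \<le> Lop (vt e \<theta>) x"
proof -
 have "Lop (vt e \<theta>) x = (LBINT z. (e \<bullet> G x - e \<bullet> G (x + z)) * kern z - \<theta> * ((p x - p (x + z)) * kern z))"
  unfolding Lop_def vt_def by (intro Lintegral_cong) (auto simp: algebra_simps)
 also have "... = Lop (%x. e \<bullet> G x) x - \<theta> * Lop p x"
  unfolding Lop_def using blip_lint[OF blip_p] blip_lint[OF blip_dir[of e]]
  by (subst Lintegral_diff) (auto simp: lint_def)
 also have "... \<ge> (1 - 3 * (u x)^2) * (e \<bullet> G x) - \<theta> * ((1 - 3 * (u x)^2) * p x)"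
  unfolding linearized using mult_left_mono[OF p_subsolution[of x] assms] by linarith
 finally show ?thesis by (simp add: vt_def algebra_simps)
qed

text \<open>Testing the linearised equation of the positive solution with \<open>\<xi>\<^sup>2/\<phi>\<close> (stability) and the
 supersolution \<open>v\<close> with \<open>v\<^sup>- \<eta>\<^sup>2\<close>, and adding.\<close>

lemma sign_interaction:
 fixes \<eta> :: "'a => real" and e :: 'a
 assumes \<theta>: "0 \<le> \<theta>" and \<eta>: "blip \<eta>" and van: "\<And>x. R \<le> norm x ==> \<eta> x = 0"
 defines "v \<equiv> vt e \<theta>"
 shows "integrable PP (%q. max 0 (v (fst q)) * max 0 (- v (snd q)) * (\<eta> (snd q))^2 * pkern q)"
  and "integrable PP (%q. max 0 (- v (fst q)) * max 0 (- v (snd q)) * (\<eta> (fst q) - \<eta> (snd q))^2 * pkern q)"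
  and "2 * (\<integral>q. max 0 (v (fst q)) * max 0 (- v (snd q)) * (\<eta> (snd q))^2 * pkern q \<partial>PP)
   \<le> (\<integral>q. max 0 (- v (fst q)) * max 0 (- v (snd q)) * (\<eta> (fst q) - \<eta> (snd q))^2 * pkern q \<partial>PP)"
proof -
 have v: "blip v" unfolding v_def by (rule blip_vt)
 define m where "m x = max 0 (- v x)" for x
 define P where "P x = max 0 (v x)" for x
 have m: "blip m" unfolding m_def[abs_def] by (intro blip_pos blip_uminus v)
 have P: "blip P" unfolding P_def[abs_def] by (intro blip_pos v)
 note [measurable] = blip_measurable[OF m] blip_measurable[OF \<eta>] blip_measurable[OF P]
 obtain C\<eta> where C\<eta>: "0 \<le> C\<eta>" "\<And>x y. \<bar>\<eta> x - \<eta> y\<bar> \<le> C\<eta> * min 1 (norm (x - y))" "\<And>x. \<bar>\<eta> x\<bar> \<le> C\<eta>" using blip_min1[OF \<eta>] by metis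
 obtain Cv where Cv: "0 \<le> Cv" "\<And>x y. \<bar>v x - v y\<bar> \<le> Cv * min 1 (norm (x - y))" "\<And>x. \<bar>v x\<bar> \<le> Cv" using blip_min1[OF v] by metis
 have mb: "0 \<le> m x" "m x \<le> Cv" for x using Cv(3)[of x] Cv(1) by (auto simp: m_def)
 have Pb: "0 \<le> P x" "P x \<le> Cv" for x using Cv(3)[of x] Cv(1) by (auto simp: P_def)
 have iN2: "integrable PP (%q. (P (fst q) * m (snd q) * (\<eta> (snd q))^2) * pkern q)"
 proof (rule pair_integrable[where R = R])
  fix x y
  have A: "P x * m y \<le> Cv * (Cv * min 1 (norm (x - y)))"
  proof (cases "m y = 0")
   case True then show ?thesis using Cv(1) by simp
  next
   case False
   then have "v y < 0" by (auto simp: m_def max_def split: if_splits)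
   then have "P x \<le> \<bar>v x - v y\<bar>" by (auto simp: P_def)
   then have "P x \<le> Cv * min 1 (norm (x - y))" using Cv(2)[of x y] by linarith
   then show ?thesis using mb[of y] Pb[of x] Cv(1) mult_mono[of "P x" "Cv * min 1 (norm (x - y))" "m y" Cv] by (simp add: mult_ac)
  qed
  have B: "(\<eta> y)^2 \<le> C\<eta>^2" using C\<eta>(3)[of y] by (metis abs_le_square_iff abs_of_nonneg C\<eta>(1))
  have "P x * m y * (\<eta> y)^2 \<le> (Cv * (Cv * min 1 (norm (x - y)))) * C\<eta>^2"
   using Cv(1) by (intro mult_mono[OF A B]) auto
  then show "\<bar>P x * m y * (\<eta> y)^2\<bar> \<le> (Cv * Cv * C\<eta>^2) * min 1 (norm (x - y))"
   using Pb[of x] mb[of y] by (simp add: abs_mult mult_ac)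
 qed (use van in auto)
 have iN1: "integrable PP (%q. (m (fst q) * m (snd q) * (\<eta> (fst q) - \<eta> (snd q))^2) * pkern q)"
 proof (rule pair_integrable[where R = R])
  fix x y
  have "(\<eta> x - \<eta> y)^2 \<le> (C\<eta> * min 1 (norm (x - y)))^2"
   using C\<eta>(2)[of x y] by (metis abs_le_square_iff abs_of_nonneg abs_ge_zero order_trans)
  also have "... \<le> C\<eta>^2 * min 1 (norm (x - y))" unfolding power_mult_distrib
   by (intro mult_left_mono min1_sq) auto
  finally have "m x * m y * (\<eta> x - \<eta> y)^2 \<le> (Cv * Cv) * (C\<eta>^2 * min 1 (norm (x - y)))"
   using mb Cv(1) by (intro mult_mono) auto
  then show "\<bar>m x * m y * (\<eta> x - \<eta> y)^2\<bar> \<le> (Cv * Cv * C\<eta>^2) * min 1 (norm (x - y))"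
   using mb[of x] mb[of y] by (simp add: abs_mult mult_ac)
 qed (use van in auto)
 show "integrable PP (%q. max 0 (v (fst q)) * max 0 (- v (snd q)) * (\<eta> (snd q))^2 * pkern q)"
  using iN2 by (simp add: P_def m_def)
 show "integrable PP (%q. max 0 (- v (fst q)) * max 0 (- v (snd q)) * (\<eta> (fst q) - \<eta> (snd q))^2 * pkern q)"
  using iN1 by (simp add: m_def)
 define \<phi> where "\<phi> x = e0 \<bullet> G x" for x
 have \<phi>: "blip \<phi>" unfolding \<phi>_def[abs_def] by (rule blip_dir)
 define \<xi> where "\<xi> x = m x * \<eta> x" for x
 have \<xi>: "blip \<xi>" unfolding \<xi>_def[abs_def] by (intro blip_mult m \<eta>)
 have \<psi>1: "blip (%x. \<xi> x ^ 2 / \<phi> x)"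
  using van phi_pos by (intro blip_divide_cutoff[of _ _ R] blip_power2 \<xi> \<phi>) (auto simp: \<xi>_def \<phi>_def)
 have \<psi>2: "blip (%x. m x * \<eta> x ^ 2)" by (intro blip_mult blip_power2 m \<eta>)
 have w1: "integrable PP (%q. (\<phi> (fst q) - \<phi> (snd q)) * (\<xi> (fst q) ^ 2 / \<phi> (fst q) - \<xi> (snd q) ^ 2 / \<phi> (snd q)) * pkern q)"
  "(\<integral>q. (\<phi> (fst q) - \<phi> (snd q)) * (\<xi> (fst q) ^ 2 / \<phi> (fst q) - \<xi> (snd q) ^ 2 / \<phi> (snd q)) * pkern q \<partial>PP)
   = 2 * (LBINT x. \<xi> x ^ 2 / \<phi> x * Lop \<phi> x)"
  "integrable lborel (%x. \<xi> x ^ 2 / \<phi> x * Lop \<phi> x)"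
  using weak_form[OF \<phi> \<psi>1, of R] van by (auto simp: \<xi>_def)
 have w2: "integrable PP (%q. (v (fst q) - v (snd q)) * (m (fst q) * \<eta> (fst q) ^ 2 - m (snd q) * \<eta> (snd q) ^ 2) * pkern q)"
  "(\<integral>q. (v (fst q) - v (snd q)) * (m (fst q) * \<eta> (fst q) ^ 2 - m (snd q) * \<eta> (snd q) ^ 2) * pkern q \<partial>PP)
   = 2 * (LBINT x. m x * \<eta> x ^ 2 * Lop v x)"
  "integrable lborel (%x. m x * \<eta> x ^ 2 * Lop v x)"
  using weak_form[OF v \<psi>2, of R] van by auto
 \<comment> \<open>The zeroth-order terms are (1 - 3u^2) \<xi>^2 with opposite signs, so the
   potential drops out.\<close>
 have sum_ge: "0 \<le> (LBINT x. \<xi> x ^ 2 / \<phi> x * Lop \<phi> x) + (LBINT x. m x * \<eta> x ^ 2 * Lop v x)"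
 proof -
  have "0 \<le> (LBINT x. \<xi> x ^ 2 / \<phi> x * Lop \<phi> x + m x * \<eta> x ^ 2 * Lop v x)"
  proof (rule Lintegral_nonneg)
   fix x
   have 1: "\<xi> x ^ 2 / \<phi> x * Lop \<phi> x = (1 - 3 * (u x)^2) * \<xi> x ^ 2"
    unfolding \<phi>_def linearized using phi_pos[of x] by simp
   have "m x * \<eta> x ^ 2 * Lop v x \<ge> m x * \<eta> x ^ 2 * ((1 - 3 * (u x)^2) * v x)"
    unfolding v_def using vt_supersolution[OF \<theta>] mb[of x] by (intro mult_left_mono) auto
   also have "m x * \<eta> x ^ 2 * ((1 - 3 * (u x)^2) * v x) = - ((1 - 3 * (u x)^2) * \<xi> x ^ 2)"
   proof -
    have "m x * v x = - (m x ^ 2)" by (auto simp: m_def max_def power2_eq_square)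
    moreover have "m x * \<eta> x ^ 2 * (c * v x) = c * \<eta> x ^ 2 * (m x * v x)" for c by simp
    ultimately have "m x * \<eta> x ^ 2 * (c * v x) = - (c * \<xi> x ^ 2)" for c by (simp add: \<xi>_def power_mult_distrib)
    then show ?thesis .
   qed
   finally show "0 \<le> \<xi> x ^ 2 / \<phi> x * Lop \<phi> x + m x * \<eta> x ^ 2 * Lop v x" unfolding 1 by linarith
  qed
  then show ?thesis using w1(3) w2(3) by simp
 qed
 have iN2': "integrable PP (%q. (P (snd q) * m (fst q) * (\<eta> (fst q))^2) * pkern q)"
  using lborel_pair.integrable_product_swap[OF iN2] by (simp add: case_prod_beta' kern_commute)
 have eN2': "(\<integral>q. (P (snd q) * m (fst q) * (\<eta> (fst q))^2) * pkern q \<partial>PP) = (\<integral>q. (P (fst q) * m (snd q) * (\<eta> (snd q))^2) * pkern q \<partial>PP)"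
  using lborel_pair.integral_product_swap[of "%q. (P (fst q) * m (snd q) * (\<eta> (snd q))^2) * pkern q"] by (simp add: case_prod_beta' kern_commute)
 let ?F1 = "%q. (\<phi> (fst q) - \<phi> (snd q)) * (\<xi> (fst q) ^ 2 / \<phi> (fst q) - \<xi> (snd q) ^ 2 / \<phi> (snd q)) * pkern q"
 let ?F2 = "%q. (v (fst q) - v (snd q)) * (m (fst q) * \<eta> (fst q) ^ 2 - m (snd q) * \<eta> (snd q) ^ 2) * pkern q"
 let ?N1 = "%q. (m (fst q) * m (snd q) * (\<eta> (fst q) - \<eta> (snd q))^2) * pkern q"
 let ?N2 = "%q. (P (fst q) * m (snd q) * (\<eta> (snd q))^2) * pkern q"
 let ?N2' = "%q. (P (snd q) * m (fst q) * (\<eta> (fst q))^2) * pkern q"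
 have "0 \<le> (\<integral>q. ?F1 q + ?F2 q \<partial>PP)" using sum_ge w1 w2 by simp
 also have "... \<le> (\<integral>q. ?N1 q - ?N2 q - ?N2' q \<partial>PP)"
 proof (rule integral_mono)
  show "integrable PP (%q. ?F1 q + ?F2 q)" using w1(1) w2(1) by (rule Lintegrable_add)
  show "integrable PP (%q. ?N1 q - ?N2 q - ?N2' q)" using iN1 iN2 iN2' by (intro Lintegrable_diff)
  fix q :: "'a \<times> 'a"
  obtain x y where q: "q = (x, y)" by (cases q)
  have a: "(\<phi> x - \<phi> y) * (\<xi> x ^ 2 / \<phi> x - \<xi> y ^ 2 / \<phi> y) \<le> (\<xi> x - \<xi> y)^2"
   using phi_pos by (intro picone) (auto simp: \<phi>_def)
  have vd: "v z = P z - m z" "P z * m z = 0" for z by (auto simp: P_def m_def max_def)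
  \<comment> \<open>The square (\<xi> x - \<xi> y)^2 enters negatively and cancels the one from
    Picone's inequality. The remaining negative terms pair positive values of v with negative
    ones.\<close>
  have b: "(v x - v y) * (m x * \<eta> x ^ 2 - m y * \<eta> y ^ 2) =
   m x * m y * (\<eta> x - \<eta> y)^2 - P x * m y * \<eta> y ^ 2 - P y * m x * \<eta> x ^ 2 - (\<xi> x - \<xi> y)^2 + (P x * m x) * \<eta> x ^ 2 + (P y * m y) * \<eta> y ^ 2"
   unfolding vd(1) \<xi>_def by (simp add: power2_eq_square algebra_simps)
  have "(\<phi> x - \<phi> y) * (\<xi> x ^ 2 / \<phi> x - \<xi> y ^ 2 / \<phi> y) + (v x - v y) * (m x * \<eta> x ^ 2 - m y * \<eta> y ^ 2)
   \<le> m x * m y * (\<eta> x - \<eta> y)^2 - P x * m y * \<eta> y ^ 2 - P y * m x * \<eta> x ^ 2"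
   using a b vd(2)[of x] vd(2)[of y] by simp
  then have "((\<phi> x - \<phi> y) * (\<xi> x ^ 2 / \<phi> x - \<xi> y ^ 2 / \<phi> y) + (v x - v y) * (m x * \<eta> x ^ 2 - m y * \<eta> y ^ 2)) * kern (x - y)
   \<le> (m x * m y * (\<eta> x - \<eta> y)^2 - P x * m y * \<eta> y ^ 2 - P y * m x * \<eta> x ^ 2) * kern (x - y)"
   by (intro mult_right_mono) auto
  then show "?F1 q + ?F2 q \<le> ?N1 q - ?N2 q - ?N2' q" unfolding q fst_conv snd_conv by (simp only: distrib_right left_diff_distrib)
 qed
 also have "... = (\<integral>q. ?N1 q \<partial>PP) - 2 * (\<integral>q. ?N2 q \<partial>PP)"
  using iN1 iN2 iN2' eN2' by simp
 finally show "2 * (\<integral>q. max 0 (v (fst q)) * max 0 (- v (snd q)) * (\<eta> (snd q))^2 * pkern q \<partial>PP)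
   \<le> (\<integral>q. max 0 (- v (fst q)) * max 0 (- v (snd q)) * (\<eta> (fst q) - \<eta> (snd q))^2 * pkern q \<partial>PP)"
  by (simp add: P_def m_def)
qed


lemma defect_nonneg: "0 \<le> p x * p y - G x \<bullet> G y"
 using norm_cauchy_schwarz[of "G x" "G y"] by simp

lemma defect_bound: "p x * p y - G x \<bullet> G y \<le> 2 * \<Lambda>^2 * min 1 (norm (x - y))"
proof -
 have 1: "p x * p y \<le> \<Lambda> * \<Lambda>" using G_bound[of x] G_bound[of y] \<Lambda>1 by (intro mult_mono) auto
 have "\<bar>G x \<bullet> G y\<bar> \<le> p x * p y" by (rule Cauchy_Schwarz_ineq2)
 with 1 have a: "p x * p y - G x \<bullet> G y \<le> 2 * \<Lambda>^2" by (simp add: power2_eq_square)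
 have "p x * p y - G x \<bullet> G y = p x * (p y - p x) + G x \<bullet> (G x - G y)"
  by (simp add: inner_diff_right power2_norm_eq_inner[symmetric] power2_eq_square algebra_simps)
 also have "... \<le> \<Lambda> * (\<Lambda> * norm (x - y)) + \<Lambda> * (\<Lambda> * norm (x - y))"
 proof (rule add_mono)
  have "p x * (p y - p x) \<le> p x * \<bar>p x - p y\<bar>" by (intro mult_left_mono) auto
  also have "... \<le> \<Lambda> * (\<Lambda> * norm (x - y))" using G_bound[of x] p_lip[of x y] \<Lambda>1 by (intro mult_mono) auto
  finally show "p x * (p y - p x) \<le> \<Lambda> * (\<Lambda> * norm (x - y))" .
  have "G x \<bullet> (G x - G y) \<le> p x * norm (G x - G y)" by (rule norm_cauchy_schwarz)
  also have "... \<le> \<Lambda> * (\<Lambda> * norm (x - y))" using G_bound[of x] G_lip[of x y] \<Lambda>1 by (intro mult_mono) auto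
  finally show "G x \<bullet> (G x - G y) \<le> \<Lambda> * (\<Lambda> * norm (x - y))" .
 qed
 finally have b: "p x * p y - G x \<bullet> G y \<le> 2 * \<Lambda>^2 * norm (x - y)" by (simp add: power2_eq_square)
 show ?thesis using a b by (cases "norm (x - y) \<le> 1") (auto simp: min_def)
qed

lemma G_measurable [measurable]: "G \<in> borel_measurable borel"
proof -
 have "\<Lambda>-lipschitz_on UNIV G" using G_lip \<Lambda>1 by (intro lipschitz_onI) (auto simp: dist_norm)
 then show ?thesis by (intro borel_measurable_continuous_onI lipschitz_on_continuous_on)
qed

text \<open>Nonlocal counterpart of the Sternberg-Zumbrun inequality. The equation of \<phi> is
  tested with p^2 \<eta>^2/\<phi>, that of each component b.G with (b.G) \<eta>^2. The zeroth-order
  terms of the first and of the sum over b coincide, hence so do the two quadratic forms. Picone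
  bounds the first by the square of p \<eta> - p' \<eta>', and expanding leaves exactly the two
  sides.\<close>

lemma energy:
 fixes \<eta> :: "'a => real"
 assumes \<eta>: "blip \<eta>" and van: "\<And>x. R \<le> norm x ==> \<eta> x = 0"
 shows "integrable PP (%q. \<eta> (fst q) * \<eta> (snd q) * (p (fst q) * p (snd q) - G (fst q) \<bullet> G (snd q)) * pkern q)"
  and "integrable PP (%q. (G (fst q) \<bullet> G (snd q)) * (\<eta> (fst q) - \<eta> (snd q))^2 * pkern q)"
  and "2 * (\<integral>q. \<eta> (fst q) * \<eta> (snd q) * (p (fst q) * p (snd q) - G (fst q) \<bullet> G (snd q)) * pkern q \<partial>PP)
   \<le> (\<integral>q. (G (fst q) \<bullet> G (snd q)) * (\<eta> (fst q) - \<eta> (snd q))^2 * pkern q \<partial>PP)"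
proof -
 note [measurable] = blip_measurable[OF \<eta>] blip_measurable[OF blip_p]
 obtain C where C: "0 \<le> C" "\<And>x y. \<bar>\<eta> x - \<eta> y\<bar> \<le> C * min 1 (norm (x - y))" "\<And>x. \<bar>\<eta> x\<bar> \<le> C" using blip_min1[OF \<eta>] by metis
 show iA: "integrable PP (%q. \<eta> (fst q) * \<eta> (snd q) * (p (fst q) * p (snd q) - G (fst q) \<bullet> G (snd q)) * pkern q)"
 proof (rule pair_integrable[where R = R])
  fix x y
  have "\<bar>\<eta> x * \<eta> y * (p x * p y - G x \<bullet> G y)\<bar> = \<bar>\<eta> x\<bar> * \<bar>\<eta> y\<bar> * (p x * p y - G x \<bullet> G y)"
   using defect_nonneg[of x y] by (simp add: abs_mult)
  also have "... \<le> C * C * (2 * \<Lambda>^2 * min 1 (norm (x - y)))"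
   using C(3)[of x] C(3)[of y] C(1) defect_bound[of x y] defect_nonneg[of x y] by (intro mult_mono) auto
  finally show "\<bar>\<eta> x * \<eta> y * (p x * p y - G x \<bullet> G y)\<bar> \<le> (C * C * 2 * \<Lambda>^2) * min 1 (norm (x - y))" by (simp add: mult_ac)
 qed (use van in auto)
 show iB: "integrable PP (%q. (G (fst q) \<bullet> G (snd q)) * (\<eta> (fst q) - \<eta> (snd q))^2 * pkern q)"
 proof (rule pair_integrable[where R = R])
  fix x y
  have "(\<eta> x - \<eta> y)^2 \<le> (C * min 1 (norm (x - y)))^2"
   using C(2)[of x y] by (metis abs_le_square_iff abs_of_nonneg abs_ge_zero order_trans)
  also have "... \<le> C^2 * min 1 (norm (x - y))" unfolding power_mult_distrib
   by (intro mult_left_mono min1_sq) auto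
  finally have A: "(\<eta> x - \<eta> y)^2 \<le> C^2 * min 1 (norm (x - y))" .
  have "\<bar>G x \<bullet> G y\<bar> \<le> p x * p y" by (rule Cauchy_Schwarz_ineq2)
  also have "... \<le> \<Lambda> * \<Lambda>" using G_bound[of x] G_bound[of y] \<Lambda>1 by (intro mult_mono) auto
  finally have "\<bar>G x \<bullet> G y\<bar> * (\<eta> x - \<eta> y)^2 \<le> \<Lambda> * \<Lambda> * (C^2 * min 1 (norm (x - y)))"
   using \<Lambda>1 by (intro mult_mono[OF _ A]) auto
  then show "\<bar>G x \<bullet> G y * (\<eta> x - \<eta> y)^2\<bar> \<le> (\<Lambda> * \<Lambda> * C^2) * min 1 (norm (x - y))" by (simp add: abs_mult mult_ac)
 qed (use van in auto)
 define \<phi> where "\<phi> x = e0 \<bullet> G x" for x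
 have \<phi>: "blip \<phi>" unfolding \<phi>_def[abs_def] by (rule blip_dir)
 define \<xi> where "\<xi> x = p x * \<eta> x" for x
 have \<xi>: "blip \<xi>" unfolding \<xi>_def[abs_def] by (intro blip_mult blip_p \<eta>)
 have \<psi>1: "blip (%x. \<xi> x ^ 2 / \<phi> x)"
  using van phi_pos by (intro blip_divide_cutoff[of _ _ R] blip_power2 \<xi> \<phi>) (auto simp: \<xi>_def \<phi>_def)
 have \<psi>2: "blip (%x. (b \<bullet> G x) * \<eta> x ^ 2)" for b by (intro blip_mult blip_power2 blip_dir \<eta>)
 let ?F1 = "%q. (\<phi> (fst q) - \<phi> (snd q)) * (\<xi> (fst q) ^ 2 / \<phi> (fst q) - \<xi> (snd q) ^ 2 / \<phi> (snd q)) * pkern q"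
 let ?F2 = "%b q. (b \<bullet> G (fst q) - b \<bullet> G (snd q)) * ((b \<bullet> G (fst q)) * \<eta> (fst q) ^ 2 - (b \<bullet> G (snd q)) * \<eta> (snd q) ^ 2) * pkern q"
 have w1: "integrable PP ?F1" "(\<integral>q. ?F1 q \<partial>PP) = 2 * (LBINT x. \<xi> x ^ 2 / \<phi> x * Lop \<phi> x)"
  "integrable lborel (%x. \<xi> x ^ 2 / \<phi> x * Lop \<phi> x)"
  using weak_form[OF \<phi> \<psi>1, of R] van by (auto simp: \<xi>_def)
 have w2: "integrable PP (?F2 b)" "(\<integral>q. ?F2 b q \<partial>PP) = 2 * (LBINT x. (b \<bullet> G x) * \<eta> x ^ 2 * Lop (%x. b \<bullet> G x) x)"
  "integrable lborel (%x. (b \<bullet> G x) * \<eta> x ^ 2 * Lop (%x. b \<bullet> G x) x)" for b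
  using weak_form[OF blip_dir \<psi>2, of R b b] van by auto
 have sq: "(\<Sum>b\<in>Basis. (b \<bullet> z)^2) = (norm z)^2" for z :: 'a
  by (subst power2_norm_eq_inner, subst euclidean_inner) (simp add: power2_eq_square inner_commute)
 have eqint: "(LBINT x. \<xi> x ^ 2 / \<phi> x * Lop \<phi> x) = (\<Sum>b\<in>Basis. LBINT x. (b \<bullet> G x) * \<eta> x ^ 2 * Lop (%x. b \<bullet> G x) x)"
 proof -
  have "(\<Sum>b\<in>Basis. LBINT x. (b \<bullet> G x) * \<eta> x ^ 2 * Lop (%x. b \<bullet> G x) x)
   = (LBINT x. (\<Sum>b\<in>Basis. (b \<bullet> G x) * \<eta> x ^ 2 * Lop (%x. b \<bullet> G x) x))"
   by (rule Lintegral_sum[symmetric]) (rule w2)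
  also have "... = (LBINT x. \<xi> x ^ 2 / \<phi> x * Lop \<phi> x)"
  proof (rule Lintegral_cong[OF refl])
   fix x
   have "(\<Sum>b\<in>Basis. (b \<bullet> G x) * \<eta> x ^ 2 * Lop (%x. b \<bullet> G x) x) = (\<Sum>b\<in>Basis. (b \<bullet> G x)^2 * ((1 - 3 * (u x)^2) * \<eta> x ^ 2))"
    unfolding linearized by (simp add: power2_eq_square mult_ac)
   also have "... = (p x)^2 * ((1 - 3 * (u x)^2) * \<eta> x ^ 2)" unfolding sum_distrib_right[symmetric] sq ..
   also have "... = \<xi> x ^ 2 / \<phi> x * Lop \<phi> x"
    unfolding \<phi>_def linearized using phi_pos[of x] by (simp add: \<xi>_def power_mult_distrib)
   finally show "(\<Sum>b\<in>Basis. (b \<bullet> G x) * \<eta> x ^ 2 * Lop (%x. b \<bullet> G x) x) = \<xi> x ^ 2 / \<phi> x * Lop \<phi> x" .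
  qed
  finally show ?thesis ..
 qed
 let ?A = "%q. \<eta> (fst q) * \<eta> (snd q) * (p (fst q) * p (snd q) - G (fst q) \<bullet> G (snd q)) * pkern q"
 let ?B = "%q. (G (fst q) \<bullet> G (snd q)) * (\<eta> (fst q) - \<eta> (snd q))^2 * pkern q"
 have "(\<integral>q. ?F1 q - (\<Sum>b\<in>Basis. ?F2 b q) \<partial>PP) = (\<integral>q. ?F1 q \<partial>PP) - (\<integral>q. (\<Sum>b\<in>Basis. ?F2 b q) \<partial>PP)"
  by (rule Lintegral_diff[OF w1(1) Lintegrable_sum[OF w2(1)]])
 also have "(\<integral>q. (\<Sum>b\<in>Basis. ?F2 b q) \<partial>PP) = (\<Sum>b\<in>Basis. \<integral>q. ?F2 b q \<partial>PP)"
  by (rule Lintegral_sum[OF w2(1)])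
 also have "(\<integral>q. ?F1 q \<partial>PP) - (\<Sum>b\<in>Basis. \<integral>q. ?F2 b q \<partial>PP) = 0"
  unfolding w1(2) w2(2) eqint sum_distrib_left by simp
 finally have "0 = (\<integral>q. ?F1 q - (\<Sum>b\<in>Basis. ?F2 b q) \<partial>PP)" ..
 also have "... \<le> (\<integral>q. ?B q - 2 * ?A q \<partial>PP)"
 proof (rule integral_mono)
  show "integrable PP (%q. ?F1 q - (\<Sum>b\<in>Basis. ?F2 b q))" using w1(1) w2(1) by (intro Lintegrable_diff Lintegrable_sum)
  show "integrable PP (%q. ?B q - 2 * ?A q)" using iA iB by (intro Lintegrable_diff integrable_mult_right)
  fix q :: "'a \<times> 'a"
  obtain x y where q: "q = (x, y)" by (cases q)
  have a: "(\<phi> x - \<phi> y) * (\<xi> x ^ 2 / \<phi> x - \<xi> y ^ 2 / \<phi> y) \<le> (\<xi> x - \<xi> y)^2"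
   using phi_pos by (intro picone) (auto simp: \<phi>_def)
  have b: "(\<Sum>b\<in>Basis. (b \<bullet> G x - b \<bullet> G y) * ((b \<bullet> G x) * \<eta> x ^ 2 - (b \<bullet> G y) * \<eta> y ^ 2))
   = (p x)^2 * \<eta> x ^ 2 + (p y)^2 * \<eta> y ^ 2 - (G x \<bullet> G y) * (\<eta> x ^ 2 + \<eta> y ^ 2)"
  proof -
   have "(\<Sum>b\<in>Basis. (b \<bullet> G x - b \<bullet> G y) * ((b \<bullet> G x) * \<eta> x ^ 2 - (b \<bullet> G y) * \<eta> y ^ 2))
    = (\<Sum>b\<in>Basis. (b \<bullet> G x)^2 * \<eta> x ^ 2 + (b \<bullet> G y)^2 * \<eta> y ^ 2 - ((G x \<bullet> b) * (G y \<bullet> b)) * (\<eta> x ^ 2 + \<eta> y ^ 2))"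
    by (intro sum.cong refl) (simp add: power2_eq_square algebra_simps inner_commute)
   also have "... = (p x)^2 * \<eta> x ^ 2 + (p y)^2 * \<eta> y ^ 2 - (G x \<bullet> G y) * (\<eta> x ^ 2 + \<eta> y ^ 2)"
    unfolding sum_subtractf sum.distrib sum_distrib_right[symmetric] sq euclidean_inner[of "G x" "G y"] ..
   finally show ?thesis .
  qed
  have "(\<xi> x - \<xi> y)^2 - ((p x)^2 * \<eta> x ^ 2 + (p y)^2 * \<eta> y ^ 2 - (G x \<bullet> G y) * (\<eta> x ^ 2 + \<eta> y ^ 2))
   = (G x \<bullet> G y) * (\<eta> x - \<eta> y)^2 - 2 * (\<eta> x * \<eta> y * (p x * p y - G x \<bullet> G y))"
   unfolding \<xi>_def by (simp add: power2_eq_square algebra_simps)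
  with a b have "(\<phi> x - \<phi> y) * (\<xi> x ^ 2 / \<phi> x - \<xi> y ^ 2 / \<phi> y) - (\<Sum>b\<in>Basis. (b \<bullet> G x - b \<bullet> G y) * ((b \<bullet> G x) * \<eta> x ^ 2 - (b \<bullet> G y) * \<eta> y ^ 2))
   \<le> (G x \<bullet> G y) * (\<eta> x - \<eta> y)^2 - 2 * (\<eta> x * \<eta> y * (p x * p y - G x \<bullet> G y))" by linarith
  then have "((\<phi> x - \<phi> y) * (\<xi> x ^ 2 / \<phi> x - \<xi> y ^ 2 / \<phi> y) - (\<Sum>b\<in>Basis. (b \<bullet> G x - b \<bullet> G y) * ((b \<bullet> G x) * \<eta> x ^ 2 - (b \<bullet> G y) * \<eta> y ^ 2))) * kern (x - y)
   \<le> ((G x \<bullet> G y) * (\<eta> x - \<eta> y)^2 - 2 * (\<eta> x * \<eta> y * (p x * p y - G x \<bullet> G y))) * kern (x - y)"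
   by (intro mult_right_mono) auto
  then show "?F1 q - (\<Sum>b\<in>Basis. ?F2 b q) \<le> ?B q - 2 * ?A q" unfolding q fst_conv snd_conv
   by (simp only: left_diff_distrib sum_distrib_right mult.assoc)
 qed
 also have "... = (\<integral>q. ?B q \<partial>PP) - 2 * (\<integral>q. ?A q \<partial>PP)" using iA iB by simp
 finally show "2 * (\<integral>q. ?A q \<partial>PP) \<le> (\<integral>q. ?B q \<partial>PP)" by simp
qed

end

section \<open>Total variation on balls\<close>

definition bmeas :: "('a::euclidean_space => real) => bool" where
 "bmeas g \<longleftrightarrow> g \<in> borel_measurable borel \<and> (\<exists>B. \<forall>x. \<bar>g x\<bar> \<le> B)"

definition bint :: "('a::euclidean_space => real) => 'a => real => real" where
 "bint g y r = (LBINT x. g x * indicator (ball y r) x)"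

lemma blip_bmeas: "blip g ==> bmeas g"
 using blip_measurable unfolding bmeas_def blip_def by metis

lemma bmeas_measurable: "bmeas g ==> g \<in> borel_measurable borel" by (simp add: bmeas_def)

lemma integrable_indicator_ball: "integrable lborel (indicator (ball (y::'a::euclidean_space) r) :: 'a => real)"
 using emeasure_lborel_ball_finite[of y r] by (intro integrable_real_indicator) auto

lemma bint_integrable:
 assumes "bmeas g" shows "integrable lborel (%x. g x * indicator (ball y r) x)"
proof -
 from assms obtain B where B: "\<And>x. \<bar>g x\<bar> \<le> B" and [measurable]: "g \<in> borel_measurable borel" by (auto simp: bmeas_def)
 show ?thesis
 proof (rule Lintegrable_bound)
  show "integrable lborel (%x. B * indicator (ball y r) x)" by (intro integrable_mult_right integrable_indicator_ball)
  show "AE x in lborel. norm (g x * indicator (ball y r) x) \<le> norm (B * indicator (ball y r) x)"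
   using B by (intro AE_I2) (auto simp: abs_mult split: split_indicator intro: order_trans[OF _ abs_ge_self])
 qed measurable
qed

lemma measure_ball_lborel: "0 \<le> r ==> measure lborel (ball (y::'a::euclidean_space) r) = unit_ball_vol (DIM('a)) * r ^ DIM('a)"
 by (simp add: measure_def emeasure_ball)

lemma bint_const: "0 \<le> r ==> bint (%x. c) (y::'a::euclidean_space) r = c * unit_ball_vol (DIM('a)) * r ^ DIM('a)"
 unfolding bint_def using measure_ball_lborel[of r y] by simp

lemma bint_mono: "bmeas g ==> bmeas h ==> (\<And>x. x \<in> ball y r ==> g x \<le> h x) ==> bint g y r \<le> bint h y r"
 unfolding bint_def by (intro integral_mono bint_integrable) (auto split: split_indicator)

lemma bint_nonneg: "(\<And>x. 0 \<le> g x) ==> 0 \<le> bint g y r"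
 unfolding bint_def by (intro Lintegral_nonneg) auto

lemma bint_subset: "bmeas g ==> (\<And>x. 0 \<le> g x) ==> ball y r \<subseteq> ball y' r' ==> bint g y r \<le> bint g y' r'"
 unfolding bint_def by (intro integral_mono bint_integrable) (auto split: split_indicator)

lemma bmeas_const [simp]: "bmeas (%x. c)" by (auto simp: bmeas_def)

lemma bint_le_vol: "bmeas g ==> (\<And>x. g x \<le> B) ==> 0 \<le> r ==> bint g (y::'a::euclidean_space) r \<le> B * unit_ball_vol (DIM('a)) * r ^ DIM('a)"
 using bint_mono[of g "%x. B" y r] by (simp add: bint_const)

lemma bint_nn:
 assumes "bmeas g" "\<And>x. 0 \<le> g x"
 shows "(NNBINT x. ennreal (g x) * indicator (ball y r) x) = ennreal (bint g y r)"
proof -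
 have "(NNBINT x. ennreal (g x) * indicator (ball y r) x) = (NNBINT x. ennreal (g x * indicator (ball y r) x))"
  by (intro nn_integral_cong) (auto split: split_indicator)
 also have "... = ennreal (bint g y r)" unfolding bint_def
  using assms(2) by (intro nn_integral_eq_integral bint_integrable assms) auto
 finally show ?thesis .
qed

definition tent :: "'a::euclidean_space => real => 'a => real" where
 "tent z R x = max 0 (min 1 (2 - norm (x - z) / R))"

lemma tent_bounds: "0 \<le> tent z R x" "tent z R x \<le> 1" by (auto simp: tent_def)

lemma tent_eq_1: "0 < R ==> norm (x - z) \<le> R ==> tent z R x = 1"
 by (simp add: tent_def field_simps)

lemma tent_eq_0: "0 < R ==> 2 * R \<le> norm (x - z) ==> tent z R x = 0"
 by (simp add: tent_def field_simps)

lemma tent_lip: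
 assumes "0 < R" shows "\<bar>tent z R x - tent z R y\<bar> \<le> min 1 (1 / R * norm (x - y))"
proof -
 have "\<bar>norm (x - z) - norm (y - z)\<bar> \<le> norm (x - y)" using norm_triangle_ineq3[of "x - z" "y - z"] by simp
 then have "\<bar>norm (x - z) / R - norm (y - z) / R\<bar> \<le> norm (x - y) / R"
  using assms by (simp add: diff_divide_distrib[symmetric] abs_divide divide_right_mono)
 then have "\<bar>tent z R x - tent z R y\<bar> \<le> norm (x - y) / R" unfolding tent_def by (auto simp: max_def min_def abs_if split: if_splits)
 moreover have "\<bar>tent z R x - tent z R y\<bar> \<le> 1" using tent_bounds[of z R x] tent_bounds[of z R y] by linarith
 ultimately show ?thesis by simp
qed

lemma blip_tent: "0 < R ==> blip (tent z R)"
 using tent_bounds[of z R] tent_lip[of R z] by (intro blipI[of _ 1 "1/R"]) auto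

text \<open>Integration by parts for difference quotients: translation invariance moves the
  increment from g to w, where the Taylor bound lets it converge. So g has to be merely integrable,
  which admits singular weights.\<close>

lemma ibp_limit:
 fixes w g :: "'a::euclidean_space => real" and Gw :: "'a => 'a" and e :: 'a
 assumes w: "bmeas w" and Gm[measurable]: "Gw \<in> borel_measurable borel" and Gb: "\<And>x. norm (Gw x) \<le> B'"
  and ty: "\<And>x h. \<bar>w (x + h) - w x - Gw x \<bullet> h\<bar> \<le> L * (norm h)^2" and g: "integrable lborel g"
 shows "(%m. LBINT x. w x * ((g (x - (1 / real (Suc m)) *\<^sub>R e) - g x) / (1 / real (Suc m)))) \<longlonglongrightarrow> (LBINT x. (e \<bullet> Gw x) * g x)"
proof -
 note [measurable] = bmeas_measurable[OF w]
 have gm[measurable]: "g \<in> borel_measurable borel" using borel_measurable_integrable[OF g] by simp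
 obtain B where B: "\<And>x. \<bar>w x\<bar> \<le> B" using w by (auto simp: bmeas_def)
 define \<tau> where "\<tau> m = 1 / real (Suc m)" for m
 have \<tau>: "0 < \<tau> m" "\<tau> m \<le> 1" for m by (auto simp: \<tau>_def)
 have \<tau>0: "\<tau> \<longlonglongrightarrow> 0" unfolding \<tau>_def using LIMSEQ_inverse_real_of_nat by (simp add: inverse_eq_divide)
 have L: "0 \<le> L"
 proof -
  obtain b :: 'a where "b \<in> Basis" by (meson nonempty_Basis ex_in_conv)
  then show ?thesis using ty[of 0 b] by simp
 qed
 have wg: "integrable lborel (%x. v x * f x)" if "\<And>x. \<bar>v x\<bar> \<le> B" "v \<in> borel_measurable borel" "integrable lborel f" for v f :: "'a => real"
 proof (rule Lintegrable_bound[of _ "%x. B * f x"])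
  show "integrable lborel (%x. B * f x)" using that by simp
  have [measurable]: "v \<in> borel_measurable borel" "f \<in> borel_measurable borel" using that borel_measurable_integrable[OF that(3)] by auto
  show "(%x. v x * f x) \<in> borel_measurable lborel" by measurable
  show "AE x in lborel. norm (v x * f x) \<le> norm (B * f x)"
   unfolding real_norm_def abs_mult by (intro AE_I2 mult_right_mono order_trans[OF that(1) abs_ge_self]) auto
 qed
 have eq: "(LBINT x. w x * ((g (x - \<tau> m *\<^sub>R e) - g x) / \<tau> m)) = (LBINT x. (w (x + \<tau> m *\<^sub>R e) - w x) / \<tau> m * g x)" for m
 proof -
  have i1: "integrable lborel (%x. w x * g (x - \<tau> m *\<^sub>R e))"
   using integrable_lborel_translate[OF g, of "- (\<tau> m *\<^sub>R e)"] by (intro wg B) auto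
  have i2: "integrable lborel (%x. w x * g x)" by (intro wg B g) auto
  have i3: "integrable lborel (%x. w (x + \<tau> m *\<^sub>R e) * g x)" by (intro wg B g) auto
  have tr: "(LBINT x. w x * g (x - \<tau> m *\<^sub>R e)) = (LBINT x. w (x + \<tau> m *\<^sub>R e) * g x)"
   using integral_lborel_translate[of "%x. w x * g (x - \<tau> m *\<^sub>R e)" "\<tau> m *\<^sub>R e"] by simp
  have "(LBINT x. w x * ((g (x - \<tau> m *\<^sub>R e) - g x) / \<tau> m)) = (LBINT x. (w x * g (x - \<tau> m *\<^sub>R e) - w x * g x) / \<tau> m)"
   by (simp add: algebra_simps)
  also have "... = (LBINT x. (w (x + \<tau> m *\<^sub>R e) * g x - w x * g x) / \<tau> m)"
   using i1 i2 i3 tr by simp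
  finally show ?thesis by (simp add: algebra_simps)
 qed
 have pt: "\<bar>(w (x + \<tau> m *\<^sub>R e) - w x) / \<tau> m - e \<bullet> Gw x\<bar> \<le> L * (norm e)^2 * \<tau> m" for x m
 proof -
  have "\<bar>w (x + \<tau> m *\<^sub>R e) - w x - \<tau> m * (e \<bullet> Gw x)\<bar> \<le> (L * (norm e)^2 * \<tau> m) * \<tau> m"
   using ty[of x "\<tau> m *\<^sub>R e"] by (simp add: power_mult_distrib inner_commute power2_eq_square mult_ac)
  moreover have "(w (x + \<tau> m *\<^sub>R e) - w x) / \<tau> m - e \<bullet> Gw x = (w (x + \<tau> m *\<^sub>R e) - w x - \<tau> m * (e \<bullet> Gw x)) / \<tau> m"
   using \<tau>[of m] by (simp add: diff_divide_distrib)
  ultimately show ?thesis using \<tau>[of m] by (simp add: abs_divide pos_divide_le_eq)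
 qed
 have "(%m. LBINT x. (w (x + \<tau> m *\<^sub>R e) - w x) / \<tau> m * g x) \<longlonglongrightarrow> (LBINT x. (e \<bullet> Gw x) * g x)"
 proof (rule integral_dominated_convergence[where w = "%x. (L * (norm e)^2 + norm e * B') * \<bar>g x\<bar>"])
  show "(%x. e \<bullet> Gw x * g x) \<in> borel_measurable lborel" "(%x. (w (x + \<tau> m *\<^sub>R e) - w x) / \<tau> m * g x) \<in> borel_measurable lborel" for m
   by measurable
  show "integrable lborel (%x. (L * (norm e)^2 + norm e * B') * \<bar>g x\<bar>)" using g by auto
  show "AE x in lborel. (%m. (w (x + \<tau> m *\<^sub>R e) - w x) / \<tau> m * g x) \<longlonglongrightarrow> e \<bullet> Gw x * g x"
  proof (intro AE_I2 tendsto_mult tendsto_const)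
   fix x
   have ev: "\<forall>\<^sub>F m in sequentially. norm ((w (x + \<tau> m *\<^sub>R e) - w x) / \<tau> m - e \<bullet> Gw x) \<le> L * (norm e)^2 * \<tau> m" using pt by simp
   have "(%m. L * (norm e)^2 * \<tau> m) \<longlonglongrightarrow> 0" using tendsto_mult_right_zero[OF \<tau>0] by simp
   with ev have "(%m. (w (x + \<tau> m *\<^sub>R e) - w x) / \<tau> m - e \<bullet> Gw x) \<longlonglongrightarrow> 0" by (rule Lim_null_comparison)
   then show "(%m. (w (x + \<tau> m *\<^sub>R e) - w x) / \<tau> m) \<longlonglongrightarrow> e \<bullet> Gw x" by (simp add: LIM_zero_iff)
  qed
  fix m
  have "\<bar>(w (x + \<tau> m *\<^sub>R e) - w x) / \<tau> m\<bar> \<le> L * (norm e)^2 + norm e * B'" for x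
  proof -
   have "L * (norm e)^2 * \<tau> m \<le> L * (norm e)^2 * 1" using L \<tau>[of m] by (intro mult_left_mono) auto
   moreover have "\<bar>e \<bullet> Gw x\<bar> \<le> norm e * B'"
    using Cauchy_Schwarz_ineq2[of e "Gw x"] mult_left_mono[OF Gb[of x], of "norm e"] by simp
   ultimately show ?thesis using pt[of x m] by linarith
  qed
  then show "AE x in lborel. norm ((w (x + \<tau> m *\<^sub>R e) - w x) / \<tau> m * g x) \<le> (L * (norm e)^2 + norm e * B') * \<bar>g x\<bar>"
   unfolding real_norm_def abs_mult by (intro AE_I2 mult_right_mono) auto
 qed
 then have "(%m. LBINT x. w x * ((g (x - \<tau> m *\<^sub>R e) - g x) / \<tau> m)) \<longlonglongrightarrow> (LBINT x. (e \<bullet> Gw x) * g x)"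
  by (simp only: eq)
 then show ?thesis unfolding \<tau>_def .
qed

text \<open>What enters is the size of w and the slope of \<zeta>; the size of the gradient of w
  does not appear in the bound.\<close>

lemma ibp_lip:
 fixes w \<zeta> :: "'a::euclidean_space => real" and Gw :: "'a => 'a" and e :: 'a
 assumes w: "bmeas w" and Gm: "Gw \<in> borel_measurable borel" and Gb: "\<And>x. norm (Gw x) \<le> B'"
  and ty: "\<And>x h. \<bar>w (x + h) - w x - Gw x \<bullet> h\<bar> \<le> L * (norm h)^2"
  and lip: "\<And>x y. \<bar>\<zeta> x - \<zeta> y\<bar> \<le> l * norm (x - y)" and bd: "\<And>x. \<bar>\<zeta> x\<bar> \<le> B" and van: "\<And>x. r \<le> norm (x - z) ==> \<zeta> x = 0" and r: "0 < r"
 shows "\<bar>LBINT x. (e \<bullet> Gw x) * \<zeta> x\<bar> \<le> l * norm e * bint (%x. \<bar>w x\<bar>) z (2 * r)"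
proof -
 have [measurable]: "\<zeta> \<in> borel_measurable borel" using blip_measurable[OF blipI[OF bd lip]] .
 note [measurable] = bmeas_measurable[OF w]
 have bw: "bmeas (%x. \<bar>w x\<bar>)" using w by (auto simp: bmeas_def)
 have l: "0 \<le> l"
 proof -
  obtain b :: 'a where "b \<in> Basis" by (meson nonempty_Basis ex_in_conv)
  then show ?thesis using lip[of b 0] by simp
 qed
 have b\<zeta>: "bmeas \<zeta>" using blip_bmeas[OF blipI[OF bd lip]] .
 have "\<zeta> x = \<zeta> x * indicator (ball z r) x" for x using van[of x] by (auto simp: dist_norm norm_minus_commute split: split_indicator)
 then have i\<zeta>: "integrable lborel \<zeta>" using bint_integrable[OF b\<zeta>, of z r] by presburger
 note lim = ibp_limit[OF w Gm Gb ty i\<zeta>, of e]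
 \<comment> \<open>From this index on, the translated support of \<zeta> stays inside the ball of
   radius 2r.\<close>
 obtain N :: nat where N: "norm e / r < N" using reals_Archimedean2 by blast
 have "\<bar>LBINT x. w x * ((\<zeta> (x - (1 / real (Suc m)) *\<^sub>R e) - \<zeta> x) / (1 / real (Suc m)))\<bar> \<le> l * norm e * bint (%x. \<bar>w x\<bar>) z (2 * r)" if "N \<le> m" for m
 proof -
  define t where "t = 1 / real (Suc m)"
  have t: "0 < t" by (simp add: t_def)
  have "norm e < r * real N" using N r by (simp add: divide_less_eq mult.commute)
  also have "... \<le> r * real (Suc m)" using that r by (intro mult_left_mono) auto
  finally have tr: "t * norm e < r" by (simp add: t_def field_simps)
  have pt: "norm (w x * ((\<zeta> (x - t *\<^sub>R e) - \<zeta> x) / t)) \<le> l * norm e * (\<bar>w x\<bar> * indicator (ball z (2 * r)) x)" for x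
  proof (cases "x \<in> ball z (2 * r)")
   case True
   have "\<bar>(\<zeta> (x - t *\<^sub>R e) - \<zeta> x) / t\<bar> \<le> l * norm e"
    using lip[of "x - t *\<^sub>R e" x] t by (simp add: abs_divide pos_divide_le_eq mult_ac)
   then have "\<bar>w x\<bar> * \<bar>(\<zeta> (x - t *\<^sub>R e) - \<zeta> x) / t\<bar> \<le> \<bar>w x\<bar> * (l * norm e)" by (intro mult_left_mono) auto
   then show ?thesis using True by (simp add: abs_mult mult_ac)
  next
   case False
   then have d: "2 * r \<le> norm (x - z)" by (simp add: dist_norm norm_minus_commute)
   have "norm (x - z) \<le> norm (x - t *\<^sub>R e - z) + norm (t *\<^sub>R e)" using norm_triangle_ineq[of "x - t *\<^sub>R e - z" "t *\<^sub>R e"] by simp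
   then have "r \<le> norm (x - t *\<^sub>R e - z)" using d tr t by simp
   then show ?thesis using van[of "x - t *\<^sub>R e"] van[of x] d r l by simp
  qed
  have "\<bar>LBINT x. w x * ((\<zeta> (x - t *\<^sub>R e) - \<zeta> x) / t)\<bar> \<le> (LBINT x. norm (w x * ((\<zeta> (x - t *\<^sub>R e) - \<zeta> x) / t)))"
   using integral_norm_bound[of lborel "%x. w x * ((\<zeta> (x - t *\<^sub>R e) - \<zeta> x) / t)"] by simp
  also have "... \<le> (LBINT x. l * norm e * (\<bar>w x\<bar> * indicator (ball z (2 * r)) x))"
  proof (rule integral_mono)
   show i: "integrable lborel (%x. l * norm e * (\<bar>w x\<bar> * indicator (ball z (2 * r)) x))" using bint_integrable[OF bw] by (rule integrable_mult_right)
   show "integrable lborel (%x. norm (w x * ((\<zeta> (x - t *\<^sub>R e) - \<zeta> x) / t)))"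
    by (rule Lintegrable_bound[OF i]) (use pt l in \<open>auto simp: abs_mult\<close>)
  qed (rule pt)
  also have "... = l * norm e * bint (%x. \<bar>w x\<bar>) z (2 * r)" by (simp add: bint_def)
  finally show ?thesis by (simp add: t_def)
 qed
 then show ?thesis by (intro LIMSEQ_le_const2[OF tendsto_rabs[OF lim]]) auto
qed

section \<open>Regularity of the cut-off kernel\<close>

context frac_order
begin

lemma powr_neg_lip:
 fixes a b m N :: real
 assumes "0 < m" "m \<le> a" "m \<le> b" "0 < N"
 shows "\<bar>a powr -N - b powr -N\<bar> \<le> N * m powr -(N+1) * \<bar>a - b\<bar>"
proof -
 have main: "\<bar>a powr -N - b powr -N\<bar> \<le> N * m powr -(N+1) * \<bar>a - b\<bar>" if ab: "a < b" "m \<le> a" for a b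
 proof -
  have "\<exists>z. a < z \<and> z < b \<and> b powr -N - a powr -N = (b - a) * (-N * z powr (-N - 1))"
   using ab assms by (intro MVT2) (auto intro!: derivative_eq_intros simp: powr_diff powr_minus field_simps)
  then obtain z where z: "a < z" "z < b" "b powr -N - a powr -N = (b - a) * (-N * z powr (-N - 1))" by blast
  have "z powr -(N+1) \<le> m powr -(N+1)" using z ab assms by (intro powr_mono2') auto
  then have "N * z powr (-N-1) * \<bar>a - b\<bar> \<le> N * m powr -(N+1) * \<bar>a - b\<bar>" using assms by (intro mult_right_mono mult_left_mono) auto
  moreover have "\<bar>a powr -N - b powr -N\<bar> = N * z powr (-N-1) * \<bar>a - b\<bar>"
  proof -
   have "\<bar>a powr -N - b powr -N\<bar> = \<bar>(b - a) * (-N * z powr (-N - 1))\<bar>" using z(3) by (simp add: abs_minus_commute)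
   then show ?thesis using assms ab by (simp add: abs_mult mult_ac)
  qed
  ultimately show ?thesis by simp
 qed
 show ?thesis using main[of a b] main[of b a] assms by (cases a b rule: linorder_cases) (auto simp: abs_minus_commute)
qed

lemma kern_lip:
 fixes z h :: "'a::euclidean_space"
 defines "N \<equiv> real DIM('a) + s"
 assumes "z \<noteq> 0" "2 * norm h \<le> norm z"
 shows "\<bar>kern (z - h) - kern z\<bar> \<le> N * 2 powr (N+1) * norm h * (kern z / norm z)" "kern (z - h) \<le> 2 powr N * kern z"
proof -
 have N: "0 < N" unfolding N_def using s_pos by (simp add: add_nonneg_pos)
 have half: "norm z / 2 \<le> norm (z - h)" using assms norm_triangle_ineq2[of z h] by linarith
 have z: "0 < norm z" using assms by simp
 have "\<bar>norm (z - h) powr -N - norm z powr -N\<bar> \<le> N * (norm z / 2) powr -(N+1) * \<bar>norm (z - h) - norm z\<bar>"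
  using half z N by (intro powr_neg_lip) auto
 also have "... \<le> N * (norm z / 2) powr -(N+1) * norm h"
  using N norm_triangle_ineq3[of "z - h" z] by (intro mult_left_mono) auto
 also have "(norm z / 2) powr -(N+1) = 2 powr (N+1) * (kern z / norm z)"
 proof -
  have "(norm z / 2) powr -(N+1) = norm z powr -(N+1) / 2 powr -(N+1)" by (rule powr_divide)
  also have "... = norm z powr -(N+1) * 2 powr (N+1)" by (subst powr_minus_divide[of 2 "N+1"]) simp
  also have "norm z powr -(N+1) = kern z / norm z"
   using z powr_diff[of "norm z" "-N" 1] by (simp add: kern_def N_def[symmetric])
  finally show ?thesis by simp
 qed
 finally show "\<bar>kern (z - h) - kern z\<bar> \<le> N * 2 powr (N+1) * norm h * (kern z / norm z)"
  by (simp add: kern_def N_def[symmetric] mult_ac)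
 have "kern (z - h) \<le> (norm z / 2) powr -N" unfolding kern_def N_def[symmetric] using half z N by (intro powr_mono2') auto
 also have "... = 2 powr N * kern z" using z by (simp add: kern_def N_def[symmetric] powr_divide powr_minus_divide)
 finally show "kern (z - h) \<le> 2 powr N * kern z" .
qed

text \<open>Since n \<ge> 2, |z|^2 times the kernel is the negative power |z|^(-(n+s-2)), and the
  shell estimate for Lebesgue measure applies.\<close>

lemma sq_kern_near_ex:
 assumes n2: "2 \<le> DIM('a::euclidean_space)"
 shows "\<exists>C>0. \<forall>(x::'a) \<rho>. 0 < \<rho> \<longrightarrow> (NNBINT y. ennreal ((norm (y - x))^2 * kern (y - x)) * indicator (ball x \<rho>) y) \<le> ennreal (C * \<rho> powr (2 - s))"
proof -
 define n where "n = real DIM('a)"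
 define b where "b = n + s - 2"
 have n: "2 \<le> n" using n2 by (simp add: n_def)
 have b: "0 < b" "b < n" using n s_pos s_lt1 by (auto simp: b_def)
 define C where "C = 2 powr b / (1 - 2 powr -(n-b)) * unit_ball_vol n"
 have C: "0 < C" unfolding C_def n_def using b powr_less_one[of 2 "-(n-b)"] by (intro mult_pos_pos divide_pos_pos) (auto simp: n_def)
 have "(NNBINT y. ennreal ((norm (y - x))^2 * kern (y - x)) * indicator (ball x \<rho>) y) \<le> ennreal (C * \<rho> powr (2 - s))" if "0 < \<rho>" for x :: 'a and \<rho>
 proof -
  have e: "(norm z)^2 * kern z = norm z powr -b" for z :: 'a
  proof (cases "z = 0")
   case False
   then have "(norm z)^2 = norm z powr 2" by (simp add: powr_numeral)
   then have "(norm z)^2 * kern z = norm z powr 2 * norm z powr -(n + s)" by (simp add: kern_def n_def)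
   also have "... = norm z powr (2 + -(n + s))" by (simp only: powr_add)
   also have "2 + -(n + s) = - b" by (simp add: b_def)
   finally show ?thesis .
  qed simp
  have "(NNBINT y. 1 * ennreal (norm (y - x) powr -b) * indicator (ball x \<rho>) y)
   \<le> ennreal (2 powr b / (1 - 2 powr -(n-b)) * unit_ball_vol n * \<rho> powr (n - b))"
   using that b by (intro nn_near_shells) (auto simp: n_def emeasure_ball powr_realpow)
  then show ?thesis unfolding e C_def by (simp add: b_def)
 qed
 then show ?thesis using C by blast
qed

text \<open>An L1 modulus of continuity for y -> (\<eta> x - \<eta> y)^2 kern (x - y). Where |y - x|
  \<ge> 2|h|, the Lipschitz bounds of \<eta> and of the kernel give the linear term in |h|. Closer
  to x both values are estimated separately by l^2 |y - x|^2 times the kernel, which yields the term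
  of order |h|^(2-s).\<close>

lemma cutoff_kernel_modulus_ex:
 assumes n2: "2 \<le> DIM('a::euclidean_space)"
 shows "\<exists>C>0. \<forall>(\<eta>::'a => real) l x h. \<eta> \<in> borel_measurable borel \<longrightarrow> 0 < l \<longrightarrow> (\<forall>x y. \<bar>\<eta> x - \<eta> y\<bar> \<le> min 1 (l * norm (x - y))) \<longrightarrow> h \<noteq> 0 \<longrightarrow>
  (NNBINT y. ennreal \<bar>(\<eta> x - \<eta> (y - h))^2 * kern (y - h - x) - (\<eta> x - \<eta> y)^2 * kern (y - x)\<bar>)
  \<le> ennreal (C * (l powr (1 + s) * norm h + l^2 * norm h powr (2 - s)))"
proof -
 define N where "N = real DIM('a) + s"
 have N: "0 < N" unfolding N_def using s_pos by (simp add: add_nonneg_pos)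
 obtain Ck where Ck: "Ck > 0" "\<And>l. l > 0 ==> integrable lborel (%z::'a::euclidean_space. min 1 (l * norm z) * kern z)"
   "\<And>l. l > 0 ==> (LBINT z. min 1 (l * norm (z::'a)) * kern z) \<le> Ck * l powr s"
  using kmin_integrable_ex[where 'a='a] by metis
 obtain Cs where Cs: "Cs > 0" "\<And>(x::'a) \<rho>. 0 < \<rho> ==> (NNBINT y. ennreal ((norm (y - x))^2 * kern (y - x)) * indicator (ball x \<rho>) y) \<le> ennreal (Cs * \<rho> powr (2 - s))"
  using sq_kern_near_ex[OF n2] by blast
 define C1 where "C1 = 3 * 2 powr N + N * 2 powr (N+1)"
 have C1: "0 < C1" unfolding C1_def using N by (intro add_pos_pos) auto
 define C where "C = max (C1 * Ck) (2 * Cs * 3 powr (2-s))"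
 have C: "0 < C" using C1 Ck by (simp add: C_def less_max_iff_disj)
 have "(NNBINT y. ennreal \<bar>(\<eta> x - \<eta> (y - h))^2 * kern (y - h - x) - (\<eta> x - \<eta> y)^2 * kern (y - x)\<bar>)
  \<le> ennreal (C * (l powr (1 + s) * norm h + l^2 * norm h powr (2 - s)))"
  if \<eta>m[measurable]: "\<eta> \<in> borel_measurable borel" and l: "0 < l" and lip: "\<And>x y. \<bar>\<eta> x - \<eta> y\<bar> \<le> min 1 (l * norm (x - y))" and h: "h \<noteq> 0"
  for \<eta> :: "'a => real" and l x h
 proof -
  define S where "S y = (norm (y - x))^2 * kern (y - x) * indicator (ball x (3 * norm h)) y" for y
  define F where "F y = C1 * l * norm h * (min 1 (l * norm (y - x)) * kern (y - x))" for y
  have F0: "0 \<le> F y" for y unfolding F_def using C1 l by auto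
  have S0: "0 \<le> S y" for y unfolding S_def by auto
  have q: "(\<eta> x - \<eta> y)^2 \<le> l^2 * (norm (y - x))^2" "(\<eta> x - \<eta> y)^2 \<le> (min 1 (l * norm (y - x)))^2" for y
  proof -
   show "(\<eta> x - \<eta> y)^2 \<le> (min 1 (l * norm (y - x)))^2"
    using lip[of x y] by (metis abs_ge_zero norm_minus_commute power2_abs power_mono)
   also have "... \<le> (l * norm (y - x))^2" using l by (intro power_mono) auto
   finally show "(\<eta> x - \<eta> y)^2 \<le> l^2 * (norm (y - x))^2" by (simp add: power_mult_distrib)
  qed
  have pt: "\<bar>(\<eta> x - \<eta> (y - h))^2 * kern (y - h - x) - (\<eta> x - \<eta> y)^2 * kern (y - x)\<bar> \<le> F y + (l^2 * S y + l^2 * S (y - h))" for y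
  proof (cases "2 * norm h \<le> norm (y - x)")
   case True
   define z where "z = y - x"
   have z: "z \<noteq> 0" "2 * norm h \<le> norm z" "0 < norm z" using True h by (auto simp: z_def)
   define m where "m = min 1 (l * norm z)"
   have m: "0 \<le> m" "m \<le> 1" "m \<le> l * norm z" using l by (auto simp: m_def)
   have ex: "\<bar>\<eta> x - \<eta> y\<bar> \<le> m" using lip[of x y] by (simp add: m_def z_def norm_minus_commute)
   have "norm (y - h - x) \<le> 3/2 * norm z" using norm_triangle_ineq4[of z h] z(2) by (simp add: z_def algebra_simps)
   then have "norm (y - h - x) \<le> 2 * norm z" using norm_ge_zero[of z] by linarith
   then have "l * norm (y - h - x) \<le> 2 * (l * norm z)" using l mult_left_mono[of "norm (y - h - x)" "2 * norm z" l] by simp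
   then have exh: "\<bar>\<eta> x - \<eta> (y - h)\<bar> \<le> 2 * m" using lip[of x "y - h"] by (auto simp: m_def norm_minus_commute min_def split: if_splits)
   have dh: "\<bar>\<eta> (y - h) - \<eta> y\<bar> \<le> l * norm h" using lip[of "y - h" y] by simp
   have "(\<eta> x - \<eta> (y - h))^2 - (\<eta> x - \<eta> y)^2 = (\<eta> y - \<eta> (y - h)) * ((\<eta> x - \<eta> (y - h)) + (\<eta> x - \<eta> y))"
    by (simp add: power2_eq_square algebra_simps)
   then have "\<bar>(\<eta> x - \<eta> (y - h))^2 - (\<eta> x - \<eta> y)^2\<bar> = \<bar>\<eta> (y - h) - \<eta> y\<bar> * \<bar>(\<eta> x - \<eta> (y - h)) + (\<eta> x - \<eta> y)\<bar>"
    by (simp add: abs_mult abs_minus_commute)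
   also have "... \<le> (l * norm h) * (3 * m)" using dh ex exh l by (intro mult_mono) auto
   finally have 1: "\<bar>(\<eta> x - \<eta> (y - h))^2 - (\<eta> x - \<eta> y)^2\<bar> \<le> (l * norm h) * (3 * m)" .
   have 2: "kern (z - h) \<le> 2 powr N * kern z" "\<bar>kern (z - h) - kern z\<bar> \<le> N * 2 powr (N+1) * norm h * (kern z / norm z)"
    using kern_lip[of z h] z unfolding N_def by auto
   have t1: "\<bar>((\<eta> x - \<eta> (y - h))^2 - (\<eta> x - \<eta> y)^2) * kern (z - h)\<bar> \<le> (l * norm h * (3 * m)) * (2 powr N * kern z)"
    unfolding abs_mult using 1 2 m l by (intro mult_mono) auto
   have "m^2 / norm z \<le> l * m" using m z(3) mult_mono[OF m(3) order_refl[of m]] l by (simp add: power2_eq_square pos_divide_le_eq mult_ac)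
   have "\<bar>(\<eta> x - \<eta> y)^2 * (kern (z - h) - kern z)\<bar> \<le> m^2 * (N * 2 powr (N+1) * norm h * (kern z / norm z))"
    unfolding abs_mult using q(2)[of y] 2 by (intro mult_mono) (auto simp: m_def z_def)
   also have "... = (m^2 / norm z) * (N * 2 powr (N+1) * norm h * kern z)" by simp
   also have "... \<le> (l * m) * (N * 2 powr (N+1) * norm h * kern z)" using \<open>m^2 / norm z \<le> l * m\<close> N by (intro mult_right_mono) auto
   finally have t2: "\<bar>(\<eta> x - \<eta> y)^2 * (kern (z - h) - kern z)\<bar> \<le> (l * m) * (N * 2 powr (N+1) * norm h * kern z)" .
   have "(\<eta> x - \<eta> (y - h))^2 * kern (y - h - x) - (\<eta> x - \<eta> y)^2 * kern (y - x)
    = ((\<eta> x - \<eta> (y - h))^2 - (\<eta> x - \<eta> y)^2) * kern (z - h) + (\<eta> x - \<eta> y)^2 * (kern (z - h) - kern z)"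
    by (simp add: z_def algebra_simps)
   then have "\<bar>(\<eta> x - \<eta> (y - h))^2 * kern (y - h - x) - (\<eta> x - \<eta> y)^2 * kern (y - x)\<bar>
    \<le> (l * norm h * (3 * m)) * (2 powr N * kern z) + (l * m) * (N * 2 powr (N+1) * norm h * kern z)"
    using t1 t2 abs_triangle_ineq[of "((\<eta> x - \<eta> (y - h))^2 - (\<eta> x - \<eta> y)^2) * kern (z - h)"] by linarith
   also have "... = F y" by (simp add: F_def C1_def m_def z_def algebra_simps)
   finally show ?thesis using S0[of y] S0[of "y - h"] by (smt (verit) mult_nonneg_nonneg zero_le_power2)
  next
   case False
   then have b: "norm (y - x) < 2 * norm h" by simp
   have "norm (y - h - x) \<le> norm (y - x) + norm h" using norm_triangle_ineq4[of "y - x" h] by (simp add: algebra_simps)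
   moreover have "0 < norm h" using h by simp
   ultimately have "norm (y - x) < 3 * norm h" "norm (y - h - x) < 3 * norm h" using b by linarith+
   then have "y \<in> ball x (3 * norm h)" "y - h \<in> ball x (3 * norm h)" by (auto simp: dist_norm norm_minus_commute)
   then have S: "S y = (norm (y - x))^2 * kern (y - x)" "S (y - h) = (norm (y - h - x))^2 * kern (y - h - x)" by (auto simp: S_def)
   have "(\<eta> x - \<eta> y)^2 * kern (y - x) \<le> l^2 * S y" unfolding S mult.assoc[symmetric] using q(1) by (intro mult_right_mono) auto
   moreover have "(\<eta> x - \<eta> (y - h))^2 * kern (y - h - x) \<le> l^2 * S (y - h)" unfolding S mult.assoc[symmetric] using q(1) by (intro mult_right_mono) auto
   moreover have "0 \<le> (\<eta> x - \<eta> y)^2 * kern (y - x)" "0 \<le> (\<eta> x - \<eta> (y - h))^2 * kern (y - h - x)" by auto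
   ultimately show ?thesis using F0[of y] by linarith
  qed
  have Fm[measurable]: "F \<in> borel_measurable borel" "S \<in> borel_measurable borel" unfolding F_def S_def by measurable
  have iF: "(NNBINT y. ennreal (F y)) \<le> ennreal (C1 * l * norm h * (Ck * l powr s))"
  proof -
   let ?J = "%z::'a. min 1 (l * norm z) * kern z"
   have "(NNBINT y. ennreal (F y)) = (NNBINT y. ennreal (C1 * l * norm h) * ennreal (?J (y + (- x))))"
    unfolding F_def using C1 l by (intro nn_integral_cong) (simp add: ennreal_mult)
   also have "... = ennreal (C1 * l * norm h) * (NNBINT y. ennreal (?J (y + (- x))))" by (rule nn_integral_cmult) measurable
   also have "(NNBINT y. ennreal (?J (y + (- x)))) = (NNBINT y. ennreal (?J y))" by (rule nn_integral_lborel_translate) measurable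
   also have "... = ennreal (LBINT y. ?J y)" using Ck(2)[OF l] l by (intro nn_integral_eq_integral) auto
   also have "ennreal (C1 * l * norm h) * ennreal (LBINT y. ?J y) \<le> ennreal (C1 * l * norm h) * ennreal (Ck * l powr s)"
    using Ck(3)[OF l] by (intro mult_left_mono ennreal_leI) auto
   also have "... = ennreal (C1 * l * norm h * (Ck * l powr s))" using C1 l Ck by (simp add: ennreal_mult)
   finally show ?thesis .
  qed
  have iS: "(NNBINT y. ennreal (S y)) \<le> ennreal (Cs * (3 * norm h) powr (2 - s))"
  proof -
   have "(NNBINT y. ennreal (S y)) = (NNBINT y. ennreal ((norm (y - x))^2 * kern (y - x)) * indicator (ball x (3 * norm h)) y)"
    unfolding S_def by (intro nn_integral_cong) (auto split: split_indicator)
   then show ?thesis using Cs(2)[of "3 * norm h" x] h by simp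
  qed
  have iSh: "(NNBINT y. ennreal (S (y - h))) = (NNBINT y. ennreal (S y))"
   using nn_integral_lborel_translate[of "%y. ennreal (S y)" "- h"] by simp
  have "(NNBINT y. ennreal \<bar>(\<eta> x - \<eta> (y - h))^2 * kern (y - h - x) - (\<eta> x - \<eta> y)^2 * kern (y - x)\<bar>)
   \<le> (NNBINT y. ennreal (F y) + (ennreal (l^2) * ennreal (S y) + ennreal (l^2) * ennreal (S (y - h))))"
   using F0 S0 by (intro nn_integral_mono order_trans[OF ennreal_leI[OF pt]]) (simp add: ennreal_mult[symmetric] flip: ennreal_plus)
  also have "... = (NNBINT y. ennreal (F y)) + (ennreal (l^2) * (NNBINT y. ennreal (S y)) + ennreal (l^2) * (NNBINT y. ennreal (S (y - h))))"
   by (simp add: nn_integral_add nn_integral_cmult)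
  also have "... \<le> ennreal (C1 * l * norm h * (Ck * l powr s)) + (ennreal (l^2) * ennreal (Cs * (3 * norm h) powr (2 - s)) + ennreal (l^2) * ennreal (Cs * (3 * norm h) powr (2 - s)))"
   unfolding iSh using iF iS by (intro add_mono mult_left_mono) auto
  also have "... = ennreal (C1 * l * norm h * (Ck * l powr s) + 2 * (l^2 * (Cs * (3 * norm h) powr (2 - s))))"
   using C1 l Ck Cs by (simp add: ennreal_mult[symmetric] flip: ennreal_plus)
  also have "... \<le> ennreal (C * (l powr (1 + s) * norm h + l^2 * norm h powr (2 - s)))"
  proof (rule ennreal_leI)
   have a: "C1 * l * norm h * (Ck * l powr s) = (C1 * Ck) * (l powr (1 + s) * norm h)" using l by (simp add: powr_add)
   have b: "2 * (l^2 * (Cs * (3 * norm h) powr (2 - s))) = (2 * Cs * 3 powr (2-s)) * (l^2 * norm h powr (2 - s))" by (simp add: powr_mult)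
   show "C1 * l * norm h * (Ck * l powr s) + 2 * (l^2 * (Cs * (3 * norm h) powr (2 - s))) \<le> C * (l powr (1 + s) * norm h + l^2 * norm h powr (2 - s))"
    unfolding a b distrib_left by (intro add_mono mult_right_mono) (auto simp: C_def)
  qed
  finally show ?thesis .
 qed
 then show ?thesis using C by blast
qed

end

lemma prod_int:
 fixes f g :: "'a::euclidean_space => real"
 assumes f: "integrable lborel f" and g: "integrable lborel g"
 shows "integrable (lborel \<Otimes>\<^sub>M lborel) (%q. f (fst q) * g (snd q))"
  and "(\<integral>q. f (fst q) * g (snd q) \<partial>(lborel \<Otimes>\<^sub>M lborel)) = (LBINT x. f x) * (LBINT x. g x)"
proof -
 have [measurable]: "f \<in> borel_measurable borel" "g \<in> borel_measurable borel"
  using borel_measurable_integrable[OF f] borel_measurable_integrable[OF g] by auto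
 show i: "integrable (lborel \<Otimes>\<^sub>M lborel) (%q. f (fst q) * g (snd q))"
 proof (rule lborel_pair.Fubini_integrable)
  show "(%q. f (fst q) * g (snd q)) \<in> borel_measurable (lborel \<Otimes>\<^sub>M lborel)" by measurable
  show "integrable lborel (%x. LBINT y. norm (f (fst (x, y)) * g (snd (x, y))))"
   using f g by (simp add: abs_mult)
  show "AE x in lborel. integrable lborel (%y. f (fst (x, y)) * g (snd (x, y)))" using g by simp
 qed
 show "(\<integral>q. f (fst q) * g (snd q) \<partial>(lborel \<Otimes>\<^sub>M lborel)) = (LBINT x. f x) * (LBINT x. g x)"
  using lborel_pair.integral_fst'[OF i] by simp
qed

section \<open>The mass estimate by absorption\<close>

context layer
begin

lemma bmeas_p: "bmeas p" by (rule blip_bmeas[OF blip_p])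
lemma bmeas_u: "bmeas u" by (rule blip_bmeas[OF blip_u])

text \<open>The weight has an L1 modulus that is l^(1+s) |h| to leading order; the rest, divided by
  the step, behaves like its power 1 - s and vanishes. Hence this weighted integral of G is bounded
  using only |u| \<le> 1. In the mass estimate it replaces a quadratic expression in p by a linear
  one.\<close>

lemma ibp_sing_ex:
 assumes n2: "2 \<le> DIM('a)"
 shows "\<exists>C>0. \<forall>(\<eta>::'a => real) l x e. \<eta> \<in> borel_measurable borel \<longrightarrow> 0 < l \<longrightarrow> (\<forall>x y. \<bar>\<eta> x - \<eta> y\<bar> \<le> min 1 (l * norm (x - y))) \<longrightarrow>
  \<bar>LBINT y. (e \<bullet> G y) * ((\<eta> x - \<eta> y)^2 * kern (x - y))\<bar> \<le> C * l powr (1 + s) * norm e"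
proof -
 from cutoff_kernel_modulus_ex[OF n2] obtain C where C: "C > 0" and mod: "\<And>(\<eta>::'a => real) l x h. \<eta> \<in> borel_measurable borel ==> 0 < l ==> (\<forall>x y. \<bar>\<eta> x - \<eta> y\<bar> \<le> min 1 (l * norm (x - y))) ==> h \<noteq> 0 ==>
  (NNBINT y. ennreal \<bar>(\<eta> x - \<eta> (y - h))^2 * kern (y - h - x) - (\<eta> x - \<eta> y)^2 * kern (y - x)\<bar>)
  \<le> ennreal (C * (l powr (1 + s) * norm h + l^2 * norm h powr (2 - s)))" by blast
 have "\<bar>LBINT y. (e \<bullet> G y) * ((\<eta> x - \<eta> y)^2 * kern (x - y))\<bar> \<le> C * l powr (1 + s) * norm e"
  if \<eta>m[measurable]: "\<eta> \<in> borel_measurable borel" and l: "0 < l" and lip: "\<forall>x y. \<bar>\<eta> x - \<eta> y\<bar> \<le> min 1 (l * norm (x - y))"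
  for \<eta> :: "'a => real" and l x e
 proof (cases "e = 0")
  case True then show ?thesis by simp
 next
  case e: False
  note [measurable] = blip_measurable[OF blip_u]
  define g where "g y = (\<eta> x - \<eta> y)^2 * kern (y - x)" for y
  have [measurable]: "g \<in> borel_measurable borel" unfolding g_def by measurable
  have g: "integrable lborel g"
  proof (rule Lintegrable_bound)
   show "integrable lborel (%y. min 1 (l * norm (y - x)) * kern (y - x))"
    using integrable_lborel_translate[OF kmin_integrable[OF l], of "- x"] by simp
   have "norm (g y) \<le> norm (min 1 (l * norm (y - x)) * kern (y - x))" for y
   proof -
    have "(\<eta> x - \<eta> y)^2 \<le> (min 1 (l * norm (y - x)))^2"
     using lip by (metis abs_ge_zero norm_minus_commute power2_abs power_mono)
    also have "... \<le> min 1 (l * norm (y - x))" using l by (intro min1_sq) auto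
    finally have "(\<eta> x - \<eta> y)^2 * kern (y - x) \<le> min 1 (l * norm (y - x)) * kern (y - x)" by (intro mult_right_mono) auto
    then show ?thesis using l by (simp add: g_def)
   qed
   then show "AE y in lborel. norm (g y) \<le> norm (min 1 (l * norm (y - x)) * kern (y - x))" by simp
  qed measurable
  note lim = ibp_limit[OF bmeas_u G_measurable G_bound taylor g, of e]
  define \<tau> where "\<tau> m = 1 / real (Suc m)" for m
  have \<tau>: "0 < \<tau> m" for m by (auto simp: \<tau>_def)
  have \<tau>0: "\<tau> \<longlonglongrightarrow> 0" unfolding \<tau>_def using LIMSEQ_inverse_real_of_nat by (simp add: inverse_eq_divide)
  have bd: "\<bar>LBINT y. u y * ((g (y - \<tau> m *\<^sub>R e) - g y) / \<tau> m)\<bar>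
   \<le> C * l powr (1 + s) * norm e + (C * l^2 * norm e powr (2 - s)) * \<tau> m powr (1 - s)" for m
  proof -
   define h where "h = \<tau> m *\<^sub>R e"
   have h: "h \<noteq> 0" "norm h = \<tau> m * norm e" using e \<tau>[of m] by (auto simp: h_def)
   define c where "c = C * (l powr (1 + s) * norm h + l^2 * norm h powr (2 - s))"
   have c: "0 \<le> c" unfolding c_def using C l by auto
   have "(NNBINT y. ennreal \<bar>g (y - h) - g y\<bar>) \<le> ennreal c"
    using mod[OF \<eta>m l lip h(1), of x] unfolding g_def c_def by simp
   from integrable_if_nn_le[OF _ _ this c] have ig: "integrable lborel (%y. \<bar>g (y - h) - g y\<bar>)" "(LBINT y. \<bar>g (y - h) - g y\<bar>) \<le> c" by auto
   have "norm (LBINT y. u y * ((g (y - h) - g y) / \<tau> m)) \<le> (LBINT y. norm (u y * ((g (y - h) - g y) / \<tau> m)))"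
    by (rule integral_norm_bound)
   also have "... \<le> (LBINT y. \<bar>g (y - h) - g y\<bar> / \<tau> m)"
   proof (rule integral_mono)
    show i: "integrable lborel (%y. \<bar>g (y - h) - g y\<bar> / \<tau> m)" using ig by simp
    have pt: "norm (u y * ((g (y - h) - g y) / \<tau> m)) \<le> \<bar>g (y - h) - g y\<bar> / \<tau> m" for y
    proof -
     have "\<bar>u y\<bar> * (\<bar>g (y - h) - g y\<bar> / \<tau> m) \<le> 1 * (\<bar>g (y - h) - g y\<bar> / \<tau> m)"
      using u_abs(1)[of y] \<tau>[of m] by (intro mult_right_mono) auto
     then show ?thesis using \<tau>[of m] by (simp add: abs_mult abs_divide)
    qed
    show "norm (u y * ((g (y - h) - g y) / \<tau> m)) \<le> \<bar>g (y - h) - g y\<bar> / \<tau> m" for y by (rule pt)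
    show "integrable lborel (%y. norm (u y * ((g (y - h) - g y) / \<tau> m)))"
     by (rule Lintegrable_bound[OF i]) (use pt \<tau>[of m] in \<open>auto intro: order_trans[OF pt[unfolded real_norm_def]]\<close>)
   qed
   also have "... \<le> c / \<tau> m" using ig(2) \<tau>[of m] by (simp add: divide_right_mono)
   also have "c / \<tau> m = C * l powr (1 + s) * norm e + (C * l^2 * norm e powr (2 - s)) * \<tau> m powr (1 - s)"
   proof -
    have "\<tau> m powr (2 - s) = \<tau> m powr (1 - s) * \<tau> m" using \<tau>[of m] powr_add[of "\<tau> m" "1 - s" 1] by simp
    then show ?thesis using \<tau>[of m] unfolding c_def h(2) by (simp add: powr_mult field_simps)
   qed
   finally show ?thesis by (simp add: h_def)
  qed
  have "(%m. \<tau> m powr (1 - s)) \<longlonglongrightarrow> 0"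
   using s_lt1 \<tau> by (intro tendsto_zero_powrI[OF \<tau>0 tendsto_const]) (auto simp: less_imp_le)
  then have "(%m. C * l powr (1 + s) * norm e + (C * l^2 * norm e powr (2 - s)) * \<tau> m powr (1 - s)) \<longlonglongrightarrow> C * l powr (1 + s) * norm e + (C * l^2 * norm e powr (2 - s)) * 0"
   by (intro tendsto_intros)
  then have "\<bar>LBINT y. (e \<bullet> G y) * g y\<bar> \<le> C * l powr (1 + s) * norm e"
   using LIMSEQ_le[OF tendsto_rabs[OF lim[folded \<tau>_def]]] bd by fastforce
  then show ?thesis by (simp add: g_def kern_commute)
 qed
 then show ?thesis using C by blast
qed

text \<open>Let X be the supremum of mass/t^n over all centres and all radii t \<ge> R0, finite
  because p is bounded. The energy inequality at a radius R \<ge> R0 bounds (mass/R^n)^2 by a/R^2 +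
  b A^n X/R + c A^(-s) X^2. The parameter A, the ratio at which far interactions begin, is chosen
  with c A^(-s) \<le> 1/2, so that the last term is absorbed; a quadratic inequality for X R0
  remains, and X \<le> C/R0.\<close>

lemma bv_bound_ex:
 assumes n2: "2 \<le> DIM('a)"
 shows "\<exists>C>0. \<forall>R>0. \<forall>z. bint p z R \<le> C * R powr (real DIM('a) - 1)"
proof -
 define n where "n = real DIM('a)"
 define N where "N = n + s"
 define \<omega> where "\<omega> = unit_ball_vol n"
 have n: "2 \<le> n" "0 < N" "0 < \<omega>" using n2 s_pos by (auto simp: n_def N_def \<omega>_def)
 obtain C0 where C0: "C0 > 0" "\<And>(\<eta>::'a => real) l x e. \<eta> \<in> borel_measurable borel ==> 0 < l ==> (\<forall>x y. \<bar>\<eta> x - \<eta> y\<bar> \<le> min 1 (l * norm (x - y))) ==>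
  \<bar>LBINT y. (e \<bullet> G y) * ((\<eta> x - \<eta> y)^2 * kern (x - y))\<bar> \<le> C0 * l powr (1 + s) * norm e"
  using ibp_sing_ex[OF n2] by blast
 define Cf where "Cf = 2 powr n / (1 - 2 powr (n - N))"
 have Cf: "0 < Cf" unfolding Cf_def N_def using s_pos powr_less_one[of 2 "-s"] by simp
 have bvol: "bint p z R \<le> \<Lambda> * \<omega> * R powr n" if "0 < R" for z R
  using bint_le_vol[OF bmeas_p G_bound, of R z] that by (simp add: \<omega>_def n_def powr_realpow)
 define a where "a = n * \<omega>^2 * 16 powr n"
 define b where "b = 4 powr N * C0 / 2"
 define c where "c = 4 powr N * 2 powr (n + s) * Cf / 2"
 have abc: "0 < a" "0 < b" "0 < c" using n C0 Cf by (auto simp: a_def b_def c_def)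
 have key: "(bint p z R / R powr n)^2 \<le> a / R^2 + b * A powr n * X / R + c * A powr -s * X^2"
  if R: "0 < R" and A: "4 \<le> A" and X: "0 \<le> X" and mass: "\<And>t y. R \<le> t ==> bint p y t \<le> X * t powr n" for R A X z
 proof -
  define \<eta> where "\<eta> = tent z R"
  define l where "l = 1 / R"
  have l: "0 < l" using R by (simp add: l_def)
  have \<eta>b: "blip \<eta>" unfolding \<eta>_def using R by (rule blip_tent)
  note [measurable] = blip_measurable[OF \<eta>b] blip_measurable[OF blip_p]
  have lip: "\<bar>\<eta> x - \<eta> y\<bar> \<le> min 1 (l * norm (x - y))" for x y unfolding \<eta>_def l_def using R by (rule tent_lip)
  have \<eta>01: "0 \<le> \<eta> x" "\<eta> x \<le> 1" for x unfolding \<eta>_def by (rule tent_bounds)+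
  have \<eta>1: "\<eta> x = 1" if "norm (x - z) \<le> R" for x unfolding \<eta>_def using R that by (rule tent_eq_1)
  have \<eta>0: "\<eta> x = 0" if "2 * R \<le> norm (x - z)" for x unfolding \<eta>_def using R that by (rule tent_eq_0)
  have van: "\<eta> x = 0" if "norm z + 2 * R \<le> norm x" for x
   using \<eta>0[of x] that norm_triangle_ineq2[of x z] by linarith
  let ?A = "%q. \<eta> (fst q) * \<eta> (snd q) * (p (fst q) * p (snd q) - G (fst q) \<bullet> G (snd q)) * pkern q"
  let ?B = "%q. (G (fst q) \<bullet> G (snd q)) * (\<eta> (fst q) - \<eta> (snd q))^2 * pkern q"
  note en = energy[of \<eta> "norm z + 2 * R", OF \<eta>b van]
  \<comment> \<open>lower bound for the left-hand side\<close>
  have i\<eta>: "integrable lborel (%x. \<eta> x * w x)" if wm: "bmeas w" for w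
  proof -
   have "bmeas (%x. \<eta> x * w x)"
   proof -
    obtain B where B: "\<And>x. \<bar>w x\<bar> \<le> B" and [measurable]: "w \<in> borel_measurable borel" using wm by (auto simp: bmeas_def)
    have "\<bar>\<eta> x * w x\<bar> \<le> 1 * B" for x unfolding abs_mult using \<eta>01[of x] B[of x] by (intro mult_mono) auto
    then show ?thesis unfolding bmeas_def by (intro conjI exI[of _ B]) auto
   qed
   from bint_integrable[OF this, of z "2 * R"]
   have "integrable lborel (%x. (\<eta> x * w x) * indicator (ball z (2 * R)) x)" .
   also have "(%x. (\<eta> x * w x) * indicator (ball z (2 * R)) x) = (%x. \<eta> x * w x)"
    using \<eta>0 by (intro ext) (auto simp: dist_norm norm_minus_commute split: split_indicator)
   finally show ?thesis .
  qed
  define P where "P = (LBINT x. \<eta> x * p x)"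
  define F where "F b = (LBINT x. \<eta> x * (b \<bullet> G x))" for b
  have ip: "integrable lborel (%x. \<eta> x * p x)" by (rule i\<eta>[OF bmeas_p])
  have ib: "integrable lborel (%x. \<eta> x * (b \<bullet> G x))" for b by (rule i\<eta>[OF blip_bmeas[OF blip_dir]])
  let ?D = "%q. (\<eta> (fst q) * p (fst q)) * (\<eta> (snd q) * p (snd q)) - (\<Sum>b\<in>Basis. (\<eta> (fst q) * (b \<bullet> G (fst q))) * (\<eta> (snd q) * (b \<bullet> G (snd q))))"
  have iD: "integrable PP ?D" by (intro Lintegrable_diff Lintegrable_sum prod_int(1) ip ib)
  have vD: "(\<integral>q. ?D q \<partial>PP) = P^2 - (\<Sum>b\<in>Basis. (F b)^2)"
  proof -
   have "(\<integral>q. ?D q \<partial>PP) = (\<integral>q. (\<eta> (fst q) * p (fst q)) * (\<eta> (snd q) * p (snd q)) \<partial>PP)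
    - (\<integral>q. (\<Sum>b\<in>Basis. (\<eta> (fst q) * (b \<bullet> G (fst q))) * (\<eta> (snd q) * (b \<bullet> G (snd q)))) \<partial>PP)"
    by (intro Lintegral_diff Lintegrable_sum prod_int(1) ip ib)
   also have "(\<integral>q. (\<Sum>b\<in>Basis. (\<eta> (fst q) * (b \<bullet> G (fst q))) * (\<eta> (snd q) * (b \<bullet> G (snd q)))) \<partial>PP)
    = (\<Sum>b\<in>Basis. \<integral>q. (\<eta> (fst q) * (b \<bullet> G (fst q))) * (\<eta> (snd q) * (b \<bullet> G (snd q))) \<partial>PP)"
    by (intro Lintegral_sum prod_int(1) ib)
   finally show ?thesis using prod_int(2)[OF ip ip] prod_int(2)[OF ib ib] by (simp add: P_def F_def power2_eq_square)
  qed
  have "(4 * R) powr -N * (\<integral>q. ?D q \<partial>PP) \<le> (\<integral>q. ?A q \<partial>PP)"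
  proof -
   have "(\<integral>q. (4 * R) powr -N * ?D q \<partial>PP) \<le> (\<integral>q. ?A q \<partial>PP)"
   proof (rule integral_mono)
    show "integrable PP (%q. (4 * R) powr -N * ?D q)" using iD by (rule integrable_mult_right)
    show "integrable PP ?A" by (rule en(1))
    fix q :: "'a \<times> 'a"
    obtain x y where q: "q = (x, y)" by (cases q)
    have e: "(\<Sum>b\<in>Basis. (\<eta> x * (b \<bullet> G x)) * (\<eta> y * (b \<bullet> G y))) = \<eta> x * \<eta> y * (G x \<bullet> G y)"
     unfolding euclidean_inner[of "G x" "G y"] sum_distrib_left by (intro sum.cong) (auto simp: inner_commute mult_ac)
    have "(4 * R) powr -N * (\<eta> x * \<eta> y * (p x * p y - G x \<bullet> G y)) \<le> \<eta> x * \<eta> y * (p x * p y - G x \<bullet> G y) * kern (x - y)"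
    proof (cases "x = y \<or> \<eta> x = 0 \<or> \<eta> y = 0")
     case True then show ?thesis by (auto simp: power2_norm_eq_inner[symmetric] power2_eq_square)
    next
     case False
     then have "norm (x - z) < 2 * R" "norm (y - z) < 2 * R" using \<eta>0 by (meson not_le)+
     then have "norm (x - y) \<le> 4 * R" using norm_triangle_ineq4[of "x - z" "y - z"] by simp
     then have k: "(4 * R) powr -N \<le> kern (x - y)" using kern_ge[of "x - y" "4 * R"] False by (simp add: N_def n_def)
     have "0 \<le> \<eta> x * \<eta> y * (p x * p y - G x \<bullet> G y)" using \<eta>01 defect_nonneg by simp
     from mult_right_mono[OF k this] show ?thesis by (simp add: mult_ac)
    qed
    then show "(4 * R) powr -N * ?D q \<le> ?A q" unfolding q fst_conv snd_conv e by (simp add: algebra_simps)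
   qed
   then show ?thesis by simp
  qed
  then have low: "(4 * R) powr -N * (P^2 - (\<Sum>b\<in>Basis. (F b)^2)) \<le> (\<integral>q. ?A q \<partial>PP)" unfolding vD .
  \<comment> \<open>The vector integral of G gains one power of R over the trivial bound because the
    derivative falls on the cutoff and |u| \<le> 1.\<close>
  have Fb: "\<bar>F b\<bar> \<le> \<omega> * 4 powr n * R powr (n - 1)" if "b \<in> Basis" for b
  proof -
   have "\<bar>LBINT x. (b \<bullet> G x) * \<eta> x\<bar> \<le> l * norm b * bint (%x. \<bar>u x\<bar>) z (2 * (2 * R))"
    using lip \<eta>01 \<eta>0 R by (intro ibp_lip[OF bmeas_u G_measurable G_bound taylor, where B = 1]) (auto simp: abs_le_iff)
   also have "... \<le> l * 1 * (1 * \<omega> * (4 * R) powr n)"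
   proof -
    have "bmeas (%x. \<bar>u x\<bar>)" using bmeas_u by (auto simp: bmeas_def)
    then have "bint (%x. \<bar>u x\<bar>) z (2 * (2 * R)) \<le> 1 * \<omega> * (4 * R) powr n"
     using bint_le_vol[of "%x. \<bar>u x\<bar>" 1 "2 * (2 * R)" z] u_abs(1) R by (simp add: \<omega>_def n_def powr_realpow)
    then show ?thesis using l that by (intro mult_mono) (auto intro!: bint_nonneg)
   qed
   also have "... = \<omega> * 4 powr n * R powr (n - 1)" using R by (simp add: l_def powr_mult powr_diff)
   finally show ?thesis by (simp add: F_def mult.commute)
  qed
  have sF: "(\<Sum>b\<in>Basis. (F b)^2) \<le> a * R powr (2 * n - 2)"
  proof -
   have "(\<Sum>b\<in>Basis. (F b)^2) \<le> (\<Sum>b\<in>(Basis::'a set). (\<omega> * 4 powr n * R powr (n - 1))^2)"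
    using Fb by (intro sum_mono) (metis abs_ge_zero power2_abs power_mono)
   also have "... = n * (\<omega>^2 * (4 powr n)^2 * (R powr (n-1))^2)" by (simp add: n_def power_mult_distrib)
   also have "(4 powr n)^2 = 16 powr n" using powr_mult[of 4 4 n] by (simp add: power2_eq_square)
   also have "(R powr (n-1))^2 = R powr (2 * n - 2)" by (simp add: power2_eq_square flip: powr_add)
   finally show ?thesis by (simp add: a_def)
  qed
  have Pge: "bint p z R \<le> P"
   unfolding P_def bint_def
  proof (rule integral_mono[OF bint_integrable[OF bmeas_p] ip])
   show "p x * indicator (ball z R) x \<le> \<eta> x * p x" for x
    using \<eta>1[of x] \<eta>01[of x] by (auto simp: dist_norm norm_minus_commute split: split_indicator)
  qed
  \<comment> \<open>upper bound for the right-hand side: near points by one integration by parts, far points crudely\<close>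
  define I where "I = (%x. indicator (ball z (A * R)) x :: real)"
  have Im[measurable]: "I \<in> borel_measurable borel" unfolding I_def by measurable
  have I01: "0 \<le> I x" "I x \<le> 1" "I x = 0 \<or> I x = 1" for x by (auto simp: I_def split: split_indicator)
  have iB1: "integrable PP (%q. I (fst q) * ?B q)"
  proof (rule Lintegrable_bound[OF en(2)])
   show "AE q in PP. norm (I (fst q) * ?B q) \<le> norm (?B q)"
    using I01 by (intro AE_I2) (auto simp: abs_mult intro!: mult_left_le_one_le)
  qed measurable
  have iB2: "integrable PP (%q. (1 - I (fst q)) * ?B q)"
   using Lintegrable_diff[OF en(2) iB1] by (simp add: algebra_simps)
  have near: "(\<integral>q. I (fst q) * ?B q \<partial>PP) \<le> C0 * l powr (1 + s) * bint p z (A * R)"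
  proof -
   have "(\<integral>q. I (fst q) * ?B q \<partial>PP) = (LBINT x. \<integral>y. I x * ((G x \<bullet> G y) * (\<eta> x - \<eta> y)^2 * kern (x - y)) \<partial>lborel)"
    using lborel_pair.integral_fst'[OF iB1] by simp
   also have "... \<le> (LBINT x. C0 * l powr (1 + s) * (p x * I x))"
   proof (rule integral_mono)
    show "integrable lborel (%x. LBINT y. I x * ((G x \<bullet> G y) * (\<eta> x - \<eta> y)^2 * kern (x - y)))"
     using lborel_pair.integrable_fst'[OF iB1] by simp
    show "integrable lborel (%x. C0 * l powr (1 + s) * (p x * I x))"
     unfolding I_def by (intro integrable_mult_right bint_integrable bmeas_p)
    fix x
    have "(LBINT y. I x * ((G x \<bullet> G y) * (\<eta> x - \<eta> y)^2 * kern (x - y))) = I x * (LBINT y. (G x \<bullet> G y) * ((\<eta> x - \<eta> y)^2 * kern (x - y)))"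
     by (simp add: mult.assoc)
    also have "... \<le> I x * (C0 * l powr (1 + s) * norm (G x))"
     using C0(2)[of \<eta> l "G x" x] l lip I01(1)[of x] by (intro mult_left_mono) (auto simp: abs_le_iff)
    finally show "(LBINT y. I x * ((G x \<bullet> G y) * (\<eta> x - \<eta> y)^2 * kern (x - y))) \<le> C0 * l powr (1 + s) * (p x * I x)" by (simp add: mult_ac)
   qed
   also have "... = C0 * l powr (1 + s) * bint p z (A * R)" by (simp add: bint_def I_def)
   finally show ?thesis .
  qed
  define c2 where "c2 = bint p z (2 * R) * (Cf * X * (A * R / 2) powr (n - N))"
  have c20: "0 \<le> c2" unfolding c2_def using Cf X by (intro mult_nonneg_nonneg bint_nonneg) auto
  have far: "(\<integral>q. (1 - I (fst q)) * ?B q \<partial>PP) \<le> c2"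
  proof -
   define H where "H q = (1 - I (fst q)) * (p (fst q) * p (snd q) * (\<eta> (snd q))^2 * pkern q)" for q
   have Hm[measurable]: "H \<in> borel_measurable (borel \<Otimes>\<^sub>M borel)" unfolding H_def by measurable
   have H0: "0 \<le> H q" for q unfolding H_def using I01(2)[of "fst q"] by simp
   have AR: "2 * R \<le> A * R / 2" "R \<le> A * R / 2" "0 < A * R / 2" using A R by (auto simp: field_simps)
   have Hin: "(NNBINT x. ennreal (H (x, y))) \<le> ennreal (Cf * X * (A * R / 2) powr (n - N)) * (ennreal (p y) * indicator (ball z (2 * R)) y)" for y
   proof (cases "y \<in> ball z (2 * R)")
    case False
    then have "\<eta> y = 0" using \<eta>0[of y] by (simp add: dist_norm norm_minus_commute)
    then show ?thesis by (simp add: H_def)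
   next
    case True
    have pt: "ennreal (H (x, y)) \<le> ennreal (p y) * (ennreal (p x) * ennreal (norm (x - y) powr -N) * indicator (- ball y (A * R / 2)) x)" for x
    proof (cases "x \<in> ball z (A * R)")
     case True then show ?thesis by (simp add: H_def I_def)
    next
     case False
     have "norm (x - z) \<le> norm (x - y) + norm (y - z)" using norm_triangle_ineq[of "x - y" "y - z"] by simp
     then have "x \<notin> ball y (A * R / 2)" using True False AR by (auto simp: dist_norm norm_minus_commute)
     moreover have "H (x, y) \<le> p y * (p x * norm (x - y) powr -N)"
     proof -
      have "(\<eta> y)^2 \<le> 1" using \<eta>01[of y] by (simp add: power_le_one)
      then have "(p x * p y * kern (x - y)) * (\<eta> y)^2 \<le> (p x * p y * kern (x - y)) * 1" by (intro mult_left_mono) auto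
      moreover have "I x = 0" using False by (simp add: I_def)
      ultimately show ?thesis by (simp add: H_def kern_def N_def n_def mult_ac)
     qed
     ultimately show ?thesis by (simp add: ennreal_mult[symmetric] ennreal_leI)
    qed
    have "(NNBINT x. ennreal (H (x, y))) \<le> (NNBINT x. ennreal (p y) * (ennreal (p x) * ennreal (norm (x - y) powr -N) * indicator (- ball y (A * R / 2)) x))"
     by (intro nn_integral_mono pt)
    also have "... = ennreal (p y) * (NNBINT x. (ennreal (p x) * ennreal (norm (x - y) powr -N) * indicator (- ball y (A * R / 2)) x))"
     by (rule nn_integral_cmult) measurable
    also have "... \<le> ennreal (p y) * ennreal (2 powr n / (1 - 2 powr (n - N)) * X * (A * R / 2) powr (n - N))"
    proof (intro mult_left_mono nn_far_shells)
     fix t assume t: "A * R / 2 \<le> t"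
     show "(NNBINT x. ennreal (p x) * indicator (ball y t) x) \<le> ennreal (X * t powr n)"
      using bint_nn[OF bmeas_p, of y t] mass[of t y] t AR by (simp add: ennreal_leI)
    qed (use AR X n s_pos in \<open>auto simp: N_def\<close>)
    also have "... = ennreal (Cf * X * (A * R / 2) powr (n - N)) * (ennreal (p y) * indicator (ball z (2 * R)) y)"
     using True by (simp add: Cf_def mult.commute)
    finally show ?thesis .
   qed
   have "(\<integral>\<^sup>+q. ennreal (H q) \<partial>PP) = (NNBINT y. (NNBINT x. ennreal (H (x, y))))"
    by (rule lborel_pair.nn_integral_snd[symmetric]) measurable
   also have "... \<le> (NNBINT y. ennreal (Cf * X * (A * R / 2) powr (n - N)) * (ennreal (p y) * indicator (ball z (2 * R)) y))"
    by (intro nn_integral_mono Hin)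
   also have "... = ennreal (Cf * X * (A * R / 2) powr (n - N)) * ennreal (bint p z (2 * R))"
    by (subst nn_integral_cmult) (auto simp: bint_nn[OF bmeas_p])
   also have "... = ennreal c2" unfolding c2_def using Cf X by (subst ennreal_mult[symmetric]) (auto intro!: bint_nonneg simp: mult.commute)
   finally have nnH: "(\<integral>\<^sup>+q. ennreal (H q) \<partial>PP) \<le> ennreal c2" .
   have iH: "integrable PP H" "integral\<^sup>L PP H \<le> c2" using integrable_if_nn_le[OF _ H0 nnH c20] by auto
   have "(\<integral>q. (1 - I (fst q)) * ?B q \<partial>PP) \<le> integral\<^sup>L PP H"
   proof (rule integral_mono[OF iB2 iH(1)])
    fix q :: "'a \<times> 'a"
    obtain x y where q: "q = (x, y)" by (cases q)
    show "(1 - I (fst q)) * ?B q \<le> H q"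
    proof (cases "I x = 1")
     case True then show ?thesis by (simp add: q H_def)
    next
     case False
     then have "x \<notin> ball z (A * R)" by (auto simp: I_def)
     then have "2 * R \<le> norm (x - z)" using AR by (auto simp: dist_norm norm_minus_commute)
     then have "\<eta> x = 0" by (rule \<eta>0)
     moreover have "(G x \<bullet> G y) * ((\<eta> y)^2 * kern (x - y)) \<le> (p x * p y) * ((\<eta> y)^2 * kern (x - y))"
      by (intro mult_right_mono norm_cauchy_schwarz) auto
     moreover have "I x = 0" using False I01(3)[of x] by simp
     ultimately show ?thesis by (simp add: q H_def mult_ac)
    qed
   qed
   then show ?thesis using iH(2) by simp
  qed
  have "(\<integral>q. ?B q \<partial>PP) = (\<integral>q. I (fst q) * ?B q + (1 - I (fst q)) * ?B q \<partial>PP)" by (intro Lintegral_cong) (auto simp: algebra_simps)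
  also have "... = (\<integral>q. I (fst q) * ?B q \<partial>PP) + (\<integral>q. (1 - I (fst q)) * ?B q \<partial>PP)" by (rule Lintegral_add[OF iB1 iB2])
  finally have up: "(\<integral>q. ?B q \<partial>PP) \<le> C0 * l powr (1 + s) * bint p z (A * R) + c2" using near far by linarith
  have "2 * ((4 * R) powr -N * (P^2 - (\<Sum>b\<in>Basis. (F b)^2))) \<le> C0 * l powr (1 + s) * bint p z (A * R) + c2"
   using low up en(3) by linarith
  also have "... \<le> C0 * l powr (1 + s) * (X * (A * R) powr n) + (X * (2 * R) powr n) * (Cf * X * (A * R / 2) powr (n - N))"
  proof -
   have "1 * R \<le> A * R" using A R by (intro mult_right_mono) auto
   then show ?thesis unfolding c2_def
    using mass[of "A * R" z] mass[of "2 * R" z] R C0 Cf X by (intro add_mono mult_left_mono mult_right_mono) auto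
  qed
  finally have fin: "2 * ((4 * R) powr -N * (P^2 - (\<Sum>b\<in>Basis. (F b)^2))) \<le> C0 * l powr (1 + s) * (X * (A * R) powr n) + (X * (2 * R) powr n) * (Cf * X * (A * R / 2) powr (n - N))" .
  define W where "W = P^2 - (\<Sum>b\<in>Basis. (F b)^2)"
  have Apos: "0 < A" using A by simp
  have "W = (4 * R) powr N * ((4 * R) powr -N * W)" using R by (simp add: powr_minus field_simps)
  also have "... \<le> (4 * R) powr N * ((C0 * l powr (1 + s) * (X * (A * R) powr n) + (X * (2 * R) powr n) * (Cf * X * (A * R / 2) powr (n - N))) / 2)"
   using fin unfolding W_def by (intro mult_left_mono) auto
  also have "... = R powr (2 * n) * (b * A powr n * X / R + c * A powr -s * X^2)"
  proof -
   have 1: "(4 * R) powr N * (l powr (1 + s) * (A * R) powr n) = R powr (2 * n) * (4 powr N * A powr n / R)"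
   proof -
    have "l powr (1 + s) = 1 / R powr (1 + s)" using R by (simp add: l_def powr_divide)
    also have "... = R powr -(1 + s)" by (simp only: powr_minus_divide)
    finally have "l powr (1 + s) = R powr -(1 + s)" .
    then have "(4 * R) powr N * (l powr (1 + s) * (A * R) powr n) = 4 powr N * A powr n * (R powr N * R powr -(1 + s) * R powr n)"
     using R Apos by (simp add: powr_mult mult_ac)
    also have "R powr N * R powr -(1 + s) * R powr n = R powr (2 * n - 1)"
     by (simp add: N_def flip: powr_add)
    also have "... = R powr (2 * n) / R" using R by (simp add: powr_diff)
    finally show ?thesis by simp
   qed
   have 2: "(4 * R) powr N * ((2 * R) powr n * (A * R / 2) powr (n - N)) = R powr (2 * n) * (4 powr N * 2 powr (n + s) * A powr -s)"
   proof -
    have "(A * R / 2) powr (n - N) = A powr -s * R powr -s * 2 powr s"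
     using R Apos by (simp add: N_def powr_mult powr_divide powr_minus_divide)
    then have "(4 * R) powr N * ((2 * R) powr n * (A * R / 2) powr (n - N)) = 4 powr N * (2 powr n * 2 powr s) * A powr -s * (R powr N * R powr n * R powr -s)"
     using R by (simp add: powr_mult mult_ac)
    also have "R powr N * R powr n * R powr -s = R powr (2 * n)" by (simp add: N_def flip: powr_add)
    also have "2 powr n * 2 powr s = (2::real) powr (n + s)" by (simp add: powr_add)
    finally show ?thesis by (simp add: mult_ac)
   qed
   have "(4 * R) powr N * ((C0 * l powr (1 + s) * (X * (A * R) powr n) + (X * (2 * R) powr n) * (Cf * X * (A * R / 2) powr (n - N))) / 2)
    = C0 * X / 2 * ((4 * R) powr N * (l powr (1 + s) * (A * R) powr n)) + Cf * X^2 / 2 * ((4 * R) powr N * ((2 * R) powr n * (A * R / 2) powr (n - N)))"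
    by (simp add: power2_eq_square algebra_simps)
   then show ?thesis unfolding 1 2 b_def c_def by (simp add: algebra_simps)
  qed
  finally have W: "W \<le> R powr (2 * n) * (b * A powr n * X / R + c * A powr -s * X^2)" .
  have "(bint p z R)^2 \<le> P^2" using Pge by (intro power_mono bint_nonneg) auto
  also have "... = W + (\<Sum>b\<in>Basis. (F b)^2)" by (simp add: W_def)
  also have "... \<le> R powr (2 * n) * (b * A powr n * X / R + c * A powr -s * X^2) + a * R powr (2 * n - 2)" using W sF by linarith
  also have "R powr (2 * n - 2) = R powr (2 * n) * (1 / R^2)" using R by (simp add: powr_diff powr_numeral)
  finally have "(bint p z R)^2 \<le> R powr (2 * n) * (a / R^2 + b * A powr n * X / R + c * A powr -s * X^2)" by (simp add: algebra_simps)
  moreover have "R powr (2 * n) = (R powr n)^2" by (simp add: power2_eq_square flip: powr_add)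
  ultimately show ?thesis using R by (simp add: power_divide pos_divide_le_eq mult.commute)
 qed
 define A where "A = max 4 ((2 * c) powr (1 / s))"
 have A: "4 \<le> A" "c * A powr -s \<le> 1 / 2"
 proof -
  show "4 \<le> A" by (simp add: A_def)
  have "(2 * c) = ((2 * c) powr (1 / s)) powr s" using abc s_pos by (simp add: powr_powr)
  also have "... \<le> A powr s" using s_pos by (intro powr_mono2) (auto simp: A_def)
  finally have "c \<le> A powr s / 2" by simp
  moreover have "0 < A powr s" using \<open>4 \<le> A\<close> by simp
  ultimately show "c * A powr -s \<le> 1 / 2" by (simp add: powr_minus_divide field_simps)
 qed
 define C where "C = 1 + 2 * a + 2 * (b * A powr n)"
 have C: "0 < C" unfolding C_def using abc by (simp add: add_pos_nonneg)
 have "bint p z R0 \<le> C * R0 powr (n - 1)" if R0: "0 < R0" for R0 z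
 proof -
  define X where "X = (SUP q \<in> {R0..} \<times> UNIV. bint p (snd q) (fst q) / fst q powr n)"
  have bdd: "bdd_above ((%q. bint p (snd q) (fst q) / fst q powr n) ` ({R0..} \<times> UNIV))"
  proof (rule bdd_aboveI2)
   fix q :: "real \<times> 'a" assume "q \<in> {R0..} \<times> UNIV"
   then have "0 < fst q" using R0 by auto
   then show "bint p (snd q) (fst q) / fst q powr n \<le> \<Lambda> * \<omega>" using bvol[of "fst q" "snd q"] by (simp add: pos_divide_le_eq)
  qed
  have up: "bint p y t / t powr n \<le> X" if "R0 \<le> t" for t y
   unfolding X_def using that by (intro cSUP_upper2[OF bdd, of "(t, y)"]) auto
  have mass: "bint p y t \<le> X * t powr n" if "R0 \<le> t" for t y
  proof -
   have "0 < t powr n" using that R0 by simp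
   then show ?thesis using up[OF that, of y] by (simp add: pos_divide_le_eq)
  qed
  have X0: "0 \<le> X" using up[of R0 0] R0 bint_nonneg[of p 0 R0] by (smt (verit) divide_nonneg_nonneg norm_ge_zero powr_ge_zero)
  define D where "D = a / R0^2 + b * A powr n * X / R0 + 1 / 2 * X^2"
  have D0: "0 \<le> D" unfolding D_def using abc X0 R0 by auto
  have "X \<le> sqrt D"
   unfolding X_def
  proof (rule cSUP_least)
   fix q :: "real \<times> 'a" assume "q \<in> {R0..} \<times> UNIV"
   then have q: "R0 \<le> fst q" by auto
   then have q0: "0 < fst q" using R0 by simp
   have "(bint p (snd q) (fst q) / fst q powr n)^2 \<le> a / (fst q)^2 + b * A powr n * X / fst q + c * A powr -s * X^2"
    using mass q by (intro key q0 A X0) auto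
   also have "... \<le> D" unfolding D_def
    using q R0 abc X0 A(2) by (intro add_mono mult_right_mono divide_left_mono power_mono mult_pos_pos) auto
   finally show "bint p (snd q) (fst q) / fst q powr n \<le> sqrt D" by (simp add: real_le_rsqrt)
  qed auto
  then have "X^2 \<le> D" using X0 D0 by (metis real_sqrt_le_iff real_sqrt_pow2 power_mono)
  then have "X^2 / 2 \<le> a / R0^2 + b * A powr n * X / R0" unfolding D_def by linarith
  then have "R0^2 * (X^2 / 2) \<le> R0^2 * (a / R0^2 + b * A powr n * X / R0)" by (intro mult_left_mono) auto
  moreover have "R0^2 * (X^2 / 2) = (X * R0)^2 / 2" by (simp add: power_mult_distrib)
  moreover have "R0^2 * (a / R0^2 + b * A powr n * X / R0) = a + b * A powr n * (X * R0)"
   using R0 by (simp add: distrib_left power2_eq_square)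
  ultimately have q: "(X * R0)^2 \<le> 2 * a + 2 * (b * A powr n) * (X * R0)" by linarith
  have Y: "X * R0 \<le> C"
  proof (cases "X * R0 \<le> 1")
   case True then show ?thesis using abc unfolding C_def by (smt (verit) mult_nonneg_nonneg powr_ge_zero)
  next
   case False
   then have "2 * a * 1 \<le> 2 * a * (X * R0)" using abc by (intro mult_left_mono) auto
   with q have "(X * R0) * (X * R0) \<le> (2 * a + 2 * (b * A powr n)) * (X * R0)" by (simp add: power2_eq_square distrib_right)
   then have "X * R0 \<le> 2 * a + 2 * (b * A powr n)" using False by (intro mult_right_le_imp_le[of "X * R0" "X * R0"]) auto
   then show ?thesis by (simp add: C_def)
  qed
  have "bint p z R0 \<le> X * R0 powr n" using mass by simp
  also have "... = (X * R0) * R0 powr (n - 1)" using R0 by (simp add: powr_diff)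
  also have "... \<le> C * R0 powr (n - 1)" using Y by (intro mult_right_mono) auto
  finally show ?thesis .
 qed
 then show ?thesis using C unfolding n_def by blast
qed

end

section \<open>Directions of monotonicity\<close>

lemma bint_pos_continuous:
 fixes f :: "'a::euclidean_space => real"
 assumes f: "bmeas f" and c: "continuous_on UNIV f" and nn: "\<And>x. 0 \<le> f x" and le: "bint f z R \<le> 0" and x: "x \<in> ball z R"
 shows "f x = 0"
proof (rule ccontr)
 assume "f x \<noteq> 0"
 then have fx: "0 < f x" using nn[of x] by simp
 have "open (ball z R \<inter> f -` {f x / 2 <..})"
  using c by (intro open_Int open_ball open_vimage) auto
 moreover have "x \<in> ball z R \<inter> f -` {f x / 2 <..}" using x fx by auto
 ultimately obtain \<delta> where \<delta>: "0 < \<delta>" "ball x \<delta> \<subseteq> ball z R \<inter> f -` {f x / 2 <..}"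
  using open_contains_ball by blast
 have "0 < f x / 2 * unit_ball_vol (DIM('a)) * \<delta> ^ DIM('a)" using fx \<delta> by simp
 also have "... = bint (%y. f x / 2) x \<delta>" using \<delta> by (simp add: bint_const)
 also have "... \<le> bint f x \<delta>" using \<delta> by (intro bint_mono f) auto
 also have "... \<le> bint f z R" using \<delta> by (intro bint_subset f nn) auto
 finally show False using le by simp
qed

lemma bint_add: "bmeas f ==> bmeas g ==> bint (%x. f x + g x) z r = bint f z r + bint g z r"
 unfolding bint_def distrib_right by (rule Lintegral_add[OF bint_integrable bint_integrable])

lemma bint_diff: "bmeas f ==> bmeas g ==> bint (%x. f x - g x) z r = bint f z r - bint g z r"
 unfolding bint_def left_diff_distrib by (rule Lintegral_diff[OF bint_integrable bint_integrable])

lemma bint_cmult: "bint (%x. c * f x) z r = c * bint f z r"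
 unfolding bint_def by (simp add: mult.assoc)

context layer
begin

lemma bmeas_dir: "bmeas (%x. e \<bullet> G x)" by (rule blip_bmeas[OF blip_dir])

lemma dir_le_p: "norm e \<le> 1 ==> e \<bullet> G x \<le> p x"
 using norm_cauchy_schwarz[of e "G x"] mult_right_mono[of "norm e" 1 "p x"] by simp

text \<open>The vector integral of G over the ball; the coordinates keep all integrals
  real-valued.\<close>

definition flux :: "'a => real => 'a" where
 "flux z r = (\<Sum>b\<in>Basis. bint (%x. b \<bullet> G x) z r *\<^sub>R b)"

lemma flux_inner: "e \<bullet> flux z r = bint (%x. e \<bullet> G x) z r"
proof -
 have pt: "e \<bullet> G x = (\<Sum>b\<in>Basis. (e \<bullet> b) * (b \<bullet> G x))" for x
  by (subst euclidean_inner[of e "G x"]) (simp add: inner_commute)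
 have "bint (%x. e \<bullet> G x) z r = (LBINT x. (\<Sum>b\<in>Basis. (e \<bullet> b) * ((b \<bullet> G x) * indicator (ball z r) x)))"
  unfolding bint_def pt by (simp add: sum_distrib_right mult.assoc)
 also have "... = (\<Sum>b\<in>Basis. (e \<bullet> b) * bint (%x. b \<bullet> G x) z r)"
  unfolding bint_def by (subst Lintegral_sum) (auto intro!: integrable_mult_right bint_integrable bmeas_dir)
 also have "... = e \<bullet> flux z r" unfolding flux_def by (simp add: inner_sum_right mult.commute)
 finally show ?thesis ..
qed

lemma norm_flux_le: "norm (flux z r) \<le> bint p z r"
proof (cases "flux z r = 0")
 case True then show ?thesis using bint_nonneg[of p z r] by simp
next
 case False
 define \<omega> where "\<omega> = flux z r /\<^sub>R norm (flux z r)"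
 have n: "norm \<omega> = 1" using False by (simp add: \<omega>_def)
 have "norm (flux z r) = \<omega> \<bullet> flux z r" using False by (simp add: \<omega>_def power2_norm_eq_inner[symmetric] power2_eq_square)
 also have "... \<le> bint p z r" unfolding flux_inner using n by (intro bint_mono bmeas_dir bmeas_p dir_le_p) auto
 finally show ?thesis .
qed

lemma bint_p_pos: assumes "0 < r" shows "0 < bint p z r"
proof (rule ccontr)
 assume "\<not> ?thesis"
 then have "p z = 0" using assms by (intro bint_pos_continuous[OF bmeas_p blip_continuous[OF blip_p], of z r]) auto
 then show False using p_pos[of z] by simp
qed

text \<open>As \<epsilon> tends to 0, the hypothesis is equality in the triangle inequality for the
  vector integral of G, so on each ball G is p times a fixed unit vector. All these balls contain 0,
  hence the vector is the direction of G 0, and u is constant along lines orthogonal to it.\<close>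

lemma one_dimensional:
 assumes conc: "\<And>R \<epsilon>. 0 < R ==> 0 < \<epsilon> ==> bint p 0 R \<le> norm (flux 0 R) + \<epsilon>"
 shows "\<exists>ubar \<omega>. norm \<omega> = 1 \<and> (\<forall>x. u x = ubar (\<omega> \<bullet> x))"
proof -
 define \<omega> where "\<omega> = G 0 /\<^sub>R p 0"
 have \<omega>: "norm \<omega> = 1" using p_pos[of 0] by (simp add: \<omega>_def)
 have Gx: "G x = p x *\<^sub>R \<omega>" for x
 proof -
  define R where "R = norm x + 1"
  have R: "0 < R" "x \<in> ball 0 R" "0 \<in> ball (0::'a) R" by (auto simp: R_def add_nonneg_pos)
  have le: "bint p 0 R \<le> norm (flux 0 R)" using conc[OF R(1)] by (rule field_le_epsilon)
  have fl: "0 < norm (flux 0 R)" using le bint_p_pos[OF R(1), of 0] by linarith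
  define w where "w = flux 0 R /\<^sub>R norm (flux 0 R)"
  have w: "norm w = 1" using fl by (simp add: w_def)
  have wf: "norm (flux 0 R) = w \<bullet> flux 0 R" using fl by (simp add: w_def power2_norm_eq_inner[symmetric] power2_eq_square)
  have z: "p y - w \<bullet> G y = 0" if "y \<in> ball 0 R" for y
  proof (rule bint_pos_continuous[OF _ _ _ _ that])
   show "bmeas (%y. p y - w \<bullet> G y)" by (intro blip_bmeas blip_diff blip_p blip_dir)
   show "continuous_on UNIV (%y. p y - w \<bullet> G y)" by (intro blip_continuous blip_diff blip_p blip_dir)
   show "0 \<le> p y - w \<bullet> G y" for y using dir_le_p[of w y] w by simp
   show "bint (%y. p y - w \<bullet> G y) 0 R \<le> 0" using le unfolding bint_diff[OF bmeas_p bmeas_dir] wf flux_inner by simp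
  qed
  have Gy: "G y = p y *\<^sub>R w" if "y \<in> ball 0 R" for y
  proof -
   have "(norm (G y - p y *\<^sub>R w))^2 = (p y)^2 - 2 * p y * (w \<bullet> G y) + (p y)^2"
   proof -
    have i: "w \<bullet> w = 1" "G y \<bullet> G y = (p y)^2" using w by (auto simp: norm_eq_1 power2_norm_eq_inner)
    have "(G y - p y *\<^sub>R w) \<bullet> (G y - p y *\<^sub>R w) = (p y)^2 - 2 * p y * (w \<bullet> G y) + (p y)^2"
     by (simp add: inner_diff_left inner_diff_right i inner_commute[of "G y" w] power2_eq_square[of "p y"] algebra_simps)
    then show ?thesis by (simp only: power2_norm_eq_inner[of "G y - p y *\<^sub>R w"])
   qed
   also have "... = 0" using z[OF that] by (simp add: power2_eq_square)
   finally show ?thesis by simp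
  qed
  have "\<omega> = (p 0 *\<^sub>R w) /\<^sub>R p 0" unfolding \<omega>_def by (rule arg_cong[where f = "%v. v /\<^sub>R p 0", OF Gy[OF R(3)]])
  also have "... = w"
  proof -
   have "(c *\<^sub>R w) /\<^sub>R c = w" if "c \<noteq> 0" for c :: real using that by simp
   moreover have "p 0 \<noteq> 0" using p_pos[of 0] by linarith
   ultimately show ?thesis by blast
  qed
  finally have "\<omega> = w" .
  then show ?thesis using Gy[OF R(2)] by simp
 qed
 have const: "u (x + h) = u x" if "\<omega> \<bullet> h = 0" for x h
 proof -
  have "h \<bullet> G y = p y * (\<omega> \<bullet> h)" for y by (subst Gx) (simp add: inner_commute[of h])
  then have d: "((%t. u (x + t *\<^sub>R h)) has_real_derivative 0) (at r)" for r
   using dir_deriv[of x h r] that by simp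
  have "u (x + 1 *\<^sub>R h) = u (x + 0 *\<^sub>R h)"
   using MVT2[of 0 1 "%t. u (x + t *\<^sub>R h)" "%_. 0"] d by auto
  then show ?thesis by simp
 qed
 show ?thesis
 proof (intro exI[of _ "%t. u (t *\<^sub>R \<omega>)"] exI[of _ \<omega>] conjI allI \<omega>)
  fix x
  have "\<omega> \<bullet> (x - (\<omega> \<bullet> x) *\<^sub>R \<omega>) = 0" using \<omega> by (simp add: inner_diff_right power2_norm_eq_inner[symmetric] norm_eq_1)
  from const[OF this, of "(\<omega> \<bullet> x) *\<^sub>R \<omega>"] show "u x = u ((\<omega> \<bullet> x) *\<^sub>R \<omega>)" by simp
 qed
qed

end

text \<open>Fixes the constants of two consequences of the absorption argument: p dx grows like an
  (n-1)-dimensional measure (\<open>Cm\<close>), and the squared truncation has a moment of order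
  l^(1+s) against it (\<open>Cp\<close>).\<close>

locale layer2 = layer +
 fixes Cm Cp :: real
 assumes dim2: "2 \<le> DIM('a)"
  and Cm: "0 < Cm" "\<And>R z. 0 < R ==> bint p z R \<le> Cm * R powr (real DIM('a) - 1)"
  and Cp: "0 < Cp" "\<And>l y. 0 < l ==> (NNBINT x. ennreal (p x) * ennreal (min 1 (l * norm (x - y)) ^ 2 * kern (x - y))) \<le> ennreal (Cp * l powr (1 + s))"

context layer
begin

lemma layer2_ex:
 assumes dim2: "2 \<le> DIM('a)"
 shows "\<exists>Cm Cp. layer2 s u e0 G \<Lambda> Cm Cp"
proof -
 define n where "n = real DIM('a)"
 have n: "2 \<le> n" using dim2 by (simp add: n_def)
 obtain Cm where Cm: "Cm > 0" "\<And>R z. 0 < R ==> bint p z R \<le> Cm * R powr (n - 1)"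
  using bv_bound_ex[OF dim2] unfolding n_def by blast
 have "\<exists>C>0. \<forall>(g :: 'a => ennreal) y l A. g \<in> borel_measurable lborel \<longrightarrow> 0 < l \<longrightarrow> 0 \<le> A \<longrightarrow>
   (\<forall>t>0. (NNBINT x. g x * indicator (ball y t) x) \<le> ennreal (A * t powr (n - 1))) \<longrightarrow>
   (NNBINT x. g x * ennreal (min 1 (l * norm (x - y)) ^ 2 * kern (x - y)))
   \<le> ennreal (C * A * l powr (real DIM('a) + s - (n - 1)))"
  using n s_pos s_lt1 by (intro nn_kmin_ex) (auto simp: n_def)
 then obtain C where C: "C > 0" "\<And>(g :: 'a => ennreal) y l A. g \<in> borel_measurable lborel ==> 0 < l ==> 0 \<le> A ==>
   (\<forall>t>0. (NNBINT x. g x * indicator (ball y t) x) \<le> ennreal (A * t powr (n - 1))) ==>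
   (NNBINT x. g x * ennreal (min 1 (l * norm (x - y)) ^ 2 * kern (x - y)))
   \<le> ennreal (C * A * l powr (real DIM('a) + s - (n - 1)))" by blast
 have "layer2 s u e0 G \<Lambda> Cm (C * Cm)"
 proof (unfold_locales)
  show "2 \<le> DIM('a)" by fact
  show "0 < Cm" by fact
  show "bint p z R \<le> Cm * R powr (real DIM('a) - 1)" if "0 < R" for R z using Cm(2)[OF that] by (simp add: n_def)
  show "0 < C * Cm" using C Cm by simp
  fix l :: real and y assume l: "0 < l"
  have [measurable]: "p \<in> borel_measurable borel" using bmeas_measurable[OF bmeas_p] .
  have "(NNBINT x. ennreal (p x) * ennreal (min 1 (l * norm (x - y)) ^ 2 * kern (x - y)))
   \<le> ennreal (C * Cm * l powr (real DIM('a) + s - (n - 1)))"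
   using l Cm by (intro C(2)) (auto simp: bint_nn[OF bmeas_p] intro!: ennreal_leI)
  then show "(NNBINT x. ennreal (p x) * ennreal (min 1 (l * norm (x - y)) ^ 2 * kern (x - y))) \<le> ennreal (C * Cm * l powr (1 + s))"
   by (simp add: n_def add.commute)
 qed
 then show ?thesis by blast
qed

end

section \<open>Comparison inequality and extreme directions\<close>

context layer2
begin

definition dimr :: real where "dimr = real DIM('a)"
definition ord :: real where "ord = dimr + s"

lemma dimr2: "2 \<le> dimr" using dim2 by (simp add: dimr_def)

text \<open>The integrand vanishes unless x or y lies in the ball. In either case the other variable
  is integrated first, with the moment bound H; the two cases account for the factor 2.\<close>

lemma cutoff_pair_bound:
 fixes m \<eta> :: "'a => real"
 assumes m: "bmeas m" "\<And>x. 0 \<le> m x" and \<eta>m[measurable]: "\<eta> \<in> borel_measurable borel"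
  and lip: "\<And>x y. \<bar>\<eta> x - \<eta> y\<bar> \<le> min 1 (l * norm (x - y))" and l: "0 < l" and van: "\<And>x. \<rho> \<le> norm (x - z) ==> \<eta> x = 0"
  and H: "0 \<le> H" "\<And>y. y \<in> ball z \<rho> ==> (NNBINT x. ennreal (m x) * ennreal (min 1 (l * norm (x - y)) ^ 2 * kern (x - y))) \<le> ennreal H"
 shows "(\<integral>q. m (fst q) * m (snd q) * (\<eta> (fst q) - \<eta> (snd q))^2 * pkern q \<partial>PP) \<le> 2 * H * bint m z \<rho>"
  and "integrable PP (%q. m (fst q) * m (snd q) * (\<eta> (fst q) - \<eta> (snd q))^2 * pkern q)"
proof -
 note [measurable] = bmeas_measurable[OF m(1)]
 define f where "f q = ennreal (m (snd q) * indicator (ball z \<rho>) (snd q)) * (ennreal (m (fst q)) * ennreal (min 1 (l * norm (fst q - snd q)) ^ 2 * pkern q))" for q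
 define f' where "f' q = ennreal (m (fst q) * indicator (ball z \<rho>) (fst q)) * (ennreal (m (snd q)) * ennreal (min 1 (l * norm (snd q - fst q)) ^ 2 * kern (snd q - fst q)))" for q
 have fm[measurable]: "f \<in> borel_measurable (borel \<Otimes>\<^sub>M borel)" "f' \<in> borel_measurable (borel \<Otimes>\<^sub>M borel)" unfolding f_def f'_def by measurable
 have inner: "(NNBINT x. ennreal (m y * indicator (ball z \<rho>) y) * (ennreal (m x) * ennreal (min 1 (l * norm (x - y)) ^ 2 * kern (x - y))))
  \<le> ennreal (m y * indicator (ball z \<rho>) y) * ennreal H" for y
 proof (cases "y \<in> ball z \<rho>")
  case True
  then show ?thesis using H(2)[OF True] by (subst nn_integral_cmult) (auto intro!: mult_left_mono)
 qed simp
 have tot: "(NNBINT y. ennreal (m y * indicator (ball z \<rho>) y) * ennreal H) = ennreal (H * bint m z \<rho>)"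
 proof -
  have "(NNBINT y. ennreal (m y * indicator (ball z \<rho>) y) * ennreal H) = ennreal H * (NNBINT y. ennreal (m y) * indicator (ball z \<rho>) y)"
   by (subst nn_integral_cmult[symmetric]) (auto intro!: nn_integral_cong simp: mult.commute split: split_indicator)
  then show ?thesis using bint_nn[OF m] H(1) bint_nonneg[of m z \<rho>] m by (simp add: ennreal_mult)
 qed
 have i1: "(\<integral>\<^sup>+q. f q \<partial>PP) \<le> ennreal (H * bint m z \<rho>)"
 proof -
  have "(\<integral>\<^sup>+q. f q \<partial>PP) = (NNBINT y. (NNBINT x. f (x, y)))" by (rule lborel_pair.nn_integral_snd[symmetric]) measurable
  also have "... \<le> (NNBINT y. ennreal (m y * indicator (ball z \<rho>) y) * ennreal H)" unfolding f_def fst_conv snd_conv by (intro nn_integral_mono inner)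
  finally show ?thesis unfolding tot .
 qed
 have i2: "(\<integral>\<^sup>+q. f' q \<partial>PP) \<le> ennreal (H * bint m z \<rho>)"
 proof -
  have "(\<integral>\<^sup>+q. f' q \<partial>PP) = (NNBINT y. (NNBINT x. f' (y, x)))" by (rule lborel.nn_integral_fst[symmetric]) measurable
  also have "... \<le> (NNBINT y. ennreal (m y * indicator (ball z \<rho>) y) * ennreal H)" unfolding f'_def fst_conv snd_conv by (intro nn_integral_mono inner)
  finally show ?thesis unfolding tot .
 qed
 have sq: "(\<eta> x - \<eta> y)^2 \<le> min 1 (l * norm (x - y)) ^ 2" for x y using lip[of x y] by (metis abs_ge_zero power2_abs power_mono)
 have pt: "ennreal (m (fst q) * m (snd q) * (\<eta> (fst q) - \<eta> (snd q))^2 * pkern q) \<le> f q + f' q" for q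
 proof -
  obtain x y where q: "q = (x, y)" by (cases q)
  have a: "m x * m y * (\<eta> x - \<eta> y)^2 * kern (x - y) \<le> m x * m y * min 1 (l * norm (x - y)) ^ 2 * kern (x - y)"
   using sq m by (intro mult_right_mono mult_left_mono) auto
  consider "y \<in> ball z \<rho>" | "x \<in> ball z \<rho>" | "y \<notin> ball z \<rho>" "x \<notin> ball z \<rho>" by blast
  then show ?thesis
  proof cases
   case 1
   then have "f q = ennreal (m x * m y * min 1 (l * norm (x - y)) ^ 2 * kern (x - y))"
    using m l by (simp add: f_def q ennreal_mult[symmetric] mult_ac)
   then show ?thesis using a ennreal_leI[OF a] by (simp add: q add_increasing2)
  next
   case 2
   then have "f' q = ennreal (m x * m y * min 1 (l * norm (x - y)) ^ 2 * kern (x - y))"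
    using m l by (simp add: f'_def q ennreal_mult[symmetric] mult_ac norm_minus_commute[of y x] kern_commute[of y x])
   then show ?thesis using a ennreal_leI[OF a] by (simp add: q add_increasing)
  next
   case 3
   then have "\<eta> x = 0" "\<eta> y = 0" using van by (auto simp: dist_norm norm_minus_commute)
   then show ?thesis by (simp add: q)
  qed
 qed
 have nn: "(\<integral>\<^sup>+q. ennreal (m (fst q) * m (snd q) * (\<eta> (fst q) - \<eta> (snd q))^2 * pkern q) \<partial>PP) \<le> ennreal (2 * H * bint m z \<rho>)"
 proof -
  have "(\<integral>\<^sup>+q. ennreal (m (fst q) * m (snd q) * (\<eta> (fst q) - \<eta> (snd q))^2 * pkern q) \<partial>PP) \<le> (\<integral>\<^sup>+q. f q + f' q \<partial>PP)"
   by (intro nn_integral_mono pt)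
  also have "... = (\<integral>\<^sup>+q. f q \<partial>PP) + (\<integral>\<^sup>+q. f' q \<partial>PP)" by (rule nn_integral_add) measurable
  also have "... \<le> ennreal (H * bint m z \<rho>) + ennreal (H * bint m z \<rho>)" by (intro add_mono i1 i2)
  also have "... = ennreal (2 * H * bint m z \<rho>)" using H(1) bint_nonneg[of m z \<rho>] m by (simp flip: ennreal_plus)
  finally show ?thesis .
 qed
 have c: "0 \<le> 2 * H * bint m z \<rho>" using H(1) bint_nonneg[of m z \<rho>] m by simp
 show "(\<integral>q. m (fst q) * m (snd q) * (\<eta> (fst q) - \<eta> (snd q))^2 * pkern q \<partial>PP) \<le> 2 * H * bint m z \<rho>"
  by (rule integrable_if_nn_le(2)[OF _ _ nn c]) (use m in auto)
 show "integrable PP (%q. m (fst q) * m (snd q) * (\<eta> (fst q) - \<eta> (snd q))^2 * pkern q)"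
  by (rule integrable_if_nn_le(1)[OF _ _ nn c]) (use m in auto)
qed

text \<open>On the ball the kernel is at least (2r)^(-(n+s)) and the cutoff equals one, so the left
  side of \<open>sign_interaction\<close> dominates the product of the two masses. A large positive
  mass therefore makes the negative mass at radius r a small multiple of that at radius 2r.\<close>

lemma sign_interaction_step:
 fixes e z :: 'a
 assumes \<theta>: "0 \<le> \<theta>" and r: "0 < r" and H: "0 \<le> H"
  and Hy: "\<And>y. y \<in> ball z (2 * r) ==> (NNBINT x. ennreal (max 0 (- vt e \<theta> x)) * ennreal (min 1 (1 / r * norm (x - y)) ^ 2 * kern (x - y))) \<le> ennreal H"
 shows "(2 * r) powr -ord * bint (%x. max 0 (vt e \<theta> x)) z r * bint (%x. max 0 (- vt e \<theta> x)) z r \<le> H * bint (%x. max 0 (- vt e \<theta> x)) z (2 * r)"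
proof -
 define v where "v = vt e \<theta>"
 define \<eta> where "\<eta> = tent z r"
 have \<eta>: "blip \<eta>" unfolding \<eta>_def by (rule blip_tent[OF r])
 have \<eta>0: "\<eta> x = 0" if "2 * r \<le> norm (x - z)" for x unfolding \<eta>_def by (rule tent_eq_0[OF r that])
 have van: "\<eta> x = 0" if "norm z + 2 * r \<le> norm x" for x
  using \<eta>0[of x] that norm_triangle_ineq2[of x z] by linarith
 have P: "bmeas (%x. max 0 (v x))" "bmeas (%x. max 0 (- v x))"
  unfolding v_def by (intro blip_bmeas blip_pos blip_uminus blip_vt)+
 note st = sign_interaction[of \<theta> \<eta> "norm z + 2 * r" e, OF \<theta> \<eta> van, folded v_def]
 have rhs: "(\<integral>q. max 0 (- v (fst q)) * max 0 (- v (snd q)) * (\<eta> (fst q) - \<eta> (snd q))^2 * pkern q \<partial>PP) \<le> 2 * H * bint (%x. max 0 (- v x)) z (2 * r)"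
  using \<eta>0 r tent_lip[OF r, of z] Hy by (intro cutoff_pair_bound(1)[OF P(2), where l = "1 / r"] blip_measurable[OF \<eta>] H) (auto simp: \<eta>_def v_def)
 let ?a = "%x. max 0 (v x) * indicator (ball z r) x" and ?b = "%x. max 0 (- v x) * indicator (ball z r) x"
 note pr = prod_int[OF bint_integrable[OF P(1), of z r] bint_integrable[OF P(2), of z r]]
 have "(\<integral>q. (2 * r) powr -ord * (?a (fst q) * ?b (snd q)) \<partial>PP) \<le> (\<integral>q. max 0 (v (fst q)) * max 0 (- v (snd q)) * (\<eta> (snd q))^2 * pkern q \<partial>PP)"
 proof (rule integral_mono[OF _ st(1)])
  show "integrable PP (%q. (2 * r) powr -ord * (?a (fst q) * ?b (snd q)))" by (intro integrable_mult_right pr(1))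
  fix q :: "'a \<times> 'a"
  obtain x y where q: "q = (x, y)" by (cases q)
  show "(2 * r) powr -ord * (?a (fst q) * ?b (snd q)) \<le> max 0 (v (fst q)) * max 0 (- v (snd q)) * (\<eta> (snd q))^2 * pkern q"
  proof (cases "x \<in> ball z r \<and> y \<in> ball z r")
   case False then show ?thesis by (auto simp: q)
  next
   case True
   then have xy: "norm (x - z) < r" "norm (y - z) < r" by (auto simp: dist_norm norm_minus_commute)
   have e1: "\<eta> y = 1" unfolding \<eta>_def using xy r by (intro tent_eq_1) auto
   show ?thesis
   proof (cases "x = y")
    case True then show ?thesis by (auto simp: q max_def)
   next
    case False
    have "norm (x - y) \<le> 2 * r" using norm_triangle_ineq4[of "x - z" "y - z"] xy by simp
    then have "(2 * r) powr -ord \<le> kern (x - y)" using kern_ge[of "x - y" "2 * r"] False by (simp add: ord_def dimr_def)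
    then have "(2 * r) powr -ord * (max 0 (v x) * max 0 (- v y)) \<le> kern (x - y) * (max 0 (v x) * max 0 (- v y))" by (intro mult_right_mono) auto
    then show ?thesis using True e1 by (simp add: q mult_ac)
   qed
  qed
 qed
 then have "(2 * r) powr -ord * (bint (%x. max 0 (v x)) z r * bint (%x. max 0 (- v x)) z r) \<le> (\<integral>q. max 0 (v (fst q)) * max 0 (- v (snd q)) * (\<eta> (snd q))^2 * pkern q \<partial>PP)"
  using pr(2) by (simp add: bint_def)
 then show ?thesis using st(3) rhs unfolding v_def[symmetric] mult.assoc[of "(2 * r) powr - ord"] by linarith
qed

text \<open>If the flux in a direction of monotonicity is nondegenerate at all large scales, then the
 direction lies in the interior of the cone of monotone directions: \<open>sign_interaction_step\<close> contracts the
 negative part of \<open>e \<bullet> G - \<tau> p\<close> from each scale to the next smaller one.\<close>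

lemma nondegenerate_direction:
 fixes e :: 'a
 assumes e: "norm e \<le> 1" "\<And>x. 0 \<le> e \<bullet> G x" and c: "0 < c" and r0: "0 < r0"
  and fl: "\<And>r. r0 \<le> r ==> c * r powr (dimr - 1) \<le> bint (%x. e \<bullet> G x) 0 r"
 shows "\<exists>\<tau>>0. \<forall>x. \<tau> * p x \<le> e \<bullet> G x"
proof -
 define \<kappa> where "\<kappa> = 2 powr (ord + 1) * Cp / c"
 have \<kappa>: "0 < \<kappa>" unfolding \<kappa>_def using Cp c by simp
 \<comment> \<open>The first entry leaves half of the flux for the positive part. The second makes
   the contraction factor per halving at most 2^(-n), which beats the growth 2^(n-1) of the
   mass.\<close>
 define \<tau> where "\<tau> = min (c / (2 * Cm)) (2 powr -dimr / \<kappa>)"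
 have \<tau>: "0 < \<tau>" "\<tau> * Cm \<le> c / 2" "\<tau> * \<kappa> \<le> 2 powr -dimr"
  unfolding \<tau>_def using c Cm \<kappa> by (auto simp: min_def field_simps)
 define m where "m x = max 0 (- vt e \<tau> x)" for x
 have m: "bmeas m" unfolding m_def[abs_def] by (intro blip_bmeas blip_pos blip_uminus blip_vt)
 have m0: "0 \<le> m x" for x by (simp add: m_def)
 have mp: "m x \<le> \<tau> * p x" for x using e(2)[of x] \<tau> by (simp add: m_def vt_def)
 have contr: "bint m 0 r \<le> \<tau> * \<kappa> * bint m 0 (2 * r)" if r: "r0 \<le> r" for r
 proof -
  have r': "0 < r" using r r0 by simp
  define H where "H = \<tau> * (Cp * (1 / r) powr (1 + s))"
  have H: "0 \<le> H" unfolding H_def using \<tau> Cp by simp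
  have Hy: "(NNBINT x. ennreal (max 0 (- vt e \<tau> x)) * ennreal (min 1 (1 / r * norm (x - y)) ^ 2 * kern (x - y))) \<le> ennreal H" for y
  proof -
   have [measurable]: "p \<in> borel_measurable borel" using bmeas_measurable[OF bmeas_p] .
   have "(NNBINT x. ennreal (max 0 (- vt e \<tau> x)) * ennreal (min 1 (1 / r * norm (x - y)) ^ 2 * kern (x - y)))
    \<le> (NNBINT x. ennreal \<tau> * (ennreal (p x) * ennreal (min 1 (1 / r * norm (x - y)) ^ 2 * kern (x - y))))"
    using mp \<tau> unfolding m_def mult.assoc[symmetric]
    by (intro nn_integral_mono mult_right_mono) (auto simp: ennreal_mult[symmetric] intro!: ennreal_leI)
   also have "... = ennreal \<tau> * (NNBINT x. ennreal (p x) * ennreal (min 1 (1 / r * norm (x - y)) ^ 2 * kern (x - y)))"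
    by (rule nn_integral_cmult) measurable
   also have "... \<le> ennreal \<tau> * ennreal (Cp * (1 / r) powr (1 + s))" using r' by (intro mult_left_mono Cp(2)) auto
   also have "... = ennreal H" unfolding H_def using \<tau> Cp by (simp add: ennreal_mult)
   finally show ?thesis .
  qed
  have "c * r powr (dimr - 1) - \<tau> * (Cm * r powr (dimr - 1)) \<le> bint (%x. e \<bullet> G x) 0 r - \<tau> * bint p 0 r"
   using fl[OF r] Cm(2)[OF r', of 0] \<tau> by (intro diff_mono mult_left_mono) (auto simp: dimr_def)
  also have "... = bint (vt e \<tau>) 0 r"
  proof -
   have "bmeas (%x. \<tau> * p x)" by (intro blip_bmeas blip_mult blip_const blip_p)
   then show ?thesis unfolding vt_def[abs_def] by (simp add: bint_diff[OF bmeas_dir] bint_cmult)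
  qed
  also have "... \<le> bint (%x. max 0 (vt e \<tau> x)) 0 r" by (intro bint_mono blip_bmeas blip_pos blip_vt) auto
  finally have "(c - \<tau> * Cm) * r powr (dimr - 1) \<le> bint (%x. max 0 (vt e \<tau> x)) 0 r" by (simp add: algebra_simps)
  moreover have "c / 2 * r powr (dimr - 1) \<le> (c - \<tau> * Cm) * r powr (dimr - 1)" using \<tau> by (intro mult_right_mono) auto
  ultimately have P: "c / 2 * r powr (dimr - 1) \<le> bint (%x. max 0 (vt e \<tau> x)) 0 r" by linarith
  have "(2 * r) powr -ord * (c / 2 * r powr (dimr - 1)) * bint m 0 r \<le> (2 * r) powr -ord * bint (%x. max 0 (vt e \<tau> x)) 0 r * bint m 0 r"
   using P bint_nonneg[of m 0 r] m0 by (intro mult_right_mono mult_left_mono) auto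
  also have "... \<le> H * bint m 0 (2 * r)" unfolding m_def using \<tau> by (intro sign_interaction_step r' H Hy) auto
  finally have a: "(2 * r) powr -ord * (c / 2 * r powr (dimr - 1)) * bint m 0 r \<le> H * bint m 0 (2 * r)" .
  have e1: "(2 * r) powr -ord * (c / 2 * r powr (dimr - 1)) = r powr -(1+s) * (2 powr -(ord + 1) * c)"
  proof -
   have "(2 * r) powr -ord = 2 powr -ord * r powr -ord" using r' by (simp add: powr_mult)
   moreover have "r powr -ord * r powr (dimr - 1) = r powr -(1+s)"
   proof -
    have "r powr -ord * r powr (dimr - 1) = r powr (-ord + (dimr - 1))" by (rule powr_add[symmetric])
    also have "-ord + (dimr - 1) = -(1+s)" by (simp add: ord_def)
    finally show ?thesis .
   qed
   moreover have "2 powr -ord / 2 = (2::real) powr -(ord + 1)" using powr_add[of "2::real" "-ord" "-1"] by (simp add: powr_minus_divide)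
   ultimately show ?thesis by (simp add: mult_ac)
  qed
  have e2: "H = r powr -(1+s) * (\<tau> * Cp)"
  proof -
   have "(1 / r) powr (1 + s) = 1 / r powr (1 + s)" using r' by (simp add: powr_divide)
   also have "... = r powr -(1 + s)" by (simp only: powr_minus_divide)
   finally show ?thesis by (simp add: H_def)
  qed
  have rp: "0 < r powr -(1+s)" using r' by simp
  from a have "r powr -(1+s) * ((2 powr -(ord + 1) * c) * bint m 0 r) \<le> r powr -(1+s) * ((\<tau> * Cp) * bint m 0 (2 * r))"
   unfolding e1 e2 by (simp only: mult.assoc)
  then have b: "(2 powr -(ord + 1) * c) * bint m 0 r \<le> (\<tau> * Cp) * bint m 0 (2 * r)" using rp by (simp only: mult_le_cancel_left_pos)
  have "2 powr (ord + 1) / c * ((2 powr -(ord + 1) * c) * bint m 0 r) \<le> 2 powr (ord + 1) / c * ((\<tau> * Cp) * bint m 0 (2 * r))"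
   using b c by (intro mult_left_mono) auto
  moreover have "2 powr (ord + 1) * (2::real) powr -(ord + 1) = 1" by (simp flip: powr_add)
  ultimately show ?thesis using c by (simp add: \<kappa>_def mult_ac)
 qed
 have iter: "bint m 0 r \<le> (\<tau> * \<kappa>)^j * bint m 0 (2^j * r)" if r: "r0 \<le> r" for r j
 proof (induction j)
  case (Suc j)
  have "1 * r \<le> 2^j * r" using r r0 by (intro mult_right_mono) auto
  then have "bint m 0 (2^j * r) \<le> \<tau> * \<kappa> * bint m 0 (2 * (2^j * r))" using r by (intro contr) auto
  then have "(\<tau> * \<kappa>)^j * bint m 0 (2^j * r) \<le> (\<tau> * \<kappa>)^j * (\<tau> * \<kappa> * bint m 0 (2 * (2^j * r)))" using \<tau> \<kappa> by (intro mult_left_mono) auto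
  then show ?case using Suc by (simp add: mult_ac)
 qed simp
 have zero: "bint m 0 r \<le> 0" if r: "r0 \<le> r" for r
 proof -
  have r': "0 < r" using r r0 by simp
  have "bint m 0 r \<le> \<tau> * Cm * r powr (dimr - 1) * (1/2)^j" for j
  proof -
   have "bint m 0 (2^j * r) \<le> bint (%x. \<tau> * p x) 0 (2^j * r)" using mp by (intro bint_mono m blip_bmeas blip_mult blip_const blip_p) auto
   also have "... \<le> \<tau> * (Cm * (2^j * r) powr (dimr - 1))"
    unfolding bint_cmult using Cm(2)[of "2^j * r" 0] r' \<tau> by (intro mult_left_mono) (auto simp: dimr_def)
   finally have 1: "bint m 0 (2^j * r) \<le> \<tau> * (Cm * (2^j * r) powr (dimr - 1))" .
   have "bint m 0 r \<le> (2 powr -dimr)^j * (\<tau> * (Cm * (2^j * r) powr (dimr - 1)))"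
    using \<tau> \<kappa> 1 m0 by (intro order_trans[OF iter[OF r, of j]] mult_mono power_mono) (auto intro: bint_nonneg)
   also have "(2^j * r) powr (dimr - 1) = (2 powr (dimr - 1))^j * r powr (dimr - 1)"
    using r' by (simp add: powr_mult powr_powr mult.commute flip: powr_realpow)
   also have "(2 powr -dimr)^j * (\<tau> * (Cm * ((2 powr (dimr - 1))^j * r powr (dimr - 1)))) = \<tau> * Cm * r powr (dimr - 1) * (2 powr -dimr * 2 powr (dimr - 1))^j"
    by (simp add: power_mult_distrib mult_ac)
   also have "2 powr -dimr * 2 powr (dimr - 1) = (2 :: real) powr (-dimr + (dimr - 1))" by (rule powr_add[symmetric])
   also have "... = 1 / 2" by (simp add: powr_minus_divide)
   finally show ?thesis .
  qed
  moreover have "(%j. \<tau> * Cm * r powr (dimr - 1) * (1/2)^j) \<longlonglongrightarrow> 0"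
   by (intro tendsto_mult_right_zero LIMSEQ_realpow_zero) auto
  ultimately show ?thesis by (intro LIMSEQ_le_const) auto
 qed
 have "\<tau> * p x \<le> e \<bullet> G x" for x
 proof -
  have "m x = 0"
   using r0 by (intro bint_pos_continuous[OF m _ m0 zero[of "r0 + norm x + 1"]])
    (auto simp: m_def[abs_def] add_nonneg_pos intro!: blip_continuous blip_pos blip_uminus blip_vt)
  then show ?thesis by (simp add: m_def vt_def max_def split: if_splits)
 qed
 then show ?thesis using \<tau> by blast
qed

text \<open>e0 is turned in a plane towards -e0, and the last angle with E t.G \<ge> 0 is taken. It
  exists because the condition is closed and lies before \<pi> because -e0 violates it. If the flux
  were nondegenerate, \<open>nondegenerate_direction\<close> would give E t.G \<ge> \<tau> p, and a
  slightly larger angle would still be admissible.\<close>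

lemma degenerate_direction_ex:
 "\<exists>e. norm e = 1 \<and> (\<forall>x. 0 \<le> e \<bullet> G x) \<and> (\<forall>c>0. \<forall>r0>0. \<exists>r\<ge>r0. bint (%x. e \<bullet> G x) 0 r < c * r powr (dimr - 1))"
proof -
 obtain y where y: "y \<noteq> 0" "orthogonal e0 y" using orthogonal_to_vector_exists[OF dim2, of e0] by blast
 define f where "f = y /\<^sub>R norm y"
 have f: "norm f = 1" "e0 \<bullet> f = 0" using y by (auto simp: f_def orthogonal_def)
 define E where "E t = cos t *\<^sub>R e0 + sin t *\<^sub>R f" for t
 have nE: "norm (E t) = 1" for t
 proof -
  have i: "e0 \<bullet> e0 = 1" "f \<bullet> f = 1" "f \<bullet> e0 = 0" using f e0_unit by (auto simp: norm_eq_1 inner_commute)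
  have "E t \<bullet> E t = (cos t)^2 + (sin t)^2"
   unfolding E_def by (simp add: inner_add_left inner_add_right i f(2) power2_eq_square)
  then show ?thesis by (simp add: norm_eq_1)
 qed
 define S where "S = {t \<in> {0..pi}. \<forall>x. 0 \<le> E t \<bullet> G x}"
 have cE: "continuous_on UNIV E" unfolding E_def by (intro continuous_intros)
 have S: "S \<noteq> {}" "bdd_above S" "closed S"
 proof -
  have "0 \<in> S" using phi_pos by (auto simp: S_def E_def less_imp_le)
  then show "S \<noteq> {}" by blast
  show "bdd_above S" by (auto simp: S_def intro!: bdd_aboveI[of _ pi])
  have "S = {0..pi} \<inter> (\<Inter>x. {t. 0 \<le> E t \<bullet> G x})" by (auto simp: S_def)
  moreover have "closed {t. 0 \<le> E t \<bullet> G x}" for x using cE by (intro closed_Collect_le continuous_intros) auto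
  ultimately show "closed S" by auto
 qed
 define t where "t = Sup S"
 have tS: "t \<in> S" unfolding t_def using S by (rule closed_contains_Sup)
 have "t \<noteq> pi"
 proof
  assume "t = pi"
  then have "0 \<le> E pi \<bullet> G 0" using tS by (auto simp: S_def)
  then show False using phi_pos[of 0] by (simp add: E_def)
 qed
 then have t: "0 \<le> t" "t < pi" "\<And>x. 0 \<le> E t \<bullet> G x" using tS by (auto simp: S_def)
 have no: "\<not> (\<exists>\<tau>>0. \<forall>x. \<tau> * p x \<le> E t \<bullet> G x)"
 proof
  assume "\<exists>\<tau>>0. \<forall>x. \<tau> * p x \<le> E t \<bullet> G x"
  then obtain \<tau> where \<tau>: "0 < \<tau>" "\<And>x. \<tau> * p x \<le> E t \<bullet> G x" by blast
  have "isCont E t" using cE by (simp add: continuous_on_eq_continuous_at)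
  then obtain \<delta> where \<delta>: "0 < \<delta>" "\<And>r. \<bar>r - t\<bar> < \<delta> ==> norm (E r - E t) < \<tau>"
   using \<tau>(1) unfolding continuous_at_eps_delta dist_norm real_norm_def by blast
  define r where "r = min pi (t + \<delta> / 2)"
  have r: "t < r" "r \<le> pi" "\<bar>r - t\<bar> < \<delta>" using \<delta> t by (auto simp: r_def min_def)
  have "0 \<le> E r \<bullet> G x" for x
  proof -
   have "\<bar>(E r - E t) \<bullet> G x\<bar> \<le> norm (E r - E t) * p x" by (rule Cauchy_Schwarz_ineq2)
   also have "... \<le> \<tau> * p x" using \<delta>(2)[OF r(3)] by (intro mult_right_mono) auto
   finally show ?thesis using \<tau>(2)[of x] by (simp add: inner_diff_left)
  qed
  then have "r \<in> S" using r t by (auto simp: S_def)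
  then have "r \<le> t" unfolding t_def using S by (intro cSup_upper)
  then show False using r by simp
 qed
 show ?thesis
 proof (intro exI[of _ "E t"] conjI allI impI nE t)
  fix c r0 :: real assume c: "0 < c" "0 < r0"
  show "\<exists>r\<ge>r0. bint (%x. E t \<bullet> G x) 0 r < c * r powr (dimr - 1)"
  proof (rule ccontr)
   assume "\<not> ?thesis"
   then have "\<And>r. r0 \<le> r ==> c * r powr (dimr - 1) \<le> bint (%x. E t \<bullet> G x) 0 r" by (meson not_le)
   from nondegenerate_direction[OF _ t(3) c this] nE[of t] no show False by simp
  qed
 qed
qed

end

section \<open>Energy and flux in balls\<close>

lemma bint_translate:
 assumes "bmeas g" shows "bint (%x. g (x + c)) z r = bint g (z + c) r"
proof -
 note [measurable] = bmeas_measurable[OF assms]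
 have "bint g (z + c) r = (LBINT x. g (x + c) * indicator (ball (z + c) r) (x + c))"
  unfolding bint_def by (rule integral_lborel_translate[symmetric]) measurable
 also have "... = bint (%x. g (x + c)) z r"
  unfolding bint_def by (intro Lintegral_cong) (auto simp: dist_norm split: split_indicator)
 finally show ?thesis ..
qed

lemma bmeas_add: assumes "bmeas f" "bmeas g" shows "bmeas (%x. f x + g x)"
proof -
 obtain A B where "\<And>x. \<bar>f x\<bar> \<le> A" "\<And>x. \<bar>g x\<bar> \<le> B" using assms by (auto simp: bmeas_def)
 then have "\<bar>f x + g x\<bar> \<le> A + B" for x by (meson abs_triangle_ineq add_mono order_trans)
 then show ?thesis using assms by (auto simp: bmeas_def)
qed

lemma bmeas_mult: assumes "bmeas f" "bmeas g" shows "bmeas (%x. f x * g x)"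
proof -
 obtain A B where "\<And>x. \<bar>f x\<bar> \<le> A" "\<And>x. \<bar>g x\<bar> \<le> B" using assms by (auto simp: bmeas_def)
 then have "\<bar>f x * g x\<bar> \<le> A * B" for x unfolding abs_mult by (meson abs_ge_zero mult_mono order_trans)
 then show ?thesis using assms by (auto simp: bmeas_def)
qed

lemma bmeas_diff: "bmeas f ==> bmeas g ==> bmeas (%x. f x - g x)"
 using bmeas_add[OF _ bmeas_mult[OF bmeas_const[of "-1"]], of f g] by simp

lemma bmeas_abs: "bmeas f ==> bmeas (%x. \<bar>f x\<bar>)"
 unfolding bmeas_def by auto

lemma blip_translate: "blip g ==> blip (%x. g (x + c))"
 unfolding blip_def by (metis add_diff_cancel_right)

section \<open>Averages over tents\<close>

lemma tent_commute: "tent y a x = tent x a y" by (simp add: tent_def norm_minus_commute)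

text \<open>An unnormalised average at scale a. The weight is Lipschitz, so that in averages of G
  the derivative can be moved onto it, which a sharp ball would not permit.\<close>

definition conv :: "real => ('a::euclidean_space => real) => 'a => real" where
 "conv a g y = (LBINT x. tent y a x * g x)"

lemma tent_mult_integrable:
 assumes a: "0 < a" and g: "bmeas g"
 shows "integrable lborel (%x. tent y a x * g x)"
proof -
 from g obtain B where B: "\<And>x. \<bar>g x\<bar> \<le> B" and [measurable]: "g \<in> borel_measurable borel" by (auto simp: bmeas_def)
 have [measurable]: "tent y a \<in> borel_measurable borel" using blip_measurable[OF blip_tent[OF a]] .
 have "bmeas (%x. tent y a x * g x)"
 proof -
  have "\<bar>tent y a x * g x\<bar> \<le> 1 * B" for x unfolding abs_mult using tent_bounds[of y a x] B[of x] by (intro mult_mono) auto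
  then show ?thesis unfolding bmeas_def by (intro conjI exI[of _ B]) auto
 qed
 from bint_integrable[OF this, of y "2 * a"]
 have "integrable lborel (%x. (tent y a x * g x) * indicator (ball y (2 * a)) x)" .
 also have "(%x. (tent y a x * g x) * indicator (ball y (2 * a)) x) = (%x. tent y a x * g x)"
 proof
  fix x
  show "(tent y a x * g x) * indicator (ball y (2 * a)) x = tent y a x * g x"
   using tent_eq_0[OF a, of x y] by (cases "x \<in> ball y (2 * a)") (auto simp: dist_norm norm_minus_commute)
 qed
 finally show ?thesis .
qed

lemma conv_diff: "0 < a ==> bmeas f ==> bmeas g ==> conv a (%x. f x - g x) y = conv a f y - conv a g y"
 unfolding conv_def right_diff_distrib by (intro Lintegral_diff tent_mult_integrable)

lemma conv_mono: "0 < a ==> bmeas f ==> bmeas g ==> (\<And>x. f x \<le> g x) ==> conv a f y \<le> conv a g y"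
 unfolding conv_def by (intro integral_mono tent_mult_integrable mult_left_mono) (auto simp: tent_bounds)

lemma conv_nonneg: "(\<And>x. 0 \<le> g x) ==> 0 \<le> conv a g y"
 unfolding conv_def by (intro Lintegral_nonneg mult_nonneg_nonneg) (auto simp: tent_bounds)

lemma bmeas_conv:
 fixes g :: "'a::euclidean_space => real"
 assumes a: "0 < a" and g: "bmeas g"
 shows "bmeas (conv a g)"
proof -
 from g obtain B where B: "\<And>x. \<bar>g x\<bar> \<le> B" and [measurable]: "g \<in> borel_measurable borel" by (auto simp: bmeas_def)
 have B0: "0 \<le> B" using B[of 0] by linarith
 have "conv a g \<in> borel_measurable borel" unfolding conv_def tent_def by measurable
 moreover have "\<bar>conv a g y\<bar> \<le> B * unit_ball_vol (DIM('a)) * (2 * a) ^ DIM('a)" for y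
 proof -
  have "\<bar>conv a g y\<bar> \<le> (LBINT x. \<bar>tent y a x * g x\<bar>)" unfolding conv_def
   using integral_norm_bound[of lborel "%x. tent y a x * g x"] by simp
  also have "... \<le> bint (%x. B) y (2 * a)" unfolding bint_def
  proof (intro integral_mono)
   show "integrable lborel (%x. \<bar>tent y a x * g x\<bar>)" using tent_mult_integrable[OF a g] by simp
   show "integrable lborel (%x. B * indicator (ball y (2 * a)) x)" by (intro integrable_mult_right integrable_indicator_ball)
   fix x
   show "\<bar>tent y a x * g x\<bar> \<le> B * indicator (ball y (2 * a)) x"
   proof (cases "x \<in> ball y (2 * a)")
    case True
    have "\<bar>tent y a x * g x\<bar> \<le> 1 * B" unfolding abs_mult using tent_bounds[of y a x] B[of x] by (intro mult_mono) auto
    then show ?thesis using True by simp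
   next
    case False
    then show ?thesis using tent_eq_0[OF a, of x y] by (simp add: dist_norm norm_minus_commute)
   qed
  qed
  also have "... = B * unit_ball_vol (DIM('a)) * (2 * a) ^ DIM('a)" using a by (simp add: bint_const)
  finally show ?thesis .
 qed
 ultimately show ?thesis unfolding bmeas_def by blast
qed

lemma conv_translate:
 assumes "bmeas g" shows "conv a (%x. g (x + c)) y = conv a g (y + c)"
proof -
 note [measurable] = bmeas_measurable[OF assms]
 have "conv a g (y + c) = (LBINT x. tent (y + c) a (x + c) * g (x + c))"
  unfolding conv_def tent_def by (rule integral_lborel_translate[symmetric]) measurable
 also have "... = conv a (%x. g (x + c)) y" unfolding conv_def tent_def by simp
 finally show ?thesis ..
qed

text \<open>Tonelli, with the symmetry of the tent in centre and argument. Stated for nonnegative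
  integrals so that upper and lower bounds follow from pointwise bounds on the inner
  integral.\<close>

lemma bint_conv_nn:
 fixes g :: "'a::euclidean_space => real"
 assumes a: "0 < a" and g: "bmeas g" "\<And>x. 0 \<le> g x"
 shows "ennreal (bint (conv a g) z r) = (NNBINT x. ennreal (g x) * (NNBINT y. ennreal (tent x a y) * indicator (ball z r) y))"
proof -
 note [measurable] = bmeas_measurable[OF g(1)]
 have [measurable]: "(%q::'a\<times>'a. tent (fst q) a (snd q)) \<in> borel_measurable (borel \<Otimes>\<^sub>M borel)" unfolding tent_def by measurable
 have "ennreal (bint (conv a g) z r) = (NNBINT y. ennreal (conv a g y) * indicator (ball z r) y)"
  by (rule bint_nn[symmetric]) (auto intro: bmeas_conv[OF a g(1)] conv_nonneg g)
 also have "... = (NNBINT y. (NNBINT x. ennreal (tent y a x * g x) * indicator (ball z r) y))"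
 proof (intro nn_integral_cong)
  fix y
  have "ennreal (conv a g y) = (NNBINT x. ennreal (tent y a x * g x))" unfolding conv_def
   by (intro nn_integral_eq_integral[symmetric] tent_mult_integrable a g) (auto simp: tent_bounds g)
  moreover have "(NNBINT x. ennreal (tent y a x * g x) * indicator (ball z r) y) = (NNBINT x. ennreal (tent y a x * g x)) * indicator (ball z r) y"
   unfolding tent_def by (intro nn_integral_multc) measurable
  ultimately show "ennreal (conv a g y) * indicator (ball z r) y = (NNBINT x. ennreal (tent y a x * g x) * indicator (ball z r) y)" by simp
 qed
 also have "... = (NNBINT x. (NNBINT y. ennreal (tent y a x * g x) * indicator (ball z r) y))"
  by (rule lborel_pair.Fubini') (unfold tent_def, measurable)
 also have "... = (NNBINT x. ennreal (g x) * (NNBINT y. ennreal (tent x a y) * indicator (ball z r) y))"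
 proof (intro nn_integral_cong)
  fix x
  have "(NNBINT y. ennreal (tent y a x * g x) * indicator (ball z r) y) = (NNBINT y. ennreal (g x) * (ennreal (tent x a y) * indicator (ball z r) y))"
   by (intro nn_integral_cong) (simp add: tent_commute[of _ a x] tent_bounds g ennreal_mult mult_ac)
  also have "... = ennreal (g x) * (NNBINT y. ennreal (tent x a y) * indicator (ball z r) y)"
   unfolding tent_def by (rule nn_integral_cmult) measurable
  finally show "(NNBINT y. ennreal (tent y a x * g x) * indicator (ball z r) y) = ennreal (g x) * (NNBINT y. ennreal (tent x a y) * indicator (ball z r) y)" .
 qed
 finally show ?thesis .
qed

lemma bint_conv_lower:
 fixes g :: "'a::euclidean_space => real"
 assumes a: "0 < a" and g: "bmeas g" "\<And>x. 0 \<le> g x"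
 shows "unit_ball_vol (DIM('a)) * a ^ DIM('a) * bint g z (r - a) \<le> bint (conv a g) z r"
proof -
 note [measurable] = bmeas_measurable[OF g(1)]
 let ?c = "unit_ball_vol (DIM('a)) * a ^ DIM('a)"
 have in_ball: "ennreal (g x) * indicator (ball z (r - a)) x * ennreal ?c \<le> ennreal (g x) * (NNBINT y. ennreal (tent x a y) * indicator (ball z r) y)" for x
 proof (cases "x \<in> ball z (r - a)")
  case True
  have "ennreal ?c = (NNBINT y. indicator (ball x a) y)" using a by (simp add: emeasure_ball)
  also have "... \<le> (NNBINT y. ennreal (tent x a y) * indicator (ball z r) y)"
  proof (intro nn_integral_mono)
   fix y
   show "indicator (ball x a) y \<le> ennreal (tent x a y) * indicator (ball z r) y"
   proof (cases "y \<in> ball x a")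
    case yb: True
    then have "tent x a y = 1" using a by (intro tent_eq_1) (auto simp: dist_norm norm_minus_commute)
    moreover have "y \<in> ball z r" using yb True dist_triangle[of z y x] by (auto simp: dist_commute)
    ultimately show ?thesis using yb by simp
   qed simp
  qed
  finally show ?thesis using True by (simp add: mult_left_mono)
 qed simp
 have "ennreal (bint g z (r - a)) * ennreal ?c = (NNBINT x. ennreal (g x) * indicator (ball z (r - a)) x * ennreal ?c)"
  unfolding bint_nn[OF g, symmetric] by (rule nn_integral_multc[symmetric]) measurable
 also have "... \<le> ennreal (bint (conv a g) z r)" unfolding bint_conv_nn[OF a g] by (intro nn_integral_mono in_ball)
 finally have "ennreal (bint g z (r - a) * ?c) \<le> ennreal (bint (conv a g) z r)" using a by (simp add: ennreal_mult bint_nonneg[OF g(2)])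
 moreover have "0 \<le> bint (conv a g) z r" by (intro bint_nonneg conv_nonneg g(2))
 ultimately show ?thesis by (simp add: mult.commute)
qed

lemma bint_conv_upper:
 fixes g :: "'a::euclidean_space => real"
 assumes a: "0 < a" and g: "bmeas g" "\<And>x. 0 \<le> g x"
 shows "bint (conv a g) z r \<le> unit_ball_vol (DIM('a)) * (2 * a) ^ DIM('a) * bint g z (r + 2 * a)"
proof -
 note [measurable] = bmeas_measurable[OF g(1)]
 let ?c = "unit_ball_vol (DIM('a)) * (2 * a) ^ DIM('a)"
 have in_ball: "ennreal (g x) * (NNBINT y. ennreal (tent x a y) * indicator (ball z r) y) \<le> ennreal (g x) * indicator (ball z (r + 2 * a)) x * ennreal ?c" for x
 proof (cases "x \<in> ball z (r + 2 * a)")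
  case True
  have "(NNBINT y. ennreal (tent x a y) * indicator (ball z r) y) \<le> (NNBINT y. indicator (ball x (2 * a)) y)"
  proof (intro nn_integral_mono)
   fix y
   show "ennreal (tent x a y) * indicator (ball z r) y \<le> indicator (ball x (2 * a)) y"
    using tent_bounds[of x a y] tent_eq_0[OF a, of y x]
    by (cases "y \<in> ball x (2 * a)") (auto simp: dist_norm norm_minus_commute split: split_indicator)
  qed
  also have "... = ennreal ?c" using a by (simp add: emeasure_ball)
  finally show ?thesis using True by (simp add: mult_left_mono)
 next
  case False
  have "(%y. ennreal (tent x a y) * indicator (ball z r) y) = (%y. 0)"
  proof
   fix y
   show "ennreal (tent x a y) * indicator (ball z r) y = 0"
   proof (cases "y \<in> ball z r")
    case True
    then have "2 * a \<le> norm (y - x)" using False dist_triangle[of z x y] by (auto simp: dist_norm norm_minus_commute)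
    then show ?thesis using tent_eq_0[OF a, of y x] by simp
   qed simp
  qed
  then show ?thesis by simp
 qed
 have "ennreal (bint (conv a g) z r) \<le> (NNBINT x. ennreal (g x) * indicator (ball z (r + 2 * a)) x * ennreal ?c)"
  unfolding bint_conv_nn[OF a g] by (intro nn_integral_mono in_ball)
 also have "... = ennreal (bint g z (r + 2 * a)) * ennreal ?c"
  unfolding bint_nn[OF g, symmetric] by (rule nn_integral_multc) measurable
 finally have "ennreal (bint (conv a g) z r) \<le> ennreal (bint g z (r + 2 * a) * ?c)" using a by (simp add: ennreal_mult bint_nonneg[OF g(2)])
 moreover have "0 \<le> bint g z (r + 2 * a) * ?c" using a by (intro mult_nonneg_nonneg bint_nonneg g(2)) auto
 ultimately show ?thesis by (simp add: mult.commute)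
qed

section \<open>The energy of a ball\<close>

context layer2
begin

text \<open>Sharp indicators instead of cutoffs make this quantity monotone in the ball and
  superadditive over disjoint balls.\<close>

definition EB :: "'a => real => real" where
 "EB z r = (\<integral>q. indicator (ball z r) (fst q) * indicator (ball z r) (snd q) * ((p (fst q) * p (snd q) - G (fst q) \<bullet> G (snd q)) * pkern q) \<partial>PP)"

lemma EB_integrable: "integrable PP (%q. indicator (ball z r) (fst q) * indicator (ball z r) (snd q) * ((p (fst q) * p (snd q) - G (fst q) \<bullet> G (snd q)) * pkern q))"
proof -
 note [measurable] = bmeas_measurable[OF bmeas_p]
 have "integrable PP (%q. (indicator (ball z r) (fst q) * indicator (ball z r) (snd q) * (p (fst q) * p (snd q) - G (fst q) \<bullet> G (snd q))) * pkern q)"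
 proof (rule pair_integrable[where R = "norm z + r"])
  fix x y
  show "\<bar>indicator (ball z r) x * indicator (ball z r) y * (p x * p y - G x \<bullet> G y)\<bar> \<le> 2 * \<Lambda>^2 * min 1 (norm (x - y))"
   using defect_bound[of x y] defect_nonneg[of x y] by (auto split: split_indicator)
  assume "norm z + r \<le> norm x"
  then have "x \<notin> ball z r" using norm_triangle_ineq2[of x z] by (auto simp: dist_norm norm_minus_commute)
  then show "indicator (ball z r) x * indicator (ball z r) y * (p x * p y - G x \<bullet> G y) = 0" by simp
 qed measurable
 then show ?thesis by (simp only: mult.assoc)
qed

lemma EB_term_nonneg: "0 \<le> indicator (ball z r) x * indicator (ball z r) y * ((p x * p y - G x \<bullet> G y) * kern (x - y))"
 using defect_nonneg[of x y] by simp

lemma EB_nonneg: "0 \<le> EB z r"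
 unfolding EB_def by (intro Lintegral_nonneg EB_term_nonneg)

lemma EB_mono: "ball z r \<subseteq> ball z' r' ==> EB z r \<le> EB z' r'"
 unfolding EB_def
proof (intro integral_mono EB_integrable mult_right_mono)
 fix q :: "'a \<times> 'a" assume "ball z r \<subseteq> ball z' r'"
 then show "indicator (ball z r) (fst q) * indicator (ball z r) (snd q) \<le> (indicator (ball z' r') (fst q) * indicator (ball z' r') (snd q) :: real)"
  by (intro mult_mono) (auto split: split_indicator)
 show "0 \<le> (p (fst q) * p (snd q) - G (fst q) \<bullet> G (snd q)) * pkern q"
  by (intro mult_nonneg_nonneg defect_nonneg kern_nonneg)
qed

text \<open>The right side of \<open>energy\<close> for a tent: G.G' \<le> p p', the moment bound
  contributes r^(-(1+s)) and the mass r^(n-1).\<close>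

lemma EB_bound:
 assumes r: "0 < r"
 shows "EB z r \<le> Cp * Cm * 2 powr (dimr - 1) * r powr (dimr - 2 - s)"
proof -
 define \<eta> where "\<eta> = tent z r"
 have \<eta>: "blip \<eta>" unfolding \<eta>_def by (rule blip_tent[OF r])
 note [measurable] = blip_measurable[OF \<eta>]
 have \<eta>0: "\<eta> x = 0" if "2 * r \<le> norm (x - z)" for x unfolding \<eta>_def by (rule tent_eq_0[OF r that])
 have van: "\<eta> x = 0" if "norm z + 2 * r \<le> norm x" for x
  using \<eta>0[of x] that norm_triangle_ineq2[of x z] by linarith
 note en = energy[of \<eta> "norm z + 2 * r", OF \<eta> van]
 have H: "0 \<le> Cp * (1 / r) powr (1 + s)" using Cp by simp
 have cb: "(\<integral>q. p (fst q) * p (snd q) * (\<eta> (fst q) - \<eta> (snd q))^2 * pkern q \<partial>PP) \<le> 2 * (Cp * (1 / r) powr (1 + s)) * bint p z (2 * r)"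
  "integrable PP (%q. p (fst q) * p (snd q) * (\<eta> (fst q) - \<eta> (snd q))^2 * pkern q)"
  using \<eta>0 r tent_lip[OF r, of z] Cp(2)[of "1 / r"] cutoff_pair_bound[OF bmeas_p _ blip_measurable[OF \<eta>], of "1 / r" "2 * r" z, OF _ _ _ _ H]
  by (auto simp: \<eta>_def)
 have 1: "EB z r \<le> (\<integral>q. \<eta> (fst q) * \<eta> (snd q) * (p (fst q) * p (snd q) - G (fst q) \<bullet> G (snd q)) * pkern q \<partial>PP)"
  unfolding EB_def
 proof (rule integral_mono[OF EB_integrable en(1)])
  fix q :: "'a \<times> 'a"
  obtain x y where q: "q = (x, y)" by (cases q)
  have "indicator (ball z r) w \<le> \<eta> w" for w using tent_eq_1[OF r, of w z] tent_bounds[of z r w]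
   by (auto simp: \<eta>_def dist_norm norm_minus_commute split: split_indicator)
  then have "indicator (ball z r) x * indicator (ball z r) y \<le> \<eta> x * \<eta> y" using tent_bounds[of z r] by (intro mult_mono) (auto simp: \<eta>_def)
  then have "indicator (ball z r) x * indicator (ball z r) y * ((p x * p y - G x \<bullet> G y) * kern (x - y)) \<le> \<eta> x * \<eta> y * ((p x * p y - G x \<bullet> G y) * kern (x - y))"
   using defect_nonneg[of x y] by (intro mult_right_mono) auto
  then show "indicator (ball z r) (fst q) * indicator (ball z r) (snd q) * ((p (fst q) * p (snd q) - G (fst q) \<bullet> G (snd q)) * pkern q)
   \<le> \<eta> (fst q) * \<eta> (snd q) * (p (fst q) * p (snd q) - G (fst q) \<bullet> G (snd q)) * pkern q" by (simp add: q mult.assoc)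
 qed
 have 2: "(\<integral>q. (G (fst q) \<bullet> G (snd q)) * (\<eta> (fst q) - \<eta> (snd q))^2 * pkern q \<partial>PP)
  \<le> (\<integral>q. p (fst q) * p (snd q) * (\<eta> (fst q) - \<eta> (snd q))^2 * pkern q \<partial>PP)"
  by (intro integral_mono en(2) cb(2) mult_right_mono norm_cauchy_schwarz) auto
 have "EB z r \<le> Cp * (1 / r) powr (1 + s) * bint p z (2 * r)" using 1 2 en(3) cb(1) by linarith
 also have "... \<le> Cp * (1 / r) powr (1 + s) * (Cm * (2 * r) powr (dimr - 1))"
  using Cm(2)[of "2 * r" z] r Cp by (intro mult_left_mono) (auto simp: dimr_def)
 also have "... = Cp * Cm * 2 powr (dimr - 1) * (r powr (dimr - 1) / r powr (1 + s))"
  using r by (simp add: powr_mult powr_divide)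
 also have "r powr (dimr - 1) / r powr (1 + s) = r powr (dimr - 1 - (1 + s))" by (rule powr_diff[symmetric])
 also have "dimr - 1 - (1 + s) = dimr - 2 - s" by simp
 finally show ?thesis .
qed

text \<open>Within the ball the kernel is at least (2r)^(-(n+s)), so dropping it costs that factor.
  Without the kernel the double integral of p p' - G.G' factorises into squares of single
  integrals.\<close>

lemma weighted_defect:
 assumes f: "integrable lborel f" "integrable lborel (%x. f x * p x)" "\<And>b. integrable lborel (%x. f x * (b \<bullet> G x))"
  and fb: "\<And>x. 0 \<le> f x" "\<And>x. f x \<le> indicator (ball z r) x" and r: "0 < r"
 shows "(LBINT x. f x * p x)^2 - (\<Sum>b\<in>Basis. (LBINT x. f x * (b \<bullet> G x))^2) \<le> (2 * r) powr ord * EB z r"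
proof -
 let ?D = "%q. (f (fst q) * p (fst q)) * (f (snd q) * p (snd q)) - (\<Sum>b\<in>Basis. (f (fst q) * (b \<bullet> G (fst q))) * (f (snd q) * (b \<bullet> G (snd q))))"
 have iD: "integrable PP ?D" by (intro Lintegrable_diff Lintegrable_sum prod_int(1) f)
 have vD: "(\<integral>q. ?D q \<partial>PP) = (LBINT x. f x * p x)^2 - (\<Sum>b\<in>Basis. (LBINT x. f x * (b \<bullet> G x))^2)"
 proof -
  have "(\<integral>q. ?D q \<partial>PP) = (\<integral>q. (f (fst q) * p (fst q)) * (f (snd q) * p (snd q)) \<partial>PP)
   - (\<integral>q. (\<Sum>b\<in>Basis. (f (fst q) * (b \<bullet> G (fst q))) * (f (snd q) * (b \<bullet> G (snd q)))) \<partial>PP)"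
   by (intro Lintegral_diff Lintegrable_sum prod_int(1) f)
  also have "(\<integral>q. (\<Sum>b\<in>Basis. (f (fst q) * (b \<bullet> G (fst q))) * (f (snd q) * (b \<bullet> G (snd q)))) \<partial>PP)
   = (\<Sum>b\<in>Basis. \<integral>q. (f (fst q) * (b \<bullet> G (fst q))) * (f (snd q) * (b \<bullet> G (snd q))) \<partial>PP)"
   by (intro Lintegral_sum prod_int(1) f)
  finally show ?thesis using prod_int(2)[OF f(2) f(2)] prod_int(2)[OF f(3) f(3)] by (simp add: power2_eq_square)
 qed
 have "(\<integral>q. ?D q \<partial>PP) \<le> (\<integral>q. (2 * r) powr ord * (indicator (ball z r) (fst q) * indicator (ball z r) (snd q) * ((p (fst q) * p (snd q) - G (fst q) \<bullet> G (snd q)) * pkern q)) \<partial>PP)"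
 proof (rule integral_mono[OF iD])
  show "integrable PP (%q. (2 * r) powr ord * (indicator (ball z r) (fst q) * indicator (ball z r) (snd q) * ((p (fst q) * p (snd q) - G (fst q) \<bullet> G (snd q)) * pkern q)))"
   by (rule integrable_mult_right[OF EB_integrable])
  fix q :: "'a \<times> 'a"
  obtain x y where q: "q = (x, y)" by (cases q)
  have e: "(\<Sum>b\<in>Basis. (f x * (b \<bullet> G x)) * (f y * (b \<bullet> G y))) = f x * f y * (G x \<bullet> G y)"
   unfolding euclidean_inner[of "G x" "G y"] sum_distrib_left by (intro sum.cong) (auto simp: inner_commute mult_ac)
  have main: "f x * f y * (p x * p y - G x \<bullet> G y) \<le> (2 * r) powr ord * (indicator (ball z r) x * indicator (ball z r) y * ((p x * p y - G x \<bullet> G y) * kern (x - y)))"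
  proof (cases "x = y \<or> x \<notin> ball z r \<or> y \<notin> ball z r")
   case True
   have "f w = 0" if "w \<notin> ball z r" for w using fb[of w] that by simp
   then show ?thesis using True by (auto simp: power2_norm_eq_inner[symmetric] power2_eq_square)
  next
   case False
   then have "norm (x - z) < r" "norm (y - z) < r" by (auto simp: dist_norm norm_minus_commute)
   then have "norm (x - y) \<le> 2 * r" using norm_triangle_ineq4[of "x - z" "y - z"] by simp
   then have "(2 * r) powr -ord \<le> kern (x - y)" using kern_ge[of "x - y" "2 * r"] False by (simp add: ord_def dimr_def)
   then have "(2 * r) powr ord * (2 * r) powr -ord \<le> (2 * r) powr ord * kern (x - y)" by (intro mult_left_mono) auto
   moreover have "(2 * r) powr ord * (2 * r) powr -ord = 1" using r by (simp flip: powr_add)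
   ultimately have k: "1 \<le> (2 * r) powr ord * kern (x - y)" by simp
   have "f x * f y \<le> 1 * 1" using fb[of x] fb[of y] False by (intro mult_mono) auto
   then have "f x * f y \<le> (2 * r) powr ord * kern (x - y)" using k by linarith
   then have "f x * f y * (p x * p y - G x \<bullet> G y) \<le> ((2 * r) powr ord * kern (x - y)) * (p x * p y - G x \<bullet> G y)"
    using defect_nonneg by (intro mult_right_mono)
   then show ?thesis using False by (simp add: mult_ac)
  qed
  then show "?D q \<le> (2 * r) powr ord * (indicator (ball z r) (fst q) * indicator (ball z r) (snd q) * ((p (fst q) * p (snd q) - G (fst q) \<bullet> G (snd q)) * pkern q))"
   unfolding q fst_conv snd_conv e by (simp add: algebra_simps)
 qed
 then show ?thesis unfolding vD by (simp add: EB_def)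
qed

lemma norm_sq_sum: "(\<Sum>b\<in>Basis. (b \<bullet> z)^2) = (norm z)^2" for z :: 'a
 by (subst power2_norm_eq_inner, subst euclidean_inner) (simp add: power2_eq_square inner_commute)

lemma ball_defect:
 assumes r: "0 < r"
 shows "(bint p z r)^2 - (norm (flux z r))^2 \<le> (2 * r) powr ord * EB z r"
proof -
 have i: "integrable lborel (%x. indicator (ball z r) x * g x)" if "bmeas g" for g :: "'a => real"
  using bint_integrable[OF that, of z r] by (simp add: mult.commute)
 have "(LBINT x. indicator (ball z r) x * p x)^2 - (\<Sum>b\<in>Basis. (LBINT x. indicator (ball z r) x * (b \<bullet> G x))^2) \<le> (2 * r) powr ord * EB z r"
  using r by (intro weighted_defect integrable_indicator_ball i bmeas_p bmeas_dir) auto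
 moreover have "(\<Sum>b\<in>Basis. (LBINT x. indicator (ball z r) x * (b \<bullet> G x))^2) = (norm (flux z r))^2"
  unfolding norm_sq_sum[symmetric] flux_inner bint_def by (simp add: mult.commute)
 ultimately show ?thesis by (simp add: bint_def mult.commute)
qed

lemma two_dim_concentration:
 assumes n: "dimr = 2" and R: "0 < R"
 shows "bint p 0 R \<le> norm (flux 0 R)"
proof -
 define K where "K = Cp * Cm * 2 powr (dimr - 1)"
 have "(bint p 0 R)^2 - (norm (flux 0 R))^2 \<le> (2 * R) powr ord * (K * (R + real j) powr -s)" for j :: nat
 proof -
  have "EB 0 R \<le> EB 0 (R + real j)" by (rule EB_mono) auto
  also have "... \<le> K * (R + real j) powr -s" using EB_bound[of "R + real j" 0] R n by (simp add: K_def)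
  finally show ?thesis using ball_defect[OF R, of 0] mult_left_mono[of "EB 0 R" _ "(2 * R) powr ord"] by fastforce
 qed
 moreover have "(%j. (2 * R) powr ord * (K * (R + real j) powr -s)) \<longlonglongrightarrow> (2 * R) powr ord * (K * 0)"
 proof (intro tendsto_intros tendsto_neg_powr)
  show "- s < 0" using s_pos by simp
  show "filterlim (%j. R + real j) at_top sequentially"
   by (rule filterlim_tendsto_add_at_top[OF tendsto_const filterlim_real_sequentially])
 qed
 ultimately have "(bint p 0 R)^2 - (norm (flux 0 R))^2 \<le> 0" by (intro LIMSEQ_le_const) auto
 then have "(bint p 0 R)^2 \<le> (norm (flux 0 R))^2" by simp
 then show ?thesis by (rule power2_le_imp_le) simp
qed

end

context layer
begin

text \<open>The translation is divided into m + 1 steps, each replaced by its Taylor polynomial; the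
  total error is of order h^2/m. The majorant g is left open: it is e.G itself if e is a direction
  of monotonicity, and p in general.\<close>

lemma translation_l1:
 fixes e z :: 'a
 assumes e: "norm e = 1" and g: "blip g" "\<And>x. \<bar>e \<bullet> G x\<bar> \<le> g x" and h: "0 < h" and r: "0 < r"
 shows "bint (%x. \<bar>u (x + h *\<^sub>R e) - u x\<bar>) z r \<le> h * bint g z (r + h)"
proof -
 have g0: "0 \<le> g x" for x using g(2)[of x] by linarith
 have b3: "bmeas (%x. \<bar>u (x + d) - u x\<bar>)" for d
  by (intro bmeas_abs bmeas_diff bmeas_u blip_bmeas[OF blip_translate] blip_u)
 define V where "V = unit_ball_vol (DIM('a)) * r ^ DIM('a)"
 have "bint (%x. \<bar>u (x + h *\<^sub>R e) - u x\<bar>) z r \<le> h * bint g z (r + h) + \<Lambda> * h^2 * V / real (Suc m)" for m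
 proof -
  define \<tau> where "\<tau> = h / real (Suc m)"
  have \<tau>: "0 < \<tau>" using h by (simp add: \<tau>_def)
  have i\<tau>: "real i * \<tau> \<le> h" if "i \<le> Suc m" for i
  proof -
   have "real i * \<tau> \<le> real (Suc m) * \<tau>" using that \<tau> by (intro mult_right_mono) auto
   then show ?thesis by (simp add: \<tau>_def)
  qed
  have step: "bint (%x. \<bar>u (x + (real i * \<tau>) *\<^sub>R e) - u x\<bar>) z r \<le> real i * (\<tau> * bint g z (r + h) + \<Lambda> * \<tau>^2 * V)" if "i \<le> Suc m" for i
   using that
  proof (induction i)
   case 0 then show ?case by (simp add: bint_def)
  next
   case (Suc i)
   define c where "c = (real i * \<tau>) *\<^sub>R e"
   have c: "norm c \<le> h" using i\<tau>[of i] Suc.prems \<tau> e by (simp add: c_def)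
   have e1: "(real (Suc i) * \<tau>) *\<^sub>R e = c + \<tau> *\<^sub>R e" by (simp add: c_def algebra_simps)
   have pt: "\<bar>u (x + (c + \<tau> *\<^sub>R e)) - u x\<bar> \<le> (\<tau> * g (x + c) + \<Lambda> * \<tau>^2) + \<bar>u (x + c) - u x\<bar>" for x
   proof -
    have "\<bar>u (x + c + \<tau> *\<^sub>R e) - u (x + c) - \<tau> * (e \<bullet> G (x + c))\<bar> \<le> \<Lambda> * \<tau>^2"
     using taylor[of "x + c" "\<tau> *\<^sub>R e"] e by (simp add: inner_commute)
    moreover have "\<bar>\<tau> * (e \<bullet> G (x + c))\<bar> \<le> \<tau> * g (x + c)" using g(2)[of "x + c"] \<tau> by (simp add: abs_mult)
    ultimately show ?thesis by (simp add: add.assoc)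
   qed
   have b1: "bmeas (%x. \<tau> * g (x + c))" by (intro blip_bmeas blip_mult blip_const blip_translate g)
   have b2: "bmeas (%x. \<tau> * g (x + c) + \<Lambda> * \<tau>^2)" by (intro blip_bmeas blip_add blip_mult blip_const blip_translate g)
   have "bint (%x. \<bar>u (x + (c + \<tau> *\<^sub>R e)) - u x\<bar>) z r \<le> bint (%x. (\<tau> * g (x + c) + \<Lambda> * \<tau>^2) + \<bar>u (x + c) - u x\<bar>) z r"
    by (intro bint_mono b3 pt bmeas_add b2)
   also have "... = \<tau> * bint (%x. g (x + c)) z r + \<Lambda> * \<tau>^2 * V + bint (%x. \<bar>u (x + c) - u x\<bar>) z r"
    unfolding bint_add[OF b2 b3] bint_add[OF b1 bmeas_const] bint_cmult using r by (simp add: bint_const V_def)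
   also have "bint (%x. g (x + c)) z r = bint g (z + c) r" by (rule bint_translate[OF blip_bmeas[OF g(1)]])
   also have "\<tau> * bint g (z + c) r \<le> \<tau> * bint g z (r + h)"
   proof (intro mult_left_mono bint_subset blip_bmeas g(1) g0)
    show "ball (z + c) r \<subseteq> ball z (r + h)"
    proof
     fix x assume "x \<in> ball (z + c) r"
     then show "x \<in> ball z (r + h)" using c dist_triangle[of z x "z + c"] by (simp add: dist_norm)
    qed
   qed (use \<tau> in auto)
   finally show ?case using Suc unfolding e1 c_def by (simp add: algebra_simps)
  qed
  have "real (Suc m) * \<tau> = h" by (simp add: \<tau>_def)
  then have "bint (%x. \<bar>u (x + h *\<^sub>R e) - u x\<bar>) z r \<le> real (Suc m) * (\<tau> * bint g z (r + h) + \<Lambda> * \<tau>^2 * V)" using step[OF order_refl] by (simp only:)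
  also have "... = h * bint g z (r + h) + \<Lambda> * h^2 * V / real (Suc m)"
  proof -
   have ar: "N * (h / N * X + L * (h / N)^2 * V) = h * X + L * h^2 * V / N" if "N \<noteq> 0" for N X L :: real
    using that by (simp add: field_simps power2_eq_square)
   show ?thesis unfolding \<tau>_def by (rule ar) simp
  qed
  finally show ?thesis .
 qed
 moreover have "(%m. h * bint g z (r + h) + \<Lambda> * h^2 * V / real (Suc m)) \<longlonglongrightarrow> h * bint g z (r + h) + 0"
  by (intro tendsto_add tendsto_const LIMSEQ_Suc[OF lim_const_over_n[of "\<Lambda> * h^2 * V"]])
 ultimately show ?thesis by (intro LIMSEQ_le_const) auto
qed

end

section \<open>One-sided minimality\<close>

lemma blip_support_integrable:
 assumes "blip g" "\<And>x. R \<le> norm x ==> g x = 0" shows "integrable lborel g"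
proof -
 have "g = (%x. g x * indicator (ball 0 R) x)" using assms(2) by (intro ext) (auto simp: not_less[symmetric] split: split_indicator)
 then show ?thesis using bint_integrable[OF blip_bmeas[OF assms(1)], of 0 R] by simp
qed

lemma blip_min: "blip f ==> blip g ==> blip (%x. min (f x) (g x))"
proof -
 assume "blip f" "blip g"
 then have "blip (%x. f x - max 0 (f x - g x))" by (intro blip_diff blip_pos)
 moreover have "(%x. f x - max 0 (f x - g x)) = (%x. min (f x) (g x))" by (auto simp: min_def)
 ultimately show ?thesis by simp
qed

context frac_order
begin

lemma Lop_add:
 assumes "blip v" "blip w" shows "Lop (%x. v x + w x) x = Lop v x + Lop w x"
proof -
 have "Lop (%x. v x + w x) x = (LBINT z. (v x - v (x + z)) * kern z + (w x - w (x + z)) * kern z)"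
  unfolding Lop_def by (intro Lintegral_cong) (auto simp: algebra_simps)
 also have "... = Lop v x + Lop w x" unfolding Lop_def
  using blip_lint[OF assms(1)] blip_lint[OF assms(2)] by (intro Lintegral_add) (auto simp: lint_def)
 finally show ?thesis .
qed

lemma Lop_mono:
 assumes "blip v" "blip w" "\<And>y. v y \<le> w y" "v x = w x" shows "Lop w x \<le> Lop v x"
 unfolding Lop_def
proof (rule integral_mono)
 show "integrable lborel (%z. (w x - w (x + z)) * kern z)" "integrable lborel (%z. (v x - v (x + z)) * kern z)"
  using blip_lint[OF assms(1)] blip_lint[OF assms(2)] by (auto simp: lint_def)
 show "(w x - w (x + z)) * kern z \<le> (v x - v (x + z)) * kern z" for z
  using assms(3)[of "x + z"] assms(4) by (intro mult_right_mono) auto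
qed

end

text \<open>The double-well potential: its derivative is minus the right-hand side of the
  equation.\<close>

definition pot :: "real => real" where "pot t = (1 - t^2)^2 / 4"

lemma pot_nonneg: "0 \<le> pot t" by (simp add: pot_def)

text \<open>The second derivative of the potential is at least -1, so it lies above its tangent up
  to d^2/2.\<close>

lemma pot_semiconvex: "- (d^2) / 2 \<le> pot (a + d) - pot a + d * (a - a^3)"
proof -
 have "pot (a + d) - pot a + d * (a - a^3) = d^2 * ((2 * a + d)^2 + 2 * a^2) / 4 - d^2 / 2"
  unfolding pot_def by (simp add: field_simps power2_eq_square power3_eq_cube)
 moreover have "0 \<le> d^2 * ((2 * a + d)^2 + 2 * a^2) / 4" by simp
 ultimately show ?thesis by linarith
qed

lemma blip_pot: "blip f ==> blip (%x. pot (f x))"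
 unfolding pot_def divide_inverse by (intro blip_mult blip_power2 blip_diff blip_const)

context layer
begin

text \<open>The energy of u + d minus that of u, for the energy with one quarter of the quadratic
  form plus the potential. Both energies are infinite in general; the cross term of the form has
  been replaced by its value from the equation, which leaves only integrals over the support of
  d.\<close>

definition gain :: "('a => real) => real" where
 "gain d = (LBINT x. d x * (u x - u x ^ 3)) + (\<integral>q. (d (fst q) - d (snd q))^2 * pkern q \<partial>PP) / 4
   + (LBINT x. pot (u x + d x) - pot (u x))"

lemma blip_force: "blip w ==> blip (%x. w x - w x ^ 3)"
 unfolding power3_eq_cube by (intro blip_diff blip_mult)

text \<open>Expansion around u + d: the first-order term is nonnegative because \<delta> lives where
  u + d is a supersolution, the quadratic form of \<delta> is nonnegative, and the potential loses
  at most \<delta>^2/2 by \<open>pot_semiconvex\<close>.\<close>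

lemma gain_step:
 assumes d: "blip d" "\<And>x. R \<le> norm x ==> d x = 0" and \<delta>: "blip \<delta>" "\<And>x. R \<le> norm x ==> \<delta> x = 0" "\<And>x. 0 \<le> \<delta> x"
  and super: "\<And>x. 0 < \<delta> x ==> (u x + d x) - (u x + d x)^3 \<le> Lop (%x. u x + d x) x"
 shows "gain d - (LBINT x. \<delta> x ^ 2) / 2 \<le> gain (%x. d x + \<delta> x)"
proof -
 let ?w = "%x. u x + d x"
 have w: "blip ?w" by (intro blip_add blip_u d)
 have i1: "integrable lborel (%x. g x * (u x - u x ^ 3))" if "blip g" "\<And>x. R \<le> norm x ==> g x = 0" for g
  using that by (intro blip_support_integrable[of _ R] blip_mult blip_force blip_u) auto
 have e1: "(LBINT x. (d x + \<delta> x) * (u x - u x ^ 3)) = (LBINT x. d x * (u x - u x ^ 3)) + (LBINT x. \<delta> x * (u x - u x ^ 3))"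
  unfolding distrib_right by (intro Lintegral_add i1 d \<delta>)
 note w1 = weak_form[OF d(1) d] and w2 = weak_form[OF d(1) \<delta>(1,2)] and w3 = weak_form[OF \<delta>(1) \<delta>(1,2)]
 have "(\<integral>q. ((d (fst q) + \<delta> (fst q)) - (d (snd q) + \<delta> (snd q)))^2 * pkern q \<partial>PP)
  = (\<integral>q. (d (fst q) - d (snd q)) * (d (fst q) - d (snd q)) * pkern q
    + 2 * ((d (fst q) - d (snd q)) * (\<delta> (fst q) - \<delta> (snd q)) * pkern q)
    + (\<delta> (fst q) - \<delta> (snd q)) * (\<delta> (fst q) - \<delta> (snd q)) * pkern q \<partial>PP)"
  by (intro Lintegral_cong) (auto simp: algebra_simps power2_eq_square)
 also have "... = (\<integral>q. (d (fst q) - d (snd q)) * (d (fst q) - d (snd q)) * pkern q \<partial>PP)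
    + 2 * (\<integral>q. (d (fst q) - d (snd q)) * (\<delta> (fst q) - \<delta> (snd q)) * pkern q \<partial>PP)
    + (\<integral>q. (\<delta> (fst q) - \<delta> (snd q)) * (\<delta> (fst q) - \<delta> (snd q)) * pkern q \<partial>PP)"
  using w1(1) w2(1) w3(1) by simp
 also have "(\<integral>q. (d (fst q) - d (snd q)) * (\<delta> (fst q) - \<delta> (snd q)) * pkern q \<partial>PP) = 2 * (LBINT x. \<delta> x * Lop d x)" by (rule w2(2))
 finally have e2: "(\<integral>q. ((d (fst q) + \<delta> (fst q)) - (d (snd q) + \<delta> (snd q)))^2 * pkern q \<partial>PP)
  \<ge> (\<integral>q. (d (fst q) - d (snd q))^2 * pkern q \<partial>PP) + 4 * (LBINT x. \<delta> x * Lop d x)"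
 proof -
  assume a: "(\<integral>q. ((d (fst q) + \<delta> (fst q)) - (d (snd q) + \<delta> (snd q)))^2 * pkern q \<partial>PP) =
   (\<integral>q. (d (fst q) - d (snd q)) * (d (fst q) - d (snd q)) * pkern q \<partial>PP) + 2 * (2 * (LBINT x. \<delta> x * Lop d x))
    + (\<integral>q. (\<delta> (fst q) - \<delta> (snd q)) * (\<delta> (fst q) - \<delta> (snd q)) * pkern q \<partial>PP)"
  have "0 \<le> (\<integral>q. (\<delta> (fst q) - \<delta> (snd q)) * (\<delta> (fst q) - \<delta> (snd q)) * pkern q \<partial>PP)"
   by (intro Lintegral_nonneg) auto
  then show ?thesis using a by (simp add: power2_eq_square)
 qed
 have ip: "integrable lborel (%x. pot (u x + d x) - pot (u x))"
  using d(2) by (intro blip_support_integrable[of _ R] blip_diff blip_pot blip_add blip_u d) auto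
 have iq: "integrable lborel (%x. pot (?w x + \<delta> x) - pot (?w x))"
  using \<delta>(2) by (intro blip_support_integrable[of _ R] blip_diff blip_pot blip_add blip_u d \<delta>) auto
 have "(LBINT x. pot (u x + (d x + \<delta> x)) - pot (u x)) = (LBINT x. (pot (?w x + \<delta> x) - pot (?w x)) + (pot (u x + d x) - pot (u x)))"
  by (intro Lintegral_cong) (auto simp: add.assoc)
 also have "... = (LBINT x. pot (?w x + \<delta> x) - pot (?w x)) + (LBINT x. pot (u x + d x) - pot (u x))"
  by (intro Lintegral_add ip iq)
 finally have e3: "(LBINT x. pot (u x + (d x + \<delta> x)) - pot (u x)) = (LBINT x. pot (?w x + \<delta> x) - pot (?w x)) + (LBINT x. pot (u x + d x) - pot (u x))" .
 have i2: "integrable lborel (%x. \<delta> x ^ 2)" using \<delta> by (intro blip_support_integrable[of _ R] blip_power2) auto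
 have "(LBINT x. - (\<delta> x ^ 2) / 2) \<le> (LBINT x. \<delta> x * (u x - u x ^ 3) + \<delta> x * Lop d x + (pot (?w x + \<delta> x) - pot (?w x)))"
 proof (intro integral_mono Lintegrable_add i1 \<delta> w2(3) iq)
  show "integrable lborel (%x. - (\<delta> x ^ 2) / 2)" using i2 by simp
  fix x
  have "\<delta> x * (?w x - ?w x ^ 3) \<le> \<delta> x * (u x - u x ^ 3) + \<delta> x * Lop d x"
  proof (cases "\<delta> x = 0")
   case False
   then have "0 < \<delta> x" using \<delta>(3)[of x] by simp
   from super[OF this] have "?w x - ?w x ^ 3 \<le> (u x - u x ^ 3) + Lop d x" unfolding Lop_add[OF blip_u d(1)] u_eq .
   then show ?thesis using \<delta>(3)[of x] by (simp flip: distrib_left add: mult_left_mono)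
  qed simp
  then show "- (\<delta> x ^ 2) / 2 \<le> \<delta> x * (u x - u x ^ 3) + \<delta> x * Lop d x + (pot (?w x + \<delta> x) - pot (?w x))"
   using pot_semiconvex[of "\<delta> x" "?w x"] by linarith
 qed
 also have "... = (LBINT x. \<delta> x * (u x - u x ^ 3)) + (LBINT x. \<delta> x * Lop d x) + (LBINT x. pot (?w x + \<delta> x) - pot (?w x))"
  using i1[OF \<delta>(1,2)] w2(3) iq by simp
 finally have "- (LBINT x. \<delta> x ^ 2) / 2 \<le> ..." by simp
 then show ?thesis unfolding gain_def e1 e3 using e2 by simp
qed

text \<open>Dini's argument: the limits at +\<infinity> are approached monotonically, so on a
  compact ball one shift serves all points.\<close>

lemma uniform_shift_ex:
 assumes "0 < \<kappa>" shows "\<exists>T\<ge>0. \<forall>x\<in>cball 0 R. 1 - \<kappa> < u (x + T *\<^sub>R e0)"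
proof -
 define U where "U n = {x. 1 - \<kappa> < u (x + real n *\<^sub>R e0)}" for n
 have U: "open (U n)" for n
  unfolding U_def by (intro open_Collect_less continuous_on_const blip_continuous blip_translate blip_u)
 have "cball 0 R \<subseteq> (\<Union>n. U n)"
 proof
  fix x :: 'a
  have "\<forall>\<^sub>F t in at_top. 1 - \<kappa> < u (x + t *\<^sub>R e0)" using order_tendstoD(1)[OF u_top[of x], of "1 - \<kappa>"] assms by simp
  then obtain t where t: "\<And>r. t \<le> r ==> 1 - \<kappa> < u (x + r *\<^sub>R e0)" by (auto simp: eventually_at_top_linorder)
  obtain n where "t \<le> real n" using real_arch_simple by blast
  then show "x \<in> (\<Union>n. U n)" using t by (auto simp: U_def)
 qed
 then obtain I where I: "finite I" "cball 0 R \<subseteq> (\<Union>n\<in>I. U n)"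
  using compactE_image[OF compact_cball, of UNIV U 0 R] U by (metis subset_UNIV)
 show ?thesis
 proof (intro exI[of _ "real (Max (insert 0 I))"] conjI ballI)
  fix x :: 'a assume "x \<in> cball 0 R"
  then obtain n where n: "n \<in> I" "1 - \<kappa> < u (x + real n *\<^sub>R e0)" using I by (auto simp: U_def)
  have "real n \<le> real (Max (insert 0 I))" using n I by simp
  from u_mono[OF this, of x] n show "1 - \<kappa> < u (x + real (Max (insert 0 I)) *\<^sub>R e0)" by linarith
 qed simp
qed

text \<open>Truncating a competitor \<open>v\<close> by the foliation \<open>u (x + t e0)\<close> connects \<open>u\<close> to \<open>v\<close>; along each small step of this
 path the energy decreases at most quadratically in the step size.\<close>

lemma gain_nonneg:
 assumes d: "blip d" "\<And>x. R \<le> norm x ==> d x = 0" "\<And>x. 0 \<le> d x" and \<kappa>: "0 < \<kappa>" "\<And>x. d x \<noteq> 0 ==> u x + d x \<le> 1 - \<kappa>"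
 shows "0 \<le> gain d"
proof -
 obtain T where T: "0 \<le> T" "\<And>x. x \<in> cball 0 R ==> 1 - \<kappa> < u (x + T *\<^sub>R e0)" using uniform_shift_ex[OF \<kappa>(1)] by blast
 define D where "D t x = min (u x + d x) (u (x + t *\<^sub>R e0)) - u x" for t x
 define V where "V = bint (%x. 1) (0::'a) R"
 have D: "blip (D t)" for t unfolding D_def by (intro blip_diff blip_min blip_add blip_u d blip_translate)
 have van: "D t x = 0" if "0 \<le> t" "R \<le> norm x" for t x
  using u_mono[of 0 t x] d(2)[OF that(2)] that(1) by (simp add: D_def)
 have step: "gain (D t) - \<Lambda>^2 * h^2 * V / 2 \<le> gain (D (t + h))" if t: "0 \<le> t" "0 \<le> h" for t h
 proof -
  define \<delta> where "\<delta> x = D (t + h) x - D t x" for x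
  have m: "u (x + t *\<^sub>R e0) \<le> u (x + (t + h) *\<^sub>R e0)" for x using t by (intro u_mono) simp
  have \<delta>: "blip \<delta>" "\<And>x. R \<le> norm x ==> \<delta> x = 0" "\<And>x. 0 \<le> \<delta> x"
  proof -
   show "blip \<delta>" unfolding \<delta>_def by (intro blip_diff D)
   show "R \<le> norm x ==> \<delta> x = 0" for x using van t by (simp add: \<delta>_def)
   show "0 \<le> \<delta> x" for x using m[of x] by (simp add: \<delta>_def D_def)
  qed
  have \<delta>le: "\<delta> x \<le> \<Lambda> * h" for x
  proof -
   have "u (x + (t + h) *\<^sub>R e0) - u (x + t *\<^sub>R e0) \<le> \<Lambda> * h"
    using u_lip[of "x + (t + h) *\<^sub>R e0" "x + t *\<^sub>R e0"] e0_unit t by (simp add: scaleR_add_left)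
   then show ?thesis using m[of x] by (simp add: \<delta>_def D_def min_def)
  qed
  have "gain (D t) - (LBINT x. \<delta> x ^ 2) / 2 \<le> gain (%x. D t x + \<delta> x)"
  proof (rule gain_step[where R = R])
   \<comment> \<open>Where the truncation can still grow, u + D t coincides with the leaf u (x + t
     e0), and it lies below that leaf everywhere. Touching a solution from below makes it a
     supersolution at x.\<close>
   fix x assume "0 < \<delta> x"
   then have e: "u x + D t x = u (x + t *\<^sub>R e0)" by (auto simp: \<delta>_def D_def min_def split: if_splits)
   have "Lop (%x. u (x + t *\<^sub>R e0)) x = Lop u (x + t *\<^sub>R e0)" unfolding Lop_def by (simp add: add_ac)
   then have "u (x + t *\<^sub>R e0) - u (x + t *\<^sub>R e0)^3 = Lop (%x. u (x + t *\<^sub>R e0)) x" by (simp add: u_eq)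
   also have "... \<le> Lop (%x. u x + D t x) x"
    using e by (intro Lop_mono blip_add blip_translate blip_u D) (auto simp: D_def)
   finally show "(u x + D t x) - (u x + D t x)^3 \<le> Lop (%x. u x + D t x) x" unfolding e .
  qed (use D van t \<delta> in auto)
  moreover have "(LBINT x. \<delta> x ^ 2) \<le> \<Lambda>^2 * h^2 * V"
  proof -
   have "(LBINT x. \<delta> x ^ 2) \<le> (LBINT x. (\<Lambda> * h)^2 * indicator (ball (0::'a) R) x)"
   proof (rule integral_mono)
    show "integrable lborel (%x. \<delta> x ^ 2)" using \<delta> by (intro blip_support_integrable[of _ R] blip_power2) auto
    show "integrable lborel (%x. (\<Lambda> * h)^2 * indicator (ball (0::'a) R) x)" by (intro integrable_mult_right integrable_indicator_ball)
    show "\<delta> x ^ 2 \<le> (\<Lambda> * h)^2 * indicator (ball 0 R) x" for x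
     using power_mono[OF \<delta>le[of x] \<delta>(3)[of x], of 2] \<delta>(2)[of x] by (cases "R \<le> norm x") auto
   qed
   also have "... = \<Lambda>^2 * h^2 * V" unfolding V_def bint_def by (simp add: power_mult_distrib)
   finally show ?thesis .
  qed
  ultimately show ?thesis by (simp add: \<delta>_def)
 qed
 have "- (\<Lambda>^2 * T^2 * V / 2) / real (Suc m) \<le> gain d" for m
 proof -
  define h where "h = T / real (Suc m)"
  have h: "0 \<le> h" using T by (simp add: h_def)
  have it: "- (real i * (\<Lambda>^2 * h^2 * V / 2)) \<le> gain (D (real i * h))" for i
  proof (induction i)
   case 0
   have "D 0 x = 0" for x using d(3)[of x] by (simp add: D_def)
   then have "D 0 = (%x. 0)" by blast
   then show ?case by (simp add: gain_def)
  next
   case (Suc i)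
   have "gain (D (real i * h)) - \<Lambda>^2 * h^2 * V / 2 \<le> gain (D (real i * h + h))" using h by (intro step) auto
   moreover have "real i * h + h = real (Suc i) * h" by (simp add: algebra_simps)
   ultimately have "gain (D (real i * h)) - \<Lambda>^2 * h^2 * V / 2 \<le> gain (D (real (Suc i) * h))" by simp
   moreover have "real (Suc i) * (\<Lambda>^2 * h^2 * V / 2) = real i * (\<Lambda>^2 * h^2 * V / 2) + \<Lambda>^2 * h^2 * V / 2" by (simp add: algebra_simps)
   ultimately show ?case using Suc by linarith
  qed
  \<comment> \<open>m + 1 steps, each losing a multiple of (T/(m+1))^2, lose O(1/m) in
    total.\<close>
  have "real (Suc m) * h = T" by (simp add: h_def)
  moreover have "D T = d"
  proof
   fix x
   show "D T x = d x"
   proof (cases "d x = 0")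
    case True then show ?thesis using u_mono[OF T(1), of x] by (simp add: D_def)
   next
    case False
    then have "norm x < R" using d(2)[of x] by force
    then show ?thesis using T(2)[of x] \<kappa>(2)[OF False] by (simp add: D_def)
   qed
  qed
  ultimately have "- (real (Suc m) * (\<Lambda>^2 * h^2 * V / 2)) \<le> gain d" using it[of "Suc m"] by (simp only:)
  moreover have "N * (\<Lambda>^2 * (T / N)^2 * V / 2) = (\<Lambda>^2 * T^2 * V / 2) / N" if "N \<noteq> 0" for N using that by (simp add: field_simps power2_eq_square)
  ultimately show ?thesis unfolding h_def by (metis minus_divide_left of_nat_0_eq_iff nat.distinct(1))
 qed
 moreover have "(%m. - (\<Lambda>^2 * T^2 * V / 2) / real (Suc m)) \<longlonglongrightarrow> 0"
  by (intro LIMSEQ_Suc[OF lim_const_over_n])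
 ultimately show ?thesis by (intro LIMSEQ_le_const2) auto
qed

text \<open>The competitor is the maximum of u and \<psi>. Writing the first-order term of
  \<open>gain\<close> with the operator of the competitor instead of that of u changes the sign of
  the quadratic form from +1/4 to -1/4; nonnegativity of the gain thus becomes an upper bound for
  the form.\<close>

lemma barrier_energy:
 assumes \<psi>: "blip \<psi>" "\<And>x. R \<le> norm x ==> \<psi> x \<le> -1" and \<kappa>: "0 < \<kappa>" "\<And>x. \<psi> x \<le> 1 - \<kappa>"
 defines "d \<equiv> %x. max 0 (\<psi> x - u x)"
 shows "integrable lborel (%x. d x * Lop (%x. u x + d x) x + (pot (u x + d x) - pot (u x)))"
  and "(\<integral>q. (d (fst q) - d (snd q))^2 * pkern q \<partial>PP) / 4 \<le> (LBINT x. d x * Lop (%x. u x + d x) x + (pot (u x + d x) - pot (u x)))"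
  and "integrable PP (%q. (d (fst q) - d (snd q))^2 * pkern q)"
proof -
 have d: "blip d" "\<And>x. 0 \<le> d x" unfolding d_def by (auto intro!: blip_pos blip_diff \<psi> blip_u)
 have van: "d x = 0" if "R \<le> norm x" for x using \<psi>(2)[OF that] u_gt_m1[of x] by (simp add: d_def)
 have g: "0 \<le> gain d"
 proof (rule gain_nonneg[OF d(1) van d(2) \<kappa>(1)])
  show "u x + d x \<le> 1 - \<kappa>" if "d x \<noteq> 0" for x using that \<kappa>(2)[of x] by (auto simp: d_def max_def split: if_splits)
 qed
 note w1 = weak_form[OF d(1) d(1) van] and w2 = weak_form[OF blip_u d(1) van] and w3 = weak_form[OF blip_add[OF blip_u d(1)] d(1) van]
 have ip: "integrable lborel (%x. pot (u x + d x) - pot (u x))"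
  using van by (intro blip_support_integrable[of _ R] blip_diff blip_pot blip_add blip_u d) auto
 show "integrable lborel (%x. d x * Lop (%x. u x + d x) x + (pot (u x + d x) - pot (u x)))"
  by (intro Lintegrable_add w3 ip)
 show "integrable PP (%q. (d (fst q) - d (snd q))^2 * pkern q)" using w1(1) by (simp add: power2_eq_square)
 have "(LBINT x. d x * Lop (%x. u x + d x) x) = (LBINT x. d x * Lop u x) + (LBINT x. d x * Lop d x)"
  unfolding Lop_add[OF blip_u d(1)] distrib_left by (intro Lintegral_add w1 w2)
 moreover have "(LBINT x. d x * Lop u x) = (LBINT x. d x * (u x - u x ^ 3))" by (simp add: u_eq)
 moreover have "(\<integral>q. (d (fst q) - d (snd q))^2 * pkern q \<partial>PP) = 2 * (LBINT x. d x * Lop d x)"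
  using w1(2) by (simp add: power2_eq_square)
 ultimately show "(\<integral>q. (d (fst q) - d (snd q))^2 * pkern q \<partial>PP) / 4 \<le> (LBINT x. d x * Lop (%x. u x + d x) x + (pot (u x + d x) - pot (u x)))"
  using g unfolding gain_def by (simp add: Lintegral_add[OF w3(3) ip])
qed

end

section \<open>Density estimates\<close>

text \<open>Comparison with the integral of r^(-s), finite at 0 since s < 1; a shift only removes
  terms or makes them smaller.\<close>

lemma sum_powr_shift_le:
 fixes s a :: real
 assumes s: "0 < s" "s < 1"
 shows "(\<Sum>i<N. if a < real i then (1 + (real i - a)) powr -s else 0) \<le> real N powr (1 - s) / (1 - s)"
proof -
 have base: "(\<Sum>i<N. (1 + real i) powr -s) \<le> real N powr (1 - s) / (1 - s)" for N
 proof (induction N)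
  case (Suc N)
  have "(1 - s) * (1 + real N) powr -s \<le> real (Suc N) powr (1 - s) - real N powr (1 - s)"
  proof (cases "N = 0")
   case False
   have "\<exists>z. real N < z \<and> z < real (Suc N) \<and> real (Suc N) powr (1 - s) - real N powr (1 - s) = (real (Suc N) - real N) * ((1 - s) * z powr (1 - s - 1))"
    using False by (intro MVT2 has_real_derivative_powr) auto
   then obtain z where z: "real N < z" "z < real (Suc N)" "real (Suc N) powr (1 - s) - real N powr (1 - s) = (1 - s) * z powr (1 - s - 1)" by auto
   have "(1 + real N) powr -s \<le> z powr -s" using z False s by (intro powr_mono2') auto
   then show ?thesis using z s by simp
  qed (use s in auto)
  then have "(1 + real N) powr -s \<le> (real (Suc N) powr (1 - s) - real N powr (1 - s)) / (1 - s)" using s by (simp add: field_simps)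
  then show ?case using Suc by (simp add: diff_divide_distrib)
 qed simp
 show ?thesis
 proof (induction N arbitrary: a)
  case (Suc N)
  show ?case
  proof (cases "0 \<le> a")
   case True
   have "(\<Sum>i<Suc N. if a < real i then (1 + (real i - a)) powr -s else 0) = (\<Sum>i<N. if a - 1 < real i then (1 + (real i - (a - 1))) powr -s else 0)"
    unfolding sum.lessThan_Suc_shift using True by (simp add: algebra_simps less_diff_eq, intro sum.cong) (auto simp: algebra_simps)
   also have "... \<le> real N powr (1 - s) / (1 - s)" by (rule Suc)
   also have "... \<le> real (Suc N) powr (1 - s) / (1 - s)" using s by (intro divide_right_mono powr_mono2) auto
   finally show ?thesis .
  next
   case False
   have "(\<Sum>i<Suc N. if a < real i then (1 + (real i - a)) powr -s else 0) \<le> (\<Sum>i<Suc N. (1 + real i) powr -s)"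
    using False s by (intro sum_mono) (auto intro!: powr_mono2')
   then show ?thesis using base[of "Suc N"] by linarith
  qed
 qed simp
qed

text \<open>Raising u to 1 - \<tau> lowers the potential by at least (3/4) \<tau> per unit. What
  matters is that 3/4 exceeds the 1/2 with which the operator term enters
  \<open>barrier_inequality_ex\<close>.\<close>

lemma pot_near_one:
 fixes \<tau> u :: real
 assumes "1 / 2 \<le> u" "u < 1 - \<tau>" "0 \<le> \<tau>"
 shows "pot (1 - \<tau>) - pot u \<le> - (3 / 4) * \<tau> * (1 - \<tau> - u)"
proof -
 define w where "w = 1 - u"
 have w: "\<tau> < w" "w \<le> 1/2" "u = 1 - w" using assms by (auto simp: w_def)
 have e: "pot (1 - \<tau>) - pot u = - (((w - \<tau>) * (2 - w - \<tau>)) * (\<tau> * (2 - \<tau>) + w * (2 - w))) / 4"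
  unfolding w(3) pot_def by (simp add: field_simps power2_eq_square)
 have 1: "w - \<tau> \<le> (w - \<tau>) * (2 - w - \<tau>)" using w assms(3) mult_left_mono[of 1 "2 - w - \<tau>" "w - \<tau>"] by auto
 have "\<tau> * (3/2) \<le> \<tau> * (2 - \<tau>)" "\<tau> * (3/2) \<le> w * (2 - w)" using w assms(3) by (intro mult_left_mono mult_mono; simp)+
 then have 2: "3 * \<tau> \<le> \<tau> * (2 - \<tau>) + w * (2 - w)" by linarith
 have "(w - \<tau>) * (3 * \<tau>) \<le> ((w - \<tau>) * (2 - w - \<tau>)) * (\<tau> * (2 - \<tau>) + w * (2 - w))"
  using w assms(3) by (intro mult_mono[OF 1 2]) auto
 then have "pot (1 - \<tau>) - pot u \<le> - ((w - \<tau>) * (3 * \<tau>)) / 4" unfolding e by (intro divide_right_mono) simp_all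
 also have "... = - (3 / 4) * \<tau> * (1 - \<tau> - u)" by (simp add: w_def)
 finally show ?thesis .
qed

lemma pot_le_sq: "0 \<le> \<tau> ==> \<tau> \<le> 2 ==> pot (1 - \<tau>) \<le> 2 * \<tau>"
proof -
 assume a: "0 \<le> \<tau>" "\<tau> \<le> 2"
 have "pot (1 - \<tau>) = \<tau> * (\<tau> * (2 - \<tau>)^2) / 4" unfolding pot_def by (simp add: field_simps power2_eq_square)
 moreover have "\<tau> * (2 - \<tau>)^2 \<le> 2 * 2^2" using a by (intro mult_mono power_mono) auto
 then have "\<tau> * (\<tau> * (2 - \<tau>)^2) \<le> \<tau> * 8" using a by (intro mult_left_mono) auto
 ultimately show ?thesis by simp
qed

section \<open>A radial barrier\<close>

context layer
begin

text \<open>The size of the operator on a profile that varies on the length 1 + distance to the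
  sphere |x| = t. For A \<ge> 2 the barrier \<open>bar\<close> built from it is -1 outside the ball
  and close to 1 deep inside; \<open>bumped\<close> is the height by which it lifts u.\<close>

definition wgt :: "real => 'a => real" where "wgt t x = (1 + max 0 (t - norm x)) powr -s"
definition bar :: "real => real => 'a => real" where "bar A t x = max (-1) (1 - A * wgt t x)"
definition bumped :: "real => real => 'a => real" where "bumped A t x = max 0 (bar A t x - u x)"

lemma wgt_pos: "0 < wgt t x" "wgt t x \<le> 1"
 using s_pos powr_mono2'[of "-s" 1 "1 + max 0 (t - norm x)"] by (auto simp: wgt_def)

lemma blip_wgt: "blip (wgt t)"
proof (rule blipI)
 show "\<bar>wgt t x\<bar> \<le> 1" for x using wgt_pos[of t x] by simp
 show "\<bar>wgt t x - wgt t y\<bar> \<le> s * norm (x - y)" for x y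
 proof -
  have "\<bar>wgt t x - wgt t y\<bar> \<le> s * 1 powr -(s+1) * \<bar>(1 + max 0 (t - norm x)) - (1 + max 0 (t - norm y))\<bar>"
   unfolding wgt_def using s_pos by (intro powr_neg_lip) auto
  also have "... \<le> s * 1 powr -(s+1) * norm (x - y)"
   using s_pos norm_triangle_ineq3[of x y] by (intro mult_left_mono) (auto simp: max_def abs_if split: if_splits)
  finally show ?thesis by simp
 qed
qed

lemma blip_bar: "blip (bar A t)"
proof -
 have "blip (%x. max 0 ((1 - A * wgt t x) - (-1)) + (-1))" by (intro blip_add blip_pos blip_diff blip_mult blip_const blip_wgt)
 moreover have "(%x. max 0 ((1 - A * wgt t x) - (-1)) + (-1)) = bar A t" by (auto simp: bar_def max_def)
 ultimately show ?thesis by simp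
qed

lemma blip_bumped: "blip (bumped A t)"
 unfolding bumped_def by (intro blip_pos blip_diff blip_bar blip_u)

lemma bumped_pos:
 assumes "0 < bumped A t x"
 shows "bar A t x = 1 - A * wgt t x" "A * wgt t x < 2" "u x < bar A t x" "u x + bumped A t x = bar A t x"
 using assms u_gt_m1[of x] by (auto simp: bumped_def bar_def max_def split: if_splits)

lemma bumped_vanish: "2 \<le> A ==> t \<le> norm x ==> bumped A t x = 0"
 using u_gt_m1[of x] by (simp add: bumped_def bar_def wgt_def)

text \<open>Let q be 1 plus the depth of x in the ball and w = |x - y|/q. If w < 1/4, the weight
  grows at most by the factor 1 + 2w from x to y; otherwise the trivial bound 2 suffices. The
  estimate is one-sided since the truncation at -1 can only raise \<open>bar\<close> at y.\<close>

lemma bar_slope: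
 assumes A: "0 \<le> A" "A * wgt t x < 2"
 shows "bar A t x - bar A t y \<le> 2 * min 1 (4 / (1 + max 0 (t - norm x)) * norm (x - y))"
proof -
 define q where "q = 1 + max 0 (t - norm x)"
 have q: "1 \<le> q" by (simp add: q_def)
 show ?thesis
 proof (cases "q \<le> 4 * norm (x - y)")
  case True
  then have "1 \<le> 4 / q * norm (x - y)" using q by (simp add: field_simps)
  moreover have "0 \<le> A * wgt t x" using A wgt_pos[of t x] by simp
  then have "bar A t x - bar A t y \<le> 2" using A by (auto simp: bar_def max_def)
  ultimately show ?thesis by (simp add: q_def[symmetric] min_def)
 next
  case False
  define w where "w = norm (x - y) / q"
  have w: "0 \<le> w" "w < 1/4" "w * q = norm (x - y)" using False q by (auto simp: w_def field_simps)
  have "q * (1 - w) \<le> 1 + max 0 (t - norm y)"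
   using norm_triangle_ineq3[of x y] w by (auto simp: q_def max_def algebra_simps abs_if split: if_splits)
  then have "wgt t y \<le> (q * (1 - w)) powr -s" unfolding wgt_def using q w s_pos by (intro powr_mono2') auto
  also have "... = wgt t x * (1 - w) powr -s" using q w by (simp add: powr_mult wgt_def q_def)
  also have "(1 - w) powr -s \<le> (1 - w) powr -1" using w s_lt1 by (intro powr_mono') auto
  also have "(1 - w) powr -1 = 1 / (1 - w)" using w by (simp add: powr_minus_divide)
  also have "... \<le> 1 + 2 * w"
  proof -
   have "w * w \<le> (1/4) * w" using w by (intro mult_right_mono) auto
   then have "1 \<le> (1 + 2 * w) * (1 - w)" using w by (simp add: algebra_simps)
   then show ?thesis using w by (simp add: pos_divide_le_eq)
  qed
  finally have "A * wgt t y \<le> A * (wgt t x * (1 + 2 * w))" using A wgt_pos[of t x] by (intro mult_left_mono) auto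
  moreover have "(A * wgt t x) * (2 * w) \<le> 2 * (2 * w)" using A w by (intro mult_right_mono) auto
  ultimately have "A * wgt t y - A * wgt t x \<le> 4 * w" by (simp add: algebra_simps)
  moreover have "bar A t x - bar A t y \<le> max 0 (A * wgt t y - A * wgt t x)" using A(2) by (auto simp: bar_def max_def)
  ultimately have "bar A t x - bar A t y \<le> 4 * w" using w(1) by (auto simp: max_def split: if_splits)
  also have "... \<le> 2 * min 1 (4 / q * norm (x - y))" using w q by (auto simp: w_def min_def field_simps)
  finally show ?thesis by (simp add: q_def)
 qed
qed

text \<open>At a lifted point the competitor equals the barrier and lies above it elsewhere, so its
  operator is at most that of the barrier. With slope 4/q the truncated moment gives q^(-s), which
  is \<open>wgt\<close>.\<close>

lemma barrier_Lop_ex: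
 "\<exists>C>0. \<forall>A t x. 0 \<le> A \<longrightarrow> 0 < bumped A t x \<longrightarrow> Lop (%x. u x + bumped A t x) x \<le> C * wgt t x"
proof -
 obtain C where C: "C > 0" "\<And>l. 0 < l ==> (LBINT z. min 1 (l * norm (z::'a)) * kern z) \<le> C * l powr s"
  using kmin_integrable_ex[where 'a='a] by blast
 show ?thesis
 proof (intro exI[of _ "2 * C * 4 powr s"] conjI allI impI)
  fix A t :: real and x assume A: "0 \<le> A" and pos: "0 < bumped A t x"
  note b = bumped_pos[OF pos]
  define q where "q = 1 + max 0 (t - norm x)"
  have q: "1 \<le> q" by (simp add: q_def)
  have "Lop (%x. u x + bumped A t x) x \<le> (LBINT z. 2 * (min 1 (4 / q * norm (z::'a)) * kern z))"
   unfolding Lop_def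
  proof (rule integral_mono)
   show "integrable lborel (%z. (u x + bumped A t x - (u (x + z) + bumped A t (x + z))) * kern z)"
    using blip_lint[OF blip_add[OF blip_u blip_bumped], of A t x] by (simp add: lint_def)
   show "integrable lborel (%z. 2 * (min 1 (4 / q * norm z) * kern z))" using q by (intro integrable_mult_right kmin_integrable) simp
   fix z
   have "u x + bumped A t x - (u (x + z) + bumped A t (x + z)) \<le> bar A t x - bar A t (x + z)" unfolding b(4) by (simp add: bumped_def)
   also have "... \<le> 2 * min 1 (4 / q * norm z)" using bar_slope[OF A b(2), of "x + z"] by (simp add: q_def)
   finally show "(u x + bumped A t x - (u (x + z) + bumped A t (x + z))) * kern z \<le> 2 * (min 1 (4 / q * norm z) * kern z)"
    by (simp add: mult_right_mono flip: mult.assoc)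
  qed
  also have "... \<le> 2 * (C * (4 / q) powr s)" using C(2)[of "4 / q"] q by simp
  also have "(4 / q) powr s = 4 powr s * wgt t x" using q by (simp add: powr_divide wgt_def q_def powr_minus_divide)
  finally show "Lop (%x. u x + bumped A t x) x \<le> 2 * C * 4 powr s * wgt t x" by (simp add: mult_ac)
 qed (use C in auto)
qed

text \<open>Two readings of \<open>barrier_energy\<close>. Where u \<ge> 7/8 the potential drop
  outweighs the operator term, so only {u < 7/8} can pay for the interaction. Keeping the term - pot
  u instead bounds the potential on the lifted set.\<close>

lemma barrier_inequality_ex:
 "\<exists>A\<ge>2. \<forall>t>0. (\<integral>q. (bumped A t (fst q) - bumped A t (snd q))^2 * pkern q \<partial>PP) / 4
    \<le> 3 * A * bint (%x. wgt t x * indicator {x. u x < 7/8} x) 0 t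
   \<and> bint (%x. pot (u x) * indicator {x. 0 < bumped A t x} x) 0 t \<le> 3 * A * bint (wgt t) 0 t
   \<and> integrable PP (%q. (bumped A t (fst q) - bumped A t (snd q))^2 * pkern q)"
proof -
 obtain C where C: "C > 0" "\<And>A t x. 0 \<le> A ==> 0 < bumped A t x ==> Lop (%x. u x + bumped A t x) x \<le> C * wgt t x"
  using barrier_Lop_ex by blast
 \<comment> \<open>2C makes the operator term at most half of A wgt t x times the lift.\<close>
 define A where "A = max 2 (2 * C)"
 have A: "2 \<le> A" "C \<le> A / 2" by (auto simp: A_def)
 show ?thesis
 proof (intro exI[of _ A] conjI allI impI A)
  fix t :: real assume t: "0 < t"
  let ?d = "bumped A t"
  define \<kappa> where "\<kappa> = min 2 (A * (1 + t) powr -s)"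
  have \<kappa>: "0 < \<kappa>" "bar A t x \<le> 1 - \<kappa>" for x
  proof -
   show "0 < \<kappa>" using A t by (simp add: \<kappa>_def)
   have "(1 + t) powr -s \<le> wgt t x" unfolding wgt_def using t s_pos by (intro powr_mono2') auto
   then have "A * (1 + t) powr -s \<le> A * wgt t x" using A by (intro mult_left_mono) auto
   then show "bar A t x \<le> 1 - \<kappa>" by (auto simp: bar_def \<kappa>_def)
  qed
  have bt: "bar A t x \<le> -1" if "t \<le> norm x" for x using that A by (simp add: bar_def wgt_def)
  note be = barrier_energy[OF blip_bar[of A t] bt \<kappa>, folded bumped_def]
  let ?h = "%x. ?d x * Lop (%x. u x + ?d x) x + (pot (u x + ?d x) - pot (u x))"
  have dL: "?d x * Lop (%x. u x + ?d x) x \<le> (A * wgt t x / 2) * ?d x" if "0 < ?d x" for x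
  proof -
   have "C * wgt t x \<le> A / 2 * wgt t x" using A wgt_pos[of t x] by (intro mult_right_mono) auto
   then have "Lop (%x. u x + ?d x) x \<le> A * wgt t x / 2" using C(2)[OF _ that] A by fastforce
   then show ?thesis using mult_left_mono[of _ _ "?d x"] that by (simp add: mult.commute)
  qed
  have h_le: "?h x \<le> 3 * (A * wgt t x) - pot (u x)" if p: "0 < ?d x" for x
  proof -
   note b = bumped_pos[OF p]
   have "?d x \<le> 2" using b u_gt_m1[of x] wgt_pos[of t x] A by (smt (verit) mult_nonneg_nonneg)
   then have "(A * wgt t x / 2) * ?d x \<le> (A * wgt t x / 2) * 2" using A wgt_pos[of t x] by (intro mult_left_mono) auto
   moreover have "pot (u x + ?d x) \<le> 2 * (A * wgt t x)" unfolding b(4) b(1) using A b(2) wgt_pos[of t x] by (intro pot_le_sq) auto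
   ultimately show ?thesis using dL[OF p] by linarith
  qed
  have h_neg: "?h x \<le> 0" if p: "0 < ?d x" and "7/8 \<le> u x" for x
  proof -
   note b = bumped_pos[OF p]
   have "pot (u x + ?d x) - pot (u x) \<le> - (3/4) * (A * wgt t x) * ?d x"
    using pot_near_one[of "u x" "A * wgt t x"] that b A wgt_pos[of t x] by (simp add: bumped_def)
   moreover have "0 \<le> (A * wgt t x) * ?d x" using p A wgt_pos[of t x] by simp
   ultimately show ?thesis using dL[OF p] by (simp add: algebra_simps)
  qed
  have h_0: "?h x = 0" if "\<not> 0 < ?d x" for x
  proof -
   have "?d x = 0" using that by (simp add: bumped_def)
   then show ?thesis by simp
  qed
  have uX[measurable]: "{x. u x < 7/8} \<in> sets borel" "{x. 0 < ?d x} \<in> sets borel"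
   using blip_measurable[OF blip_u] blip_measurable[OF blip_bumped] by measurable
  have bi: "bmeas (indicator S)" if "S \<in> sets borel" for S :: "'a set"
   using that by (auto simp: bmeas_def intro!: exI[of _ 1])
  have w1: "bmeas (%x. wgt t x * indicator {x. u x < 7/8} x)" by (intro bmeas_mult bi uX blip_bmeas blip_wgt)
  have w2: "bmeas (%x. pot (u x) * indicator {x. 0 < ?d x} x)" by (intro bmeas_mult bi uX blip_bmeas blip_pot blip_u)
  have inb: "x \<in> ball 0 t" if "0 < ?d x" for x using bumped_vanish[OF A(1), of t x] that by force
  have "(LBINT x. ?h x) \<le> (LBINT x. 3 * A * ((wgt t x * indicator {x. u x < 7/8} x) * indicator (ball 0 t) x))"
  proof (intro integral_mono be integrable_mult_right bint_integrable w1)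
   fix x
   show "?h x \<le> 3 * A * ((wgt t x * indicator {x. u x < 7/8} x) * indicator (ball 0 t) x)"
   proof (cases "0 < ?d x")
    case p: True
    have "?h x \<le> 3 * (A * wgt t x)" using h_le[OF p] pot_nonneg[of "u x"] by linarith
    then show ?thesis using h_neg[OF p] inb[OF p] by (cases "u x < 7/8") auto
   next
    case False
    then show ?thesis unfolding h_0[OF False] using A wgt_pos[of t x] by simp
   qed
  qed
  then show "(\<integral>q. (?d (fst q) - ?d (snd q))^2 * pkern q \<partial>PP) / 4 \<le> 3 * A * bint (%x. wgt t x * indicator {x. u x < 7/8} x) 0 t"
   unfolding bint_def Lintegral_mult_right_zero by (intro order_trans[OF be(2)])
  show "integrable PP (%q. (?d (fst q) - ?d (snd q))^2 * pkern q)" by (rule be(3))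
  have "0 \<le> (\<integral>q. (?d (fst q) - ?d (snd q))^2 * pkern q \<partial>PP)" by (intro Lintegral_nonneg) auto
  also have "... / 4 \<le> (LBINT x. ?h x)" by (rule be(2))
  also have "... \<le> (LBINT x. 3 * A * (wgt t x * indicator (ball 0 t) x) - (pot (u x) * indicator {x. 0 < ?d x} x) * indicator (ball 0 t) x)"
  proof (intro integral_mono be Lintegrable_diff integrable_mult_right bint_integrable w2 blip_bmeas blip_wgt)
   fix x
   show "?h x \<le> 3 * A * (wgt t x * indicator (ball 0 t) x) - (pot (u x) * indicator {x. 0 < ?d x} x) * indicator (ball 0 t) x"
   proof (cases "0 < ?d x")
    case p: True
    then show ?thesis using h_le[OF p] inb[OF p] by simp
   next
    case False
    then show ?thesis unfolding h_0[OF False] using A wgt_pos[of t x] by simp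
   qed
  qed
  also have "... = 3 * A * bint (wgt t) 0 t - bint (%x. pot (u x) * indicator {x. 0 < ?d x} x) 0 t" unfolding bint_def
   by (subst Lintegral_diff) (auto intro!: bint_integrable w2 blip_bmeas blip_wgt)
  finally show "bint (%x. pot (u x) * indicator {x. 0 < ?d x} x) 0 t \<le> 3 * A * bint (wgt t) 0 t" by simp
 qed
qed

end

lemma bmeas_indicator: "S \<in> sets borel ==> bmeas (indicator S)"
 by (auto simp: bmeas_def intro!: exI[of _ 1])

lemma integral_lborel_reflect:
 fixes f :: "'a::euclidean_space => real"
 assumes [measurable]: "f \<in> borel_measurable borel"
 shows "(LBINT x. f (- x)) = (LBINT x. f x)"
proof -
 have d: "(lborel :: 'a measure) = distr lborel borel uminus"
  by (subst lborel_affine[of "-1" 0]) (auto simp: density_1 one_ennreal_def[symmetric])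
 have "(LBINT x. f x) = (\<integral>x. f x \<partial>(distr lborel borel (uminus :: 'a => 'a)))" by (subst d) (rule refl)
 also have "... = (LBINT x. f (- x))" by (rule integral_distr) auto
 finally show ?thesis ..
qed

lemma bint_reflect:
 assumes "bmeas g" shows "bint (%x. g (- x)) 0 r = bint g 0 r"
proof -
 note [measurable] = bmeas_measurable[OF assms]
 have "bint (%x. g (- x)) 0 r = (LBINT x. g (- x) * indicator (ball 0 r) (- x))"
  unfolding bint_def by (intro Lintegral_cong) (auto split: split_indicator)
 also have "... = bint g 0 r" unfolding bint_def by (rule integral_lborel_reflect) measurable
 finally show ?thesis .
qed

context frac_order
begin

lemma Lop_reflect:
 fixes v :: "'a::euclidean_space => real"
 assumes "blip v" shows "Lop (%x. v (- x)) x = Lop v (- x)"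
proof -
 note [measurable] = blip_measurable[OF assms]
 have "Lop v (- x) = (LBINT z. (v (- x) - v (- x + - z)) * kern (- z))"
  unfolding Lop_def by (rule integral_lborel_reflect[symmetric]) measurable
 then show ?thesis unfolding Lop_def by (simp add: minus_diff_commute)
qed

end

context layer
begin

text \<open>This symmetry keeps the equation and the direction e0 and exchanges the two phases, so
  volume bounds for one phase carry over to the other.\<close>

lemma layer_reflect: "layer s (%x. - u (- x)) e0 (%x. G (- x)) \<Lambda>"
proof (unfold_locales)
 have bu: "blip (%x. u (- x))"
 proof (rule blipI)
  show "\<bar>u (- x)\<bar> \<le> 1" for x by (rule u_abs)
  show "\<bar>u (- x) - u (- y)\<bar> \<le> \<Lambda> * norm (x - y)" for x y using u_lip[of "- x" "- y"] by (simp add: norm_minus_commute)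
 qed
 have b: "blip (%x. - u (- x))" by (intro blip_uminus bu)
 show "continuous_on UNIV (%x. - u (- x))" by (rule blip_continuous[OF b])
 show "lint (%x. - u (- x)) x" for x by (rule blip_lint[OF b])
 show "Lop (%x. - u (- x)) x = - u (- x) - (- u (- x))^3" for x
 proof -
  have "Lop (%x. - u (- x)) x = - Lop (%x. u (- x)) x" unfolding Lop_def Lintegral_minus[symmetric]
   by (intro Lintegral_cong) (auto simp: algebra_simps)
  then show ?thesis by (simp add: Lop_reflect[OF blip_u] u_eq)
 qed
 show "norm e0 = 1" by (rule e0_unit)
 show "\<exists>d>0. ((%t. - u (- (x + t *\<^sub>R e0))) has_real_derivative d) (at 0)" for x
  using DERIV_minus[OF dir_deriv[of "- x" "- e0" 0]] phi_pos[of "- x"] by (intro exI[of _ "e0 \<bullet> G (- x)"]) simp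
 show "((%t. - u (- (x + t *\<^sub>R e0))) \<longlongrightarrow> 1) at_top" for x
  using tendsto_minus[OF filterlim_compose[OF u_bot[of "- x"] filterlim_uminus_at_bot_at_top]] by simp
 show "((%t. - u (- (x + t *\<^sub>R e0))) \<longlongrightarrow> -1) at_bot" for x
  using tendsto_minus[OF filterlim_compose[OF u_top[of "- x"] filterlim_uminus_at_top_at_bot]] by simp
 show "1 \<le> \<Lambda>" by (rule \<Lambda>1)
 show "norm (G (- x)) \<le> \<Lambda>" for x by (rule G_bound)
 show "norm (G (- x) - G (- y)) \<le> \<Lambda> * norm (x - y)" for x y using G_lip[of "- x" "- y"] by (simp add: norm_minus_commute)
 show "\<bar>- u (- (x + h)) - - u (- x) - G (- x) \<bullet> h\<bar> \<le> \<Lambda> * (norm h)^2" for x h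
  using taylor[of "- x" "- h"] by (simp add: abs_if split: if_splits)
 show "Lop (%x. e \<bullet> G (- x)) x = (1 - 3 * (- u (- x))^2) * (e \<bullet> G (- x))" for e x
  using Lop_reflect[OF blip_dir[of e], of x] by (simp add: linearized)
qed

section \<open>Volumes of sublevel sets\<close>

definition low :: "real => real => real" where "low c r = bint (indicator {x. u x < c}) 0 r"
definition mid :: "real => real" where "mid r = bint (indicator {x. \<bar>u x\<bar> < 31/32}) 0 r"

lemma level_sets [measurable]: "{x. u x < c} \<in> sets borel" "{x. \<bar>u x\<bar> < c} \<in> sets borel" "{x. c \<le> u x} \<in> sets borel" "{x. u x \<le> c} \<in> sets borel"
 using blip_measurable[OF blip_u] by measurable

lemma low_nonneg: "0 \<le> low c r" "0 \<le> mid r" by (auto simp: low_def mid_def intro: bint_nonneg)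

text \<open>The weight is large only near the sphere of radius t. Averaging over about r/2 values of
  t spaced by one replaces it by its mean, of order r^(-s) at every point.\<close>

lemma averaging:
 assumes r: "4 \<le> r" and g: "bmeas g" "\<And>x. 0 \<le> g x"
  and a: "\<And>t. 3 * r / 2 \<le> t ==> t \<le> 2 * r ==> a \<le> bint (%x. wgt t x * g x) 0 t"
 shows "a \<le> 4 powr s / (1 - s) * r powr -s * bint g 0 (2 * r)"
proof -
 define N where "N = nat \<lfloor>r / 2\<rfloor>"
 have N: "real N \<le> r / 2" "r / 4 \<le> real N" "0 < real N" using r unfolding N_def by linarith+
 let ?t = "%i. 3 * r / 2 + real i"
 have bw: "bmeas (%x. wgt t x * g x)" for t by (intro bmeas_mult g blip_bmeas blip_wgt)
 have "real N * a = (\<Sum>i<N. a)" by simp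
 also have "... \<le> (\<Sum>i<N. bint (%x. wgt (?t i) x * g x) 0 (?t i))" using N by (intro sum_mono a) auto
 also have "... = (LBINT x. (\<Sum>i<N. (wgt (?t i) x * g x) * indicator (ball 0 (?t i)) x))"
  unfolding bint_def by (rule Lintegral_sum[symmetric]) (rule bint_integrable[OF bw])
 also have "... \<le> (LBINT x. (real N powr (1 - s) / (1 - s)) * (g x * indicator (ball 0 (2 * r)) x))"
 proof (intro integral_mono Lintegrable_sum bint_integrable bw integrable_mult_right g)
  fix x :: 'a
  have "(\<Sum>i<N. (wgt (?t i) x * g x) * indicator (ball 0 (?t i)) x)
   = g x * (\<Sum>i<N. if norm x - 3 * r / 2 < real i then (1 + (real i - (norm x - 3 * r / 2))) powr -s else 0)"
   unfolding sum_distrib_left wgt_def by (intro sum.cong) (auto simp: algebra_simps max_def)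
  also have "... \<le> (real N powr (1 - s) / (1 - s)) * (g x * indicator (ball 0 (2 * r)) x)"
  proof (cases "norm x < 2 * r")
   case True
   then show ?thesis using mult_left_mono[OF sum_powr_shift_le[OF s_pos s_lt1, of "norm x - 3 * r / 2" N] g(2)[of x]] by (simp add: mult.commute)
  next
   case False
   then have "(\<Sum>i<N. if norm x - 3 * r / 2 < real i then (1 + (real i - (norm x - 3 * r / 2))) powr -s else 0) = 0"
    using N by (intro sum.neutral) auto
   then show ?thesis using False by simp
  qed
  finally show "(\<Sum>i<N. (wgt (?t i) x * g x) * indicator (ball 0 (?t i)) x) \<le> (real N powr (1 - s) / (1 - s)) * (g x * indicator (ball 0 (2 * r)) x)" .
 qed
 also have "... = real N powr (1 - s) / (1 - s) * bint g 0 (2 * r)" by (simp add: bint_def)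
 also have "real N powr (1 - s) = real N * real N powr -s" using N powr_add[of "real N" 1 "-s"] by simp
 finally have "real N * a \<le> real N * (real N powr -s / (1 - s) * bint g 0 (2 * r))" by (simp only: times_divide_eq_left times_divide_eq_right mult.assoc)
 then have "a \<le> real N powr -s / (1 - s) * bint g 0 (2 * r)" using N(3) by (simp only: mult_le_cancel_left_pos)
 also have "... \<le> (r / 4) powr -s / (1 - s) * bint g 0 (2 * r)"
  using N r s_pos s_lt1 by (intro mult_right_mono divide_right_mono powr_mono2' bint_nonneg g) auto
 also have "(r / 4) powr -s = 4 powr s * r powr -s" using r by (simp add: powr_divide powr_minus_divide)
 finally show ?thesis by simp
qed

lemma bar_deep_ex: "\<exists>D\<ge>0. \<forall>t x. norm x \<le> t - D \<longrightarrow> 63/64 \<le> bar A t x"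
proof -
 have "((%D. A * (1 + D) powr -s) \<longlongrightarrow> A * 0) at_top"
  using s_pos by (intro tendsto_intros tendsto_neg_powr filterlim_tendsto_add_at_top[OF tendsto_const filterlim_ident]) auto
 from order_tendstoD(2)[OF this, of "1/64"]
 obtain D1 where D1: "\<And>D. D1 \<le> D ==> A * (1 + D) powr -s < 1/64" by (auto simp: eventually_at_top_linorder)
 show ?thesis
 proof (intro exI[of _ "max 0 D1"] conjI allI impI)
  fix t :: real and x :: 'a assume "norm x \<le> t - max 0 D1"
  then have "D1 \<le> max 0 (t - norm x)" by auto
  from D1[OF this] show "63/64 \<le> bar A t x" by (simp add: bar_def wgt_def)
 qed simp
qed

text \<open>Points with |u| < 31/32 carry a fixed amount of potential and are lifted by the barrier
  when they lie deep in the ball. The second inequality of \<open>barrier_inequality_ex\<close>,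
  averaged over t, then bounds their volume by r^(n-s).\<close>

lemma mid_bound_ex: "\<exists>C>0. \<exists>r0>0. \<forall>r\<ge>r0. mid r \<le> C * r powr -s * r ^ DIM('a)"
proof -
 obtain A where A: "2 \<le> A" "\<And>t. 0 < t ==> bint (%x. pot (u x) * indicator {x. 0 < bumped A t x} x) 0 t \<le> 3 * A * bint (wgt t) 0 t"
  using barrier_inequality_ex by blast
 obtain D where D: "0 \<le> D" "\<And>t x. norm x \<le> t - D ==> 63/64 \<le> bar A t x" using bar_deep_ex by blast
 define C where "C = 4096 * (3 * A) * (4 powr s / (1 - s)) * (unit_ball_vol (DIM('a)) * 2 ^ DIM('a))"
 have C: "0 < C" using A s_lt1 by (simp add: C_def)
 have "mid r \<le> C * r powr -s * r ^ DIM('a)" if r: "max 4 (2 * D) \<le> r" for r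
 proof -
  have "mid r / (4096 * (3 * A)) \<le> bint (%x. wgt t x * 1) 0 t" if t: "3 * r / 2 \<le> t" "t \<le> 2 * r" for t
  proof -
   have t0: "0 < t" "r \<le> t - D" "r \<le> t" using t r by auto
   have bp: "bmeas (%x. pot (u x) * indicator {x. 0 < bumped A t x} x)"
    using blip_measurable[OF blip_bumped] by (intro bmeas_mult bmeas_indicator blip_bmeas blip_pot blip_u) measurable
   have "(1/4096) * mid r = (LBINT x. (1/4096) * (indicator {x. \<bar>u x\<bar> < 31/32} x * indicator (ball 0 r) x))" by (simp add: mid_def bint_def)
   also have "... \<le> (LBINT x. (pot (u x) * indicator {x. 0 < bumped A t x} x) * indicator (ball 0 t) x)"
   proof (intro integral_mono integrable_mult_right bint_integrable bp bmeas_indicator level_sets)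
    fix x :: 'a
    show "(1/4096) * (indicator {x. \<bar>u x\<bar> < 31/32} x * indicator (ball 0 r) x) \<le> (pot (u x) * indicator {x. 0 < bumped A t x} x) * indicator (ball 0 t) x"
    proof (cases "\<bar>u x\<bar> < 31/32 \<and> norm x < r")
     case True
     \<comment> \<open>Below the level 31/32 the potential is at least (1/32)^2/4 = 1/4096, and u
       stays below 63/64, so the barrier lifts this point.\<close>
     have "(u x)^2 \<le> (31/32)^2" using True abs_le_square_iff[of "u x" "31/32"] by simp
     then have "(1/32)^2 \<le> (1 - (u x)^2)^2" by (intro power_mono) (auto simp: power2_eq_square)
     then have "1/4096 \<le> pot (u x)" by (simp add: pot_def power2_eq_square)
     moreover have "0 < bumped A t x" using D(2)[of x t] True t0 by (auto simp: bumped_def)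
     ultimately show ?thesis using True t0 by simp
    qed (auto simp: pot_nonneg split: split_indicator)
   qed
   also have "... \<le> 3 * A * bint (wgt t) 0 t" using A(2)[OF t0(1)] by (simp add: bint_def)
   finally have "(1/4096) * mid r \<le> 3 * A * bint (%x. wgt t x * 1) 0 t" by simp
   then show ?thesis using A by (simp add: field_simps)
  qed
  then have "mid r / (4096 * (3 * A)) \<le> 4 powr s / (1 - s) * r powr -s * bint (%x. 1) (0::'a) (2 * r)"
   using r by (intro averaging) auto
  also have "... = 4 powr s / (1 - s) * r powr -s * (unit_ball_vol (DIM('a)) * 2 ^ DIM('a) * r ^ DIM('a))"
   using r by (simp add: bint_const power_mult_distrib mult.assoc)
  finally show ?thesis using A unfolding C_def by (simp add: field_simps)
 qed
 moreover have "0 < max 4 (2 * D)" by simp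
 ultimately show ?thesis using C by blast
qed

text \<open>A point with u < 7/8 deep in the ball is lifted distinctly more than any point that is
  outside radius 2r or has u \<ge> 31/32. By \<open>Z\<close>, such points fill at least half of
  every ball of radius \<rho>, so each low point interacts with them by at least a multiple of
  \<rho>^(-s).\<close>

lemma bumped_interaction:
 assumes r: "0 < r" "r \<le> t" "t \<le> 2 * r" and \<rho>: "0 < \<rho>"
  and deep: "\<And>x. norm x \<le> r ==> 63/64 \<le> bar A t x" and A: "2 \<le> A"
  and Z: "low (31/32) (2 * r) \<le> unit_ball_vol (DIM('a)) * \<rho> ^ DIM('a) / 2"
  and int: "integrable PP (%q. (bumped A t (fst q) - bumped A t (snd q))^2 * pkern q)"
 shows "1/512 * unit_ball_vol (DIM('a)) * \<rho> powr -s * low (7/8) r \<le> (\<integral>q. (bumped A t (fst q) - bumped A t (snd q))^2 * pkern q \<partial>PP)"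
proof -
 let ?d = "bumped A t"
 define w where "w = unit_ball_vol (DIM('a))"
 define k :: "'a => real" where "k y = 1 - indicator {x. u x < 31/32} y * indicator (ball 0 (2 * r)) y" for y :: 'a
 define c where "c = 1/256 * \<rho> powr -(real DIM('a) + s)"
 note [measurable] = blip_measurable[OF blip_bumped]
 have bk: "bmeas k" unfolding k_def by (intro bmeas_diff bmeas_const bmeas_mult bmeas_indicator) measurable
 have k01: "0 \<le> k y" "k y \<le> 1" for y by (auto simp: k_def split: split_indicator)
 note [measurable] = bmeas_measurable[OF bk]
 have kint: "w * \<rho> ^ DIM('a) / 2 \<le> bint k x \<rho>" for x
 proof -
  have "bint (%y. indicator {x. u x < 31/32} y * indicator (ball 0 (2 * r)) y) x \<rho> \<le> low (31/32) (2 * r)"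
   unfolding bint_def low_def
  proof (rule integral_mono)
   show "integrable lborel (%y. indicator {x. u x < 31/32} y * indicator (ball 0 (2 * r)) y * indicator (ball x \<rho>) y :: real)"
    by (intro bint_integrable bmeas_mult bmeas_indicator) measurable
   show "integrable lborel (%y. indicator {x. u x < 31/32} y * indicator (ball 0 (2 * r)) y :: real)"
    by (intro bint_integrable bmeas_indicator) measurable
  qed (auto split: split_indicator)
  moreover have "bint k x \<rho> = bint (%y. 1) x \<rho> - bint (%y. indicator {x. u x < 31/32} y * indicator (ball 0 (2 * r)) y) x \<rho>"
   unfolding k_def by (intro bint_diff bmeas_const bmeas_mult bmeas_indicator) measurable
  ultimately show ?thesis using Z \<rho> by (simp add: bint_const w_def)
 qed
 have inner: "ennreal (indicator {x. u x < 7/8} x) * indicator (ball 0 r) x * ennreal (c * (w * \<rho> ^ DIM('a) / 2))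
  \<le> (NNBINT y. ennreal ((?d x - ?d y)^2 * kern (x - y)))" for x
 proof (cases "u x < 7/8 \<and> norm x < r")
  case True
  have dx: "7/64 \<le> ?d x" using deep[of x] True by (simp add: bumped_def)
  have "ennreal (c * (w * \<rho> ^ DIM('a) / 2)) \<le> ennreal (c * bint k x \<rho>)" using kint[of x] by (intro ennreal_leI mult_left_mono) (simp_all add: c_def)
  also have "... = ennreal c * (NNBINT y. ennreal (k y) * indicator (ball x \<rho>) y)"
   unfolding bint_nn[OF bk k01(1)] by (rule ennreal_mult) (simp_all add: bint_nonneg k01 c_def)
  also have "... = (NNBINT y. ennreal c * (ennreal (k y) * indicator (ball x \<rho>) y))" by (rule nn_integral_cmult[symmetric]) measurable
  also have "... \<le> (NNBINT y. ennreal ((?d x - ?d y)^2 * kern (x - y)))"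
  proof (intro nn_integral_mono)
   fix y
   show "ennreal c * (ennreal (k y) * indicator (ball x \<rho>) y) \<le> ennreal ((?d x - ?d y)^2 * kern (x - y))"
   proof (cases "y \<in> ball x \<rho> \<and> \<not> (u y < 31/32 \<and> norm y < 2 * r)")
    case y: True
    have "?d y \<le> 1/32"
    proof (cases "norm y < 2 * r")
     case True
     then have "31/32 \<le> u y" using y by auto
     moreover have "bar A t y \<le> 1" using wgt_pos[of t y] A by (auto simp: bar_def)
     ultimately show ?thesis unfolding bumped_def by linarith
    next
     case False
     then show ?thesis using bumped_vanish[OF A, of t y] r by simp
    qed
    \<comment> \<open>The lift is at least 63/64 - 7/8 = 7/64 at x and at most 1/32 at y.\<close>
    then have "1/16 \<le> ?d x - ?d y" using dx by simp
    then have sq: "(1/16)^2 \<le> (?d x - ?d y)^2" by (intro power_mono) auto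
    have "x \<noteq> y" using y True r by auto
    then have "\<rho> powr -(real DIM('a) + s) \<le> kern (x - y)" using y by (intro kern_ge) (auto simp: dist_norm)
    then have "(1/16)^2 * \<rho> powr -(real DIM('a) + s) \<le> (?d x - ?d y)^2 * kern (x - y)" using sq by (intro mult_mono) auto
    then have "c * k y \<le> (?d x - ?d y)^2 * kern (x - y)" using y by (auto simp: c_def k_def power2_eq_square split: split_indicator)
    then show ?thesis using y k01[of y] by (simp add: ennreal_leI c_def flip: ennreal_mult)
   next
    case False
    then show ?thesis by (auto simp: k_def split: split_indicator)
   qed
  qed
  finally show ?thesis using True by simp
 qed (auto split: split_indicator)
 have bX: "bmeas (indicator {x. u x < 7/8})" by (intro bmeas_indicator) measurable
 have "ennreal (low (7/8) r * (c * (w * \<rho> ^ DIM('a) / 2))) = (NNBINT x. ennreal (indicator {x. u x < 7/8} x) * indicator (ball 0 r) x * ennreal (c * (w * \<rho> ^ DIM('a) / 2)))"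
 proof -
  have "(NNBINT x. ennreal (indicator {x. u x < 7/8} x) * indicator (ball 0 r) x * ennreal (c * (w * \<rho> ^ DIM('a) / 2)))
   = (NNBINT x. ennreal (indicator {x. u x < 7/8} x) * indicator (ball 0 r) x) * ennreal (c * (w * \<rho> ^ DIM('a) / 2))"
   by (rule nn_integral_multc) measurable
  also have "(NNBINT x. ennreal (indicator {x. u x < 7/8} x) * indicator (ball 0 r) x) = ennreal (low (7/8) r)"
   unfolding low_def by (rule bint_nn[OF bX]) simp
  finally have tot: "(NNBINT x. ennreal (indicator {x. u x < 7/8} x) * indicator (ball 0 r) x * ennreal (c * (w * \<rho> ^ DIM('a) / 2)))
   = ennreal (low (7/8) r) * ennreal (c * (w * \<rho> ^ DIM('a) / 2))" .
  show ?thesis unfolding tot using low_nonneg(1) \<rho> by (intro ennreal_mult) (simp_all add: c_def w_def)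
 qed
 also have "... \<le> (NNBINT x. (NNBINT y. ennreal ((?d x - ?d y)^2 * kern (x - y))))" by (intro nn_integral_mono inner)
 also have "... = (\<integral>\<^sup>+q. ennreal ((?d (fst q) - ?d (snd q))^2 * pkern q) \<partial>PP)"
  using lborel.nn_integral_fst[of "%q. ennreal ((?d (fst q) - ?d (snd q))^2 * pkern q)" lborel] by simp
 also have "... = ennreal (\<integral>q. (?d (fst q) - ?d (snd q))^2 * pkern q \<partial>PP)"
  by (intro nn_integral_eq_integral int) auto
 finally have "low (7/8) r * (c * (w * \<rho> ^ DIM('a) / 2)) \<le> (\<integral>q. (?d (fst q) - ?d (snd q))^2 * pkern q \<partial>PP)"
  by (subst (asm) ennreal_le_iff) (auto intro!: Lintegral_nonneg)
 moreover have "\<rho> powr -(real DIM('a) + s) * \<rho> ^ DIM('a) = \<rho> powr -s"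
  using \<rho> by (simp flip: powr_realpow powr_add)
 then have "c * (w * \<rho> ^ DIM('a) / 2) = 1/512 * w * \<rho> powr -s" unfolding c_def by (simp add: mult_ac)
 ultimately have "low (7/8) r * (1/512 * w * \<rho> powr -s) \<le> (\<integral>q. (?d (fst q) - ?d (snd q))^2 * pkern q \<partial>PP)" by (simp only:)
 then show ?thesis by (simp add: w_def mult_ac)
qed

end

context layer
begin

lemma low_le_mid: "low (31/32) r \<le> low (7/8) r + mid r"
proof -
 have b: "bmeas (indicator {x. u x < c})" "bmeas (indicator {x. \<bar>u x\<bar> < c})" for c by (intro bmeas_indicator level_sets)+
 have "low (31/32) r \<le> bint (%x. indicator {x. u x < 7/8} x + indicator {x. \<bar>u x\<bar> < 31/32} x) 0 r"
  unfolding low_def by (intro bint_mono bmeas_add b) (auto split: split_indicator)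
 then show ?thesis by (simp only: bint_add[OF b] low_def mid_def)
qed

text \<open>If low points are rare at radius 2r, \<open>bumped_interaction\<close> holds with \<rho>
  = \<kappa> r, and averaging the barrier inequality bounds \<rho>^(-s) times the low volume at r by
  a multiple of r^(-s) times that at 2r. The resulting factor \<kappa>^s is made smaller than the
  volume ratio 2^(-n) by another half.\<close>

lemma low_contraction_ex:
 "\<exists>\<epsilon>>0. \<exists>r0>0. \<forall>r\<ge>r0. low (7/8) (2 * r) \<le> \<epsilon> * (2 * r) ^ DIM('a) \<longrightarrow> low (7/8) r \<le> (1/2) ^ Suc (DIM('a)) * low (7/8) (2 * r)"
proof -
 define n where "n = DIM('a)"
 define w where "w = unit_ball_vol (DIM('a))"
 have w: "0 < w" by (simp add: w_def)
 obtain A where A: "2 \<le> A" "\<And>t. 0 < t ==> (\<integral>q. (bumped A t (fst q) - bumped A t (snd q))^2 * pkern q \<partial>PP) / 4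
    \<le> 3 * A * bint (%x. wgt t x * indicator {x. u x < 7/8} x) 0 t"
  "\<And>t. 0 < t ==> integrable PP (%q. (bumped A t (fst q) - bumped A t (snd q))^2 * pkern q)"
  using barrier_inequality_ex by blast
 obtain D where D: "0 \<le> D" "\<And>t x. norm x \<le> t - D ==> 63/64 \<le> bar A t x" using bar_deep_ex by blast
 obtain C r1 where C: "0 < C" "0 < r1" "\<And>r. r1 \<le> r ==> mid r \<le> C * r powr -s * r ^ n" using mid_bound_ex unfolding n_def by blast
 define B where "B = (512 * (12 * A) / w) * (4 powr s / (1 - s))"
 have B: "0 < B" using A w s_lt1 by (simp add: B_def)
 define \<kappa> where "\<kappa> = ((1/2) ^ Suc n / B) powr (1 / s)"
 have \<kappa>: "0 < \<kappa>" "B * \<kappa> powr s = (1/2) ^ Suc n" using B s_pos by (auto simp: \<kappa>_def powr_powr)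
 \<comment> \<open>Small enough that low and intermediate points together, each of density at most
   \<epsilon> at radius 2r, fill at most half of a ball of radius \<kappa> r.\<close>
 define \<epsilon> where "\<epsilon> = w * \<kappa> ^ n / (4 * 2 ^ n)"
 have \<epsilon>: "0 < \<epsilon>" using w \<kappa> by (simp add: \<epsilon>_def)
 have "((%r. C * (2 * r) powr -s) \<longlongrightarrow> C * 0) at_top"
  using s_pos by (intro tendsto_intros tendsto_neg_powr filterlim_tendsto_pos_mult_at_top[OF tendsto_const _ filterlim_ident]) auto
 from order_tendstoD(2)[OF this, of \<epsilon>] \<epsilon>
 obtain r2 where r2: "\<And>r. r2 \<le> r ==> C * (2 * r) powr -s < \<epsilon>" by (auto simp: eventually_at_top_linorder)
 define r0 where "r0 = max (max 4 (2 * D)) (max r1 r2)"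
 have "low (7/8) r \<le> (1/2) ^ Suc n * low (7/8) (2 * r)" if r: "r0 \<le> r" and small: "low (7/8) (2 * r) \<le> \<epsilon> * (2 * r) ^ n" for r
 proof -
  have r': "4 \<le> r" "2 * D \<le> r" "r1 \<le> 2 * r" "r2 \<le> r" using r C by (auto simp: r0_def)
  define \<rho> where "\<rho> = \<kappa> * r"
  have \<rho>: "0 < \<rho>" using \<kappa> r' by (simp add: \<rho>_def)
  have "mid (2 * r) \<le> C * (2 * r) powr -s * (2 * r) ^ n" using C(3) r' by blast
  also have "... \<le> \<epsilon> * (2 * r) ^ n" using r2[OF r'(4)] r' by (intro mult_right_mono) auto
  finally have "low (31/32) (2 * r) \<le> 2 * (\<epsilon> * (2 * r) ^ n)" using low_le_mid[of "2 * r"] small by linarith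
  also have "... = w * \<rho> ^ n / 2" by (simp add: \<epsilon>_def \<rho>_def power_mult_distrib)
  finally have Z: "low (31/32) (2 * r) \<le> w * \<rho> ^ n / 2" .
  have "w * \<rho> powr -s * low (7/8) r / (512 * (12 * A)) \<le> bint (%x. wgt t x * indicator {x. u x < 7/8} x) 0 t" if t: "3 * r / 2 \<le> t" "t \<le> 2 * r" for t
  proof -
   have "1/512 * w * \<rho> powr -s * low (7/8) r \<le> (\<integral>q. (bumped A t (fst q) - bumped A t (snd q))^2 * pkern q \<partial>PP)"
    using t r' A \<rho> Z unfolding w_def n_def by (intro bumped_interaction D(2)) auto
   also have "... \<le> 12 * A * bint (%x. wgt t x * indicator {x. u x < 7/8} x) 0 t" using A(2)[of t] t r' by simp
   finally show ?thesis using A(1) by (simp add: field_simps)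
  qed
  then have "w * \<rho> powr -s * low (7/8) r / (512 * (12 * A)) \<le> 4 powr s / (1 - s) * r powr -s * low (7/8) (2 * r)"
   unfolding low_def using r' by (intro averaging bmeas_indicator level_sets) auto
  then have "(512 * (12 * A) / w * \<rho> powr s) * (w * \<rho> powr -s * low (7/8) r / (512 * (12 * A))) \<le> (512 * (12 * A) / w * \<rho> powr s) * (4 powr s / (1 - s) * r powr -s * low (7/8) (2 * r))"
   using A w by (intro mult_left_mono) auto
  also have "... = B * (\<rho> powr s * r powr -s) * low (7/8) (2 * r)" by (simp add: B_def mult_ac)
  also have "\<rho> powr s * r powr -s = \<kappa> powr s" using \<kappa> r' by (simp add: \<rho>_def powr_mult powr_minus_divide)
  finally have "(512 * (12 * A) / w * \<rho> powr s) * (w * \<rho> powr -s * low (7/8) r / (512 * (12 * A))) \<le> (1/2) ^ Suc n * low (7/8) (2 * r)"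
   unfolding \<kappa>(2) .
  moreover have "(512 * (12 * A) / w * \<rho> powr s) * (w * \<rho> powr -s * low (7/8) r / (512 * (12 * A))) = (\<rho> powr s * \<rho> powr -s) * low (7/8) r"
   using A w by (simp add: field_simps)
  moreover have "\<rho> powr s * \<rho> powr -s = 1" using \<rho> by (simp flip: powr_add)
  ultimately show ?thesis by simp
 qed
 moreover have "0 < r0" by (simp add: r0_def)
 ultimately show ?thesis using \<epsilon> unfolding n_def by blast
qed

text \<open>If the low density at a large radius R were below \<epsilon>, the contraction would
  apply at every smaller dyadic radius as well and reach a fixed radius with density \<epsilon>
  2^(-k), where 2^k is the ratio of the radii. At that fixed radius the low volume is positive,
  which bounds k.\<close>

lemma low_growth_ex: "\<exists>\<epsilon>>0. \<exists>r0>0. \<forall>r\<ge>r0. \<epsilon> * r ^ DIM('a) \<le> low (7/8) r"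
proof -
 define n where "n = DIM('a)"
 obtain \<epsilon> r0 where c: "0 < \<epsilon>" "0 < r0" "\<And>r. r0 \<le> r ==> low (7/8) (2 * r) \<le> \<epsilon> * (2 * r) ^ n ==> low (7/8) r \<le> (1/2) ^ Suc n * low (7/8) (2 * r)"
  using low_contraction_ex unfolding n_def by blast
 have mono: "low c a \<le> low c b" if "a \<le> b" for a b c :: real
  unfolding low_def using that by (intro bint_subset bmeas_indicator level_sets) auto
 have it: "low (7/8) r \<le> \<epsilon> * r ^ n * (1/2) ^ j" if "r0 \<le> r" "low (7/8) (2 ^ j * r) \<le> \<epsilon> * (2 ^ j * r) ^ n" for r j
  using that
 proof (induction j arbitrary: r)
  case (Suc j)
  have "1 * r \<le> 2 ^ j * r" using Suc.prems c(2) by (intro mult_right_mono) auto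
  have "low (7/8) (2 * r) \<le> \<epsilon> * (2 * r) ^ n * (1/2) ^ j" using Suc.prems c(2) by (intro Suc.IH) (auto simp: mult_ac)
  moreover have "\<epsilon> * (2 * r) ^ n * (1/2) ^ j \<le> \<epsilon> * (2 * r) ^ n * 1" using c Suc.prems by (intro mult_left_mono power_le_one) auto
  ultimately have "low (7/8) (2 * r) \<le> \<epsilon> * (2 * r) ^ n" by simp
  from c(3)[OF Suc.prems(1) this] have "low (7/8) r \<le> (1/2) ^ Suc n * low (7/8) (2 * r)" .
  also have "... \<le> (1/2) ^ Suc n * (\<epsilon> * (2 * r) ^ n * (1/2) ^ j)" using \<open>low (7/8) (2 * r) \<le> \<epsilon> * (2 * r) ^ n * (1/2) ^ j\<close> by (intro mult_left_mono) auto
  also have "... = \<epsilon> * r ^ n * (1/2) ^ Suc j" by (simp add: power_mult_distrib power_divide)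
  finally show ?case .
 qed simp
 have "\<forall>\<^sub>F t in at_bot. u (0 + t *\<^sub>R e0) < 7/8" using order_tendstoD(2)[OF u_bot[of 0], of "7/8"] by simp
 then obtain t where t: "u (t *\<^sub>R e0) < 7/8" using eventually_happens by fastforce
 define r1 where "r1 = max r0 (\<bar>t\<bar> + 1)"
 have r1: "r0 \<le> r1" "0 < r1" "t *\<^sub>R e0 \<in> ball 0 r1" using e0_unit c(2) by (auto simp: r1_def)
 have pos: "0 < low (7/8) r1"
 proof (rule ccontr)
  assume "\<not> ?thesis"
  have bg: "blip (%x. max 0 (7/8 - u x))" by (intro blip_pos blip_diff blip_const blip_u)
  have "bint (%x. max 0 (7/8 - u x)) 0 r1 \<le> bint (%x. 2 * indicator {x. u x < 7/8} x) 0 r1"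
  proof (rule bint_mono[OF blip_bmeas[OF bg]])
   show "bmeas (%x. 2 * indicator {x. u x < 7/8} x)" by (intro bmeas_mult bmeas_const bmeas_indicator level_sets)
   show "max 0 (7/8 - u x) \<le> 2 * indicator {x. u x < 7/8} x" for x using u_gt_m1[of x] by (auto split: split_indicator)
  qed
  also have "... \<le> 0" using \<open>\<not> 0 < low (7/8) r1\<close> unfolding bint_cmult low_def by simp
  finally have "max 0 (7/8 - u (t *\<^sub>R e0)) = 0" by (intro bint_pos_continuous[OF blip_bmeas[OF bg] blip_continuous[OF bg] _ _ r1(3)]) auto
  then show False using t by simp
 qed
 have q: "0 < \<epsilon> * (2 * r1) ^ n" using c r1 by simp
 \<comment> \<open>After J halvings the contracted bound falls below the volume present at radius
   r1.\<close>
 obtain J where "(1/2) ^ J < low (7/8) r1 / (\<epsilon> * (2 * r1) ^ n)"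
  using real_arch_pow_inv[of "low (7/8) r1 / (\<epsilon> * (2 * r1) ^ n)" "1/2"] pos q by auto
 then have J: "(1/2) ^ J * (\<epsilon> * (2 * r1) ^ n) < low (7/8) r1" using q by (simp only: pos_less_divide_eq)
 have "\<epsilon> * R ^ n \<le> low (7/8) R" if R: "2 ^ J * r1 \<le> R" for R
 proof (rule ccontr)
  assume "\<not> ?thesis"
  then have sm: "low (7/8) R \<le> \<epsilon> * R ^ n" by simp
  have "1 * r1 \<le> 2 ^ J * r1" using r1 by (intro mult_right_mono) auto
  then obtain k where k: "r1 * 2 ^ k \<le> R" "R < r1 * 2 ^ (k + 1)" using dyadic_far[OF r1(2), of R] R by auto
  have "2 ^ J * r1 < 2 ^ (k + 1) * r1" using k R by (simp add: mult.commute)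
  then have "(2::real) ^ J < 2 ^ (k + 1)" using r1 by simp
  then have "J \<le> k" using power_less_imp_less_exp[of "2::real" J "k + 1"] by simp
  define r where "r = R / 2 ^ k"
  have r: "r1 \<le> r" "r \<le> 2 * r1" "2 ^ k * r = R" using k by (auto simp: r_def field_simps)
  have "low (7/8) r1 \<le> low (7/8) r" using r by (intro mono)
  also have "... \<le> \<epsilon> * r ^ n * (1/2) ^ k" using r r1 sm by (intro it) auto
  also have "... \<le> \<epsilon> * (2 * r1) ^ n * (1/2) ^ J" using r r1 c \<open>J \<le> k\<close> by (intro mult_mono mult_left_mono power_mono power_decreasing) auto
  finally show False using J by (simp add: mult.commute)
 qed
 moreover have "0 < 2 ^ J * r1" using r1 by simp
 ultimately show ?thesis using c(1) unfolding n_def by blast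
qed

lemma high_growth_ex: "\<exists>\<epsilon>>0. \<exists>r0>0. \<forall>r\<ge>r0. \<epsilon> * r ^ DIM('a) \<le> bint (indicator {x. -7/8 < u x}) 0 r"
proof -
 interpret R: layer s "%x. - u (- x)" e0 "%x. G (- x)" \<Lambda> by (rule layer_reflect)
 have [measurable]: "{x. -7/8 < u x} \<in> sets borel" using blip_measurable[OF blip_u] by measurable
 have "R.low (7/8) r = bint (indicator {x. -7/8 < u x}) 0 r" for r
 proof -
  have "R.low (7/8) r = bint (%x. indicator {x. -7/8 < u x} (- x)) 0 r"
   unfolding R.low_def by (intro arg_cong[where f = "%g. bint g 0 r"] ext) (auto split: split_indicator)
  also have "... = bint (indicator {x. -7/8 < u x}) 0 r" by (rule bint_reflect) (intro bmeas_indicator, measurable)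
  finally show ?thesis .
 qed
 then show ?thesis using R.low_growth_ex by simp
qed

text \<open>A Poincare inequality in translation form: with y = x + h and |h| < 2r, the integral
  over x is at most |h| times the mass of p on the ball of radius 3r, and h ranges over a ball of
  radius 2r.\<close>

lemma oscillation_bound:
 assumes r: "0 < r"
 shows "(NNBINT x. (NNBINT y. ennreal \<bar>u x - u y\<bar> * indicator (ball 0 r) y) * indicator (ball 0 r) x)
  \<le> ennreal (unit_ball_vol (DIM('a)) * (2 * r) ^ DIM('a) * (2 * r * bint p 0 (3 * r)))"
proof -
 note [measurable] = blip_measurable[OF blip_u]
 have "(NNBINT x. (NNBINT y. ennreal \<bar>u x - u y\<bar> * indicator (ball 0 r) y) * indicator (ball 0 r) x)
  \<le> (NNBINT x. (NNBINT h. ennreal \<bar>u (x + h) - u x\<bar> * indicator (ball 0 (2 * r)) h * indicator (ball 0 r) x))"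
 proof (intro nn_integral_mono)
  fix x :: 'a
  show "(NNBINT y. ennreal \<bar>u x - u y\<bar> * indicator (ball 0 r) y) * indicator (ball 0 r) x
   \<le> (NNBINT h. ennreal \<bar>u (x + h) - u x\<bar> * indicator (ball 0 (2 * r)) h * indicator (ball 0 r) x)"
  proof (cases "x \<in> ball 0 r")
   case True
   have "(NNBINT y. ennreal \<bar>u x - u y\<bar> * indicator (ball 0 r) y) = (NNBINT h. ennreal \<bar>u x - u (h + x)\<bar> * indicator (ball 0 r) (h + x))"
    by (rule nn_integral_lborel_translate[symmetric]) measurable
   also have "... \<le> (NNBINT h. ennreal \<bar>u (x + h) - u x\<bar> * indicator (ball 0 (2 * r)) h)"
   proof (intro nn_integral_mono)
    fix h
    have "norm h < 2 * r" if "norm (h + x) < r" using that True norm_triangle_ineq4[of "h + x" x] by simp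
    then show "ennreal \<bar>u x - u (h + x)\<bar> * indicator (ball 0 r) (h + x) \<le> ennreal \<bar>u (x + h) - u x\<bar> * indicator (ball 0 (2 * r)) h"
     by (auto simp: abs_minus_commute add.commute split: split_indicator)
   qed
   finally show ?thesis using True by simp
  qed simp
 qed
 also have "... = (NNBINT h. (NNBINT x. ennreal \<bar>u (x + h) - u x\<bar> * indicator (ball 0 (2 * r)) h * indicator (ball 0 r) x))"
  by (rule lborel_pair.Fubini') measurable
 also have "... \<le> (NNBINT h. ennreal (2 * r * bint p 0 (3 * r)) * indicator (ball (0::'a) (2 * r)) h)"
 proof (intro nn_integral_mono)
  fix h :: 'a
  show "(NNBINT x. ennreal \<bar>u (x + h) - u x\<bar> * indicator (ball 0 (2 * r)) h * indicator (ball 0 r) x) \<le> ennreal (2 * r * bint p 0 (3 * r)) * indicator (ball 0 (2 * r)) h"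
  proof (cases "h \<noteq> 0 \<and> h \<in> ball 0 (2 * r)")
   case True
   define e where "e = h /\<^sub>R norm h"
   have e: "norm e = 1" "norm h *\<^sub>R e = h" using True by (auto simp: e_def)
   have bu: "bmeas (%x. \<bar>u (x + h) - u x\<bar>)" by (intro bmeas_abs bmeas_diff bmeas_u blip_bmeas[OF blip_translate] blip_u)
   have "bint (%x. \<bar>u (x + h) - u x\<bar>) 0 r \<le> norm h * bint p 0 (r + norm h)"
    using translation_l1[OF e(1) blip_p, of "norm h" r 0] True r e Cauchy_Schwarz_ineq2[of e] by simp
   also have "... \<le> 2 * r * bint p 0 (3 * r)"
    using True r by (intro mult_mono bint_subset bmeas_p bint_nonneg) auto
   finally show ?thesis using True by (simp add: bint_nn[OF bu] ennreal_leI)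
  qed (auto split: split_indicator)
 qed
 also have "... = ennreal (2 * r * bint p 0 (3 * r)) * ennreal (unit_ball_vol (DIM('a)) * (2 * r) ^ DIM('a))"
  using r by (subst nn_integral_cmult_indicator) (auto simp: emeasure_ball)
 also have "... = ennreal (unit_ball_vol (DIM('a)) * (2 * r) ^ DIM('a) * (2 * r * bint p 0 (3 * r)))"
  using r by (simp add: ennreal_mult bint_nonneg mult.commute)
 finally show ?thesis .
qed

text \<open>The low and high volumes grow like r^n, and removing the intermediate values costs only
  r^(n-s).\<close>

lemma phase_volume_ex: "\<exists>\<epsilon>>0. \<exists>r0>0. \<forall>r\<ge>r0. \<epsilon> * r ^ DIM('a) \<le> bint (indicator {x. u x \<le> -31/32}) 0 r \<and> \<epsilon> * r ^ DIM('a) \<le> bint (indicator {x. 31/32 \<le> u x}) 0 r"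
proof -
 obtain \<epsilon>1 r1 where 1: "0 < \<epsilon>1" "\<And>r. r1 \<le> r ==> \<epsilon>1 * r ^ DIM('a) \<le> low (7/8) r" using low_growth_ex by blast
 obtain \<epsilon>2 r2 where 2: "0 < \<epsilon>2" "\<And>r. r2 \<le> r ==> \<epsilon>2 * r ^ DIM('a) \<le> bint (indicator {x. -7/8 < u x}) 0 r" using high_growth_ex by blast
 obtain C r3 where 3: "0 < C" "0 < r3" "\<And>r. r3 \<le> r ==> mid r \<le> C * r powr -s * r ^ DIM('a)" using mid_bound_ex by blast
 define \<epsilon> where "\<epsilon> = min \<epsilon>1 \<epsilon>2 / 2"
 have \<epsilon>: "0 < \<epsilon>" using 1 2 by (simp add: \<epsilon>_def)
 have "((%r. C * r powr -s) \<longlongrightarrow> C * 0) at_top" using s_pos by (intro tendsto_intros tendsto_neg_powr filterlim_ident) auto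
 from order_tendstoD(2)[OF this, of \<epsilon>] \<epsilon>
 obtain r4 where r4: "\<And>r. r4 \<le> r ==> C * r powr -s < \<epsilon>" by (auto simp: eventually_at_top_linorder)
 define r0 where "r0 = max (max r1 r2) (max r3 r4)"
 have b[measurable]: "{x. -7/8 < u x} \<in> sets borel" using blip_measurable[OF blip_u] by measurable
 have bm: "bmeas (indicator {x. u x < c})" "bmeas (indicator {x. u x \<le> c})" "bmeas (indicator {x. c \<le> u x})" "bmeas (indicator {x. \<bar>u x\<bar> < c})" "bmeas (indicator {x. -7/8 < u x})" for c
  by (intro bmeas_indicator level_sets b)+
 have "\<epsilon> * r ^ DIM('a) \<le> bint (indicator {x. u x \<le> -31/32}) 0 r \<and> \<epsilon> * r ^ DIM('a) \<le> bint (indicator {x. 31/32 \<le> u x}) 0 r" if r: "r0 \<le> r" for r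
 proof -
  have r': "r1 \<le> r" "r2 \<le> r" "r3 \<le> r" "r4 \<le> r" "0 < r" using r 3 by (auto simp: r0_def)
  have "mid r \<le> C * r powr -s * r ^ DIM('a)" by (rule 3(3)[OF r'(3)])
  also have "... \<le> \<epsilon> * r ^ DIM('a)" using r4[OF r'(4)] r'(5) by (intro mult_right_mono) auto
  finally have m: "mid r \<le> \<epsilon> * r ^ DIM('a)" .
  have "low (7/8) r \<le> bint (%x. indicator {x. u x \<le> -31/32} x + indicator {x. \<bar>u x\<bar> < 31/32} x) 0 r"
   unfolding low_def by (intro bint_mono bmeas_add bm) (auto split: split_indicator)
  then have a: "low (7/8) r \<le> bint (indicator {x. u x \<le> -31/32}) 0 r + mid r" by (simp only: bint_add[OF bm(2,4)] mid_def)
  have "bint (indicator {x. -7/8 < u x}) 0 r \<le> bint (%x. indicator {x. 31/32 \<le> u x} x + indicator {x. \<bar>u x\<bar> < 31/32} x) 0 r"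
   by (intro bint_mono bmeas_add bm) (auto split: split_indicator)
  then have c: "bint (indicator {x. -7/8 < u x}) 0 r \<le> bint (indicator {x. 31/32 \<le> u x}) 0 r + mid r" by (simp only: bint_add[OF bm(3,4)] mid_def)
  have "2 * \<epsilon> * r ^ DIM('a) \<le> \<epsilon>1 * r ^ DIM('a)" "2 * \<epsilon> * r ^ DIM('a) \<le> \<epsilon>2 * r ^ DIM('a)" using r'(5) by (auto simp: \<epsilon>_def intro!: mult_right_mono)
  then show ?thesis using a c m 1(2)[OF r'(1)] 2(2)[OF r'(2)] by linarith
 qed
 moreover have "0 < r0" using 3 by (simp add: r0_def)
 ultimately show ?thesis using \<epsilon> by blast
qed

text \<open>An isoperimetric argument: between the two phases u jumps by more than one, so the
  product of their volumes, of order r^(2n), is bounded by the total oscillation, of order r^(n+1)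
  times the mass on the tripled ball.\<close>

lemma density_ex: "\<exists>c>0. \<exists>r0>0. \<forall>r\<ge>r0. c * r powr (real DIM('a) - 1) \<le> bint p 0 r"
proof -
 define n where "n = DIM('a)"
 define w where "w = unit_ball_vol (DIM('a))"
 have w: "0 < w" by (simp add: w_def)
 obtain \<epsilon> r0 where e: "0 < \<epsilon>" "0 < r0" "\<And>r. r0 \<le> r ==> \<epsilon> * r ^ n \<le> bint (indicator {x. u x \<le> -31/32}) 0 r"
  "\<And>r. r0 \<le> r ==> \<epsilon> * r ^ n \<le> bint (indicator {x. 31/32 \<le> u x}) 0 r"
  using phase_volume_ex unfolding n_def by blast
 note [measurable] = blip_measurable[OF blip_u]
 have main: "\<epsilon> * \<epsilon> * r ^ n \<le> w * 2 ^ n * 2 * r * bint p 0 (3 * r)" if r: "r0 \<le> r" for r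
 proof -
  have r': "0 < r" using r e by simp
  let ?L = "{x. u x \<le> -31/32}" and ?H = "{x. 31/32 \<le> u x}"
  have bL: "bmeas (indicator ?L)" and bH: "bmeas (indicator ?H)" by (intro bmeas_indicator level_sets)+
  have "ennreal (bint (indicator ?L) 0 r * bint (indicator ?H) 0 r) = (NNBINT x. (ennreal (indicator ?L x) * indicator (ball 0 r) x) * ennreal (bint (indicator ?H) 0 r))"
  proof -
   have "(NNBINT x. (ennreal (indicator ?L x) * indicator (ball 0 r) x) * ennreal (bint (indicator ?H) 0 r))
    = (NNBINT x. ennreal (indicator ?L x) * indicator (ball 0 r) x) * ennreal (bint (indicator ?H) 0 r)"
    by (rule nn_integral_multc) measurable
   also have "(NNBINT x. ennreal (indicator ?L x) * indicator (ball 0 r) x) = ennreal (bint (indicator ?L) 0 r)" by (rule bint_nn[OF bL]) simp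
   finally have tot: "(NNBINT x. (ennreal (indicator ?L x) * indicator (ball 0 r) x) * ennreal (bint (indicator ?H) 0 r))
    = ennreal (bint (indicator ?L) 0 r) * ennreal (bint (indicator ?H) 0 r)" .
   show ?thesis unfolding tot by (intro ennreal_mult bint_nonneg) auto
  qed
  also have "... \<le> (NNBINT x. (NNBINT y. ennreal \<bar>u x - u y\<bar> * indicator (ball 0 r) y) * indicator (ball 0 r) x)"
  proof (intro nn_integral_mono)
   fix x :: 'a
   show "(ennreal (indicator ?L x) * indicator (ball 0 r) x) * ennreal (bint (indicator ?H) 0 r) \<le> (NNBINT y. ennreal \<bar>u x - u y\<bar> * indicator (ball 0 r) y) * indicator (ball 0 r) x"
   proof (cases "x \<in> ?L \<and> x \<in> ball 0 r")
    case True
    have "ennreal (bint (indicator ?H) 0 r) = (NNBINT y. ennreal (indicator ?H y) * indicator (ball 0 r) y)" by (rule bint_nn[OF bH, symmetric]) simp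
    also have "... \<le> (NNBINT y. ennreal \<bar>u x - u y\<bar> * indicator (ball 0 r) y)"
     using True by (intro nn_integral_mono mult_right_mono ennreal_leI) (auto split: split_indicator)
    finally show ?thesis using True by simp
   qed (auto split: split_indicator)
  qed
  also have "... \<le> ennreal (w * (2 * r) ^ n * (2 * r * bint p 0 (3 * r)))" unfolding w_def n_def by (rule oscillation_bound[OF r'])
  finally have "bint (indicator ?L) 0 r * bint (indicator ?H) 0 r \<le> w * (2 * r) ^ n * (2 * r * bint p 0 (3 * r))"
   using w r' by (subst (asm) ennreal_le_iff) (auto intro!: mult_nonneg_nonneg bint_nonneg)
  moreover have "(\<epsilon> * r ^ n) * (\<epsilon> * r ^ n) \<le> bint (indicator ?L) 0 r * bint (indicator ?H) 0 r"
   using e(1) r' by (intro mult_mono e(3,4) r bint_nonneg) auto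
  ultimately have "r ^ n * (\<epsilon> * \<epsilon> * r ^ n) \<le> r ^ n * (w * 2 ^ n * 2 * r * bint p 0 (3 * r))" by (simp add: power_mult_distrib mult_ac)
  then show ?thesis using r' by simp
 qed
 define c where "c = \<epsilon> * \<epsilon> / (w * 2 ^ n * 2) * 3 powr -(real n - 1)"
 have c: "0 < c" using e w by (simp add: c_def)
 have "c * R powr (real n - 1) \<le> bint p 0 R" if R: "3 * r0 \<le> R" for R
 proof -
  define r where "r = R / 3"
  have r: "r0 \<le> r" "0 < r" "R = 3 * r" using R e by (auto simp: r_def)
  have "r ^ n = r powr (real n - 1) * r" using r by (simp flip: powr_realpow powr_mult_base add: powr_diff)
  then have "r * (\<epsilon> * \<epsilon> * r powr (real n - 1)) \<le> r * (w * 2 ^ n * 2 * bint p 0 R)" using main[OF r(1)] by (simp add: r(3) mult_ac)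
  then have "\<epsilon> * \<epsilon> * r powr (real n - 1) \<le> w * 2 ^ n * 2 * bint p 0 R" using r by (simp only: mult_le_cancel_left_pos)
  then have "\<epsilon> * \<epsilon> / (w * 2 ^ n * 2) * r powr (real n - 1) \<le> bint p 0 R" using w by (simp add: field_simps)
  moreover have "r powr (real n - 1) = 3 powr -(real n - 1) * R powr (real n - 1)" using r by (simp add: powr_mult flip: powr_add mult.assoc)
  ultimately show ?thesis by (simp add: c_def mult_ac)
 qed
 then show ?thesis using c e(2) unfolding n_def by (intro exI[of _ c] exI[of _ "3 * r0"] conjI) auto
qed

end

section \<open>Flatness at large scales\<close>

lemma indicator_ball_measurable [measurable (raw)]:
 fixes f g :: "'b => 'a::euclidean_space"
 assumes [measurable]: "f \<in> borel_measurable M" "g \<in> borel_measurable M"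
 shows "(%w. indicator (ball (f w) r) (g w) :: ennreal) \<in> borel_measurable M"
proof -
 have "(%w. indicator (ball (f w) r) (g w) :: ennreal) = (%w. if norm (f w - g w) < r then 1 else 0)"
  by (auto simp: dist_norm split: split_indicator)
 moreover have "... \<in> borel_measurable M" by measurable
 ultimately show ?thesis by simp
qed

text \<open>Both follow from (x - y)^2 \<le> x^2 - y^2. The first is linear in V, so it can be
  integrated when V varies from ball to ball.\<close>

lemma sqrt_gap:
 fixes x y \<mu> V :: real
 assumes "0 \<le> y" "y \<le> x" "x^2 - y^2 \<le> V" "0 < \<mu>"
 shows "x - y \<le> (\<mu> + V / \<mu>) / 2" "x - y \<le> sqrt V"
proof -
 have "(x - y)^2 \<le> V" using assms mult_mono[of y x y y] by (simp add: power2_eq_square algebra_simps)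
 then show "x - y \<le> sqrt V" using real_le_rsqrt by blast
 have "0 \<le> (\<mu> - (x - y))^2" by simp
 then have "2 * \<mu> * (x - y) \<le> \<mu>^2 + V" using \<open>(x - y)^2 \<le> V\<close> by (simp add: power2_eq_square algebra_simps)
 then show "x - y \<le> (\<mu> + V / \<mu>) / 2" using assms(4) by (simp add: field_simps power2_eq_square)
qed

section \<open>Averaging and pigeonhole for the energy\<close>

context layer2
begin

abbreviation dens :: "'a \<times> 'a => real" where
 "dens q \<equiv> (p (fst q) * p (snd q) - G (fst q) \<bullet> G (snd q)) * pkern q"

lemma dens_nonneg: "0 \<le> dens q" by (intro mult_nonneg_nonneg defect_nonneg kern_nonneg)

lemma dens_measurable [measurable]: "dens \<in> borel_measurable (borel \<Otimes>\<^sub>M borel)"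
proof -
 note [measurable] = bmeas_measurable[OF bmeas_p]
 show ?thesis by measurable
qed

lemma EB_nn: "ennreal (EB z r) = (\<integral>\<^sup>+q. ennreal (dens q) * (indicator (ball z r) (fst q) * indicator (ball z r) (snd q)) \<partial>PP)"
proof -
 have "ennreal (EB z r) = (\<integral>\<^sup>+q. ennreal (indicator (ball z r) (fst q) * indicator (ball z r) (snd q) * dens q) \<partial>PP)"
  unfolding EB_def by (intro nn_integral_eq_integral[symmetric] EB_integrable AE_I2 mult_nonneg_nonneg dens_nonneg) auto
 also have "... = (\<integral>\<^sup>+q. ennreal (dens q) * (indicator (ball z r) (fst q) * indicator (ball z r) (snd q)) \<partial>PP)"
  by (intro nn_integral_cong) (auto split: split_indicator)
 finally show ?thesis .
qed

text \<open>A pair of points contributes to EB y a only if y lies within a of both, so the centres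
  that see it have at most the volume of one ball of radius a.\<close>

lemma EB_average:
 assumes a: "0 < a" and r: "0 < r"
 shows "bmeas (%y. EB y a)" "bint (%y. EB y a) 0 r \<le> unit_ball_vol (DIM('a)) * a ^ DIM('a) * EB 0 (r + a)"
proof -
 have 0: "(%w::'a \<times> 'a \<times> 'a. ennreal (dens (snd w)) * (indicator (ball (fst w) a) (fst (snd w)) * indicator (ball (fst w) a) (snd (snd w)))) \<in> borel_measurable (borel \<Otimes>\<^sub>M (borel \<Otimes>\<^sub>M borel))"
  by (intro borel_measurable_times_ennreal indicator_ball_measurable measurable_compose[OF measurable_compose[OF measurable_snd dens_measurable] measurable_ennreal]
    measurable_fst measurable_compose[OF measurable_snd measurable_fst] measurable_compose[OF measurable_snd measurable_snd])
 have jm: "(%(y, q). ennreal (dens q) * (indicator (ball y a) (fst q) * indicator (ball y a) (snd q)) * indicator (ball 0 r) y) \<in> borel_measurable (lborel \<Otimes>\<^sub>M (lborel :: ('a \<times> 'a) measure))"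
 proof -
  have "(%w::'a \<times> 'a \<times> 'a. indicator (ball 0 r) (fst w) :: ennreal) \<in> borel_measurable (borel \<Otimes>\<^sub>M (borel \<Otimes>\<^sub>M borel))" by measurable
  from borel_measurable_times_ennreal[OF 0 this] show ?thesis by (simp add: case_prod_beta' borel_prod lborel_prod)
 qed
 have EBm: "(%y. ennreal (EB y a)) \<in> borel_measurable borel"
 proof -
  have "(%(y, q). ennreal (dens q) * (indicator (ball y a) (fst q) * indicator (ball y a) (snd q))) \<in> borel_measurable (lborel \<Otimes>\<^sub>M (lborel :: ('a \<times> 'a) measure))"
   using 0 by (simp add: case_prod_beta' borel_prod lborel_prod)
  from lborel.borel_measurable_nn_integral[OF this] show ?thesis unfolding EB_nn lborel_prod by simp
 qed
 have "(%y. enn2real (ennreal (EB y a))) \<in> borel_measurable borel" using EBm by measurable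
 then have "(%y. EB y a) \<in> borel_measurable borel" by (simp add: EB_nonneg)
 then show bE: "bmeas (%y. EB y a)" using EB_bound[OF a] EB_nonneg[of _ a] unfolding bmeas_def by auto
 have "ennreal (bint (%y. EB y a) 0 r) = (NNBINT y. ennreal (EB y a) * indicator (ball 0 r) y)" by (rule bint_nn[OF bE EB_nonneg, symmetric])
 also have "... = (NNBINT y. (\<integral>\<^sup>+q. ennreal (dens q) * (indicator (ball y a) (fst q) * indicator (ball y a) (snd q)) * indicator (ball 0 r) y \<partial>PP))"
  unfolding EB_nn by (intro nn_integral_cong nn_integral_multc[symmetric]) measurable
 also have "... = (\<integral>\<^sup>+q. (NNBINT y. ennreal (dens q) * (indicator (ball y a) (fst q) * indicator (ball y a) (snd q)) * indicator (ball 0 r) y) \<partial>PP)"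
  unfolding lborel_prod by (rule lborel_pair.Fubini'[symmetric]) (use jm in \<open>simp add: case_prod_beta'\<close>)
 also have "... \<le> (\<integral>\<^sup>+q. ennreal (dens q) * (indicator (ball 0 (r + a)) (fst q) * indicator (ball 0 (r + a)) (snd q)) * ennreal (unit_ball_vol (DIM('a)) * a ^ DIM('a)) \<partial>PP)"
 proof (intro nn_integral_mono)
  fix q :: "'a \<times> 'a"
  have "(NNBINT y. ennreal (dens q) * (indicator (ball y a) (fst q) * indicator (ball y a) (snd q)) * indicator (ball 0 r) y)
   \<le> (NNBINT y. (ennreal (dens q) * (indicator (ball 0 (r + a)) (fst q) * indicator (ball 0 (r + a)) (snd q))) * indicator (ball (fst q) a) y)"
  proof (intro nn_integral_mono)
   fix y :: 'a
   have t: "norm w < r + a" if "dist y w < a" "norm y < r" for w using that dist_triangle[of 0 w y] by (simp add: dist_norm)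
   show "ennreal (dens q) * (indicator (ball y a) (fst q) * indicator (ball y a) (snd q)) * indicator (ball 0 r) y
    \<le> (ennreal (dens q) * (indicator (ball 0 (r + a)) (fst q) * indicator (ball 0 (r + a)) (snd q))) * indicator (ball (fst q) a) y"
   proof (cases "dist y (fst q) < a \<and> dist y (snd q) < a \<and> norm y < r")
    case True
    then show ?thesis using t[of "fst q"] t[of "snd q"] by (simp add: dist_commute)
   qed (auto split: split_indicator)
  qed
  also have "... = ennreal (dens q) * (indicator (ball 0 (r + a)) (fst q) * indicator (ball 0 (r + a)) (snd q)) * ennreal (unit_ball_vol (DIM('a)) * a ^ DIM('a))"
   using a by (subst nn_integral_cmult_indicator) (auto simp: emeasure_ball)
  finally show "(NNBINT y. ennreal (dens q) * (indicator (ball y a) (fst q) * indicator (ball y a) (snd q)) * indicator (ball 0 r) y)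
   \<le> ennreal (dens q) * (indicator (ball 0 (r + a)) (fst q) * indicator (ball 0 (r + a)) (snd q)) * ennreal (unit_ball_vol (DIM('a)) * a ^ DIM('a))" .
 qed
 also have "... = ennreal (EB 0 (r + a)) * ennreal (unit_ball_vol (DIM('a)) * a ^ DIM('a))"
  unfolding EB_nn by (rule nn_integral_multc) measurable
 also have "... = ennreal (unit_ball_vol (DIM('a)) * a ^ DIM('a) * EB 0 (r + a))"
  using a by (simp add: ennreal_mult EB_nonneg mult.commute)
 finally show "bint (%y. EB y a) 0 r \<le> unit_ball_vol (DIM('a)) * a ^ DIM('a) * EB 0 (r + a)"
  using a by (subst (asm) ennreal_le_iff) (auto intro!: mult_nonneg_nonneg EB_nonneg)
qed

text \<open>The balls are disjoint, so a pair of points lies in at most one of them and their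
  energies add up to at most that of the large ball.\<close>

lemma EB_pigeonhole:
 fixes z :: "nat => 'a"
 assumes k: "0 < k" and disj: "\<And>i j. i < k ==> j < k ==> i \<noteq> j ==> 2 * r \<le> norm (z i - z j)" and sub: "\<And>i. i < k ==> ball (z i) r \<subseteq> ball 0 R"
 shows "\<exists>i<k. real k * EB (z i) r \<le> EB 0 R"
proof -
 have "(\<Sum>i<k. EB (z i) r) = (\<integral>q. (\<Sum>i<k. indicator (ball (z i) r) (fst q) * indicator (ball (z i) r) (snd q) * dens q) \<partial>PP)"
  unfolding EB_def by (rule Lintegral_sum[symmetric]) (rule EB_integrable)
 also have "... \<le> EB 0 R" unfolding EB_def
 proof (intro integral_mono Lintegrable_sum EB_integrable)
  fix q :: "'a \<times> 'a"
  have "(\<Sum>i<k. indicator (ball (z i) r) (fst q) * indicator (ball (z i) r) (snd q)) \<le> (indicator (ball 0 R) (fst q) * indicator (ball 0 R) (snd q) :: real)"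
  proof (cases "\<exists>i<k. fst q \<in> ball (z i) r \<and> snd q \<in> ball (z i) r")
   case True
   then obtain i where i: "i < k" "fst q \<in> ball (z i) r" "snd q \<in> ball (z i) r" by blast
   have "(\<Sum>j<k. indicator (ball (z j) r) (fst q) * indicator (ball (z j) r) (snd q) :: real) = (\<Sum>j\<in>{i}. indicator (ball (z j) r) (fst q) * indicator (ball (z j) r) (snd q))"
   proof (rule sum.mono_neutral_right)
    show "\<forall>j\<in>{..<k} - {i}. indicator (ball (z j) r) (fst q) * indicator (ball (z j) r) (snd q) = (0::real)"
    proof
     fix j assume j: "j \<in> {..<k} - {i}"
     have "\<not> dist (z j) (fst q) < r"
      using disj[of i j] j i dist_triangle[of "z i" "z j" "fst q"] by (auto simp: dist_norm norm_minus_commute)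
     then show "indicator (ball (z j) r) (fst q) * indicator (ball (z j) r) (snd q) = (0::real)" by simp
    qed
   qed (use i in auto)
   also have "... \<le> indicator (ball 0 R) (fst q) * indicator (ball 0 R) (snd q)" using i subsetD[OF sub[OF i(1)]] by simp
   finally show ?thesis .
  next
   case False
   then have "(\<Sum>i<k. indicator (ball (z i) r) (fst q) * indicator (ball (z i) r) (snd q)) = (0::real)" by (intro sum.neutral) (auto split: split_indicator)
   then show ?thesis by simp
  qed
  then show "(\<Sum>i<k. indicator (ball (z i) r) (fst q) * indicator (ball (z i) r) (snd q) * dens q) \<le> indicator (ball 0 R) (fst q) * indicator (ball 0 R) (snd q) * dens q"
   unfolding sum_distrib_right[symmetric] by (rule mult_right_mono[OF _ dens_nonneg])
 qed
 finally have S: "(\<Sum>i<k. EB (z i) r) \<le> EB 0 R" .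
 show ?thesis
 proof (rule ccontr)
  assume "\<not> ?thesis"
  then have "\<And>i. i < k ==> EB 0 R / real k < EB (z i) r" using k by (auto simp: field_simps not_le)
  then have "(\<Sum>i<k. EB 0 R / real k) < (\<Sum>i<k. EB (z i) r)" using k by (intro sum_strict_mono) auto
  then show False using S k by simp
 qed
qed

definition cflux :: "real => 'a => 'a" where "cflux a y = (\<Sum>b\<in>Basis. conv a (%x. b \<bullet> G x) y *\<^sub>R b)"

lemma cflux_inner:
 assumes a: "0 < a" shows "e \<bullet> cflux a y = conv a (%x. e \<bullet> G x) y"
proof -
 have pt: "e \<bullet> G x = (\<Sum>b\<in>Basis. (e \<bullet> b) * (b \<bullet> G x))" for x
  by (subst euclidean_inner[of e "G x"]) (simp add: inner_commute)
 have "conv a (%x. e \<bullet> G x) y = (LBINT x. (\<Sum>b\<in>Basis. (e \<bullet> b) * (tent y a x * (b \<bullet> G x))))"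
  unfolding conv_def pt by (simp add: sum_distrib_left mult_ac)
 also have "... = (\<Sum>b\<in>Basis. (e \<bullet> b) * conv a (%x. b \<bullet> G x) y)"
  unfolding conv_def by (subst Lintegral_sum) (auto intro!: integrable_mult_right tent_mult_integrable a bmeas_dir)
 also have "... = e \<bullet> cflux a y" unfolding cflux_def by (simp add: inner_sum_right mult.commute)
 finally show ?thesis ..
qed

lemma norm_le_if_inner: "(\<And>e. norm e = 1 ==> e \<bullet> v \<le> c) ==> 0 \<le> c ==> norm v \<le> c" for v :: 'a
proof (cases "v = 0")
 case False
 assume "\<And>e. norm e = 1 ==> e \<bullet> v \<le> c"
 from this[of "v /\<^sub>R norm v"] False have "(v \<bullet> v) / norm v \<le> c" by (simp add: divide_inverse mult.commute)
 then show ?thesis using False by (simp add: power2_norm_eq_inner[symmetric] power2_eq_square)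
qed simp

lemma norm_cflux_le: assumes a: "0 < a" shows "norm (cflux a y) \<le> conv a p y"
 by (rule norm_le_if_inner) (auto simp: cflux_inner[OF a] intro!: conv_mono a bmeas_dir bmeas_p dir_le_p conv_nonneg)

lemma cflux_gap:
 assumes a: "0 < a" shows "(conv a p y)^2 - (norm (cflux a y))^2 \<le> (4 * a) powr ord * EB y (2 * a)"
proof -
 have "(LBINT x. tent y a x * p x)^2 - (\<Sum>b\<in>Basis. (LBINT x. tent y a x * (b \<bullet> G x))^2) \<le> (2 * (2 * a)) powr ord * EB y (2 * a)"
 proof (rule weighted_defect)
  show "integrable lborel (tent y a)" using tent_mult_integrable[OF a bmeas_const[of 1], of y] by simp
  show "tent y a x \<le> indicator (ball y (2 * a)) x" for x
   using tent_bounds[of y a x] tent_eq_0[OF a, of x y] by (cases "x \<in> ball y (2 * a)") (auto simp: dist_norm norm_minus_commute)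
 qed (use a in \<open>auto intro!: tent_mult_integrable bmeas_p bmeas_dir tent_bounds\<close>)
 moreover have "(\<Sum>b\<in>Basis. (LBINT x. tent y a x * (b \<bullet> G x))^2) = (norm (cflux a y))^2"
  unfolding norm_sq_sum[symmetric] cflux_inner[OF a] conv_def ..
 ultimately show ?thesis by (simp add: conv_def)
qed

text \<open>The gradient is moved to the tent, of slope 1/a; what remains is the L1 distance of u to
  its translate.\<close>

lemma cflux_translate:
 assumes a: "0 < a" shows "norm (cflux a (y + z) - cflux a y) \<le> 1 / a * bint (%x. \<bar>u (x + z) - u x\<bar>) y (4 * a)"
proof (rule norm_le_if_inner)
 fix e :: 'a assume e: "norm e = 1"
 have b: "bmeas (%x. e \<bullet> G (x + z))" by (intro blip_bmeas blip_translate[of "%x. e \<bullet> G x"] blip_dir)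
 have "e \<bullet> (cflux a (y + z) - cflux a y) = conv a (%x. e \<bullet> G (x + z)) y - conv a (%x. e \<bullet> G x) y"
  unfolding inner_diff_right cflux_inner[OF a] conv_translate[OF bmeas_dir] ..
 also have "... = conv a (%x. e \<bullet> G (x + z) - e \<bullet> G x) y" by (rule conv_diff[OF a b bmeas_dir, symmetric])
 also have "... = (LBINT x. (e \<bullet> (G (x + z) - G x)) * tent y a x)" unfolding conv_def by (simp add: inner_diff_right mult.commute)
 also have "... \<le> \<bar>...\<bar>" by simp
 also have "... \<le> 1 / a * norm e * bint (%x. \<bar>u (x + z) - u x\<bar>) y (2 * (2 * a))"
 proof (rule ibp_lip)
  show "bmeas (%x. u (x + z) - u x)" by (intro blip_bmeas blip_diff blip_translate blip_u)
  show "(%x. G (x + z) - G x) \<in> borel_measurable borel" by measurable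
  show "norm (G (x + z) - G x) \<le> 2 * \<Lambda>" for x using norm_triangle_ineq4[of "G (x + z)" "G x"] G_bound[of x] G_bound[of "x + z"] by linarith
  show "\<bar>u (x + h + z) - u (x + h) - (u (x + z) - u x) - (G (x + z) - G x) \<bullet> h\<bar> \<le> 2 * \<Lambda> * (norm h)^2" for x h
   using taylor[of "x + z" h] taylor[of x h] by (simp add: inner_diff_left add_ac abs_le_iff)
  show "\<bar>tent y a x - tent y a x'\<bar> \<le> 1 / a * norm (x - x')" for x x' using tent_lip[OF a, of y x x'] by linarith
  show "\<bar>tent y a x\<bar> \<le> 1" for x using tent_bounds[of y a x] by simp
  show "2 * a \<le> norm (x - y) ==> tent y a x = 0" for x by (rule tent_eq_0[OF a])
  show "0 < 2 * a" using a by simp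
 qed
 finally show "e \<bullet> (cflux a (y + z) - cflux a y) \<le> 1 / a * bint (%x. \<bar>u (x + z) - u x\<bar>) y (4 * a)" using e by simp
qed (use a in \<open>intro mult_nonneg_nonneg bint_nonneg; simp\<close>)

end

context layer2
begin

lemma gap_facts:
 assumes "norm \<omega> = 1"
 shows "blip (%x. p x - \<omega> \<bullet> G x)" "0 \<le> p x - \<omega> \<bullet> G x" "bmeas (%x. p x - \<omega> \<bullet> G x)"
 using dir_le_p[of \<omega> x] assms by (auto intro!: blip_bmeas blip_diff blip_p blip_dir)

text \<open>Each summand of the bound is one error. Among k disjoint balls of radius 2r placed along
  e, one has energy at most K (12kr)^(1-s)/k, so there G is aligned with some \<omega> up to a
  multiple of k^(-s/2) r^2. As the flux along e is small, u changes little in L1 on the way back to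
  the origin, which controls averages of G at scale \<delta> r with an error c k^3/\<delta>^4.
  Returning from averages to p and G themselves costs the energy at scale \<delta> r, averaged over
  centres: a multiple of \<delta>^(s/2) r^2.\<close>

lemma flat_step:
 fixes e :: 'a and k :: nat
 defines "K \<equiv> Cp * Cm * 2 powr (dimr - 1)"
 assumes n3: "DIM('a) = 3" and e: "norm e = 1" "\<And>x. 0 \<le> e \<bullet> G x" and k: "0 < k" and \<delta>: "0 < \<delta>" "\<delta> \<le> 1/4" and r: "0 < r"
  and c: "0 \<le> c" "bint (%x. e \<bullet> G x) 0 (12 * real k * r) \<le> c * (12 * real k * r)^2"
 shows "\<exists>\<omega>. norm \<omega> = 1 \<and> bint (%x. p x - \<omega> \<bullet> G x) 0 (3 * r / 4)
  \<le> ((1 + 4 powr (3 + s) * 8 * K * 2 powr (1 - s)) / 2 * \<delta> powr (s/2) + 8 * sqrt (4 powr (3 + s) * K * 12 powr (1 - s) * real k powr -s) + 2304 * c * real k ^ 3 / \<delta> ^ 4) * r^2"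
proof -
 have d3: "dimr = 3" "ord = 3 + s" "dimr - 2 - s = 1 - s" using n3 by (auto simp: dimr_def ord_def)
 have K: "0 < K" "\<And>z r. 0 < r ==> EB z r \<le> K * r powr (1 - s)" using Cp(1) Cm(1) EB_bound d3 by (auto simp: K_def)
 define w where "w = unit_ball_vol 3"
 have w: "0 < w" by (simp add: w_def)
 have r4: "r powr (3 + s) * r powr (1 - s) = r^2 * r^2"
 proof -
  have "r powr (3 + s) * r powr (1 - s) = r powr (3 + s + (1 - s))" by (rule powr_add[symmetric])
  also have "3 + s + (1 - s) = real 4" by simp
  also have "r powr real 4 = r^4" using r by (rule powr_realpow)
  finally show ?thesis by (simp add: power4_eq_xxxx power2_eq_square)
 qed
 \<comment> \<open>Centres at spacing 8r keep balls of radius 2r disjoint, all inside the ball of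
   radius 12kr.\<close>
 define z where "z i = (8 * real i * r) *\<^sub>R e" for i :: nat
 have "\<exists>i<k. real k * EB (z i) (2 * r) \<le> EB 0 (12 * real k * r)"
 proof (rule EB_pigeonhole[OF k])
  fix i j assume "i < k" "j < k" "i \<noteq> j"
  have "1 \<le> \<bar>real i - real j\<bar>" using \<open>i \<noteq> j\<close> by linarith
  then have "8 * r * 1 \<le> 8 * r * \<bar>real i - real j\<bar>" using r by (intro mult_left_mono) auto
  moreover have "z i - z j = (8 * r * (real i - real j)) *\<^sub>R e" by (simp add: z_def algebra_simps)
  then have "norm (z i - z j) = 8 * r * \<bar>real i - real j\<bar>" using e r by (simp add: abs_mult)
  ultimately show "2 * (2 * r) \<le> norm (z i - z j)" using r by simp
 next
  fix i assume i: "i < k"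
  have "(8 * real i + 2) * r \<le> (12 * real k) * r" using i r by (intro mult_right_mono) auto
  then have "norm (z i) + 2 * r \<le> 12 * real k * r" using e r by (simp add: z_def algebra_simps)
  then have le: "norm (z i) + 2 * r \<le> 12 * real k * r" .
  show "ball (z i) (2 * r) \<subseteq> ball 0 (12 * real k * r)"
  proof
   fix x assume "x \<in> ball (z i) (2 * r)"
   then show "x \<in> ball 0 (12 * real k * r)" using le norm_triangle_ineq4[of "z i" "z i - x"] by (simp add: dist_norm)
  qed
 qed
 then obtain i where i: "i < k" "real k * EB (z i) (2 * r) \<le> EB 0 (12 * real k * r)" by blast
 define y0 where "y0 = z i"
 define C1 where "C1 = 4 powr (3 + s) * K * 12 powr (1 - s) * real k powr -s"
 have C1: "0 < C1" using K k by (simp add: C1_def)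
 \<comment> \<open>If the flux vanishes, any unit vector will do.\<close>
 define \<omega> where "\<omega> = (if flux y0 (2 * r) = 0 then e else flux y0 (2 * r) /\<^sub>R norm (flux y0 (2 * r)))"
 have \<omega>: "norm \<omega> = 1" using e by (auto simp: \<omega>_def)
 have \<omega>f: "\<omega> \<bullet> flux y0 (2 * r) = norm (flux y0 (2 * r))"
  by (auto simp: \<omega>_def power2_norm_eq_inner[symmetric] power2_eq_square)
 define q where "q x = p x - \<omega> \<bullet> G x" for x
 have q: "bmeas q" "\<And>x. 0 \<le> q x" using gap_facts[OF \<omega>] by (auto simp: q_def[abs_def])
 have qz: "bint q y0 (2 * r) \<le> sqrt C1 * r^2"
 proof -
  have "real k * EB y0 (2 * r) \<le> K * (12 * real k * r) powr (1 - s)" using i(2) K(2)[of "12 * real k * r" 0] k r by (simp add: y0_def)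
  also have "... = real k * (K * 12 powr (1 - s) * real k powr -s * r powr (1 - s))"
   using k r powr_add[of "real k" 1 "-s"] by (simp add: powr_mult)
  finally have E: "EB y0 (2 * r) \<le> K * 12 powr (1 - s) * real k powr -s * r powr (1 - s)" using k by (simp only: mult_le_cancel_left_pos of_nat_0_less_iff)
  have "(bint p y0 (2 * r))^2 - (norm (flux y0 (2 * r)))^2 \<le> (2 * (2 * r)) powr ord * EB y0 (2 * r)" using r by (intro ball_defect) simp
  also have "... \<le> (4 * r) powr (3 + s) * (K * 12 powr (1 - s) * real k powr -s * r powr (1 - s))" unfolding d3 using E by (intro mult_mono) (auto intro: EB_nonneg)
  also have "... = C1 * (r powr (3 + s) * r powr (1 - s))" using r by (simp add: C1_def powr_mult)
  also have "r powr (3 + s) * r powr (1 - s) = (r^2)^2" unfolding r4 by (simp add: power2_eq_square)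
  finally have "bint p y0 (2 * r) - norm (flux y0 (2 * r)) \<le> sqrt (C1 * (r^2)^2)" by (intro sqrt_gap(2)[of _ _ _ 1] norm_flux_le) auto
  also have "... = sqrt C1 * r^2" unfolding real_sqrt_mult real_sqrt_abs by simp
  finally show ?thesis unfolding q_def[abs_def] bint_diff[OF bmeas_p bmeas_dir] flux_inner[symmetric] \<omega>f .
 qed
 define a where "a = \<delta> * r"
 have a: "0 < a" "4 * a \<le> r" using \<delta> r by (auto simp: a_def)
 define T where "T = 1152 * c * real k ^ 3 * r^2 / \<delta>"
 have T: "norm (cflux a (y + y0) - cflux a y) \<le> T" if y: "norm y < r" for y
 proof (cases "i = 0")
  case True
  then show ?thesis using c \<delta> by (simp add: y0_def z_def T_def)
 next
  case False
  define h where "h = 8 * real i * r"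
  have h: "0 < h" "h \<le> 8 * real k * r" using False r i by (auto simp: h_def intro!: mult_right_mono)
  have "(8 * real i + 2) * r \<le> (12 * real k) * r" using i r by (intro mult_right_mono) auto
  then have h2: "2 * r + h \<le> 12 * real k * r" by (simp add: h_def algebra_simps)
  have bu: "bmeas (%x. \<bar>u (x + y0) - u x\<bar>)" by (intro bmeas_abs bmeas_diff bmeas_u blip_bmeas[OF blip_translate] blip_u)
  have "bint (%x. \<bar>u (x + y0) - u x\<bar>) y (4 * a) \<le> bint (%x. \<bar>u (x + y0) - u x\<bar>) 0 (2 * r)"
  proof (intro bint_subset bu)
   show "ball y (4 * a) \<subseteq> ball 0 (2 * r)"
   proof
    fix x assume "x \<in> ball y (4 * a)"
    then show "x \<in> ball 0 (2 * r)" using y a norm_triangle_ineq4[of y "y - x"] by (simp add: dist_norm)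
   qed
  qed simp
  also have "... \<le> h * bint (%x. e \<bullet> G x) 0 (2 * r + h)"
   unfolding y0_def z_def h_def[symmetric] using e h r by (intro translation_l1 blip_dir) auto
  also have "... \<le> (8 * real k * r) * (c * (12 * real k * r)^2)"
   using h h2 e(2) c(2) r by (intro mult_mono order_trans[OF bint_subset c(2)] bmeas_dir bint_nonneg) auto
  finally have "norm (cflux a (y + y0) - cflux a y) \<le> 1 / a * ((8 * real k * r) * (c * (12 * real k * r)^2))"
   using a by (intro order_trans[OF cflux_translate[OF a(1)]] mult_left_mono) auto
  also have "... = T" using r \<delta> by (simp add: a_def T_def field_simps power2_eq_square power3_eq_cube)
  finally show ?thesis .
 qed
 \<comment> \<open>Balances the linearised gap: \<mu>/\<delta>^3 and the averaged energy term with
   V/\<mu> are both of order \<delta>^(s/2) r^2.\<close>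
 define \<mu> where "\<mu> = \<delta> powr (3 + s/2) * r^2"
 have \<mu>: "0 < \<mu>" using \<delta> r by (simp add: \<mu>_def)
 define V where "V = (4 * a) powr (3 + s)"
 have V: "0 < V" using a by (simp add: V_def)
 have bE: "bmeas (%y. EB y (2 * a))" using a r by (intro EB_average(1)[OF _ r]) simp
 have bc: "bmeas (%y. conv a q (y + y0))"
  using bmeas_conv[OF a(1) q(1)] measurable_compose[of "%y. y + y0" borel borel "conv a q" borel] by (auto simp: bmeas_def)
 have bcq: "bmeas (conv a q)" by (rule bmeas_conv[OF a(1) q(1)])
 have bE2: "bmeas (%y. (V / \<mu> / 2) * EB y (2 * a))" by (intro bmeas_mult bmeas_const bE)
 \<comment> \<open>The misalignment at y is that at y + y0, plus twice the translation error
   \<open>T\<close>, plus the gap between averaged mass and averaged flux at scale a.\<close>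
 have pt: "conv a q y \<le> conv a q (y + y0) + ((2 * T + \<mu> / 2) + (V / \<mu> / 2) * EB y (2 * a))" if y: "y \<in> ball 0 r" for y
 proof -
  have cq: "conv a q y = conv a p y - \<omega> \<bullet> cflux a y" for y
   unfolding q_def[abs_def] cflux_inner[OF a(1)] by (rule conv_diff[OF a(1) bmeas_p bmeas_dir])
  have g: "conv a p y - norm (cflux a y) \<le> (\<mu> + (V * EB y (2 * a)) / \<mu>) / 2"
   using cflux_gap[OF a(1), of y] norm_cflux_le[OF a(1), of y] unfolding d3 V_def[symmetric] by (intro sqrt_gap(1) \<mu>) auto
  have t: "norm (cflux a (y + y0) - cflux a y) \<le> T" using T y by simp
  have "norm (cflux a y) \<le> norm (cflux a (y + y0)) + T" using t norm_triangle_sub[of "cflux a y" "cflux a (y + y0)"] by (simp add: norm_minus_commute)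
  moreover have "\<omega> \<bullet> (cflux a (y + y0) - cflux a y) \<le> T" using norm_cauchy_schwarz[of \<omega> "cflux a (y + y0) - cflux a y"] t \<omega> by simp
  moreover have "norm (cflux a (y + y0)) \<le> conv a p (y + y0)" by (rule norm_cflux_le[OF a(1)])
  ultimately have "norm (cflux a y) - \<omega> \<bullet> cflux a y \<le> conv a q (y + y0) + 2 * T" unfolding cq[of "y + y0"] by (simp add: inner_diff_right)
  then show ?thesis using g unfolding cq[of y] by (simp add: add_divide_distrib)
 qed
 have B1: "bint (conv a q) y0 r \<le> w * (2 * a)^3 * (sqrt C1 * r^2)"
 proof -
  have "bint (conv a q) y0 r \<le> w * (2 * a)^3 * bint q y0 (r + 2 * a)" using bint_conv_upper[OF a(1) q, of y0 r] n3 by (simp add: w_def)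
  also have "... \<le> w * (2 * a)^3 * bint q y0 (2 * r)" using w a r by (intro mult_left_mono bint_subset q) auto
  also have "... \<le> w * (2 * a)^3 * (sqrt C1 * r^2)" using w a by (intro mult_left_mono qz) auto
  finally show ?thesis .
 qed
 have B2: "bint (%y. EB y (2 * a)) 0 r \<le> w * (2 * a)^3 * (K * (2 * r) powr (1 - s))"
 proof -
  have "bint (%y. EB y (2 * a)) 0 r \<le> w * (2 * a)^3 * EB 0 (r + 2 * a)" using EB_average(2)[of "2 * a" r] a r n3 by (simp add: w_def)
  also have "... \<le> w * (2 * a)^3 * EB 0 (2 * r)" using w a r by (intro mult_left_mono EB_mono) auto
  also have "... \<le> w * (2 * a)^3 * (K * (2 * r) powr (1 - s))" using w a r K(2)[of "2 * r" 0] by (intro mult_left_mono) auto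
  finally show ?thesis .
 qed
 have "w * a^3 * bint q 0 (r - a) \<le> bint (conv a q) 0 r" using bint_conv_lower[OF a(1) q, of 0 r] n3 by (simp add: w_def)
 also have "... \<le> bint (%y. conv a q (y + y0) + ((2 * T + \<mu> / 2) + (V / \<mu> / 2) * EB y (2 * a))) 0 r"
  by (intro bint_mono pt bcq bmeas_add bc bmeas_const bE2)
 also have "... = bint (conv a q) y0 r + ((2 * T + \<mu> / 2) * w * r^3 + (V / \<mu> / 2) * bint (%y. EB y (2 * a)) 0 r)"
  unfolding bint_add[OF bc bmeas_add[OF bmeas_const bE2]] bint_add[OF bmeas_const bE2] bint_cmult bint_translate[OF bcq]
  using r n3 by (simp add: bint_const w_def)
 also have "... \<le> w * (2 * a)^3 * (sqrt C1 * r^2) + ((2 * T + \<mu> / 2) * w * r^3 + (V / \<mu> / 2) * (w * (2 * a)^3 * (K * (2 * r) powr (1 - s))))"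
  using V \<mu> by (intro add_mono mult_left_mono B1 B2 order_refl) auto
 also have "... = w * a^3 * (8 * sqrt C1 * r^2 + (2 * T + \<mu> / 2) / \<delta>^3 + (V / \<mu> / 2) * (8 * (K * (2 * r) powr (1 - s))))"
  using r \<delta> by (simp add: a_def field_simps power_mult_distrib)
 finally have m1: "bint q 0 (r - a) \<le> 8 * sqrt C1 * r^2 + (2 * T + \<mu> / 2) / \<delta>^3 + (V / \<mu> / 2) * (8 * (K * (2 * r) powr (1 - s)))"
  using w a by simp
 have t1: "2 * T / \<delta>^3 = 2304 * c * real k ^ 3 / \<delta>^4 * r^2" using \<delta> by (simp add: T_def field_simps power3_eq_cube power4_eq_xxxx)
 have "\<delta> powr (3 + s/2) = \<delta>^3 * \<delta> powr (s/2)" unfolding powr_add using \<delta> by simp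
 then have t2: "\<mu> / \<delta>^3 = \<delta> powr (s/2) * r^2" using \<delta> by (simp add: \<mu>_def)
 have t3: "V / \<mu> * (8 * (K * (2 * r) powr (1 - s))) = 4 powr (3 + s) * 8 * K * 2 powr (1 - s) * \<delta> powr (s/2) * r^2"
 proof -
  have "\<delta> powr (3 + s/2) * \<delta> powr (s/2) = \<delta> powr (3 + s)" by (subst powr_add[symmetric]) (simp add: add.commute)
  then have "V = 4 powr (3 + s) * (\<delta> powr (3 + s/2) * \<delta> powr (s/2)) * r powr (3 + s)"
   using \<delta> r by (simp add: V_def a_def powr_mult)
  moreover note r4
  moreover have "(2 * r) powr (1 - s) = 2 powr (1 - s) * r powr (1 - s)" using r by (simp add: powr_mult)
  ultimately have "V * (8 * (K * (2 * r) powr (1 - s))) = (4 powr (3 + s) * 8 * K * 2 powr (1 - s) * \<delta> powr (s/2) * r^2) * \<mu>"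
   by (simp add: \<mu>_def algebra_simps)
  then show ?thesis using \<mu> by (simp add: field_simps)
 qed
 have "bint q 0 (3 * r / 4) \<le> bint q 0 (r - a)" using a by (intro bint_subset q) auto
 also have "... \<le> 8 * sqrt C1 * r^2 + (2 * T / \<delta>^3 + (\<mu> / \<delta>^3) / 2) + (V / \<mu> * (8 * (K * (2 * r) powr (1 - s)))) / 2"
  using m1 by (simp add: add_divide_distrib)
 also have "... = ((1 + 4 powr (3 + s) * 8 * K * 2 powr (1 - s)) / 2 * \<delta> powr (s/2) + 8 * sqrt C1 + 2304 * c * real k ^ 3 / \<delta>^4) * r^2"
  unfolding t1 t2 t3 by (simp add: algebra_simps add_divide_distrib)
 finally show ?thesis using \<omega> unfolding q_def[abs_def] C1_def by blast
qed

text \<open>The order of choices matters: \<delta> for the local error, then k for the share of the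
  energy, then c for the translation error, which contains both. Degeneracy of e finally offers
  arbitrarily large radii at level c.\<close>

lemma flat_scale_ex:
 assumes n3: "DIM('a) = 3" and \<epsilon>: "0 < \<epsilon>" and r1: "0 < r1"
 shows "\<exists>r\<ge>r1. \<exists>\<omega>. norm \<omega> = 1 \<and> bint (%x. p x - \<omega> \<bullet> G x) 0 r \<le> \<epsilon> * r^2"
proof -
 define K where "K = Cp * Cm * 2 powr (dimr - 1)"
 define B where "B = (1 + 4 powr (3 + s) * 8 * K * 2 powr (1 - s)) / 2"
 define A where "A = 4 powr (3 + s) * K * 12 powr (1 - s)"
 have K: "0 < K" using Cp(1) Cm(1) by (simp add: K_def)
 have AB: "0 < A" "0 < B" using K by (auto simp: A_def B_def add_pos_pos)
 define \<epsilon>' where "\<epsilon>' = \<epsilon> / 8"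
 have e': "0 < \<epsilon>'" using \<epsilon> by (simp add: \<epsilon>'_def)
 define \<delta> where "\<delta> = min (1/4) ((\<epsilon>' / B) powr (2 / s))"
 have \<delta>: "0 < \<delta>" "\<delta> \<le> 1/4" using e' AB by (auto simp: \<delta>_def)
 have "\<delta> powr (s/2) \<le> ((\<epsilon>' / B) powr (2 / s)) powr (s/2)" using s_pos \<delta> by (intro powr_mono2) (auto simp: \<delta>_def)
 also have "... = \<epsilon>' / B" using s_pos e' AB by (simp add: powr_powr)
 finally have d1: "B * \<delta> powr (s/2) \<le> \<epsilon>'" using AB by (simp add: field_simps)
 have "(%k. 8 * sqrt (A * real k powr -s)) \<longlonglongrightarrow> 8 * sqrt (A * 0)"
  using s_pos by (intro tendsto_intros tendsto_neg_powr filterlim_real_sequentially) auto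
 from order_tendstoD(2)[OF this, of \<epsilon>'] e' have "\<forall>\<^sub>F k in sequentially. 8 * sqrt (A * real k powr -s) < \<epsilon>'" by simp
 then have "\<forall>\<^sub>F k in sequentially. 8 * sqrt (A * real k powr -s) < \<epsilon>' \<and> 0 < k" using eventually_gt_at_top[of 0] by (rule eventually_conj)
 then obtain k where k: "8 * sqrt (A * real k powr -s) < \<epsilon>'" "0 < k" using eventually_happens trivial_limit_sequentially by blast
 define c where "c = \<epsilon>' * \<delta>^4 / (2304 * real k ^ 3)"
 have c: "0 < c" "2304 * c * real k ^ 3 / \<delta>^4 = \<epsilon>'" using e' \<delta> k by (auto simp: c_def)
 obtain e where e: "norm e = 1" "\<And>x. 0 \<le> e \<bullet> G x" "\<And>c r0. 0 < c ==> 0 < r0 ==> \<exists>r\<ge>r0. bint (%x. e \<bullet> G x) 0 r < c * r powr (dimr - 1)"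
  using degenerate_direction_ex by blast
 obtain R where R: "12 * real k * (2 * r1) \<le> R" "bint (%x. e \<bullet> G x) 0 R < c * R powr (dimr - 1)"
  using e(3)[OF c(1), of "12 * real k * (2 * r1)"] k r1 by auto
 define r where "r = R / (12 * real k)"
 have "0 < 12 * real k * (2 * r1)" using k r1 by simp
 then have R0: "0 < R" using R(1) by linarith
 have r: "2 * r1 \<le> r" "12 * real k * r = R" "0 < r" using R(1) R0 k by (auto simp: r_def field_simps)
 have "R powr (dimr - 1) = R^2" using n3 R0 by (simp add: dimr_def)
 then have c2: "bint (%x. e \<bullet> G x) 0 (12 * real k * r) \<le> c * (12 * real k * r)^2" using R(2) unfolding r(2) by simp
 obtain \<omega> where \<omega>: "norm \<omega> = 1" "bint (%x. p x - \<omega> \<bullet> G x) 0 (3 * r / 4) \<le> (B * \<delta> powr (s/2) + 8 * sqrt (A * real k powr -s) + 2304 * c * real k ^ 3 / \<delta> ^ 4) * r^2"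
  using flat_step[OF n3 e(1,2) k(2) \<delta> r(3) less_imp_le[OF c(1)] c2] unfolding A_def B_def K_def by blast
 note \<omega>(2)
 also have "(B * \<delta> powr (s/2) + 8 * sqrt (A * real k powr -s) + 2304 * c * real k ^ 3 / \<delta> ^ 4) * r^2 \<le> (3 * \<epsilon>') * r^2"
  using d1 k(1) unfolding c(2) by (intro mult_right_mono) auto
 also have "... \<le> \<epsilon> * (3 * r / 4)^2" using \<epsilon> by (simp add: \<epsilon>'_def power2_eq_square field_simps)
 finally have "bint (%x. p x - \<omega> \<bullet> G x) 0 (3 * r / 4) \<le> \<epsilon> * (3 * r / 4)^2" .
 moreover have "r1 \<le> 3 * r / 4" using r r1 by simp
 ultimately show ?thesis using \<omega>(1) by blast
qed

end

section \<open>Descent to fixed scales\<close>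

context layer2
begin

text \<open>Improves the moment bound \<open>Cp\<close> by a power of r/D. The split is at radius r
  \<eta> with \<eta> = (r/D)^(1/8). Inside, g \<le> 2p and the quadratic growth of the mass give the
  factor \<eta>^(1-s). Outside, the assumed smallness gives r/D, spoiled by \<eta>^(-(3+s)) because
  it is known only from radius r on; the exponent 1 - (3+s)/8 that results is still at least
  (1-s)/8.\<close>

lemma tail_bound_ex:
 assumes n3: "DIM('a) = 3" and B: "0 < B"
 shows "\<exists>C>0. \<forall>(g :: 'a => real) r D y. bmeas g \<longrightarrow> (\<forall>x. 0 \<le> g x \<and> g x \<le> 2 * p x) \<longrightarrow> 0 < r \<longrightarrow> r \<le> D \<longrightarrow>
  (\<forall>t\<ge>r. bint g y t \<le> B * t^3 / D) \<longrightarrow>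
  (NNBINT x. ennreal (g x) * ennreal (min 1 (1 / r * norm (x - y)) ^ 2 * kern (x - y))) \<le> ennreal (C * r powr -(1 + s) * (r / D) powr ((1 - s) / 8))"
proof -
 define c1 where "c1 = 2 powr (1 + s) / (1 - 2 powr -(2 - (1 + s))) * Cm"
 define c2 where "c2 = 2 powr 3 / (1 - 2 powr (3 - (3 + s))) * B"
 have c: "0 < c1" "0 < c2" using s_pos s_lt1 Cm(1) B powr_less_one[of 2 "-(2 - (1 + s))"] powr_less_one[of 2 "3 - (3 + s)"]
  by (auto simp: c1_def c2_def intro!: mult_pos_pos divide_pos_pos)
 note [measurable] = bmeas_measurable[OF bmeas_p]
 have "(NNBINT x. ennreal (g x) * ennreal (min 1 (1 / r * norm (x - y)) ^ 2 * kern (x - y))) \<le> ennreal ((2 * c1 + c2) * r powr -(1 + s) * (r / D) powr ((1 - s) / 8))"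
  if g: "bmeas g" "\<And>x. 0 \<le> g x" "\<And>x. g x \<le> 2 * p x" and r: "0 < r" "r \<le> D" and mass: "\<And>t. r \<le> t ==> bint g y t \<le> B * t^3 / D"
  for g :: "'a => real" and r D y
 proof -
  note [measurable] = bmeas_measurable[OF g(1)]
  define \<eta> where "\<eta> = (r / D) powr (1 / 8)"
  have rD: "0 < r / D" "r / D \<le> 1" "0 < D" using r by auto
  have \<eta>: "0 < \<eta>" "\<eta> \<le> 1" using rD powr_mono2[of "1/8" "r / D" 1] by (auto simp: \<eta>_def)
  define \<rho> where "\<rho> = r * \<eta>"
  have \<rho>: "0 < \<rho>" using r \<eta> by (simp add: \<rho>_def)
  have near: "(NNBINT x. ennreal (p x) * ennreal (norm (x - y) powr -(1 + s)) * indicator (ball y \<rho>) x) \<le> ennreal (c1 * \<rho> powr (1 - s))"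
  proof -
   have "(NNBINT x. ennreal (p x) * ennreal (norm (x - y) powr -(1 + s)) * indicator (ball y \<rho>) x)
    \<le> ennreal (2 powr (1 + s) / (1 - 2 powr -(2 - (1 + s))) * Cm * \<rho> powr (2 - (1 + s)))"
   proof (rule nn_near_shells)
    fix t :: real assume "0 < t"
    then show "(NNBINT x. ennreal (p x) * indicator (ball y t) x) \<le> ennreal (Cm * t powr 2)"
     using Cm(2)[of t y] n3 by (simp add: bint_nn[OF bmeas_p] ennreal_leI del: powr_numeral)
   qed (use \<rho> s_pos s_lt1 Cm in auto)
   then show ?thesis by (simp add: c1_def)
  qed
  have far: "(NNBINT x. ennreal (g x) * ennreal (norm (x - y) powr -(3 + s)) * indicator (- ball y \<rho>) x) \<le> ennreal (c2 * (1 / \<eta>^3 / D) * \<rho> powr -s)"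
  proof -
   have "(NNBINT x. ennreal (g x) * ennreal (norm (x - y) powr -(3 + s)) * indicator (- ball y \<rho>) x)
    \<le> ennreal (2 powr 3 / (1 - 2 powr (3 - (3 + s))) * (B * (1 / \<eta>^3 / D)) * \<rho> powr (3 - (3 + s)))"
   proof (rule nn_far_shells)
    fix t assume t: "\<rho> \<le> t"
    then have t0: "0 < t" using \<rho> by simp
    have "bint g y t \<le> B * (1 / \<eta>^3 / D) * t^3"
    proof (cases "r \<le> t")
     case True
     have "B * t^3 / D * 1 \<le> B * t^3 / D * (1 / \<eta>^3)" using B t0 rD \<eta> by (intro mult_left_mono) (auto simp: power_le_one)
     then show ?thesis using mass[OF True] by (simp add: mult_ac)
    next
     case False
     have "bint g y t \<le> bint g y r" using False by (intro bint_subset g) auto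
     also have "... \<le> B * r^3 / D" by (rule mass) simp
     also have "... = B * (1 / \<eta>^3 / D) * \<rho>^3" using \<eta> by (simp add: \<rho>_def power_mult_distrib)
     also have "... \<le> B * (1 / \<eta>^3 / D) * t^3" using B \<eta> rD \<rho> t by (intro mult_left_mono power_mono) auto
     finally show ?thesis .
    qed
    then show "(NNBINT x. ennreal (g x) * indicator (ball y t) x) \<le> ennreal (B * (1 / \<eta>^3 / D) * t powr 3)"
     using t0 by (simp add: bint_nn[OF g(1,2)] ennreal_leI)
   qed (use \<rho> s_pos B \<eta> rD in auto)
   then show ?thesis by (simp add: c2_def mult_ac)
  qed
  have pt: "ennreal (g x) * ennreal (min 1 (1 / r * norm (x - y)) ^ 2 * kern (x - y))
   \<le> ennreal (2 / r^2) * (ennreal (p x) * ennreal (norm (x - y) powr -(1 + s)) * indicator (ball y \<rho>) x) + ennreal (g x) * ennreal (norm (x - y) powr -(3 + s)) * indicator (- ball y \<rho>) x" for x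
  proof (cases "x \<in> ball y \<rho>")
   case True
   have kb: "min 1 (1 / r * norm (x - y)) ^ 2 * kern (x - y) \<le> 1 / r^2 * norm (x - y) powr -(1 + s)"
   proof (cases "x = y")
    case False
    then have nz: "0 < norm (x - y)" by simp
    have "min 1 (1 / r * norm (x - y)) ^ 2 * kern (x - y) \<le> (1 / r * norm (x - y)) ^ 2 * kern (x - y)" using r by (intro mult_right_mono power_mono) auto
    also have "... = 1 / r^2 * (norm (x - y) powr 2 * norm (x - y) powr -(3 + s))" using n3 nz by (simp add: kern_def power_divide)
    also have "norm (x - y) powr 2 * norm (x - y) powr -(3 + s) = norm (x - y) powr -(1 + s)" by (subst powr_add[symmetric]) simp
    finally show ?thesis .
   qed simp
   have "g x * (min 1 (1 / r * norm (x - y)) ^ 2 * kern (x - y)) \<le> (2 * p x) * (1 / r^2 * norm (x - y) powr -(1 + s))"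
    using r by (intro mult_mono[OF g(3) kb]) auto
   also have "... = 2 / r^2 * (p x * norm (x - y) powr -(1 + s))" by simp
   finally have m: "g x * (min 1 (1 / r * norm (x - y)) ^ 2 * kern (x - y)) \<le> 2 / r^2 * (p x * norm (x - y) powr -(1 + s))" .
   have "ennreal (g x) * ennreal (min 1 (1 / r * norm (x - y)) ^ 2 * kern (x - y)) = ennreal (g x * (min 1 (1 / r * norm (x - y)) ^ 2 * kern (x - y)))"
    by (intro ennreal_mult[symmetric] g) simp
   also have "... \<le> ennreal (2 / r^2 * (p x * norm (x - y) powr -(1 + s)))" by (rule ennreal_leI[OF m])
   also have "... = ennreal (2 / r^2) * ennreal (p x * norm (x - y) powr -(1 + s))" by (rule ennreal_mult) auto
   also have "ennreal (p x * norm (x - y) powr -(1 + s)) = ennreal (p x) * ennreal (norm (x - y) powr -(1 + s))" by (rule ennreal_mult) auto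
   finally have m2: "ennreal (g x) * ennreal (min 1 (1 / r * norm (x - y)) ^ 2 * kern (x - y)) \<le> ennreal (2 / r^2) * (ennreal (p x) * ennreal (norm (x - y) powr -(1 + s)))" .
   have ind: "indicator (ball y \<rho>) x = (1::ennreal)" "indicator (- ball y \<rho>) x = (0::ennreal)" using True by auto
   show ?thesis unfolding ind mult_1_right mult_zero_right add_0_right by (rule m2)
  next
   case False
   have "min 1 (1 / r * norm (x - y)) ^ 2 * kern (x - y) \<le> 1 ^ 2 * kern (x - y)" using r by (intro mult_right_mono power_mono) auto
   then have "min 1 (1 / r * norm (x - y)) ^ 2 * kern (x - y) \<le> norm (x - y) powr -(3 + s)" using n3 by (simp add: kern_def)
   then show ?thesis using False by (auto intro!: mult_left_mono ennreal_leI)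
  qed
  have "(NNBINT x. ennreal (g x) * ennreal (min 1 (1 / r * norm (x - y)) ^ 2 * kern (x - y)))
   \<le> (NNBINT x. ennreal (2 / r^2) * (ennreal (p x) * ennreal (norm (x - y) powr -(1 + s)) * indicator (ball y \<rho>) x) + ennreal (g x) * ennreal (norm (x - y) powr -(3 + s)) * indicator (- ball y \<rho>) x)"
   by (intro nn_integral_mono pt)
  also have "... = (NNBINT x. ennreal (2 / r^2) * (ennreal (p x) * ennreal (norm (x - y) powr -(1 + s)) * indicator (ball y \<rho>) x))
   + (NNBINT x. ennreal (g x) * ennreal (norm (x - y) powr -(3 + s)) * indicator (- ball y \<rho>) x)"
   by (rule nn_integral_add) measurable
  also have "(NNBINT x. ennreal (2 / r^2) * (ennreal (p x) * ennreal (norm (x - y) powr -(1 + s)) * indicator (ball y \<rho>) x))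
   = ennreal (2 / r^2) * (NNBINT x. ennreal (p x) * ennreal (norm (x - y) powr -(1 + s)) * indicator (ball y \<rho>) x)"
   by (rule nn_integral_cmult) measurable
  also have "... + (NNBINT x. ennreal (g x) * ennreal (norm (x - y) powr -(3 + s)) * indicator (- ball y \<rho>) x)
   \<le> ennreal (2 / r^2) * ennreal (c1 * \<rho> powr (1 - s)) + ennreal (c2 * (1 / \<eta>^3 / D) * \<rho> powr -s)"
   by (intro add_mono mult_left_mono near far) auto
  also have "... = ennreal (2 / r^2 * (c1 * \<rho> powr (1 - s)) + c2 * (1 / \<eta>^3 / D) * \<rho> powr -s)"
  proof -
   have ar: "ennreal a * ennreal b + ennreal d = ennreal (a * b + d)" if "0 \<le> a" "0 \<le> b" "0 \<le> d" for a b d :: real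
    using that by (simp add: ennreal_mult ennreal_plus)
   show ?thesis by (rule ar) (use c \<eta> rD in auto)
  qed
  also have "... \<le> ennreal ((2 * c1 + c2) * r powr -(1 + s) * (r / D) powr ((1 - s) / 8))"
  proof (rule ennreal_leI)
   have e1: "\<eta> powr (1 - s) = (r / D) powr ((1 - s) / 8)" by (simp add: \<eta>_def powr_powr)
   have rr: "r powr (1 - s) = r^2 * r powr -(1 + s)" using r powr_add[of r 2 "-(1 + s)"] by simp
   have n: "2 / r^2 * (c1 * \<rho> powr (1 - s)) = 2 * c1 * r powr -(1 + s) * (r / D) powr ((1 - s) / 8)"
    unfolding e1[symmetric] \<rho>_def using r \<eta> by (simp add: powr_mult rr)
   have x: "1 / \<eta>^3 * \<eta> powr -s = (r / D) powr (-(3 + s) / 8)"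
   proof -
    have "\<eta> powr -(3 + s) = \<eta> powr -3 * \<eta> powr -s" by (subst powr_add[symmetric]) simp
    moreover have "\<eta> powr -3 = 1 / \<eta>^3" using \<eta> by (simp add: powr_minus_divide)
    moreover have "\<eta> powr -(3 + s) = (r / D) powr (-(3 + s) / 8)" by (simp add: \<eta>_def powr_powr)
    ultimately show ?thesis by simp
   qed
   have "\<rho> powr -s = (r * r powr -(1 + s)) * \<eta> powr -s" unfolding \<rho>_def using r \<eta> powr_add[of r 1 "-(1 + s)"] by (simp add: powr_mult)
   then have f: "c2 * (1 / \<eta>^3 / D) * \<rho> powr -s = c2 * r powr -(1 + s) * ((r / D) * (r / D) powr (-(3 + s) / 8))"
    unfolding x[symmetric] by (simp add: mult_ac)
   have "(r / D) * (r / D) powr (-(3 + s) / 8) = (r / D) powr (1 + (-(3 + s) / 8))" using rD r powr_add[of "r / D" 1 "-(3 + s) / 8"] by simp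
   also have "... \<le> (r / D) powr ((1 - s) / 8)" proof (rule powr_mono')
    show "(1 - s) / 8 \<le> 1 + - (3 + s) / 8" by (simp add: field_simps)
   qed (use rD in auto)
   finally have "c2 * r powr -(1 + s) * ((r / D) * (r / D) powr (-(3 + s) / 8)) \<le> c2 * r powr -(1 + s) * (r / D) powr ((1 - s) / 8)"
    using c by (intro mult_left_mono) auto
   then show "2 / r^2 * (c1 * \<rho> powr (1 - s)) + c2 * (1 / \<eta>^3 / D) * \<rho> powr -s \<le> (2 * c1 + c2) * r powr -(1 + s) * (r / D) powr ((1 - s) / 8)"
    unfolding n f by (simp add: algebra_simps)
  qed
  finally show ?thesis .
 qed
 then show ?thesis using c by (intro exI[of _ "2 * c1 + c2"]) auto
qed

definition negp :: "'a => real => 'a => real" where "negp \<omega> \<theta> x = max 0 (- vt \<omega> \<theta> x)"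

lemma bmeas_negp: "bmeas (negp \<omega> \<theta>)"
 unfolding negp_def[abs_def] by (intro blip_bmeas blip_pos blip_uminus blip_vt)

lemma negp_bounds:
 assumes "norm \<omega> = 1" "0 \<le> \<theta>" "\<theta> \<le> 1"
 shows "0 \<le> negp \<omega> \<theta> x" "negp \<omega> \<theta> x \<le> 2 * p x" "negp \<omega> \<theta> x \<le> p x - \<omega> \<bullet> G x"
proof -
 have 1: "\<bar>\<omega> \<bullet> G x\<bar> \<le> p x" using Cauchy_Schwarz_ineq2[of \<omega> "G x"] assms by simp
 have 2: "\<theta> * p x \<le> 1 * p x" using assms by (intro mult_right_mono) auto
 show "0 \<le> negp \<omega> \<theta> x" by (simp add: negp_def)
 show "negp \<omega> \<theta> x \<le> 2 * p x" "negp \<omega> \<theta> x \<le> p x - \<omega> \<bullet> G x"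
  using 1 2 unfolding negp_def vt_def by linarith+
qed

lemma negp_mono: "\<theta> \<le> \<theta>' ==> negp \<omega> \<theta> x \<le> negp \<omega> \<theta>' x"
 using mult_right_mono[of \<theta> \<theta>' "p x"] by (auto simp: negp_def vt_def)

text \<open>Lowering the slope from \<theta> to \<theta>' turns (\<theta> - \<theta>') p into
  positive mass, except where the old negative part lies. This mass is at least P r^2, and
  \<open>sign_interaction_step\<close> divides the negative mass by it.\<close>

lemma descent_step:
 assumes n3: "DIM('a) = 3" and \<omega>: "norm \<omega> = 1" and th: "0 \<le> \<theta>'" "\<theta>' \<le> \<theta>" "\<theta> \<le> 1" and r: "0 < r" and H: "0 \<le> H"
  and Hy: "\<And>y. y \<in> ball 0 (2 * r) ==> (NNBINT x. ennreal (negp \<omega> \<theta>' x) * ennreal (min 1 (1 / r * norm (x - y)) ^ 2 * kern (x - y))) \<le> ennreal (H * r powr -(1 + s))"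
  and P: "0 < P" "P * r^2 \<le> (\<theta> - \<theta>') * bint p 0 r - bint (negp \<omega> \<theta>) 0 (2 * r)"
 shows "2 powr -(3 + s) * P * bint (negp \<omega> \<theta>') 0 r \<le> H * bint (negp \<omega> \<theta>) 0 (2 * r)"
proof -
 let ?m = "bint (negp \<omega> \<theta>') 0 r"
 have o: "ord = 3 + s" using n3 by (simp add: ord_def dimr_def)
 have th1: "0 \<le> \<theta>" "\<theta>' \<le> 1" using th by auto
 note nb = negp_bounds[OF \<omega> th1(1) th(3)] and nb' = negp_bounds[OF \<omega> th(1) th1(2)]
 have bp: "bmeas (%x. (\<theta> - \<theta>') * p x)" by (intro bmeas_mult bmeas_const bmeas_p)
 have "(\<theta> - \<theta>') * bint p 0 r - bint (negp \<omega> \<theta>) 0 r = bint (%x. (\<theta> - \<theta>') * p x - negp \<omega> \<theta> x) 0 r"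
  by (simp add: bint_diff[OF bp bmeas_negp] bint_cmult)
 also have "... \<le> bint (%x. max 0 (vt \<omega> \<theta>' x)) 0 r"
 proof (intro bint_mono bmeas_diff bp bmeas_negp)
  show "bmeas (%x. max 0 (vt \<omega> \<theta>' x))" by (intro blip_bmeas blip_pos blip_vt)
  show "(\<theta> - \<theta>') * p x - negp \<omega> \<theta> x \<le> max 0 (vt \<omega> \<theta>' x)" for x by (simp add: negp_def vt_def algebra_simps)
 qed
 finally have "(\<theta> - \<theta>') * bint p 0 r - bint (negp \<omega> \<theta>) 0 r \<le> bint (%x. max 0 (vt \<omega> \<theta>' x)) 0 r" .
 moreover have "bint (negp \<omega> \<theta>) 0 r \<le> bint (negp \<omega> \<theta>) 0 (2 * r)" using r by (intro bint_subset bmeas_negp nb) auto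
 ultimately have P2: "P * r^2 \<le> bint (%x. max 0 (vt \<omega> \<theta>' x)) 0 r" using P(2) by linarith
 have m0: "0 \<le> ?m" by (intro bint_nonneg nb')
 have e: "(2 * r) powr -ord * (P * r^2) = r powr -(1 + s) * (2 powr -(3 + s) * P)"
 proof -
  have "r powr -(3 + s) * r^2 = r powr -(1 + s)" using r powr_add[of r "-(3 + s)" 2] by simp
  then show ?thesis unfolding o using r by (simp add: powr_mult)
 qed
 have "(2 * r) powr -ord * (P * r^2) * ?m \<le> (2 * r) powr -ord * bint (%x. max 0 (vt \<omega> \<theta>' x)) 0 r * ?m"
  by (intro mult_right_mono mult_left_mono P2 m0) auto
 also have "... \<le> (H * r powr -(1 + s)) * bint (negp \<omega> \<theta>') 0 (2 * r)"
  using sign_interaction_step[where z = 0, OF th(1) r _ Hy[unfolded negp_def]] H by (simp add: negp_def[abs_def])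
 also have "... \<le> (H * r powr -(1 + s)) * bint (negp \<omega> \<theta>) 0 (2 * r)"
  using H by (intro mult_left_mono bint_mono bmeas_negp negp_mono th) auto
 finally have "r powr -(1 + s) * (2 powr -(3 + s) * P * ?m) \<le> r powr -(1 + s) * (H * bint (negp \<omega> \<theta>) 0 (2 * r))"
  unfolding e by (simp only: mult_ac)
 moreover have "0 < r powr -(1 + s)" using r by simp
 ultimately show ?thesis by (simp only: mult_le_cancel_left_pos)
qed

text \<open>At a flat scale \<open>D\<close> the negative part of \<open>\<omega> \<bullet> G - \<theta> p\<close> is a tiny fraction of \<open>D^2\<close>. Passing to half the scale
 while giving up a geometrically small part of \<open>\<theta>\<close>, \<open>sign_interaction_step\<close> keeps it below \<open>r^3 / D\<close> down to unit scale.\<close>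

lemma concentration:
 assumes n3: "DIM('a) = 3" and R: "0 < R" and \<epsilon>: "0 < \<epsilon>"
 shows "bint p 0 R \<le> norm (flux 0 R) + \<epsilon>"
proof -
 obtain c0 \<rho>0 where c0: "0 < c0" "0 < \<rho>0" "\<And>r. \<rho>0 \<le> r ==> c0 * r^2 \<le> bint p 0 r"
 proof -
  obtain c r0 where d: "0 < c" "0 < r0" "\<And>r. r0 \<le> r ==> c * r powr (real DIM('a) - 1) \<le> bint p 0 r" using density_ex by blast
  have "c * r^2 \<le> bint p 0 r" if "r0 \<le> r" for r using d(3)[OF that] d(2) that n3 by simp
  then show ?thesis using that d by blast
 qed
 \<comment> \<open>27 = 3^3: balls of radius t about other centres are enclosed in balls of radius
   3t about 0.\<close>
 define B where "B = (2 * Cm + 8) * 27"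
 have B: "0 < B" using Cm by (simp add: B_def)
 obtain C where C: "0 < C" "\<And>(g :: 'a => real) r D y. bmeas g ==> (\<And>x. 0 \<le> g x \<and> g x \<le> 2 * p x) ==> 0 < r ==> r \<le> D ==>
  (\<And>t. r \<le> t ==> bint g y t \<le> B * t^3 / D) ==>
  (NNBINT x. ennreal (g x) * ennreal (min 1 (1 / r * norm (x - y)) ^ 2 * kern (x - y))) \<le> ennreal (C * r powr -(1 + s) * (r / D) powr ((1 - s) / 8))"
  using tail_bound_ex[OF n3 B] by blast
 \<comment> \<open>The slope never falls below 1 - 2l, and this total sacrifice costs at most
   \<epsilon>/2 of the mass on the target ball.\<close>
 define l where "l = min (1/4) (\<epsilon> / (4 * (bint p 0 R + 1)))"
 have p0: "0 \<le> bint p 0 R" by (intro bint_nonneg) simp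
 have l: "0 < l" "l \<le> 1/4" "2 * l * bint p 0 R \<le> \<epsilon> / 2"
 proof -
  show "0 < l" using \<epsilon> p0 by (auto simp: l_def)
  show "l \<le> 1/4" unfolding l_def by (rule min.cobounded1)
  define Y where "Y = bint p 0 R + 1"
  have Y: "0 < Y" using p0 by (simp add: Y_def)
  have "l * Y \<le> \<epsilon> / (4 * Y) * Y" using Y by (intro mult_right_mono) (auto simp: l_def Y_def)
  also have "... = \<epsilon> / 4" using Y by simp
  finally have "l * bint p 0 R + l \<le> \<epsilon> / 4" by (simp add: Y_def distrib_left)
  then show "2 * l * bint p 0 R \<le> \<epsilon> / 2" using \<open>0 < l\<close> by simp
 qed
 define \<gamma> where "\<gamma> = (1 - s) / 8"
 have \<gamma>: "0 < \<gamma>" "\<gamma> < 1" using s_pos s_lt1 by (auto simp: \<gamma>_def)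
 \<comment> \<open>After j halvings the moment bound gains (r/D)^\<gamma> = q^(2j), while the slope
   is lowered only by a multiple of q^j. The quotient, of order q^j, tends to zero although the
   sacrifices are summable.\<close>
 define q where "q = (2::real) powr -(\<gamma> / 2)"
 have q: "0 < q" "q < 1" "1/2 < q" "q^2 = 2 powr -\<gamma>"
 proof -
  show "0 < q" "q < 1" using \<gamma> powr_less_one[of 2 "-(\<gamma>/2)"] by (auto simp: q_def)
  have "(2::real) powr -1 < 2 powr -(\<gamma>/2)" using \<gamma> by (intro powr_less_mono) auto
  then show "1/2 < q" by (simp add: q_def powr_minus_divide)
  show "q^2 = 2 powr -\<gamma>" unfolding q_def power2_eq_square powr_add[symmetric] by simp
 qed
 define th where "th j = 1 - 2 * l + l * q ^ j" for j :: nat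
 have th: "0 \<le> th j" "th j \<le> 1" "1 - 2 * l \<le> th j" "th j - th (Suc j) = l * (1 - q) * q ^ j" for j
 proof -
  have "0 \<le> q ^ j" "q ^ j \<le> 1" using q by (auto simp: power_le_one)
  then have a: "0 \<le> l * q ^ j" "l * q ^ j \<le> l * 1" using l by (auto intro!: mult_left_mono)
  then show "0 \<le> th j" "th j \<le> 1" "1 - 2 * l \<le> th j" using l by (auto simp: th_def)
  show "th j - th (Suc j) = l * (1 - q) * q ^ j" by (simp add: th_def algebra_simps)
 qed
 have th_mono: "th j \<le> th i" if "i \<le> j" for i j
  using power_decreasing[OF that, of q] q l by (auto simp: th_def)
 define \<sigma> where "\<sigma> = l * (1 - q) * c0"
 have \<sigma>: "0 < \<sigma>" using l q c0 by (simp add: \<sigma>_def)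
 \<comment> \<open>The first condition keeps the negative mass at radius 2r, at most 8 (r/D) r^2,
   below half of the positive mass created; it can be met because q > 1/2. The second makes the
   contraction beat the factor 8 between (2r)^3/D and r^3/D.\<close>
 obtain j1 where j1: "\<And>j. j1 \<le> j ==> 8 * (1 / (2 * q)) ^ j < \<sigma>" "\<And>j. j1 \<le> j ==> 2 * 2 powr (3 + s) * C / \<sigma> * q ^ j < 1/8"
 proof -
  have "(%j. 8 * (1 / (2 * q)) ^ j) \<longlonglongrightarrow> 8 * 0" using q by (intro tendsto_intros LIMSEQ_realpow_zero) auto
  from order_tendstoD(2)[OF this, of \<sigma>] \<sigma> obtain a where a: "\<And>j. a \<le> j ==> 8 * (1 / (2 * q)) ^ j < \<sigma>" by (auto simp: eventually_sequentially)
  have "(%j. 2 * 2 powr (3 + s) * C / \<sigma> * q ^ j) \<longlonglongrightarrow> 2 * 2 powr (3 + s) * C / \<sigma> * 0" using q by (intro tendsto_intros LIMSEQ_realpow_zero) auto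
  from order_tendstoD(2)[OF this, of "1/8"] obtain b where b: "\<And>j. b \<le> j ==> 2 * 2 powr (3 + s) * C / \<sigma> * q ^ j < 1/8" by (auto simp: eventually_sequentially)
  show ?thesis using a b by (intro that[of "max a b"]) auto
 qed
 define R' where "R' = max R \<rho>0"
 have R': "0 < R'" "R \<le> R'" "\<rho>0 \<le> R'" using R by (auto simp: R'_def)
 \<comment> \<open>Flatness at level 8^(-j1) makes the claim automatic for the first j1
   halvings.\<close>
 obtain D \<omega> where D: "max R' (16 * R'^3 / \<epsilon>) \<le> D" and \<omega>: "norm \<omega> = 1" and fl: "bint (%x. p x - \<omega> \<bullet> G x) 0 D \<le> (1/8)^j1 * D^2"
 proof -
  have "0 < (1/8::real)^j1" "0 < max R' (16 * R'^3 / \<epsilon>)" using R'(1) by (auto simp: less_max_iff_disj)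
  from flat_scale_ex[OF n3 this] show ?thesis using that by blast
 qed
 have D0: "0 < D" "R' \<le> D" "16 * R'^3 / \<epsilon> \<le> D" using D R' by auto
 note nb = negp_bounds[OF \<omega> th(1,2)]
 have claim: "bint (negp \<omega> (th j)) 0 (D / 2^j) \<le> (D / 2^j)^3 / D" if "R' \<le> D / 2^j" for j
  using that
 proof (induction j rule: less_induct)
  case (less j)
  show ?case
  proof (cases "j \<le> j1")
   case True
   have "1 \<le> (2::real)^j" by simp
   then have "D / 2^j \<le> D" using D0 by (simp add: divide_le_eq)
   then have "bint (negp \<omega> (th j)) 0 (D / 2^j) \<le> bint (negp \<omega> (th j)) 0 D" by (intro bint_subset bmeas_negp nb) auto
   also have "... \<le> bint (%x. p x - \<omega> \<bullet> G x) 0 D" by (intro bint_mono bmeas_negp gap_facts \<omega> nb)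
   also have "... \<le> (1/8)^j1 * D^2" by (rule fl)
   also have "... \<le> (1/8)^j * D^2" using True by (intro mult_right_mono power_decreasing) auto
   also have "... = (D / 2^j)^3 / D"
   proof -
    have "((2::real)^j)^3 = 8^j" by (simp flip: power_mult add: mult.commute[of j 3] power_mult)
    then show ?thesis using D0 by (simp add: power_divide power2_eq_square power3_eq_cube)
   qed
   finally show ?thesis .
  next
   case False
   then obtain i where i: "j = Suc i" "j1 \<le> i" by (cases j) auto
   define r where "r = D / 2^j"
   have r: "0 < r" "2 * r = D / 2^i" "R' \<le> r" "\<rho>0 \<le> r" "r / D = (1/2)^j" using D0 less.prems R' i by (auto simp: r_def power_divide)
   have rD: "r \<le> D" using r(5) D0 power_le_one[of "1/2::real" j] by (simp add: divide_le_eq_1 flip: r(5))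
   have Mi: "bint (negp \<omega> (th i)) 0 (2 * r) \<le> (2 * r)^3 / D" using less.IH[of i] i r by simp
   \<comment> \<open>The kernel tail sees every radius t \<ge> r. Below D the strong induction
     hypothesis at the dyadic radius just above 3t applies, with a larger slope and hence a larger
     negative part; beyond D the growth of the mass of p is enough.\<close>
   have mass: "bint (negp \<omega> (th j)) y t \<le> B * t^3 / D" if y: "y \<in> ball 0 (2 * r)" and t: "r \<le> t" for y t
   proof -
    define T where "T = 3 * t"
    have T: "0 < T" "2 * r < T" using t r by (auto simp: T_def)
    have "ball y t \<subseteq> ball 0 T"
    proof
     fix x assume "x \<in> ball y t"
     then show "x \<in> ball 0 T" using y t norm_triangle_ineq4[of y "y - x"] by (simp add: dist_norm T_def)
    qed
    then have "bint (negp \<omega> (th j)) y t \<le> bint (negp \<omega> (th j)) 0 T" by (intro bint_subset bmeas_negp nb)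
    also have "... \<le> (2 * Cm + 8) * T^3 / D"
    proof (cases "T < D")
     case False
     have b2: "bmeas (%x. 2 * p x)" by (intro bmeas_mult bmeas_const bmeas_p)
     have "bint (negp \<omega> (th j)) 0 T \<le> bint (%x. 2 * p x) 0 T" by (intro bint_mono bmeas_negp nb b2)
     also have "... \<le> 2 * Cm * T^2" using Cm(2)[OF T(1), of 0] T n3 by (simp add: bint_cmult)
     also have "... \<le> 2 * Cm * T^2 * (T / D)" using False D0 Cm mult_left_mono[of 1 "T / D" "2 * Cm * T^2"] by simp
     also have "... \<le> (2 * Cm + 8) * T^3 / D" using D0 T by (simp add: power2_eq_square power3_eq_cube field_simps)
     finally show ?thesis .
    next
     case True
     obtain k where k: "D / 2^(k+1) \<le> T" "T < D / 2^k" using dyadic_near[OF T(1) True] by blast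
     have "D / 2^i < D / 2^k" using k T r(2) by linarith
     then have "(2::real)^k < 2^i" using D0 by (simp add: divide_less_cancel divide_strict_left_mono_neg frac_less2 field_simps)
     then have ki: "k < i" by simp
     have "2 * r = D / 2^i" by (rule r(2))
     have "r \<le> D / 2^k" using k T r by linarith
     then have "bint (negp \<omega> (th k)) 0 (D / 2^k) \<le> (D / 2^k)^3 / D" using less.IH[of k] ki i r(3) by simp
     moreover have "bint (negp \<omega> (th j)) 0 T \<le> bint (negp \<omega> (th k)) 0 T" using ki i by (intro bint_mono bmeas_negp negp_mono th_mono) auto
     moreover have "bint (negp \<omega> (th k)) 0 T \<le> bint (negp \<omega> (th k)) 0 (D / 2^k)" using k by (intro bint_subset bmeas_negp nb) auto
     moreover have "(D / 2^k)^3 / D \<le> (2 * T)^3 / D" using k D0 by (intro divide_right_mono power_mono) auto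
     moreover have "(2 * T)^3 / D \<le> (2 * Cm + 8) * T^3 / D" using D0 T Cm by (intro divide_right_mono) (auto simp: power_mult_distrib intro!: mult_right_mono)
     ultimately show ?thesis by linarith
    qed
    also have "... = B * t^3 / D" by (simp add: T_def B_def power_mult_distrib)
    finally show ?thesis .
   qed
   have "2 powr -(3 + s) * (\<sigma> * q^i / 2) * bint (negp \<omega> (th j)) 0 r \<le> (C * (r / D) powr \<gamma>) * bint (negp \<omega> (th i)) 0 (2 * r)"
   proof (rule descent_step[OF n3 \<omega> th(1) _ th(2) r(1)])
    show "th j \<le> th i" using i by (intro th_mono) simp
    show "0 \<le> C * (r / D) powr \<gamma>" using C by simp
    show "(NNBINT x. ennreal (negp \<omega> (th j) x) * ennreal (min 1 (1 / r * norm (x - y)) ^ 2 * kern (x - y))) \<le> ennreal (C * (r / D) powr \<gamma> * r powr -(1 + s))"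
     if "y \<in> ball 0 (2 * r)" for y
     using C(2)[OF bmeas_negp _ r(1) rD mass[OF that]] nb by (simp add: \<gamma>_def mult_ac)
    show "0 < \<sigma> * q^i / 2" using \<sigma> q by simp
    have "8 * (1 / 2)^i = 8 * (1 / (2 * q))^i * q^i" using q by (simp add: power_divide power_mult_distrib)
    also have "... \<le> \<sigma> * q^i" using j1(1)[OF i(2)] q by (intro mult_right_mono) auto
    finally have "8 * (r / D) \<le> \<sigma> * q^i / 2" unfolding r(5) i(1) by simp
    then have "8 * (r / D) * r^2 \<le> \<sigma> * q^i / 2 * r^2" by (intro mult_right_mono) auto
    moreover have "(2 * r)^3 / D = 8 * (r / D) * r^2" by (simp add: power_mult_distrib power2_eq_square power3_eq_cube)
    ultimately have "bint (negp \<omega> (th i)) 0 (2 * r) \<le> \<sigma> * q^i / 2 * r^2" using Mi by linarith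
    moreover have "l * (1 - q) * q^i * (c0 * r^2) \<le> l * (1 - q) * q^i * bint p 0 r" using l q by (intro mult_left_mono c0(3) r) auto
    then have "\<sigma> * q^i * r^2 \<le> (th i - th j) * bint p 0 r" unfolding i(1) th(4) by (simp add: \<sigma>_def mult_ac)
    moreover have "\<sigma> * q^i / 2 * r^2 + \<sigma> * q^i / 2 * r^2 = \<sigma> * q^i * r^2" by simp
    ultimately show "\<sigma> * q^i / 2 * r^2 \<le> (th i - th j) * bint p 0 r - bint (negp \<omega> (th i)) 0 (2 * r)" by linarith
   qed
   moreover have "(r / D) powr \<gamma> \<le> q^i * q^i"
   proof -
    have "(r / D) powr \<gamma> = (q^2)^j" unfolding r(5) q(4) by (simp add: powr_minus_divide powr_divide powr_power powr_powr mult.commute power_one_over flip: powr_realpow)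
    also have "... \<le> (q^2)^i" using q(1,2) i(1) by (intro power_decreasing power_le_one) auto
    finally show ?thesis by (simp add: power2_eq_square power_mult_distrib)
   qed
   then have "(C * (r / D) powr \<gamma>) * bint (negp \<omega> (th i)) 0 (2 * r) \<le> (C * (q^i * q^i)) * bint (negp \<omega> (th i)) 0 (2 * r)"
    using C by (intro mult_right_mono mult_left_mono bint_nonneg nb) auto
   ultimately have "2 powr -(3 + s) * (\<sigma> * q^i / 2) * bint (negp \<omega> (th j)) 0 r \<le> (C * (q^i * q^i)) * bint (negp \<omega> (th i)) 0 (2 * r)" by linarith
   then have "(2 * 2 powr (3 + s) / (\<sigma> * q^i)) * (2 powr -(3 + s) * (\<sigma> * q^i / 2) * bint (negp \<omega> (th j)) 0 r)
    \<le> (2 * 2 powr (3 + s) / (\<sigma> * q^i)) * ((C * (q^i * q^i)) * bint (negp \<omega> (th i)) 0 (2 * r))" using \<sigma> q by (intro mult_left_mono) auto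
   moreover have "(2 * 2 powr (3 + s) / (\<sigma> * q^i)) * (2 powr -(3 + s) * (\<sigma> * q^i / 2) * X) = X" for X
   proof -
    have "2 powr (3 + s) * 2 powr -(3 + s) = (1::real)" by (simp flip: powr_add)
    moreover have "(2 * a / y) * (b * (y / 2) * X) = (a * b) * X" if "y \<noteq> 0" for a b y :: real using that by simp
    moreover have "\<sigma> * q^i \<noteq> 0" using \<sigma> q by simp
    ultimately show ?thesis using q(1) by auto
   qed
   moreover have "(2 * 2 powr (3 + s) / (\<sigma> * q^i)) * ((C * (q^i * q^i)) * X) = (2 * 2 powr (3 + s) * C / \<sigma> * q^i) * X" for X
    using \<sigma> q by (simp add: field_simps)
   ultimately have "bint (negp \<omega> (th j)) 0 r \<le> (2 * 2 powr (3 + s) * C / \<sigma> * q^i) * bint (negp \<omega> (th i)) 0 (2 * r)" by simp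
   also have "... \<le> (1/8) * ((2 * r)^3 / D)"
    using j1(2)[OF i(2)] Mi D0 r by (intro mult_mono bint_nonneg nb) auto
   also have "... = r^3 / D" by (simp add: power_mult_distrib)
   finally show ?thesis by (simp add: r_def)
  qed
 qed
 obtain k where k: "R' * 2^k \<le> D" "D < R' * 2^(k+1)" using dyadic_far[OF R'(1) D0(2)] by blast
 have k': "R' \<le> D / 2^k" "D / 2^k \<le> 2 * R'" using k by (auto simp: field_simps)
 have "bint (%x. th k * p x - \<omega> \<bullet> G x) 0 R \<le> bint (negp \<omega> (th k)) 0 R"
  by (intro bint_mono bmeas_negp bmeas_diff bmeas_mult bmeas_const bmeas_p bmeas_dir) (auto simp: negp_def vt_def)
 also have "... \<le> bint (negp \<omega> (th k)) 0 (D / 2^k)" using k' R' by (intro bint_subset bmeas_negp nb) auto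
 also have "... \<le> (D / 2^k)^3 / D" by (rule claim[OF k'(1)])
 also have "... \<le> (2 * R')^3 / D" using k' D0 R' by (intro divide_right_mono power_mono) auto
 also have "... \<le> \<epsilon> / 2" using D0 \<epsilon> by (simp add: power_mult_distrib field_simps)
 finally have "th k * bint p 0 R - \<omega> \<bullet> flux 0 R \<le> \<epsilon> / 2"
  by (simp add: bint_diff[OF bmeas_mult[OF bmeas_const bmeas_p] bmeas_dir] bint_cmult flux_inner)
 moreover have "(1 - 2 * l) * bint p 0 R \<le> th k * bint p 0 R" by (intro mult_right_mono th p0)
 moreover have "\<omega> \<bullet> flux 0 R \<le> norm (flux 0 R)" using norm_cauchy_schwarz[of \<omega> "flux 0 R"] \<omega> by simp
 ultimately show ?thesis using l(3) by (simp add: algebra_simps)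
qed

end

context monotone_layer
begin

lemma layer_ex: "\<exists>G \<Lambda>. layer s u e0 G \<Lambda>"
proof -
 obtain G :: "'a => 'a" and \<Lambda> where "1 \<le> \<Lambda>" "\<And>x. norm (G x) \<le> \<Lambda>" "\<And>x y. norm (G x - G y) \<le> \<Lambda> * norm (x - y)"
   "\<And>x h. \<bar>u (x + h) - u x - G x \<bullet> h\<bar> \<le> \<Lambda> * (norm h)^2"
   "\<And>e x. Lop (%x. e \<bullet> G x) x = (1 - 3 * (u x)^2) * (e \<bullet> G x)" using gradient_ex by blast
 then have "layer s u e0 G \<Lambda>" by unfold_locales
 then show ?thesis by blast
qed

end

theorem theorem1p4:
  fixes s :: real and u :: "real^'n \<Rightarrow> real" and k :: 'n
  assumes "0 < s" and "s < 1"
    and "CARD('n) \<le> 3"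
    and "allen_cahn_solution s u"
    and "\<forall>x. \<exists>d>0. ((\<lambda>t. u (x + t *\<^sub>R axis k 1)) has_real_derivative d) (at 0)"
    and "\<forall>x. ((\<lambda>t. u (\<chi> i. if i = k then t else x $ i)) \<longlongrightarrow> 1) at_top"
    and "\<forall>x. ((\<lambda>t. u (\<chi> i. if i = k then t else x $ i)) \<longlongrightarrow> -1) at_bot"
  shows "\<exists>ubar :: real \<Rightarrow> real. \<exists>\<omega> :: real^'n. norm \<omega> = 1 \<and> (\<forall>x. u x = ubar (\<omega> \<bullet> x))"
proof (cases "CARD('n) = 1")
  \<comment> \<open>On a line every function depends on one variable only.\<close>
  case True
  then have one: "i = k" for i :: 'n by (metis UNIV_I card_1_singletonE singletonD)
  show ?thesis
  proof (intro exI[of _ "\<lambda>t. u (t *\<^sub>R axis k 1)"] exI[of _ "axis k 1"] conjI allI)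
    show "norm (axis k (1::real)) = 1" by (simp add: norm_eq_1 inner_axis_axis)
    fix x :: "real^'n"
    have "x $ i = ((axis k 1 \<bullet> x) *\<^sub>R axis k 1) $ i" for i
    proof -
      have "i = k" by (rule one)
      then show ?thesis by (simp add: inner_commute[of _ x] inner_axis)
    qed
    then have "x = (axis k 1 \<bullet> x) *\<^sub>R axis k 1" by (subst vec_eq_iff) blast
    then show "u x = u ((axis k 1 \<bullet> x) *\<^sub>R axis k 1)" by simp
  qed
next
  case False
  moreover have "0 < CARD('n)" by simp
  moreover have "DIM(real^'n) = CARD('n)" by simp
  ultimately have dim2: "2 \<le> DIM(real^'n)" by linarith
  interpret frac_order s by unfold_locales fact+
  have ker: "(\<lambda>z. (u x - u (x + z)) * kern z) = frac_lap_kernel s u x" for x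
    by (rule ext) (unfold kern_def frac_lap_kernel_def powr_minus_divide, simp)
  have line: "x + t *\<^sub>R axis k 1 = (\<chi> i. if i = k then x $ k + t else x $ i)" for x :: "real^'n" and t
    by (simp add: vec_eq_iff axis_def)
  have "monotone_layer s u (axis k 1)"
  proof unfold_locales
    show "continuous_on UNIV u" using assms(4) by (simp add: allen_cahn_solution_def)
    show "lint u x" for x using assms(4) by (simp add: allen_cahn_solution_def lint_def ker)
    show "Lop u x = u x - u x ^ 3" for x using assms(4) by (simp add: allen_cahn_solution_def Lop_def ker frac_lap_def)
    show "norm (axis k (1::real)) = 1" by (simp add: norm_eq_1 inner_axis_axis)
    show "\<exists>d>0. ((\<lambda>t. u (x + t *\<^sub>R axis k 1)) has_real_derivative d) (at 0)" for x using assms(5) by blast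
    show "((\<lambda>t. u (x + t *\<^sub>R axis k 1)) \<longlongrightarrow> 1) at_top" for x
      unfolding line by (rule filterlim_compose[OF spec[OF assms(6)] filterlim_tendsto_add_at_top[OF tendsto_const filterlim_ident]])
    have bot: "filterlim (\<lambda>t. c + t) at_bot at_bot" for c :: real
      unfolding filterlim_at_bot eventually_at_bot_linorder
    proof
      fix Z show "\<exists>N. \<forall>n\<le>N. c + n \<le> Z" by (rule exI[of _ "Z - c"]) auto
    qed
    show "((\<lambda>t. u (x + t *\<^sub>R axis k 1)) \<longlongrightarrow> -1) at_bot" for x
      unfolding line by (rule filterlim_compose[OF spec[OF assms(7)] bot])
  qed
  then interpret monotone_layer s u "axis k 1" .
  obtain G \<Lambda> where "layer s u (axis k 1) G \<Lambda>" using layer_ex by blast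
  then interpret layer s u "axis k 1" G \<Lambda> .
  obtain Cm Cp where "layer2 s u (axis k 1) G \<Lambda> Cm Cp" using layer2_ex[OF dim2] by blast
  then interpret layer2 s u "axis k 1" G \<Lambda> Cm Cp .
  have "bint p 0 R \<le> norm (flux 0 R) + \<epsilon>" if R: "0 < R" and \<epsilon>: "0 < \<epsilon>" for R \<epsilon>
  proof (cases "CARD('n) = 3")
    case True
    then show ?thesis by (intro concentration R \<epsilon>) simp
  next
    case False
    then have "dimr = 2" using dim2 assms(3) by (simp add: dimr_def)
    from two_dim_concentration[OF this R] show ?thesis using \<epsilon> by linarith
  qed
  then show ?thesis by (rule one_dimensional)
qed

end
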